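(* Assume (H1) and (H2) as given in the context, and let $\mathbf{y}\in\mathbb{R}^d$. As $n\to\infty$, the following convergence in distribution holds: $$\mathbb{P}_{\delta_{\sqrt{n}\mathbf{y}}}\Big(\frac{M_n^d}{\sqrt{n}} \in \cdot \,\Big|\, Z_n(\mathbb{R}^d)>0\Big)\ \Longrightarrow\ \mathbb{N}_{\mathbf{y}}\big(M_1^X \in \cdot\,\big|\,w_1(\mathbb{R}^d)\neq 0\big).$$
   Context: Notation: $\|\cdot\|$ is the Euclidean norm on $\mathbb{R}^d$; $D_r=\{\mathbf{z}\in\mathbb{R}^d:\|\mathbf{z}\|<r\}$, and $D_r^c$ is its complement. (H1) The offspring law $\{p_k\}_{k\ge0}$ satisfies $\sum_{k\ge1} kp_k=1$, $p_1<1$, and belongs to the domain of attraction of an $\alpha$-stable distribution with $\alpha\in(1,2]$; precisely, either there are $\alpha\in(1,2)$ and $\kappa(\alpha)\in(0,\infty)$ with $\lim_{n\to\infty}n^\alpha\sum_{k=n}^\infty p_k=\kappa(\alpha)$, or (corresponding to $\alpha=2$) $\sum_k k^2p_k<\infty$. (H2) The jump $\mathbf{X}$ is a $d$-dimensional random vector independent of the offspring variable $N$ (which has law $\{p_k\}$), with $\mathbb{E}\mathbf{X}=\mathbf{0}$, $\eta^2=\mathbb{E}\|\mathbf{X}\|^2\in(0,\infty)$ and $\mathbb{E}\|\mathbf{X}\|^{\frac{2\alpha}{\alpha-1}}<\infty$. Branching random walk (BRW) in $\mathbb{R}^d$. Each particle lives for one unit of time, then dies and produces a random number of offspring; if it is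 located at $\mathbf{x}$, the positions of its offspring are formed by the point process $\mathbf{x}+N\delta_{\mathbf{X}}$; all particles evolve independently and according to the same law. In terms of trees: $\mathbb{T}$ is the genealogical tree with root $\emptyset$ and offspring law $\{p_k\}$; for a start at the origin, $\mathbf{X}_\emptyset=\mathbf{0}$, $\{\mathbf{X}_v,v\in\mathbb{T}\setminus\emptyset\}$ are i.i.d. copies of $\mathbf{X}$ ($\mathbf{X}_v$ is the displacement of $v$), and $V(w)=\sum_{v\prec w}\mathbf{X}_v$ is the position of $w$, where $v\prec w$ means $v=w$ or $v$ is an ancestor of $w$; $|w|$ is the generation of $w$, and $Z_n=\sum_{|w|=n}\delta_{V(w)}$. $\mathbb{P}_\mu$ is the law of the BRW with $Z_0=\mu$, a finite point measure; thus $\mathbb{P}_{\delta_{\mathbf{a}}}$ means one initial particle at $\mathbf{a}$. Maximal displacement at generation $n$. For $d=1$: $M_n^1=\max_{|w|=n}V(w)$. For $d\ge2$: $M_n^d=\max_{|w|=n}\|V(w)\|$. Super-Brownian motion. $W$ is a $d$-dimensional Brownian motion with covariance matrix $\Sigma=\mathbb{E}(\mathbf{X}\mathbf{X}^{\mathsf T})$. $\mathcal{C}(\alpha)=\frac{\kappa(\alpha)\Gamma(2-\alpha)}{\alpha-1}$ if $\alpha\in(1,2)$, and $\mathcal{C}(2)=\frac12\sum_{k\ge1} k(k-1)p_k$. $X=\{X_t\}_{t\ge0}$ is the super-Brownian motion with spatial motion $W$ and branching mechanism $\psi(u)=\mathcal{C}(\alpha)u^\alpha$: for bounded continuous $\varphi\ge0$,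 $\mathbb{E}_\mu[e^{-\langle\varphi,X_t\rangle}]=e^{-\langle u_\varphi(t,\cdot),\mu\rangle}$, where $u_\varphi$ is the unique non-negative solution of $u_\varphi(t,\mathbf{x})=\mathbb{E}_{\mathbf{x}}(\varphi(W_t))-\mathcal{C}(\alpha)\int_0^t\mathbb{E}_{\mathbf{x}}(u_\varphi^\alpha(t-s,W_s))\,\mathrm{d}s$. $\{\mathbb{N}_{\mathbf{y}}:\mathbf{y}\in\mathbb{R}^d\}$ are the excursion measures ($\mathbb{N}$-measures) associated with $X$: the unique family of $\sigma$-finite measures on the space of right-continuous paths $w$ from $[0,\infty)$ to the finite Borel measures on $\mathbb{R}^d$ having zero as a trap, such that $\mathbb{N}_{\mathbf{y}}(1-e^{-\langle f,w_t\rangle})=-\log\mathbb{E}_{\delta_{\mathbf{y}}}(e^{-\langle f,X_t\rangle})$ for all $t>0$, $\mathbf{y}\in\mathbb{R}^d$ and non-negative bounded $f$. Finally $M_t^X=\inf\{r\ge0:w_t(D_r^c)=0\}$, and $\mathbb{N}_{\mathbf{y}}(\cdot\,|A)=\mathbb{N}_{\mathbf{y}}(\cdot\cap A)/\mathbb{N}_{\mathbf{y}}(A)$.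
   Formalization: For d=1, where M_n^1 is the signed rightmost position, D_r is read as (-∞,r) with r over all reals, so M_1^X is the right end of the support of w_1 (with the symmetric ball the claim is false); zero is a trap for the paths w only from positive times on. *)

theory Defs
  imports "HOL-Probability.Probability"
begin

section \<open>Offspring law and jump law\<close>

definition offspring_hyp :: "nat pmf \<Rightarrow> real \<Rightarrow> real \<Rightarrow> bool" where
  "offspring_hyp p \<alpha> \<kappa> \<longleftrightarrow>
     (\<lambda>k. real k * pmf p k) sums 1 \<and> pmf p 1 < 1 \<and>
     ((1 < \<alpha> \<and> \<alpha> < 2 \<and> 0 < \<kappa> \<and>
         (\<lambda>n. real n powr \<alpha> * (\<Sum>k. pmf p (n + k))) \<longlonglongrightarrow> \<kappa>) \<or>
      (\<alpha> = 2 \<and> summable (\<lambda>k. (real k)\<^sup>2 * pmf p k)))"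

definition jump_hyp :: "real \<Rightarrow> (real ^ 'd) measure \<Rightarrow> bool" where
  "jump_hyp \<alpha> \<nu> \<longleftrightarrow>
     prob_space \<nu> \<and> sets \<nu> = sets borel \<and>
     integrable \<nu> (\<lambda>x. x) \<and> (\<integral>x. x \<partial>\<nu>) = 0 \<and>
     integrable \<nu> (\<lambda>x. (norm x)\<^sup>2) \<and> 0 < (\<integral>x. (norm x)\<^sup>2 \<partial>\<nu>) \<and>
     integrable \<nu> (\<lambda>x. norm x powr (2 * \<alpha> / (\<alpha> - 1)))"

definition jump_cov :: "(real ^ 'd) measure \<Rightarrow> real ^ 'd ^ 'd" where
  "jump_cov \<nu> = (\<chi> i j. \<integral>x. x $ i * x $ j \<partial>\<nu>)"

text \<open>For \<open>\<alpha> = 2\<close> the parameter \<open>\<kappa>\<close> plays no role, neither here nor in \<open>offspring_hyp\<close>.\<close>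

definition branching_const :: "nat pmf \<Rightarrow> real \<Rightarrow> real \<Rightarrow> real" where
  "branching_const p \<alpha> \<kappa> =
     (if \<alpha> < 2 then \<kappa> * Gamma (2 - \<alpha>) / (\<alpha> - 1)
      else (1 / 2) * (\<Sum>k. real k * (real k - 1) * pmf p k))"

section \<open>Branching random walk\<close>

text \<open>
  Individuals are Ulam--Harris words. The sample point \<open>\<omega>\<close> attaches to every word \<open>v\<close> an
  offspring number \<open>fst (\<omega> v)\<close> and a displacement \<open>snd (\<omega> v)\<close>, all independent; the
  displacement attached to the root \<open>[]\<close> is never used. The law of the walk started from one
  particle at \<open>a\<close> is obtained by passing \<open>a\<close> as the starting point to the functions below.
\<close>

definition brw_measure ::
    "nat pmf \<Rightarrow> (real ^ 'd) measure \<Rightarrow> (nat list \<Rightarrow> nat \<times> (real ^ 'd)) measure" where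
  "brw_measure p \<nu> = (\<Pi>\<^sub>M v \<in> UNIV. measure_pmf p \<Otimes>\<^sub>M \<nu>)"

definition generation :: "(nat list \<Rightarrow> nat \<times> (real ^ 'd)) \<Rightarrow> nat \<Rightarrow> nat list set" where
  "generation \<omega> n = {w. length w = n \<and> (\<forall>k < n. w ! k < fst (\<omega> (take k w)))}"

definition position ::
    "real ^ 'd \<Rightarrow> (nat list \<Rightarrow> nat \<times> (real ^ 'd)) \<Rightarrow> nat list \<Rightarrow> real ^ 'd" where
  "position a \<omega> w = a + (\<Sum>k = 1..length w. snd (\<omega> (take k w)))"

text \<open>The point measure \<open>Z\<^sub>n\<close>, the sum of the unit masses at the positions in generation \<open>n\<close>.\<close>

definition population ::
    "real ^ 'd \<Rightarrow> nat \<Rightarrow> (nat list \<Rightarrow> nat \<times> (real ^ 'd)) \<Rightarrow> (real ^ 'd) measure" where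
  "population a n \<omega> = distr (count_space (generation \<omega> n)) borel (position a \<omega>)"

text \<open>For \<open>d = 1\<close> the sum below has one summand, so \<open>displacement\<close> is the signed coordinate.\<close>

definition displacement :: "real ^ 'd \<Rightarrow> real" where
  "displacement z = (if CARD('d) = 1 then (\<Sum>i\<in>UNIV. z $ i) else norm z)"

text \<open>Only used on the event that generation \<open>n\<close> is nonempty.\<close>

definition max_displacement ::
    "real ^ 'd \<Rightarrow> nat \<Rightarrow> (nat list \<Rightarrow> nat \<times> (real ^ 'd)) \<Rightarrow> real" where
  "max_displacement a n \<omega> = (MAX w\<in>generation \<omega> n. displacement (position a \<omega> w))"

section \<open>Brownian motion\<close>

definition centred_normal :: "real \<Rightarrow> real measure" where
  "centred_normal v =
     (if v = 0 then return borel 0 else density lborel (normal_density 0 (sqrt v)))"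

text \<open>
  \<open>W\<close> starts at \<open>0\<close>; the motion started at \<open>x\<close> is \<open>x + W\<close>. The covariance matrix \<open>S\<close> may be
  singular, so the Gaussian law is described by its one-dimensional projections.
\<close>

definition brownian_motion ::
    "'b measure \<Rightarrow> real ^ 'd ^ 'd \<Rightarrow> (real \<Rightarrow> 'b \<Rightarrow> real ^ 'd) \<Rightarrow> bool" where
  "brownian_motion B S W \<longleftrightarrow>
     prob_space B \<and>
     (\<forall>t\<ge>0. W t \<in> borel_measurable B) \<and>
     (\<forall>\<omega>\<in>space B. W 0 \<omega> = 0 \<and> continuous_on {0..} (\<lambda>t. W t \<omega>)) \<and>
     (\<forall>(\<tau> :: nat \<Rightarrow> real) n. 0 \<le> \<tau> 0 \<longrightarrow> mono \<tau> \<longrightarrow>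
        prob_space.indep_vars B (\<lambda>_. borel)
          (\<lambda>i \<omega>. W (\<tau> (Suc i)) \<omega> - W (\<tau> i) \<omega>) {..<n}) \<and>
     (\<forall>s t \<theta>. 0 \<le> s \<longrightarrow> s \<le> t \<longrightarrow>
        distr B borel (\<lambda>\<omega>. \<theta> \<bullet> (W t \<omega> - W s \<omega>)) = centred_normal ((t - s) * (\<theta> \<bullet> (S *v \<theta>))))"

section \<open>Spaces of measure-valued paths\<close>

text \<open>Finite Borel measures, with the \<open>\<sigma>\<close>-algebra generated by the evaluations on Borel sets.\<close>

definition finite_measures :: "'a::topological_space measure measure" where
  "finite_measures =
     (SUP A \<in> sets borel.
        vimage_algebra {\<mu>. finite_measure \<mu> \<and> sets \<mu> = sets borel} (\<lambda>\<mu>. emeasure \<mu> A) borel)"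

lemma space_finite_measures:
  "space finite_measures = {\<mu>. finite_measure \<mu> \<and> sets \<mu> = sets borel}"
  by (auto simp add: finite_measures_def space_Sup_eq_UN)

text \<open>Right-continuity is with respect to the weak topology on finite measures.\<close>

definition right_continuous_path :: "(real \<Rightarrow> 'a::topological_space measure) \<Rightarrow> bool" where
  "right_continuous_path w \<longleftrightarrow>
     (\<forall>t\<ge>0. \<forall>f :: 'a \<Rightarrow> real. continuous_on UNIV f \<longrightarrow> bounded (range f) \<longrightarrow>
        ((\<lambda>s. \<integral>x. f x \<partial>w s) \<longlongrightarrow> (\<integral>x. f x \<partial>w t)) (at_right t))"

text \<open>
  Absorption at zero is required from positive times on only. Under the excursion measures a
  path starts from the zero measure and is nonzero immediately afterwards, so that demanding it
  at time \<open>0\<close> too would leave nothing but the zero path.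
\<close>

definition zero_trap :: "(real \<Rightarrow> 'a::topological_space measure) \<Rightarrow> bool" where
  "zero_trap w \<longleftrightarrow>
     (\<forall>s t. 0 < s \<longrightarrow> s \<le> t \<longrightarrow> emeasure (w s) UNIV = 0 \<longrightarrow> emeasure (w t) UNIV = 0)"

definition path_space :: "(real \<Rightarrow> 'a::topological_space measure) measure" where
  "path_space = restrict_space (\<Pi>\<^sub>M t \<in> {0..}. finite_measures) {w. right_continuous_path w}"

definition excursion_space :: "(real \<Rightarrow> 'a::topological_space measure) measure" where
  "excursion_space =
     restrict_space (\<Pi>\<^sub>M t \<in> {0..}. finite_measures) {w. right_continuous_path w \<and> zero_trap w}"

section \<open>Super-Brownian motion and its excursion measures\<close>

text \<open>
  The integral equation of the log-Laplace functional. Every non-negative solution is bounded by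
  \<open>sup \<phi>\<close>; boundedness and measurability are listed so that the Bochner integrals are meaningful.
\<close>

definition log_laplace_solution ::
    "'b measure \<Rightarrow> (real \<Rightarrow> 'b \<Rightarrow> real ^ 'd) \<Rightarrow> real \<Rightarrow> real \<Rightarrow>
     (real ^ 'd \<Rightarrow> real) \<Rightarrow> (real \<Rightarrow> real ^ 'd \<Rightarrow> real) \<Rightarrow> bool" where
  "log_laplace_solution B W c \<alpha> \<phi> u \<longleftrightarrow>
     (\<lambda>(t, x). u t x) \<in> borel_measurable (restrict_space borel {0..} \<Otimes>\<^sub>M borel) \<and>
     (\<exists>K. \<forall>t\<ge>0. \<forall>x. 0 \<le> u t x \<and> u t x \<le> K) \<and>
     (\<forall>t\<ge>0. \<forall>x. u t x =
        (\<integral>\<omega>. \<phi> (x + W t \<omega>) \<partial>B) -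
        c * (LINT s:{0..t}|lborel. (\<integral>\<omega>. u (t - s) (x + W s \<omega>) powr \<alpha> \<partial>B)))"

text \<open>
  \<open>P \<mu>\<close> is the law on path space, under which the coordinate process \<open>w t\<close> is the
  superprocess started from \<open>\<mu>\<close>. The last clause is the Markov property: the events
  \<open>restrict w {0..s} \<in> A\<close> are those of the natural filtration at time \<open>s\<close>.
\<close>

definition super_brownian_motion ::
    "'b measure \<Rightarrow> (real \<Rightarrow> 'b \<Rightarrow> real ^ 'd) \<Rightarrow> real \<Rightarrow> real \<Rightarrow>
     ((real ^ 'd) measure \<Rightarrow> (real \<Rightarrow> (real ^ 'd) measure) measure) \<Rightarrow> bool" where
  "super_brownian_motion B W c \<alpha> P \<longleftrightarrow>
     (\<forall>\<mu>\<in>space finite_measures. prob_space (P \<mu>) \<and> sets (P \<mu>) = sets path_space) \<and>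
     (\<forall>\<phi>. continuous_on UNIV \<phi> \<longrightarrow> bounded (range \<phi>) \<longrightarrow> (\<forall>x. 0 \<le> \<phi> x) \<longrightarrow>
        (\<exists>u. log_laplace_solution B W c \<alpha> \<phi> u \<and>
          (\<forall>\<mu>\<in>space finite_measures. \<forall>t\<ge>0.
             (\<integral>w. exp (- (\<integral>x. \<phi> x \<partial>w t)) \<partial>P \<mu>) = exp (- (\<integral>x. u t x \<partial>\<mu>))) \<and>
          (\<forall>\<mu>\<in>space finite_measures. \<forall>s\<ge>0. \<forall>t\<ge>0. \<forall>A\<in>sets (\<Pi>\<^sub>M r \<in> {0..s}. finite_measures).
             (\<integral>w. indicator A (restrict w {0..s}) * exp (- (\<integral>x. \<phi> x \<partial>w (s + t))) \<partial>P \<mu>) =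
             (\<integral>w. indicator A (restrict w {0..s}) * exp (- (\<integral>x. u t x \<partial>w s)) \<partial>P \<mu>))))"

definition excursion_measures ::
    "((real ^ 'd) measure \<Rightarrow> (real \<Rightarrow> (real ^ 'd) measure) measure) \<Rightarrow>
     (real ^ 'd \<Rightarrow> (real \<Rightarrow> (real ^ 'd) measure) measure) \<Rightarrow> bool" where
  "excursion_measures P \<N> \<longleftrightarrow>
     (\<forall>y. sigma_finite_measure (\<N> y) \<and> sets (\<N> y) = sets excursion_space) \<and>
     (\<forall>y. \<forall>t>0. \<forall>f \<in> borel_measurable borel. bounded (range f) \<longrightarrow> (\<forall>x. 0 \<le> f x) \<longrightarrow>
        (\<integral>\<^sup>+ w. ennreal (1 - exp (- (\<integral>x. f x \<partial>w t))) \<partial>\<N> y) =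
        ennreal (- ln (\<integral>w. exp (- (\<integral>x. f x \<partial>w t)) \<partial>P (return borel y))))"

text \<open>
  For \<open>d \<ge> 2\<close> this is \<open>D\<^sub>r = {z. norm z < r}\<close> and \<open>inf {r \<ge> 0. w\<^sub>t(D\<^sub>r\<^sup>c) = 0}\<close>. For \<open>d = 1\<close>, where the
  maximal displacement of the walk is the signed rightmost position, the corresponding object is
  the right end of the support of \<open>w\<^sub>t\<close>: the domain is the half-line \<open>z < r\<close>, and \<open>r\<close> ranges over
  all reals. (The Euclidean radius cannot be the limit there: it is non-negative, whereas the
  rightmost position is below \<open>-sqrt n\<close> with asymptotically positive conditional probability.)
  Under each excursion measure, for \<open>t > 0\<close>, almost every \<open>w\<close> with \<open>w\<^sub>t \<noteq> 0\<close> has compactly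
  supported \<open>w\<^sub>t\<close>; then the infimum is over a nonempty set that is bounded below.
\<close>

definition displacement_domain :: "real \<Rightarrow> (real ^ 'd) set" where
  "displacement_domain r = {z. displacement z < r}"

definition support_radius :: "real \<Rightarrow> (real \<Rightarrow> (real ^ 'd) measure) \<Rightarrow> real" where
  "support_radius t w =
     Inf {r. (CARD('d) = 1 \<or> 0 \<le> r) \<and> emeasure (w t) (- displacement_domain r) = 0}"

end

theory Submission
  imports Defs "HOL-Real_Asymp.Real_Asymp"
begin

text \<open>
  Let \<open>hit p s\<close> be the probability that at least one offspring is marked when each is marked
  independently with probability \<open>s\<close>. Branching at the root shows that the probability that
  generation \<open>n\<close> of the walk from \<open>a\<close> visits \<open>A\<close> is the \<open>n\<close>-th iterate, at \<open>a\<close>, of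
  \<open>f \<mapsto> hit p (\<integral> f (\<cdot> + h) d\<nu> h)\<close> applied to the indicator of \<open>A\<close>. Under (H1) the defect
  \<open>s - hit p s\<close> is asymptotic to \<open>C s\<^sup>\<alpha>\<close> (an Abelian argument when \<open>\<alpha> < 2\<close>), so with
  \<open>\<beta> = 1 / (\<alpha> - 1)\<close> and diffusive scaling the iteration, multiplied by \<open>n\<^sup>\<beta>\<close>, is an explicit scheme
  for the log-Laplace equation of the super-Brownian motion. A Lindeberg argument and Gronwall's
  inequality make it converge for bounded Lipschitz initial functions.

  Letting the initial functions \<open>m g\<close> increase turns their limits into the excursion measure of
  \<open>{w. w\<^sub>1 {g > 0} > 0}\<close>, which is a lower bound for the rescaled probability of a displacement beyond
  \<open>r \<surd>n\<close>. For the upper bound the walk is cut at generation \<open>(1 - \<delta>) n\<close>: by the moment hypothesis in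
  (H2) particles at distance at least \<open>\<epsilon> \<surd>n\<close> from the target are unlikely to reach it in the remaining
  \<open>\<delta> n\<close> generations, and the others contribute at most their survival probability, of order
  \<open>(\<delta> n)\<close> to the power \<open>- \<beta>\<close>, which a finite \<open>m\<close> dominates. At continuity points of the limit law
  the two bounds meet; conditioning on survival divides by \<open>n\<^sup>\<beta>\<close> times the survival probability, which
  tends to the excursion measure of survival.
\<close>

section \<open>Generating functions\<close>

text \<open>Two obstacles shape the argument. Duhamel's formula applies the random walk semigroup to
  nonlinear terms that depend on \<open>n\<close> and on the step, so the central limit theorem is
  needed uniformly over all functions with a given bound and Lipschitz constant. Such functions need
  not be differentiable and the covariance matrix may be singular, so Brownian motion cannot supply
  the derivatives; an auxiliary isotropic Gaussian smoothing does, and since convolutions commute it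
  can be moved to wherever a jump is being replaced.

  For displacements, a first-moment bound over all particles controls the chance of travelling
  \<open>\<rho>\<close> in \<open>n\<close> generations but lacks the factor
  \<open>n powr - \<beta>\<close>, the order of the survival probability. Halving the time restores
  it: a particle that ends far out either was far out at mid-time, and then its line must in
  addition survive the second half, or travels a fixed fraction of the distance in the second half.
  The latter event is of the original kind and closes a recursion.\<close>

definition pgf :: "nat pmf \<Rightarrow> real \<Rightarrow> real" where
  "pgf p x = (\<Sum>k. pmf p k * x ^ k)"

definition hit :: "nat pmf \<Rightarrow> real \<Rightarrow> real" where
  "hit p s = 1 - pgf p (1 - s)"

definition tail_prob :: "nat pmf \<Rightarrow> nat \<Rightarrow> real" where
  "tail_prob p n = (\<Sum>k. pmf p (n + k))"

lemma pmf_nat_sums_one: "pmf (p :: nat pmf) sums 1"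
proof -
  have "(\<lambda>n. measure_pmf.prob p {n}) sums measure_pmf.prob p (\<Union>n. {n})"
    by (rule measure_pmf.finite_measure_UNION) (auto simp: disjoint_family_on_def)
  then show ?thesis by (simp add: measure_pmf_single)
qed

lemma pgf_sums:
  assumes "0 \<le> x" "x \<le> 1"
  shows "(\<lambda>k. pmf p k * x ^ k) sums pgf p x"
  unfolding pgf_def
  by (rule summable_sums, rule summable_comparison_test[OF _ sums_summable[OF pmf_nat_sums_one[of p]]])
    (use assms in \<open>auto simp: mult_left_le power_le_one\<close>)

lemma pgf_one: "pgf p 1 = 1"
  using pmf_nat_sums_one[of p] by (simp add: pgf_def sums_iff)

lemma hit_zero [simp]: "hit p 0 = 0"
  by (simp add: hit_def pgf_one)

lemma power_diff_le_mult:
  fixes x y :: real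
  assumes "0 \<le> y" "y \<le> x" "x \<le> 1"
  shows "x ^ k - y ^ k \<le> real k * (x - y)"
proof (induction k)
  case (Suc k)
  have "x ^ Suc k - y ^ Suc k = x * (x ^ k - y ^ k) + (x - y) * y ^ k" by (simp add: algebra_simps)
  also have "\<dots> \<le> 1 * (x ^ k - y ^ k) + (x - y) * 1"
    using assms by (intro add_mono mult_mono power_le_one) (auto intro: power_mono)
  finally show ?case using Suc by (simp add: algebra_simps)
qed simp

lemma hit_mono:
  assumes "0 \<le> s" "s \<le> t" "t \<le> 1"
  shows "hit p s \<le> hit p t"
proof -
  have "pgf p (1 - t) \<le> pgf p (1 - s)"
    by (rule sums_le[OF _ pgf_sums pgf_sums])
      (use assms in \<open>auto intro!: mult_left_mono power_mono\<close>)
  then show ?thesis by (simp add: hit_def)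
qed

lemma hit_nonneg: "0 \<le> s \<Longrightarrow> s \<le> 1 \<Longrightarrow> 0 \<le> hit p s"
  using hit_mono[of 0 s p] by simp

text \<open>Criticality in the form used throughout: a generating function with mean
  \<open>1\<close> has slope at most \<open>1\<close> on the unit interval, so differences do not
  grow under \<open>hit p\<close>. Termwise this is \<open>power_diff_le_mult\<close>.\<close>

lemma hit_diff_le:
  assumes "(\<lambda>k. real k * pmf p k) sums 1" "0 \<le> s" "s \<le> t" "t \<le> 1"
  shows "hit p t - hit p s \<le> t - s"
proof -
  have "(\<lambda>k. pmf p k * (1 - s) ^ k - pmf p k * (1 - t) ^ k) sums (pgf p (1 - s) - pgf p (1 - t))"
    by (intro sums_diff pgf_sums) (use assms in auto)
  moreover have "(\<lambda>k. (t - s) * (real k * pmf p k)) sums ((t - s) * 1)"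
    by (intro sums_mult assms)
  moreover have "pmf p k * (1 - s) ^ k - pmf p k * (1 - t) ^ k \<le> (t - s) * (real k * pmf p k)" for k
    using mult_left_mono[OF power_diff_le_mult[of "1 - t" "1 - s" k], of "pmf p k"] assms
    by (simp add: algebra_simps)
  ultimately have "pgf p (1 - s) - pgf p (1 - t) \<le> (t - s) * 1"
    by (rule sums_le[rotated 1])
  then show ?thesis by (simp add: hit_def)
qed

lemma hit_le_self:
  assumes "(\<lambda>k. real k * pmf p k) sums 1" "0 \<le> s" "s \<le> 1"
  shows "hit p s \<le> s"
  using hit_diff_le[OF assms(1), of 0 s] assms by simp

lemma hit_mem: "(\<lambda>k. real k * pmf p k) sums 1 \<Longrightarrow> 0 \<le> s \<Longrightarrow> s \<le> 1 \<Longrightarrow> 0 \<le> hit p s \<and> hit p s \<le> 1"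
  using hit_le_self[of p s] hit_nonneg[of s p] by simp

section \<open>Summed tails of the offspring law\<close>

lemma tail_prob_Suc: "tail_prob p (Suc n) = tail_prob p n - pmf p n"
proof -
  have "summable (\<lambda>k. pmf p (k + n))"
    using sums_summable[OF pmf_nat_sums_one[of p]] by (rule summable_ignore_initial_segment)
  from suminf_split_head[OF this] show ?thesis
    by (simp add: tail_prob_def add.commute)
qed

lemma tail_prob_0: "tail_prob p 0 = 1"
  using pmf_nat_sums_one[of p] by (simp add: tail_prob_def sums_iff)

lemma tail_prob_nonneg: "0 \<le> tail_prob p n"
proof -
  have "summable (\<lambda>k. pmf p (k + n))"
    using sums_summable[OF pmf_nat_sums_one[of p]] by (rule summable_ignore_initial_segment)
  then show ?thesis unfolding tail_prob_def by (intro suminf_nonneg) (simp_all add: add.commute)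
qed

lemma tail_prob_sums_mean:
  assumes "(\<lambda>k. real k * pmf p k) sums 1"
  shows "(\<lambda>j. tail_prob p (Suc j)) sums 1"
proof -
  \<comment> \<open>Summation by parts. The boundary term vanishes because \<open>le\<close> bounds
    it by the remainder of the convergent mean series.\<close>
  have eq: "(\<Sum>j<n. tail_prob p (Suc j)) = (\<Sum>k<Suc n. real k * pmf p k) + real n * tail_prob p (Suc n)" for n
  proof (induction n)
    case (Suc n)
    show ?case unfolding sum.lessThan_Suc[of _ "n"] Suc
      by (simp add: tail_prob_Suc[of p "Suc n"] algebra_simps)
  qed simp
  have sm: "summable (\<lambda>k. real k * pmf p k)" using assms by (rule sums_summable)
  have le: "real n * tail_prob p (Suc n) \<le> (\<Sum>k. real (k + Suc n) * pmf p (k + Suc n))" for n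
  proof -
    have s1: "summable (\<lambda>k. pmf p (k + Suc n))"
      using sums_summable[OF pmf_nat_sums_one[of p]] by (rule summable_ignore_initial_segment)
    have "real n * tail_prob p (Suc n) = (\<Sum>k. real n * pmf p (k + Suc n))"
      unfolding tail_prob_def using suminf_mult[OF s1, of "real n"] by (simp add: add.commute)
    also have "\<dots> \<le> (\<Sum>k. real (k + Suc n) * pmf p (k + Suc n))"
      by (intro suminf_le summable_mult s1 summable_ignore_initial_segment[OF sm] mult_right_mono) auto
    finally show ?thesis .
  qed
  have eqs: "(\<Sum>k. real (k + Suc n) * pmf p (k + Suc n)) = 1 - (\<Sum>k<Suc n. real k * pmf p k)" for n
    using suminf_minus_initial_segment[OF sm, of "Suc n"] assms by (simp add: sums_iff)
  have l1: "(\<lambda>n. \<Sum>k<Suc n. real k * pmf p k) \<longlonglongrightarrow> 1"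
    using assms unfolding sums_def by (rule LIMSEQ_Suc)
  have "(\<lambda>n. real n * tail_prob p (Suc n)) \<longlonglongrightarrow> 0"
  proof (rule tendsto_sandwich[OF _ _ tendsto_const])
    show "(\<lambda>n. 1 - (\<Sum>k<Suc n. real k * pmf p k)) \<longlonglongrightarrow> 0"
      using tendsto_diff[OF tendsto_const l1, of 1] by simp
    show "\<forall>\<^sub>F n in sequentially. 0 \<le> real n * tail_prob p (Suc n)"
      by (simp add: tail_prob_nonneg)
    show "\<forall>\<^sub>F n in sequentially. real n * tail_prob p (Suc n) \<le> 1 - (\<Sum>k<Suc n. real k * pmf p k)"
      using le unfolding eqs by simp
  qed
  from tendsto_add[OF l1 this] show ?thesis unfolding sums_def eq by simp
qed

text \<open>This is the expectation of the positive part of \<open>N - 1 - i\<close>, where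
  \<open>N\<close> has law \<open>p\<close>. Tails are summed twice because at criticality the
  generating function minus the identity carries the factor \<open>(1 - x)\<^sup>2\<close>, and
  these are the coefficients of the quotient.\<close>

definition tail_sum :: "nat pmf \<Rightarrow> nat \<Rightarrow> real" where
  "tail_sum p i = (\<Sum>j. tail_prob p (Suc (Suc (i + j))))"

context
  fixes p :: "nat pmf"
  assumes mean: "(\<lambda>k. real k * pmf p k) sums 1"
begin

lemma tail_sum_summable: "summable (\<lambda>j. tail_prob p (Suc (Suc (i + j))))"
proof -
  have "summable (\<lambda>j. tail_prob p (Suc (j + Suc i)))"
    using sums_summable[OF tail_prob_sums_mean[OF mean]] by (rule summable_ignore_initial_segment)
  then show ?thesis by (simp add: add.commute)
qed

lemma tail_sum_nonneg: "0 \<le> tail_sum p i"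
  unfolding tail_sum_def by (intro suminf_nonneg tail_sum_summable tail_prob_nonneg)

lemma tail_sum_Suc: "tail_sum p (Suc i) = tail_sum p i - tail_prob p (Suc (Suc i))"
  unfolding tail_sum_def using suminf_split_head[OF tail_sum_summable[of i]] by simp

lemma tail_sum_0: "tail_sum p 0 = pmf p 0"
  unfolding tail_sum_def
  using suminf_split_head[OF sums_summable[OF tail_prob_sums_mean[OF mean]]] tail_prob_sums_mean[OF mean]
  by (simp add: sums_iff tail_prob_Suc tail_prob_0)

lemma tail_sum_le_one: "tail_sum p i \<le> 1"
proof (induction i)
  case 0 then show ?case by (simp add: tail_sum_0 pmf_le_1)
next
  case (Suc i) then show ?case using tail_prob_nonneg[of p "Suc (Suc i)"] by (simp add: tail_sum_Suc)
qed

lemma tail_sum_power_summable: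
  assumes "0 \<le> x" "x < 1"
  shows "summable (\<lambda>i. tail_sum p i * x ^ i)"
  by (rule summable_comparison_test[OF _ summable_geometric[of x]])
    (use assms in \<open>auto simp: tail_sum_nonneg tail_sum_le_one intro!: mult_left_le_one_le\<close>)

text \<open>Two summations by parts, each extracting one factor \<open>1 - x\<close>:
  \<open>A\<close> passes from the doubly summed tails to the tails, \<open>B\<close> from the tails
  to the point probabilities, and \<open>C\<close> rewrites the generating function so that the
  common series can be eliminated.\<close>

lemma pgf_minus_self:
  assumes x: "0 \<le> x" "x < 1"
  shows "pgf p x - x = (1 - x)\<^sup>2 * (\<Sum>i. tail_sum p i * x ^ i)"
proof -
  let ?a = "\<lambda>i. tail_sum p i * x ^ i" and ?t = "\<lambda>i. tail_prob p (Suc (Suc i)) * x ^ i"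
  have sa: "summable ?a" by (rule tail_sum_power_summable[OF x])
  have t_le: "tail_prob p n \<le> 1" for n
  proof (induction n)
    case (Suc n)
    then show ?case using pmf_nonneg[of p n] unfolding tail_prob_Suc by linarith
  qed (simp add: tail_prob_0)
  have st: "summable ?t"
    by (rule summable_comparison_test[OF _ summable_geometric[of x]])
      (use x in \<open>auto simp: tail_prob_nonneg t_le intro!: mult_left_le_one_le\<close>)
  have sp: "summable (\<lambda>k. pmf p k * x ^ k)" using pgf_sums[of x p] x by (simp add: sums_iff)
  have 1: "(\<Sum>i. ?a (Suc i)) = suminf ?a - pmf p 0"
    using suminf_split_head[OF sa] by (simp add: tail_sum_0)
  have "(\<Sum>i. ?a (Suc i)) = (\<Sum>i. x * ?a i - x * ?t i)"
    by (simp add: tail_sum_Suc algebra_simps)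
  also have "\<dots> = x * suminf ?a - x * suminf ?t"
    using suminf_diff[OF summable_mult[OF sa] summable_mult[OF st], of x x]
      suminf_mult[OF sa, of x] suminf_mult[OF st, of x] by simp
  finally have A: "suminf ?a - pmf p 0 = x * suminf ?a - x * suminf ?t" using 1 by simp
  have 2: "(\<Sum>i. ?t (Suc i)) = suminf ?t - (1 - pmf p 0 - pmf p 1)"
    using suminf_split_head[OF st] by (simp add: tail_prob_Suc tail_prob_0)
  have sp2: "summable (\<lambda>k. pmf p (Suc (Suc k)) * x ^ Suc k)"
  proof (rule summable_comparison_test[OF _ summable_geometric[of x]])
    have "pmf p n * x ^ Suc k \<le> 1 * x ^ k" for n k
      using x by (intro mult_mono pmf_le_1) (auto simp: mult_left_le_one_le)
    then show "\<exists>N. \<forall>n\<ge>N. norm (pmf p (Suc (Suc n)) * x ^ Suc n) \<le> x ^ n"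
      using x by (auto simp: abs_mult)
    show "norm x < 1" using x by simp
  qed
  have "(\<Sum>i. ?t (Suc i)) = (\<Sum>i. x * ?t i - pmf p (Suc (Suc i)) * x ^ Suc i)"
    by (simp add: tail_prob_Suc[of p "Suc (Suc i)" for i] algebra_simps)
  also have "\<dots> = x * suminf ?t - (\<Sum>i. pmf p (Suc (Suc i)) * x ^ Suc i)"
    using suminf_diff[OF summable_mult[OF st, of x] sp2] suminf_mult[OF st, of x] by simp
  finally have B: "suminf ?t - (1 - pmf p 0 - pmf p 1) =
      x * suminf ?t - (\<Sum>i. pmf p (Suc (Suc i)) * x ^ Suc i)" using 2 by simp
  have "pgf p x = pmf p 0 + (pmf p 1 * x + (\<Sum>i. pmf p (Suc (Suc i)) * x ^ Suc (Suc i)))"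
    unfolding pgf_def
    using suminf_split_initial_segment[OF sp, of 2] by (simp add: numeral_2_eq_2)
  also have "(\<Sum>i. pmf p (Suc (Suc i)) * x ^ Suc (Suc i)) = x * (\<Sum>i. pmf p (Suc (Suc i)) * x ^ Suc i)"
    using suminf_mult[OF sp2, of x] by (simp add: ac_simps)
  finally have C: "pgf p x = pmf p 0 + (pmf p 1 * x + x * (\<Sum>i. pmf p (Suc (Suc i)) * x ^ Suc i))" .
  show ?thesis using A B C by (simp add: power2_eq_square) algebra
qed

end

section \<open>The defect at the critical point\<close>

text \<open>The remainders obey \<open>r (k + 1) = (1 - s) * r k + k * s\<^sup>2\<close>, so this
  limit, which is \<open>0 + 1 + ... + (k - 1)\<close>, and the bounds of the next lemma follow by
  induction on \<open>k\<close>.\<close>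

lemma binomial_remainder_tendsto:
  "((\<lambda>s::real. ((1 - s) ^ k - 1 + real k * s) / s\<^sup>2) \<longlongrightarrow> real k * (real k - 1) / 2) (at_right 0)"
proof (induction k)
  case (Suc k)
  have "((\<lambda>s::real. real k + (1 - s) * (((1 - s) ^ k - 1 + real k * s) / s\<^sup>2)) \<longlongrightarrow>
      real k + (1 - 0) * (real k * (real k - 1) / 2)) (at_right 0)"
    by (intro tendsto_intros Suc)
  moreover have "\<forall>\<^sub>F s::real in at_right 0. real k + (1 - s) * (((1 - s) ^ k - 1 + real k * s) / s\<^sup>2) =
      ((1 - s) ^ Suc k - 1 + real (Suc k) * s) / s\<^sup>2"
    using eventually_at_right_less[of "0::real"]
    by eventually_elim (simp add: field_simps power2_eq_square)
  ultimately have "((\<lambda>s::real. ((1 - s) ^ Suc k - 1 + real (Suc k) * s) / s\<^sup>2) \<longlongrightarrow>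
      real k + (1 - 0) * (real k * (real k - 1) / 2)) (at_right 0)"
    by (rule Lim_transform_eventually)
  then show ?case by (simp add: field_simps)
qed simp

lemma binomial_remainder_bounds:
  fixes s :: real
  assumes "0 \<le> s" "s \<le> 1"
  shows "0 \<le> (1 - s) ^ k - 1 + real k * s \<and> (1 - s) ^ k - 1 + real k * s \<le> (real k)\<^sup>2 * s\<^sup>2"
proof (induction k)
  case (Suc k)
  let ?r = "(1 - s) ^ k - 1 + real k * s"
  have eq: "(1 - s) ^ Suc k - 1 + real (Suc k) * s = (1 - s) * ?r + real k * s\<^sup>2"
    by (simp add: algebra_simps power2_eq_square)
  have "(1 - s) * ?r \<le> ?r" using Suc assms by (intro mult_left_le_one_le) auto
  then have "(1 - s) * ?r + real k * s\<^sup>2 \<le> (real k)\<^sup>2 * s\<^sup>2 + real k * s\<^sup>2" using Suc by simp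
  also have "\<dots> \<le> (real (Suc k))\<^sup>2 * s\<^sup>2"
    using assms by (simp add: power2_eq_square algebra_simps)
  finally show ?case unfolding eq using Suc assms by simp
qed simp

lemma self_minus_hit_sums:
  assumes "(\<lambda>k. real k * pmf p k) sums 1" "0 \<le> s" "s \<le> 1"
  shows "(\<lambda>k. pmf p k * ((1 - s) ^ k - 1 + real k * s)) sums (s - hit p s)"
proof -
  have "(\<lambda>k. pmf p k * (1 - s) ^ k - pmf p k + s * (real k * pmf p k)) sums (pgf p (1 - s) - 1 + s * 1)"
    by (intro sums_add sums_diff sums_mult pgf_sums pmf_nat_sums_one assms) (use assms in auto)
  then show ?thesis by (simp add: hit_def algebra_simps)
qed

text \<open>Dominated convergence for series: the finite second moment supplies the majorant
  \<open>k\<^sup>2 * pmf p k\<close>, uniform in \<open>s\<close>.\<close>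

lemma hit_defect_finite_variance:
  assumes mean: "(\<lambda>k. real k * pmf p k) sums 1" and var: "summable (\<lambda>k. (real k)\<^sup>2 * pmf p k)"
  shows "((\<lambda>s. (s - hit p s) / s\<^sup>2) \<longlongrightarrow> (1 / 2) * (\<Sum>k. real k * (real k - 1) * pmf p k)) (at_right 0)"
proof -
  have ev: "\<forall>\<^sub>F s::real in at_right 0. 0 < s \<and> s < 1"
    by (auto simp: eventually_at_right_field intro: exI[of _ 1])
  have "((\<lambda>s. \<Sum>k. pmf p k * (((1 - s) ^ k - 1 + real k * s) / s\<^sup>2)) \<longlongrightarrow>
      (\<Sum>k. pmf p k * (real k * (real k - 1) / 2))) (at_right 0)"
  proof (rule tannerys_theorem[THEN conjunct2, THEN conjunct2])
    show "((\<lambda>s. pmf p k * (((1 - s) ^ k - 1 + real k * s) / s\<^sup>2)) \<longlongrightarrow>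
      pmf p k * (real k * (real k - 1) / 2)) (at_right 0)" for k
      by (intro tendsto_mult tendsto_const binomial_remainder_tendsto)
    have "\<forall>\<^sub>F x in sequentially \<times>\<^sub>F at_right (0::real). 0 < snd x \<and> snd x < 1"
      by (rule eventually_compose_filterlim[OF ev filterlim_snd])
    then show "\<forall>\<^sub>F (k, s) in sequentially \<times>\<^sub>F at_right (0::real).
        norm (pmf p k * (((1 - s) ^ k - 1 + real k * s) / s\<^sup>2)) \<le> (real k)\<^sup>2 * pmf p k"
    proof (eventually_elim, clarsimp)
      fix k :: nat and s :: real assume s: "0 < s" "s < 1"
      then have "\<bar>((1 - s) ^ k - 1 + real k * s) / s\<^sup>2\<bar> \<le> (real k)\<^sup>2"
        using binomial_remainder_bounds[of s k] by (simp add: field_simps abs_of_nonneg)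
      then show "\<bar>pmf p k * ((1 - s) ^ k - 1 + real k * s)\<bar> / s\<^sup>2 \<le> (real k)\<^sup>2 * pmf p k"
        using mult_left_mono[of _ _ "pmf p k"] by (fastforce simp: abs_mult mult.commute)
    qed
  qed (use var in auto)
  also have "(\<Sum>k. pmf p k * (real k * (real k - 1) / 2)) = (\<Sum>k. 1 / 2 * (real k * (real k - 1) * pmf p k))"
    by (simp add: mult_ac)
  also have "\<dots> = 1 / 2 * (\<Sum>k. real k * (real k - 1) * pmf p k)"
  proof (rule suminf_mult)
    show "summable (\<lambda>k. real k * (real k - 1) * pmf p k)"
      using summable_diff[OF var sums_summable[OF mean]] by (simp add: power2_eq_square algebra_simps)
  qed
  finally show ?thesis
  proof (rule Lim_transform_eventually)
    show "\<forall>\<^sub>F s in at_right 0. (\<Sum>k. pmf p k * (((1 - s) ^ k - 1 + real k * s) / s\<^sup>2)) = (s - hit p s) / s\<^sup>2"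
      using ev
    proof eventually_elim
      case (elim s)
      have "(\<lambda>k. pmf p k * ((1 - s) ^ k - 1 + real k * s) / s\<^sup>2) sums ((s - hit p s) / s\<^sup>2)"
        by (intro sums_divide self_minus_hit_sums mean) (use elim in auto)
      then show ?case by (simp add: sums_iff)
    qed
  qed
qed

text \<open>The Stolz-Cesaro theorem in its 0/0 form. From some index on, \<open>x j\<close> differs
  from \<open>L\<close> times the decrement of \<open>b\<close> by a small multiple of that
  decrement, and the decrements telescope to \<open>b i\<close>.\<close>

lemma tail_series_ratio_tendsto:
  fixes x b :: "nat \<Rightarrow> real"
  assumes sx: "summable x" and b0: "b \<longlonglongrightarrow> 0" and dec: "\<And>j. b (Suc j) < b j"
    and lim: "(\<lambda>j. x j / (b j - b (Suc j))) \<longlonglongrightarrow> L"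
  shows "(\<lambda>i. (\<Sum>j. x (i + j)) / b i) \<longlonglongrightarrow> L"
proof (rule LIMSEQ_I)
  fix e :: real assume "0 < e"
  then obtain N where N: "\<And>j. j \<ge> N \<Longrightarrow> \<bar>x j / (b j - b (Suc j)) - L\<bar> < e / 2"
    using LIMSEQ_D[OF lim, of "e / 2"] by auto
  have pos: "0 < b j" for j
  proof -
    have "b (Suc j) \<ge> 0"
      by (rule LIMSEQ_le_const2[OF b0])
        (use lift_Suc_antimono_le[of b, OF less_imp_le[OF dec]] in \<open>auto intro!: exI[of _ "Suc j"]\<close>)
    then show ?thesis using dec[of j] by simp
  qed
  show "\<exists>N. \<forall>i\<ge>N. norm ((\<Sum>j. x (i + j)) / b i - L) < e"
  proof (intro exI allI impI)
    fix i assume i: "N \<le> i"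
    have sxi: "summable (\<lambda>j. x (i + j))"
      using summable_ignore_initial_segment[OF sx, of i] by (simp add: add.commute)
    have tele: "(\<lambda>j. b (i + j) - b (i + Suc j)) sums (b i)"
      using telescope_sums'[of "\<lambda>j. b (i + j)" 0] LIMSEQ_ignore_initial_segment[OF b0, of i]
      by (simp add: add.commute)
    have trm: "\<bar>x j - L * (b j - b (Suc j))\<bar> \<le> e / 2 * (b j - b (Suc j))" if "N \<le> j" for j
    proof -
      have d: "0 < b j - b (Suc j)" using dec[of j] by simp
      have "x j - L * (b j - b (Suc j)) = (x j / (b j - b (Suc j)) - L) * (b j - b (Suc j))"
        using d by (simp add: field_simps)
      then show ?thesis using N[OF that] d by (simp add: abs_mult)
    qed
    have A: "(\<lambda>j. x (i + j) - L * (b (i + j) - b (i + Suc j))) sums ((\<Sum>j. x (i + j)) - L * b i)"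
      by (intro sums_diff sums_mult summable_sums sxi tele)
    have trm': "\<bar>x (i + j) - L * (b (i + j) - b (Suc (i + j)))\<bar> \<le> e / 2 * (b (i + j) - b (Suc (i + j)))" for j
      using trm[of "i + j"] i by simp
    have "\<bar>(\<Sum>j. x (i + j)) - L * b i\<bar> \<le> e / 2 * b i"
    proof (rule abs_leI)
      show "(\<Sum>j. x (i + j)) - L * b i \<le> e / 2 * b i"
        by (rule sums_le[OF _ A sums_mult[OF tele]], unfold add_Suc_right, rule abs_le_D1[OF trm'])
      show "- ((\<Sum>j. x (i + j)) - L * b i) \<le> e / 2 * b i"
        by (rule sums_le[OF _ sums_minus[OF A] sums_mult[OF tele]], unfold add_Suc_right, rule abs_le_D2[OF trm'])
    qed
    moreover have "(\<Sum>j. x (i + j)) / b i - L = ((\<Sum>j. x (i + j)) - L * b i) / b i"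
      using pos[of i] by (simp add: field_simps)
    ultimately have "\<bar>(\<Sum>j. x (i + j)) / b i - L\<bar> \<le> e / 2"
      using pos[of i] by (simp add: abs_divide divide_le_eq)
    then show "norm ((\<Sum>j. x (i + j)) / b i - L) < e" using \<open>0 < e\<close> by simp
  qed
qed

text \<open>An Abelian comparison: finitely many terms contribute a bounded error, which the
  diverging denominator absorbs, and the remaining terms have a small relative error because
  \<open>a\<close> is positive.\<close>

lemma abel_ratio_tendsto:
  fixes r a :: "nat \<Rightarrow> real"
  assumes a: "\<And>i. 0 < a i" and lim: "(\<lambda>i. r i / a i) \<longlonglongrightarrow> L"
    and sa: "\<And>x. 0 < x \<Longrightarrow> x < 1 \<Longrightarrow> summable (\<lambda>i. a i * x ^ i)"
    and sr: "\<And>x. 0 < x \<Longrightarrow> x < 1 \<Longrightarrow> summable (\<lambda>i. r i * x ^ i)"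
    and top: "filterlim (\<lambda>x. \<Sum>i. a i * x ^ i) at_top (at_left 1)"
  shows "((\<lambda>x. (\<Sum>i. r i * x ^ i) / (\<Sum>i. a i * x ^ i)) \<longlongrightarrow> L) (at_left 1)"
proof (rule tendstoI)
  fix e :: real assume "0 < e"
  then obtain N where N: "\<And>j. j \<ge> N \<Longrightarrow> \<bar>r j / a j - L\<bar> < e / 2"
    using LIMSEQ_D[OF lim, of "e / 2"] by auto
  define M where "M = (\<Sum>i<N. \<bar>r i - L * a i\<bar>) + 1"
  have "M \<ge> 1" by (simp add: M_def sum_nonneg)
  have ev1: "\<forall>\<^sub>F x::real in at_left 1. 0 < x \<and> x < 1"
    by (auto simp: eventually_at_left_field intro: exI[of _ 0])
  have ev2: "\<forall>\<^sub>F x in at_left 1. 2 * M / e < (\<Sum>i. a i * x ^ i)"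
    using top by (simp add: filterlim_at_top_dense)
  show "\<forall>\<^sub>F x in at_left 1. dist ((\<Sum>i. r i * x ^ i) / (\<Sum>i. a i * x ^ i)) L < e"
    using ev1 ev2
  proof eventually_elim
    case (elim x)
    let ?A = "\<Sum>i. a i * x ^ i" and ?R = "\<Sum>i. r i * x ^ i"
    have x: "0 < x" "x < 1" using elim by auto
    have Apos: "0 < ?A" 
    proof -
      have "0 < 2 * M / e" using \<open>M \<ge> 1\<close> \<open>0 < e\<close> by simp
      then show ?thesis using elim by linarith
    qed
    have s1: "(\<lambda>i. (r i - L * a i) * x ^ i) sums (?R - L * ?A)"
      using sums_diff[OF summable_sums[OF sr[OF x]] sums_mult[OF summable_sums[OF sa[OF x]], of L]]
      by (simp add: algebra_simps)
    define c where "c i = (if i < N then \<bar>r i - L * a i\<bar> else 0)" for i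
    have sc: "c sums (M - 1)"
      using sums_finite[of "{..<N}" c] unfolding M_def c_def by simp
    have bnd: "\<bar>(r i - L * a i) * x ^ i\<bar> \<le> c i + e / 2 * (a i * x ^ i)" for i
    proof (cases "i < N")
      case True
      have "\<bar>(r i - L * a i) * x ^ i\<bar> \<le> \<bar>r i - L * a i\<bar> * 1"
        unfolding abs_mult using x by (intro mult_left_mono) (auto simp: power_le_one)
      moreover have "0 \<le> e / 2 * (a i * x ^ i)" using a[of i] x \<open>0 < e\<close> by simp
      ultimately show ?thesis using True by (simp add: c_def)
    next
      case False
      have "r i - L * a i = (r i / a i - L) * a i" using a[of i] by (simp add: field_simps)
      then have "\<bar>r i - L * a i\<bar> \<le> e / 2 * a i"
        using N[of i] False a[of i] by (simp add: abs_mult)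
      then have "\<bar>r i - L * a i\<bar> * x ^ i \<le> e / 2 * a i * x ^ i" using x by (intro mult_right_mono) auto
      then show ?thesis using False x by (simp add: c_def abs_mult mult.assoc)
    qed
    have s2: "(\<lambda>i. c i + e / 2 * (a i * x ^ i)) sums (M - 1 + e / 2 * ?A)"
      by (intro sums_add sc sums_mult summable_sums sa x)
    have "\<bar>?R - L * ?A\<bar> \<le> M - 1 + e / 2 * ?A"
    proof (rule abs_leI)
      show "?R - L * ?A \<le> M - 1 + e / 2 * ?A"
        by (rule sums_le[OF _ s1 s2]) (use bnd in \<open>simp add: abs_le_iff\<close>)
      show "- (?R - L * ?A) \<le> M - 1 + e / 2 * ?A"
        by (rule sums_le[OF _ sums_minus[OF s1] s2]) (use bnd in \<open>simp add: abs_le_iff\<close>)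
    qed
    also have "\<dots> < e * ?A" using elim \<open>0 < e\<close> by (simp add: field_simps)
    finally have "\<bar>?R - L * ?A\<bar> < e * ?A" .
    moreover have "?R / ?A - L = (?R - L * ?A) / ?A" using Apos by (simp add: field_simps)
    ultimately show ?case using Apos by (simp add: dist_real_def abs_divide divide_less_eq)
  qed
qed

lemma power_law_difference_ratio:
  fixes \<alpha> :: real
  assumes "1 < \<alpha>" "\<alpha> < 2"
  shows "(\<lambda>j. real (Suc (Suc j)) powr (- \<alpha>) / (real (Suc j) powr (1 - \<alpha>) - real (Suc (Suc j)) powr (1 - \<alpha>)))
    \<longlonglongrightarrow> 1 / (\<alpha> - 1)"
  using assms unfolding inverse_eq_divide[symmetric] by real_asymp

text \<open>Three comparisons are chained. The tail is asymptotic to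
  \<open>\<kappa> * j powr - \<alpha>\<close>, so the doubly summed tail is asymptotic to
  \<open>\<kappa> / (\<alpha> - 1)\<close> times \<open>b\<close>; \<open>a\<close> lists the
  coefficients of the binomial series of \<open>(1 - x) powr (\<alpha> - 2)\<close>, and
  \<open>b / a\<close> tends to \<open>Gamma (2 - \<alpha>)\<close>;
  \<open>abel_ratio_tendsto\<close> passes from coefficients to functions.\<close>

lemma hit_defect_power_tail:
  assumes mean: "(\<lambda>k. real k * pmf p k) sums 1" and al: "1 < \<alpha>" "\<alpha> < 2"
    and tail: "(\<lambda>n. real n powr \<alpha> * tail_prob p n) \<longlonglongrightarrow> \<kappa>"
  shows "((\<lambda>s. (s - hit p s) / s powr \<alpha>) \<longlongrightarrow> \<kappa> * Gamma (2 - \<alpha>) / (\<alpha> - 1)) (at_right 0)"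
proof -
  define b where "b i = real (Suc i) powr (1 - \<alpha>)" for i
  define a where "a i = pochhammer (2 - \<alpha>) i / fact i" for i
  define r where "r = tail_sum p"
  have b0: "b \<longlonglongrightarrow> 0" unfolding b_def using al by real_asymp
  have bdec: "b (Suc j) < b j" for j
    unfolding b_def using al by (intro powr_less_mono2_neg) auto
  have "(\<lambda>j. real (Suc (Suc j)) powr \<alpha> * tail_prob p (Suc (Suc j)) *
      (real (Suc (Suc j)) powr (- \<alpha>) / (b j - b (Suc j)))) \<longlonglongrightarrow> \<kappa> * (1 / (\<alpha> - 1))"
    unfolding b_def
    by (intro tendsto_mult power_law_difference_ratio al LIMSEQ_Suc[OF LIMSEQ_Suc[OF tail]])
  then have lim: "(\<lambda>j. tail_prob p (Suc (Suc j)) / (b j - b (Suc j))) \<longlonglongrightarrow> \<kappa> / (\<alpha> - 1)"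
    by (simp add: powr_minus divide_simps)
  have rb: "(\<lambda>i. r i / b i) \<longlonglongrightarrow> \<kappa> / (\<alpha> - 1)"
    unfolding r_def tail_sum_def
    using tail_series_ratio_tendsto[OF _ b0 bdec lim] tail_sum_summable[OF mean, of 0] by simp
  have apos: "0 < a i" for i
    unfolding a_def using al by (intro divide_pos_pos pochhammer_pos) auto
  have "(\<lambda>i. a i / b i) \<longlonglongrightarrow> rGamma (2 - \<alpha>)"
  proof -
    \<comment> \<open>\<open>rGamma_series\<close> has one Pochhammer factor and one power of
      \<open>i\<close> too many; the second factor here removes both, and the third replaces
      \<open>i\<close> by \<open>Suc i\<close> in the remaining power.\<close>
    have "(\<lambda>i. rGamma_series (2 - \<alpha>) i * (real i / (2 - \<alpha> + real i)) * (real i powr (1 - \<alpha>) / b i)) \<longlonglongrightarrow> rGamma (2 - \<alpha>) * 1 * 1"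
    proof (intro tendsto_mult rGamma_series_LIMSEQ)
      show "(\<lambda>i. real i / (2 - \<alpha> + real i)) \<longlonglongrightarrow> 1" using al by real_asymp
      show "(\<lambda>i. real i powr (1 - \<alpha>) / b i) \<longlonglongrightarrow> 1" unfolding b_def using al by real_asymp
    qed
    moreover have "\<forall>\<^sub>F i in sequentially. rGamma_series (2 - \<alpha>) i * (real i / (2 - \<alpha> + real i)) * (real i powr (1 - \<alpha>) / b i) = a i / b i"
      using eventually_gt_at_top[of 0]
    proof eventually_elim
      case (elim i)
      have "exp ((2 - \<alpha>) * ln (real i)) = real i * real i powr (1 - \<alpha>)"
        using elim powr_add[of "real i" 1 "1 - \<alpha>"] by (simp add: powr_def)
      moreover have "P * d / (F * (m * X)) * (m / d) * (X / c) = P / F / c"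
        if "d \<noteq> 0" "m \<noteq> 0" "X \<noteq> 0" for P d F m X c :: real
        using that by simp
      ultimately show ?case
        using elim al by (simp add: rGamma_series_def a_def pochhammer_Suc)
    qed
    ultimately show ?thesis by (simp add: Lim_transform_eventually)
  qed
  then have ba: "(\<lambda>i. b i / a i) \<longlonglongrightarrow> Gamma (2 - \<alpha>)"
    using tendsto_inverse[of "\<lambda>i. a i / b i" "rGamma (2 - \<alpha>)"] al Gamma_real_pos[of "2 - \<alpha>"]
    by (simp add: Gamma_def)
  have bpos: "0 < b i" for i by (simp add: b_def)
  have ra: "(\<lambda>i. r i / a i) \<longlonglongrightarrow> \<kappa> * Gamma (2 - \<alpha>) / (\<alpha> - 1)"
  proof -
    have eq: "r i / b i * (b i / a i) = r i / a i" for i using bpos[of i] by simp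
    have "(\<lambda>i. r i / b i * (b i / a i)) \<longlonglongrightarrow> \<kappa> / (\<alpha> - 1) * Gamma (2 - \<alpha>)"
      by (rule tendsto_mult[OF rb ba])
    then show ?thesis unfolding eq by simp
  qed
  have sa: "(\<lambda>i. a i * x ^ i) sums (1 - x) powr (\<alpha> - 2)" if "0 < x" "x < 1" for x
  proof -
    have "(\<lambda>n. ((\<alpha> - 2) gchoose n) * (- x) ^ n) sums (1 + (- x)) powr (\<alpha> - 2)"
      by (rule gen_binomial_real) (use that in auto)
    moreover have "((\<alpha> - 2) gchoose n) * (- x) ^ n = a n * x ^ n" for n
    proof -
      have "(- 1 :: real) ^ n * (- 1) ^ n = 1" by (simp flip: power_mult_distrib)
      moreover have "c * P / F * (c * X) = c * c * (P / F * X)" for c P F X :: real by simp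
      ultimately show ?thesis
        by (simp only: gbinomial_pochhammer a_def power_minus[of x] minus_diff_eq mult_1)
    qed
    ultimately show ?thesis by simp
  qed
  have top: "filterlim (\<lambda>x. \<Sum>i. a i * x ^ i) at_top (at_left 1)"
  proof -
    have "filterlim (\<lambda>x::real. (1 - x) powr (\<alpha> - 2)) at_top (at_left 1)" using al by real_asymp
    moreover have "\<forall>\<^sub>F x::real in at_left 1. 0 < x \<and> x < 1"
      by (auto simp: eventually_at_left_field intro: exI[of _ 0])
    then have "\<forall>\<^sub>F x in at_left 1. (1 - x) powr (\<alpha> - 2) = (\<Sum>i. a i * x ^ i)"
      by eventually_elim (use sa in \<open>auto simp: sums_iff\<close>)
    ultimately show ?thesis by (rule filterlim_mono_eventually[OF _ order_refl order_refl])
  qed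
  have "((\<lambda>x. (\<Sum>i. r i * x ^ i) / (\<Sum>i. a i * x ^ i)) \<longlongrightarrow> \<kappa> * Gamma (2 - \<alpha>) / (\<alpha> - 1)) (at_left 1)"
    by (rule abel_ratio_tendsto[OF apos ra _ _ top])
      (use sa tail_sum_power_summable[OF mean] in \<open>auto simp: r_def sums_iff\<close>)
  moreover have "filterlim (\<lambda>s::real. 1 - s) (at_left 1) (at_right 0)" by real_asymp
  ultimately have "((\<lambda>s. (\<Sum>i. r i * (1 - s) ^ i) / (\<Sum>i. a i * (1 - s) ^ i)) \<longlongrightarrow>
      \<kappa> * Gamma (2 - \<alpha>) / (\<alpha> - 1)) (at_right 0)"
    by (rule filterlim_compose)
  then show ?thesis
  proof (rule Lim_transform_eventually)
    have "\<forall>\<^sub>F s::real in at_right 0. 0 < s \<and> s < 1"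
      by (auto simp: eventually_at_right_field intro: exI[of _ 1])
    then show "\<forall>\<^sub>F s in at_right 0. (\<Sum>i. r i * (1 - s) ^ i) / (\<Sum>i. a i * (1 - s) ^ i) = (s - hit p s) / s powr \<alpha>"
    proof eventually_elim
      case (elim s)
      have "(\<Sum>i. a i * (1 - s) ^ i) = s powr (\<alpha> - 2)"
        using sa[of "1 - s"] elim by (simp add: sums_iff)
      moreover have "s - hit p s = s\<^sup>2 * (\<Sum>i. r i * (1 - s) ^ i)"
        using pgf_minus_self[OF mean, of "1 - s"] elim by (simp add: hit_def r_def)
      moreover have "s powr \<alpha> = s\<^sup>2 * s powr (\<alpha> - 2)"
        using elim by (simp add: powr_diff)
      ultimately show ?case using elim by simp
    qed
  qed
qed

section \<open>Survival probability\<close>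

lemma offspring_hyp_defect:
  assumes "offspring_hyp p \<alpha> \<kappa>"
  shows "((\<lambda>s. (s - hit p s) / s powr \<alpha>) \<longlongrightarrow> branching_const p \<alpha> \<kappa>) (at_right 0)"
proof (cases "\<alpha> < 2")
  case True
  then show ?thesis
    using hit_defect_power_tail[of p \<alpha> \<kappa>] assms
    by (auto simp: offspring_hyp_def branching_const_def tail_prob_def)
next
  case False
  then have "((\<lambda>s. (s - hit p s) / s\<^sup>2) \<longlongrightarrow> branching_const p \<alpha> \<kappa>) (at_right 0)"
    using hit_defect_finite_variance[of p] assms by (auto simp: offspring_hyp_def branching_const_def)
  then show ?thesis
  proof (rule Lim_transform_eventually)
    show "\<forall>\<^sub>F s in at_right 0. (s - hit p s) / s\<^sup>2 = (s - hit p s) / s powr \<alpha>"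
      using eventually_at_right_less[of "0::real"]
      by eventually_elim (use False assms in \<open>auto simp: offspring_hyp_def powr_numeral\<close>)
  qed
qed

text \<open>For \<open>\<alpha> = 2\<close> the constant is half the second factorial moment. If it
  vanished, all mass would sit at \<open>0\<close> and \<open>1\<close>, and mean \<open>1\<close>
  would force \<open>pmf p 1 = 1\<close>.\<close>

lemma branching_const_pos:
  assumes "offspring_hyp p \<alpha> \<kappa>"
  shows "0 < branching_const p \<alpha> \<kappa>"
proof (cases "\<alpha> < 2")
  case True
  then show ?thesis
    using assms by (auto simp: offspring_hyp_def branching_const_def intro!: divide_pos_pos mult_pos_pos Gamma_real_pos)
next
  case False
  then have mean: "(\<lambda>k. real k * pmf p k) sums 1" and p1: "pmf p 1 < 1"
    and var: "summable (\<lambda>k. (real k)\<^sup>2 * pmf p k)"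
    using assms by (auto simp: offspring_hyp_def)
  have sm: "summable (\<lambda>k. real k * (real k - 1) * pmf p k)"
    using summable_diff[OF var sums_summable[OF mean]] by (simp add: power2_eq_square algebra_simps)
  have nn: "0 \<le> real k * (real k - 1) * pmf p k" for k by (cases k) auto
  have "\<exists>k\<ge>2. pmf p k \<noteq> 0"
  proof (rule ccontr)
    assume "\<not> ?thesis"
    have z: "pmf p k = 0" if "k \<ge> 2" for k
      using that \<open>\<not> (\<exists>k\<ge>2. pmf p k \<noteq> 0)\<close> by blast
    have "real k * pmf p k = 0" if "k \<notin> {1}" for k
    proof (cases "k = 0")
      case False
      then have "k \<ge> 2" using that by simp
      then show ?thesis using z by simp
    qed simp
    then have "(\<lambda>k. real k * pmf p k) sums (\<Sum>k\<in>{1}. real k * pmf p k)" by (intro sums_finite) auto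
    then have "(\<lambda>k. real k * pmf p k) sums pmf p 1" by simp
    then show False using mean p1 by (simp add: sums_iff)
  qed
  then obtain k where k: "k \<ge> 2" "pmf p k \<noteq> 0" by blast
  then have "0 < real k * (real k - 1) * pmf p k"
    by (intro mult_pos_pos pmf_pos) auto
  then have "0 < (\<Sum>k. real k * (real k - 1) * pmf p k)"
    using suminf_pos2[OF sm nn] by blast
  then show ?thesis using False by (simp add: branching_const_def)
qed

locale critical_stable =
  fixes p :: "nat pmf" and \<alpha> \<kappa> :: real
  assumes offspring: "offspring_hyp p \<alpha> \<kappa>"
begin

definition "C = branching_const p \<alpha> \<kappa>"
text \<open>With \<open>N = n powr \<beta>\<close> one has \<open>N powr \<alpha> = n * N\<close>:
  at values of order \<open>1 / N\<close> the defect accumulated over \<open>n\<close> generations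
  is again of order \<open>1 / N\<close>.\<close>

definition "\<beta> = 1 / (\<alpha> - 1)"

lemma mean: "(\<lambda>k. real k * pmf p k) sums 1"
  using offspring by (simp add: offspring_hyp_def)

lemma alpha: "1 < \<alpha>" "\<alpha> \<le> 2"
  using offspring by (auto simp: offspring_hyp_def)

lemma beta: "1 \<le> \<beta>" "\<beta> * (\<alpha> - 1) = 1" "\<beta> * \<alpha> = \<beta> + 1"
proof -
  show 1: "\<beta> * (\<alpha> - 1) = 1" using alpha by (simp add: \<beta>_def)
  then show "\<beta> * \<alpha> = \<beta> + 1" by (simp add: right_diff_distrib)
  show "1 \<le> \<beta>" using alpha by (simp add: \<beta>_def le_divide_eq)
qed

lemma C_pos: "0 < C"
  unfolding C_def using offspring by (rule branching_const_pos)

lemma defect: "((\<lambda>s. (s - hit p s) / s powr \<alpha>) \<longlongrightarrow> C) (at_right 0)"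
  unfolding C_def using offspring by (rule offspring_hyp_defect)

text \<open>The expansion at \<open>0\<close> yields positivity for small \<open>s\<close> only; by
  \<open>hit_diff_le\<close> the defect is nondecreasing, which carries it to the whole
  interval.\<close>

lemma defect_pos:
  assumes "0 < s" "s \<le> 1"
  shows "hit p s < s"
proof -
  have "\<forall>\<^sub>F s in at_right 0. 0 < (s - hit p s) / s powr \<alpha>"
    using order_tendstoD(1)[OF defect C_pos] .
  then obtain b where b: "0 < b" "\<And>t. 0 < t \<Longrightarrow> t < b \<Longrightarrow> 0 < (t - hit p t) / t powr \<alpha>"
    by (auto simp: eventually_at_right_field)
  define t where "t = min s (b / 2)"
  have t: "0 < t" "t < b" "t \<le> s" using b assms by (auto simp: t_def)
  have "hit p t < t" using b(2)[OF t(1,2)] t by (simp add: zero_less_divide_iff)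
  then show ?thesis using hit_diff_le[OF mean, of t s] t assms by simp
qed

lemma hit_pos:
  assumes "0 < s" "s \<le> 1"
  shows "0 < hit p s"
proof -
  have "((\<lambda>s. (s - hit p s) / s powr \<alpha> * s powr (\<alpha> - 1)) \<longlongrightarrow> C * 0) (at_right 0)"
  proof (intro tendsto_mult defect)
    show "((\<lambda>s. s powr (\<alpha> - 1)) \<longlongrightarrow> 0) (at_right 0)" using alpha by real_asymp
  qed
  then have "\<forall>\<^sub>F s in at_right 0. (s - hit p s) / s powr \<alpha> * s powr (\<alpha> - 1) < 1"
    by (rule order_tendstoD(2)) simp
  then obtain b where b: "0 < b" "\<And>t. 0 < t \<Longrightarrow> t < b \<Longrightarrow> (t - hit p t) / t powr \<alpha> * t powr (\<alpha> - 1) < 1"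
    by (auto simp: eventually_at_right_field)
  define t where "t = min s (b / 2)"
  have t: "0 < t" "t < b" "t \<le> s" using b assms by (auto simp: t_def)
  have "t powr (\<alpha> - 1) = t powr \<alpha> / t" using t by (simp add: powr_diff)
  then have "(t - hit p t) / t powr \<alpha> * t powr (\<alpha> - 1) = (t - hit p t) / t" using t by simp
  then have "(t - hit p t) / t < 1" using b(2)[OF t(1,2)] by simp
  then have "0 < hit p t" using t by (simp add: divide_less_eq)
  then show ?thesis using hit_mono[of t s p] t assms by simp
qed

section \<open>Iterates of the one-generation map\<close>

lemma iterate_bounds:
  assumes "0 < s" "s \<le> 1"
  shows "0 < (hit p ^^ k) s \<and> (hit p ^^ k) s \<le> s"
proof (induction k)
  case (Suc k)
  then show ?case
    using hit_pos[of "(hit p ^^ k) s"] hit_le_self[OF mean, of "(hit p ^^ k) s"] assms by simp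
qed (use assms in simp)

text \<open>Discrete version of solving \<open>x' = - C * x powr \<alpha>\<close> through
  \<open>x powr (1 - \<alpha>)\<close>, which grows linearly. The increment is expanded in the
  relative loss \<open>v s\<close>, which tends to \<open>0\<close>.\<close>

lemma hit_increment:
  "((\<lambda>s. hit p s powr (1 - \<alpha>) - s powr (1 - \<alpha>)) \<longlongrightarrow> (\<alpha> - 1) * C) (at_right 0)"
proof -
  define v where "v s = (s - hit p s) / s" for s
  have v_eq: "\<forall>\<^sub>F s in at_right 0. v s = (s - hit p s) / s powr \<alpha> * s powr (\<alpha> - 1)"
    using eventually_at_right_less[of "0::real"]
    by eventually_elim (simp add: v_def powr_diff)
  have "((\<lambda>s. (s - hit p s) / s powr \<alpha> * s powr (\<alpha> - 1)) \<longlongrightarrow> C * 0) (at_right 0)"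
  proof (intro tendsto_mult defect)
    show "((\<lambda>s. s powr (\<alpha> - 1)) \<longlongrightarrow> 0) (at_right 0)" using alpha by real_asymp
  qed
  then have v0: "(v \<longlongrightarrow> 0) (at_right 0)"
    unfolding mult_zero_right by (rule Lim_transform_eventually) (use v_eq in eventually_elim, simp)
  have ev: "\<forall>\<^sub>F s::real in at_right 0. 0 < s \<and> s < 1"
    by (auto simp: eventually_at_right_field intro: exI[of _ 1])
  have v_pos: "\<forall>\<^sub>F s in at_right 0. v s > 0 \<and> v s < 1"
    using ev
  proof eventually_elim
    case (elim s)
    then show ?case using defect_pos[of s] hit_pos[of s] by (simp add: v_def)
  qed
  have fl: "filterlim v (at_right 0) (at_right 0)"
    unfolding filterlim_at using v0 v_pos by (auto elim: eventually_mono)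
  have "((\<lambda>x::real. ((1 - x) powr (1 - \<alpha>) - 1) / x) \<longlongrightarrow> \<alpha> - 1) (at_right 0)"
    using alpha by real_asymp
  from filterlim_compose[OF this fl]
  have "((\<lambda>s. ((1 - v s) powr (1 - \<alpha>) - 1) / v s * ((s - hit p s) / s powr \<alpha>)) \<longlongrightarrow> (\<alpha> - 1) * C) (at_right 0)"
    by (intro tendsto_mult defect)
  then show ?thesis
  proof (rule Lim_transform_eventually)
    show "\<forall>\<^sub>F s in at_right 0. ((1 - v s) powr (1 - \<alpha>) - 1) / v s * ((s - hit p s) / s powr \<alpha>) =
        hit p s powr (1 - \<alpha>) - s powr (1 - \<alpha>)"
      using ev v_pos v_eq
    proof eventually_elim
      case (elim s)
      have h: "hit p s = s * (1 - v s)" using elim by (simp add: v_def field_simps)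
      have "hit p s powr (1 - \<alpha>) = s powr (1 - \<alpha>) * (1 - v s) powr (1 - \<alpha>)"
        unfolding h using elim by (intro powr_mult) 
      moreover have "(s - hit p s) / s powr \<alpha> = v s * s powr (1 - \<alpha>)"
        using elim by (simp add: v_def powr_diff)
      moreover have "(X - 1) / w * (w * Y) = Y * X - Y" if "0 < w" for X Y w :: real
        using that by (simp add: field_simps)
      ultimately show ?case using elim(2) by presburger
    qed
  qed
qed

text \<open>Iterates decrease, so an orbit started below \<open>b\<close> stays where the one-step
  estimate holds, and the errors simply add.\<close>

lemma hit_increment_uniform:
  assumes "0 < e"
  obtains b where "0 < b" "b \<le> 1"
    "\<And>s k. 0 < s \<Longrightarrow> s < b \<Longrightarrow>
      \<bar>(hit p ^^ k) s powr (1 - \<alpha>) - s powr (1 - \<alpha>) - real k * ((\<alpha> - 1) * C)\<bar> \<le> real k * e"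
proof -
  have "\<forall>\<^sub>F s in at_right 0. dist (hit p s powr (1 - \<alpha>) - s powr (1 - \<alpha>)) ((\<alpha> - 1) * C) < e"
    using tendstoD[OF hit_increment assms] .
  then obtain b where b: "0 < b"
    "\<And>s. 0 < s \<Longrightarrow> s < b \<Longrightarrow> \<bar>hit p s powr (1 - \<alpha>) - s powr (1 - \<alpha>) - (\<alpha> - 1) * C\<bar> < e"
    by (auto simp: eventually_at_right_field dist_real_def)
  show thesis
  proof (rule that[of "min b 1"])
    fix s k assume s: "0 < s" "s < min b 1"
    show "\<bar>(hit p ^^ k) s powr (1 - \<alpha>) - s powr (1 - \<alpha>) - real k * ((\<alpha> - 1) * C)\<bar> \<le> real k * e"
    proof (induction k)
      case (Suc k)
      have "0 < (hit p ^^ k) s" "(hit p ^^ k) s < b" using iterate_bounds[of s k] s by auto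
      from b(2)[OF this] show ?case using Suc by (simp add: algebra_simps abs_le_iff abs_less_iff)
    qed simp
  qed (use b in auto)
qed

text \<open>The explicit solution for spatially constant data: \<open>L\<close> encodes the initial
  value, the elapsed unit of time adds \<open>(\<alpha> - 1) * C\<close>, and the power
  \<open>- \<beta>\<close> inverts the power \<open>1 - \<alpha>\<close>.\<close>

lemma scaled_iterate_limit:
  fixes x :: "nat \<Rightarrow> real"
  assumes x0: "x \<longlonglongrightarrow> 0" and pos: "\<forall>\<^sub>F n in sequentially. 0 < x n"
    and lim: "(\<lambda>n. x n powr (1 - \<alpha>) / real n) \<longlonglongrightarrow> L" and k: "(\<lambda>n. real (k n) / real n) \<longlonglongrightarrow> 1"
    and L: "0 \<le> L"
  shows "(\<lambda>n. real n powr \<beta> * (hit p ^^ k n) (x n)) \<longlonglongrightarrow> (L + (\<alpha> - 1) * C) powr (- \<beta>)"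
proof -
  define D where "D = (\<alpha> - 1) * C"
  have D: "0 < D" unfolding D_def using alpha C_pos by (intro mult_pos_pos) simp_all
  define g where "g n = (hit p ^^ k n) (x n) powr (1 - \<alpha>)" for n
  have "(\<lambda>n. (g n - x n powr (1 - \<alpha>) - real (k n) * D) / real n) \<longlonglongrightarrow> 0"
  proof (rule tendstoI)
    fix e :: real assume "0 < e"
    obtain b where b: "0 < b" "b \<le> 1" "\<And>s k. 0 < s \<Longrightarrow> s < b \<Longrightarrow>
      \<bar>(hit p ^^ k) s powr (1 - \<alpha>) - s powr (1 - \<alpha>) - real k * ((\<alpha> - 1) * C)\<bar> \<le> real k * (e / 2)"
      by (rule hit_increment_uniform[of "e / 2"]) (use \<open>0 < e\<close> in auto)
    have "\<forall>\<^sub>F n in sequentially. real (k n) / real n < 2" by (rule order_tendstoD(2)[OF k]) simp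
    moreover have "\<forall>\<^sub>F n in sequentially. x n < b" by (rule order_tendstoD(2)[OF x0 b(1)])
    ultimately show "\<forall>\<^sub>F n in sequentially. dist ((g n - x n powr (1 - \<alpha>) - real (k n) * D) / real n) 0 < e"
      using pos eventually_gt_at_top[of 0]
    proof eventually_elim
      case (elim n)
      have "\<bar>g n - x n powr (1 - \<alpha>) - real (k n) * D\<bar> \<le> real (k n) * (e / 2)"
        unfolding g_def D_def using elim by (intro b(3)) auto
      also have "\<dots> < e * real n" using elim \<open>0 < e\<close> by (simp add: field_simps)
      finally show ?case using elim by (simp add: dist_real_def abs_divide field_simps)
    qed
  qed
  from tendsto_add[OF this tendsto_add[OF lim tendsto_mult[OF k tendsto_const[of D]]]]
  have "(\<lambda>n. g n / real n) \<longlonglongrightarrow> L + D"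
    by (simp add: add_divide_distrib diff_divide_distrib)
  then have "(\<lambda>n. (g n / real n) powr (- \<beta>)) \<longlonglongrightarrow> (L + D) powr (- \<beta>)"
    using L D by (intro tendsto_powr tendsto_const) auto
  then show ?thesis unfolding D_def[symmetric]
  proof (rule Lim_transform_eventually)
    have "\<forall>\<^sub>F n in sequentially. x n < 1" by (rule order_tendstoD(2)[OF x0]) simp
    then show "\<forall>\<^sub>F n in sequentially. (g n / real n) powr - \<beta> = real n powr \<beta> * (hit p ^^ k n) (x n)"
      using pos eventually_gt_at_top[of 0]
    proof eventually_elim
      case (elim n)
      have p: "0 < (hit p ^^ k n) (x n)" using iterate_bounds[of "x n"] elim by simp
      have "(1 - \<alpha>) * (- \<beta>) = 1" using beta by (simp add: algebra_simps)
      then have "g n powr (- \<beta>) = (hit p ^^ k n) (x n)" unfolding g_def powr_powr using p by simp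
      moreover have "(g n / real n) powr (- \<beta>) = g n powr (- \<beta>) / real n powr (- \<beta>)"
        using p elim by (intro powr_divide)
      ultimately show ?case by (simp add: powr_minus field_simps)
    qed
  qed
qed

lemma iterate_tendsto_zero: "(\<lambda>k. (hit p ^^ k) 1) \<longlonglongrightarrow> 0"
proof -
  let ?s = "\<lambda>k. (hit p ^^ k) 1"
  have dec: "decseq ?s"
  proof (rule decseq_SucI)
    show "?s (Suc k) \<le> ?s k" for k
      using hit_le_self[OF mean, of "?s k"] iterate_bounds[of 1 k] by simp
  qed
  have bd: "0 < ?s k" "?s k \<le> 1" for k using iterate_bounds[of 1 k] by auto
  obtain L where L: "?s \<longlonglongrightarrow> L" "\<And>k. L \<le> ?s k"
    using decseq_convergent[OF dec, of 0] less_imp_le[OF bd(1)] by auto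
  have L0: "0 \<le> L" by (rule LIMSEQ_le_const[OF L(1)]) (use less_imp_le[OF bd(1)] in auto)
  have "L = 0"
  proof (rule ccontr)
    assume "L \<noteq> 0"
    then have Lp: "0 < L" "L \<le> 1" using L0 L(2)[of 0] by auto
    \<comment> \<open>Each step of the decreasing orbit loses at least the defect at the limit
      \<open>L\<close>, which \<open>defect_pos\<close> makes positive.\<close>
    have step: "?s (Suc k) \<le> ?s k - (L - hit p L)" for k
      using hit_diff_le[OF mean, of L "?s k"] L(2)[of k] Lp bd[of k] by simp
    have "L \<le> L - (L - hit p L)"
      by (rule LIMSEQ_le[OF LIMSEQ_Suc[OF L(1)] tendsto_diff[OF L(1) tendsto_const]]) (use step in auto)
    then show False using defect_pos[OF Lp] by simp
  qed
  then show ?thesis using L by simp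
qed

text \<open>Kolmogorov's estimate for critical branching. After \<open>m\<close> generations the
  survival probability is below the threshold of \<open>hit_increment_uniform\<close>; the first
  \<open>m\<close> generations enter only through the constant \<open>K\<close>, which division by
  \<open>n\<close> removes.\<close>

lemma survival_asymptotics:
  "(\<lambda>n. real n powr \<beta> * (hit p ^^ n) 1) \<longlonglongrightarrow> ((\<alpha> - 1) * C) powr (- \<beta>)"
proof -
  let ?s = "\<lambda>k. (hit p ^^ k) 1"
  have bd: "0 < ?s k" "?s k \<le> 1" for k using iterate_bounds[of 1 k] by auto
  define D where "D = (\<alpha> - 1) * C"
  have D: "0 < D" unfolding D_def using alpha C_pos by (intro mult_pos_pos) auto
  have "(\<lambda>n. ?s n powr (1 - \<alpha>) / real n) \<longlonglongrightarrow> D"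
  proof (rule tendstoI)
    fix e :: real assume e: "0 < e"
    obtain b where b: "0 < b" "b \<le> 1" "\<And>s k. 0 < s \<Longrightarrow> s < b \<Longrightarrow>
      \<bar>(hit p ^^ k) s powr (1 - \<alpha>) - s powr (1 - \<alpha>) - real k * ((\<alpha> - 1) * C)\<bar> \<le> real k * (e / 2)"
      by (rule hit_increment_uniform[of "e / 2"]) (use e in auto)
    obtain m where m: "?s m < b"
      using order_tendstoD(2)[OF iterate_tendsto_zero b(1)] by (auto simp: eventually_sequentially)
    define K where "K = \<bar>?s m powr (1 - \<alpha>) - real m * D\<bar>"
    have "(\<lambda>n. K / real n) \<longlonglongrightarrow> 0" by real_asymp
    then have "\<forall>\<^sub>F n in sequentially. K / real n < e / 2" by (rule order_tendstoD(2)) (use e in auto)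
    then show "\<forall>\<^sub>F n in sequentially. dist (?s n powr (1 - \<alpha>) / real n) D < e"
      using eventually_ge_at_top[of "Suc m"]
    proof eventually_elim
      case (elim n)
      have "?s n = (hit p ^^ (n - m)) (?s m)"
        using elim funpow_add[of "n - m" m "hit p"] by simp
      then have "\<bar>?s n powr (1 - \<alpha>) - ?s m powr (1 - \<alpha>) - real (n - m) * D\<bar> \<le> real (n - m) * (e / 2)"
        unfolding D_def using b(3)[OF bd(1) m] by simp
      also have nm: "real (n - m) = real n - real m" using elim by simp
      finally have "\<bar>?s n powr (1 - \<alpha>) - ?s m powr (1 - \<alpha>) - (real n - real m) * D\<bar> \<le> (real n - real m) * (e / 2)"
        by (simp only: nm)
      moreover have "?s n powr (1 - \<alpha>) - D * real n = (?s n powr (1 - \<alpha>) - ?s m powr (1 - \<alpha>) - (real n - real m) * D) +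
          (?s m powr (1 - \<alpha>) - real m * D)" by (simp add: algebra_simps)
      ultimately have "\<bar>?s n powr (1 - \<alpha>) - D * real n\<bar> \<le> K + (real n - real m) * (e / 2)"
        unfolding K_def by linarith
      also have "\<dots> \<le> K + real n * (e / 2)" using e by simp
      also have "\<dots> < e / 2 * real n + real n * (e / 2)" using elim e by (simp add: field_simps)
      finally have "\<bar>?s n powr (1 - \<alpha>) - D * real n\<bar> < e * real n" by simp
      moreover have "?s n powr (1 - \<alpha>) / real n - D = (?s n powr (1 - \<alpha>) - D * real n) / real n"
        using elim by (simp add: field_simps)
      ultimately show ?case using elim by (simp add: dist_real_def abs_divide divide_less_eq)
    qed
  qed
  then have lim: "(\<lambda>n. (?s n powr (1 - \<alpha>) / real n) powr (- \<beta>)) \<longlonglongrightarrow> D powr (- \<beta>)"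
    using D by (intro tendsto_powr tendsto_const) auto
  have eq: "(?s n powr (1 - \<alpha>) / real n) powr (- \<beta>) = real n powr \<beta> * ?s n" for n
  proof -
    have "(1 - \<alpha>) * (- \<beta>) = 1" using beta by (simp add: algebra_simps)
    then have "(?s n powr (1 - \<alpha>)) powr (- \<beta>) = ?s n" unfolding powr_powr using bd[of n] by simp
    moreover have "(?s n powr (1 - \<alpha>) / real n) powr (- \<beta>) = (?s n powr (1 - \<alpha>)) powr (- \<beta>) / real n powr (- \<beta>)"
      using bd[of n] by (intro powr_divide)
    ultimately show ?thesis by (simp add: powr_minus field_simps)
  qed
  show ?thesis using lim unfolding eq D_def .
qed

lemma survival_bound:
  obtains c where "0 < c" "\<And>m. 0 < m \<Longrightarrow> (hit p ^^ m) 1 \<le> c * real m powr (- \<beta>)"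
proof -
  have "Bseq (\<lambda>n. real n powr \<beta> * (hit p ^^ n) 1)"
    using survival_asymptotics by (intro convergent_imp_Bseq convergentI)
  then obtain c where c: "0 < c" "\<And>n. norm (real n powr \<beta> * (hit p ^^ n) 1) \<le> c"
    by (auto simp: Bseq_def)
  show thesis
  proof (rule that[OF c(1)])
    fix m :: nat assume "0 < m"
    then show "(hit p ^^ m) 1 \<le> c * real m powr (- \<beta>)"
      using c(2)[of m] iterate_bounds[of 1 m] by (simp add: powr_minus field_simps abs_mult)
  qed
qed

end

section \<open>Averaging over one jump\<close>

definition borel_prob :: "'a::euclidean_space measure \<Rightarrow> bool" where
  "borel_prob \<mu> \<longleftrightarrow> prob_space \<mu> \<and> sets \<mu> = sets borel"

definition bdd_meas :: "real \<Rightarrow> ('a::euclidean_space \<Rightarrow> real) \<Rightarrow> bool" where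
  "bdd_meas K f \<longleftrightarrow> f \<in> borel_measurable borel \<and> (\<forall>x. \<bar>f x\<bar> \<le> K)"

definition lip :: "real \<Rightarrow> ('a::euclidean_space \<Rightarrow> real) \<Rightarrow> bool" where
  "lip L f \<longleftrightarrow> 0 \<le> L \<and> (\<forall>x y. \<bar>f x - f y\<bar> \<le> L * norm (x - y))"

definition step :: "'a::euclidean_space measure \<Rightarrow> ('a \<Rightarrow> real) \<Rightarrow> 'a \<Rightarrow> real" where
  "step \<mu> f x = (\<integral>z. f (x + z) \<partial>\<mu>)"

lemma borel_prob_space: "borel_prob \<mu> \<Longrightarrow> space \<mu> = UNIV"
  using sets_eq_imp_space_eq[of \<mu> borel] by (simp add: borel_prob_def)

lemma borel_prob_measurable: "borel_prob \<mu> \<Longrightarrow> f \<in> borel_measurable borel \<Longrightarrow> f \<in> borel_measurable \<mu>"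
  using measurable_cong_sets[of \<mu> borel] by (auto simp: borel_prob_def)

lemma borel_prob_distr:
  assumes "prob_space M" "X \<in> borel_measurable M"
  shows "borel_prob (distr M borel X)"
  using prob_space.prob_space_distr[OF assms] by (simp add: borel_prob_def)

lemma bdd_meas_shift:
  assumes "bdd_meas K f"
  shows "bdd_meas K (\<lambda>z. f (x + z))"
proof -
  have [measurable]: "f \<in> borel_measurable borel" using assms by (simp add: bdd_meas_def)
  have "(\<lambda>z. f (x + z)) \<in> borel_measurable borel" by measurable
  then show ?thesis using assms by (simp add: bdd_meas_def)
qed

lemma bdd_meas_integrable:
  assumes "bdd_meas K f" "borel_prob \<mu>"
  shows "integrable \<mu> f"
proof -
  interpret prob_space \<mu> using assms by (simp add: borel_prob_def)
  show ?thesis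
    by (rule integrable_const_bound[where B = K])
      (use assms borel_prob_measurable in \<open>auto simp: bdd_meas_def\<close>)
qed

lemma bdd_meas_integrable_shift:
  "bdd_meas K f \<Longrightarrow> borel_prob \<mu> \<Longrightarrow> integrable \<mu> (\<lambda>z. f (x + z))"
  by (rule bdd_meas_integrable[OF bdd_meas_shift])

lemma step_measurable:
  assumes f: "f \<in> borel_measurable borel" and \<mu>: "borel_prob \<mu>"
  shows "step \<mu> f \<in> borel_measurable borel"
proof -
  interpret prob_space \<mu> using \<mu> by (simp add: borel_prob_def)
  have [measurable_cong]: "sets \<mu> = sets borel" using \<mu> by (simp add: borel_prob_def)
  note f[measurable]
  have "(\<lambda>x. \<integral>z. f (x + z) \<partial>\<mu>) \<in> borel_measurable borel" by measurable
  then show ?thesis by (simp add: step_def[abs_def])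
qed

lemma step_bdd_meas:
  assumes "bdd_meas K f" "borel_prob \<mu>"
  shows "bdd_meas K (step \<mu> f)"
proof -
  interpret prob_space \<mu> using assms by (simp add: borel_prob_def)
  have "\<bar>step \<mu> f x\<bar> \<le> K" for x
  proof -
    have "\<bar>step \<mu> f x\<bar> \<le> (\<integral>z. \<bar>f (x + z)\<bar> \<partial>\<mu>)" unfolding step_def by (rule integral_abs_bound)
    also have "\<dots> \<le> (\<integral>z. K \<partial>\<mu>)"
      by (intro integral_mono integrable_abs bdd_meas_integrable_shift[OF assms])
        (use assms in \<open>auto simp: bdd_meas_def\<close>)
    finally show ?thesis by (simp add: prob_space)
  qed
  then show ?thesis using step_measurable assms by (auto simp: bdd_meas_def)
qed

lemma step_mono:
  assumes "bdd_meas K f" "bdd_meas K' g" "borel_prob \<mu>" "\<And>x. f x \<le> g x"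
  shows "step \<mu> f x \<le> step \<mu> g x"
  unfolding step_def by (intro integral_mono bdd_meas_integrable_shift assms; fact assms)+

lemma step_add:
  assumes "bdd_meas K f" "bdd_meas K' g" "borel_prob \<mu>"
  shows "step \<mu> (\<lambda>x. f x + g x) x = step \<mu> f x + step \<mu> g x"
  unfolding step_def
  by (intro Bochner_Integration.integral_add bdd_meas_integrable_shift[OF assms(1,3)] bdd_meas_integrable_shift[OF assms(2,3)])

lemma step_diff:
  assumes "bdd_meas K f" "bdd_meas K' g" "borel_prob \<mu>"
  shows "step \<mu> (\<lambda>x. f x - g x) x = step \<mu> f x - step \<mu> g x"
  unfolding step_def
  by (intro Bochner_Integration.integral_diff bdd_meas_integrable_shift[OF assms(1,3)] bdd_meas_integrable_shift[OF assms(2,3)])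

lemma step_cmult: "step \<mu> (\<lambda>x. c * f x) x = c * step \<mu> f x"
  by (simp add: step_def)

lemma step_const: "borel_prob \<mu> \<Longrightarrow> step \<mu> (\<lambda>_. c) x = c"
  by (simp add: step_def borel_prob_def prob_space.prob_space)

lemma step_translate: "step \<mu> (\<lambda>z. f (a + z)) x = step \<mu> f (a + x)"
  by (simp add: step_def add.assoc)

lemma lip_measurable:
  assumes "lip L f"
  shows "f \<in> borel_measurable borel"
proof -
  have "L-lipschitz_on UNIV f"
    using assms by (intro lipschitz_onI) (auto simp: lip_def dist_real_def dist_norm)
  then have "continuous_on UNIV f" by (rule lipschitz_on_continuous_on)
  then show ?thesis by (rule borel_measurable_continuous_onI)
qed

lemma step_diff_le:
  assumes f: "bdd_meas K f" "bdd_meas K' g" and \<mu>: "borel_prob \<mu>" and d: "\<And>z. \<bar>f z - g z\<bar> \<le> d"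
  shows "\<bar>step \<mu> f x - step \<mu> g x\<bar> \<le> d"
proof -
  have "bdd_meas d (\<lambda>z. f z - g z)" using f d by (auto simp: bdd_meas_def)
  from step_bdd_meas[OF this \<mu>] have "\<bar>step \<mu> (\<lambda>z. f z - g z) x\<bar> \<le> d" by (simp add: bdd_meas_def)
  then show ?thesis using step_diff[OF f \<mu>] by simp
qed

lemma step_lip:
  assumes f: "bdd_meas K f" and L: "lip L f" and \<mu>: "borel_prob \<mu>"
  shows "lip L (step \<mu> f)"
proof -
  have "\<bar>step \<mu> f x - step \<mu> f y\<bar> \<le> L * norm (x - y)" for x y
  proof -
    have "\<bar>step \<mu> (\<lambda>z. f (x + z)) 0 - step \<mu> (\<lambda>z. f (y + z)) 0\<bar> \<le> L * norm (x - y)"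
    proof (rule step_diff_le[OF bdd_meas_shift[OF f] bdd_meas_shift[OF f] \<mu>])
      show "\<bar>f (x + z) - f (y + z)\<bar> \<le> L * norm (x - y)" for z
        using L unfolding lip_def by (metis add_diff_cancel_right)
    qed
    then show ?thesis by (simp add: step_translate)
  qed
  then show ?thesis using L by (simp add: lip_def)
qed

text \<open>By Fubini. It moves the Gaussian smoothing past other averages, so that the function
  seen by the jump being replaced is always a smoothed one.\<close>

lemma step_commute:
  assumes f: "bdd_meas K f" and \<mu>: "borel_prob \<mu>" and \<nu>: "borel_prob \<nu>"
  shows "step \<mu> (step \<nu> f) x = step \<nu> (step \<mu> f) x"
proof -
  interpret M: prob_space \<mu> using \<mu> by (simp add: borel_prob_def)
  interpret N: prob_space \<nu> using \<nu> by (simp add: borel_prob_def)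
  interpret pair_prob_space \<mu> \<nu> ..
  have [measurable_cong]: "sets \<mu> = sets borel" "sets \<nu> = sets borel"
    using \<mu> \<nu> by (simp_all add: borel_prob_def)
  have [measurable]: "f \<in> borel_measurable borel" using f by (simp add: bdd_meas_def)
  have "integrable (\<mu> \<Otimes>\<^sub>M \<nu>) (\<lambda>(u, v). f (x + u + v))"
    by (rule integrable_const_bound[where B = K]) (use f in \<open>auto simp: bdd_meas_def split_beta\<close>)
  from Fubini_integral[OF this] show ?thesis
    by (simp add: step_def ac_simps)
qed

lemma step_pow_bdd_meas: "bdd_meas K f \<Longrightarrow> borel_prob \<mu> \<Longrightarrow> bdd_meas K ((step \<mu> ^^ k) f)"
  by (induction k) (auto intro: step_bdd_meas)

lemma step_pow_diff_le:
  assumes "bdd_meas K f" "bdd_meas K' g" "borel_prob \<mu>" "\<And>z. \<bar>f z - g z\<bar> \<le> d"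
  shows "\<bar>(step \<mu> ^^ k) f x - (step \<mu> ^^ k) g x\<bar> \<le> d"
proof (induction k arbitrary: x)
  case (Suc k)
  show ?case unfolding funpow.simps comp_def
    by (rule step_diff_le[OF step_pow_bdd_meas[OF assms(1,3)] step_pow_bdd_meas[OF assms(2,3)] assms(3) Suc])
qed (use assms in simp)

lemma step_pow_affine:
  assumes "bdd_meas K f" "borel_prob \<mu>"
  shows "(step \<mu> ^^ k) (\<lambda>x. a * f x + b) = (\<lambda>x. a * (step \<mu> ^^ k) f x + b)"
proof (induction k)
  case (Suc k)
  have b1: "bdd_meas (\<bar>a\<bar> * K) (\<lambda>x. a * (step \<mu> ^^ k) f x)"
    using step_pow_bdd_meas[OF assms, of k] by (auto simp: bdd_meas_def abs_mult intro: mult_left_mono)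
  have b2: "bdd_meas \<bar>b\<bar> (\<lambda>_::'a. b)" by (simp add: bdd_meas_def)
  show ?case
    by (simp add: fun_eq_iff Suc step_add[OF b1 b2 assms(2)] step_const[OF assms(2)] step_cmult)
qed simp

lemma step_pow_mono:
  assumes "bdd_meas K f" "bdd_meas K' g" "borel_prob \<mu>" "\<And>x. f x \<le> g x"
  shows "(step \<mu> ^^ k) f x \<le> (step \<mu> ^^ k) g x"
proof (induction k arbitrary: x)
  case (Suc k)
  show ?case unfolding funpow.simps comp_def
    by (rule step_mono[OF step_pow_bdd_meas[OF assms(1,3)] step_pow_bdd_meas[OF assms(2,3)] assms(3) Suc])
qed (use assms in simp)

section \<open>The one-generation operator of the branching random walk\<close>

definition hop :: "nat pmf \<Rightarrow> 'a::euclidean_space measure \<Rightarrow> ('a \<Rightarrow> real) \<Rightarrow> 'a \<Rightarrow> real" where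
  "hop p \<nu> f x = hit p (step \<nu> f x)"

definition unit_meas :: "('a::euclidean_space \<Rightarrow> real) \<Rightarrow> bool" where
  "unit_meas f \<longleftrightarrow> f \<in> borel_measurable borel \<and> (\<forall>x. 0 \<le> f x \<and> f x \<le> 1)"

lemma unit_meas_bdd: "unit_meas f \<Longrightarrow> bdd_meas 1 f"
  by (auto simp: unit_meas_def bdd_meas_def)

lemma hit_measurable: "hit p \<in> borel_measurable borel"
proof -
  have "(\<lambda>s. 1 - (\<Sum>k. pmf p k * (1 - s) ^ k)) \<in> borel_measurable borel" by measurable
  then show ?thesis by (simp add: hit_def[abs_def] pgf_def)
qed

lemma step_unit:
  assumes "unit_meas f" "borel_prob \<nu>"
  shows "0 \<le> step \<nu> f x" "step \<nu> f x \<le> 1"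
proof -
  have "bdd_meas 0 (\<lambda>_. 0)" by (simp add: bdd_meas_def)
  from step_mono[OF this unit_meas_bdd[OF assms(1)] assms(2)] show "0 \<le> step \<nu> f x"
    using assms by (simp add: unit_meas_def step_const)
  show "step \<nu> f x \<le> 1"
    using step_bdd_meas[OF unit_meas_bdd[OF assms(1)] assms(2)] by (auto simp: bdd_meas_def abs_le_iff)
qed

context
  fixes p :: "nat pmf" and \<nu> :: "'a::euclidean_space measure"
  assumes mean: "(\<lambda>k. real k * pmf p k) sums 1" and \<nu>: "borel_prob \<nu>"
begin

lemma hop_unit:
  assumes "unit_meas f"
  shows "unit_meas (hop p \<nu> f)"
  unfolding unit_meas_def hop_def[abs_def]
  using step_unit[OF assms \<nu>] hit_mem[OF mean] assms
  by (auto simp: unit_meas_def intro: measurable_compose[OF step_measurable[OF _ \<nu>] hit_measurable])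

lemma hop_pow_unit: "unit_meas f \<Longrightarrow> unit_meas ((hop p \<nu> ^^ k) f)"
  by (induction k) (auto intro: hop_unit)

text \<open>Additive errors do not grow: where \<open>step \<nu> f\<close> exceeds
  \<open>step \<nu> g\<close>, the slope of \<open>hit p\<close> is at most \<open>1\<close>;
  elsewhere monotonicity suffices. The cut of the walk relies on this to carry a small error through
  many generations.\<close>

lemma hop_le_add:
  assumes f: "unit_meas f" and g: "unit_meas g" and c: "0 \<le> c" and le: "\<And>x. f x \<le> g x + c"
  shows "hop p \<nu> f x \<le> hop p \<nu> g x + c"
proof -
  have "bdd_meas (1 + c) (\<lambda>x. g x + c)"
    using g c by (auto simp: unit_meas_def bdd_meas_def)
  from step_mono[OF unit_meas_bdd[OF f] this \<nu> le]
  have "step \<nu> f x \<le> step \<nu> (\<lambda>x. g x + c) x" .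
  also have "\<dots> = step \<nu> g x + c"
    by (subst step_add[OF unit_meas_bdd[OF g] _ \<nu>, where K' = c])
      (use c in \<open>auto simp: bdd_meas_def step_const[OF \<nu>]\<close>)
  finally have le': "step \<nu> f x \<le> step \<nu> g x + c" .
  note b = step_unit[OF f \<nu>, of x] step_unit[OF g \<nu>, of x]
  show ?thesis
  proof (cases "step \<nu> f x \<le> step \<nu> g x")
    case True
    then show ?thesis using hit_mono[of "step \<nu> f x" "step \<nu> g x" p] b c by (simp add: hop_def)
  next
    case False
    then show ?thesis using hit_diff_le[OF mean, of "step \<nu> g x" "step \<nu> f x"] b le' by (simp add: hop_def)
  qed
qed

lemma hop_pow_le_add:
  assumes "unit_meas f" "unit_meas g" "0 \<le> c" "\<And>x. f x \<le> g x + c"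
  shows "(hop p \<nu> ^^ k) f x \<le> (hop p \<nu> ^^ k) g x + c"
proof (induction k arbitrary: x)
  case (Suc k)
  show ?case unfolding funpow.simps comp_def
    by (rule hop_le_add[OF hop_pow_unit[OF assms(1)] hop_pow_unit[OF assms(2)] assms(3) Suc])
qed (use assms in simp)

lemma hop_pow_mono:
  assumes "unit_meas f" "unit_meas g" "\<And>x. f x \<le> g x"
  shows "(hop p \<nu> ^^ k) f x \<le> (hop p \<nu> ^^ k) g x"
  using hop_pow_le_add[OF assms(1,2), of 0] assms(3) by simp

text \<open>The first-moment bound: with mean offspring \<open>1\<close> the right side is the
  expected sum of \<open>f\<close> over generation \<open>k\<close>, and \<open>hit_le_self\<close>
  is the union bound for one generation.\<close>

lemma hop_pow_le_step_pow:
  assumes "unit_meas f"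
  shows "(hop p \<nu> ^^ k) f x \<le> (step \<nu> ^^ k) f x"
proof (induction k arbitrary: x)
  case (Suc k)
  have u: "unit_meas ((hop p \<nu> ^^ k) f)" by (rule hop_pow_unit[OF assms])
  have "hop p \<nu> ((hop p \<nu> ^^ k) f) x \<le> step \<nu> ((hop p \<nu> ^^ k) f) x"
    unfolding hop_def[of p \<nu> "(hop p \<nu> ^^ k) f" x]
    by (rule hit_le_self[OF mean]) (use step_unit[OF u \<nu>] in auto)
  also have "\<dots> \<le> step \<nu> ((step \<nu> ^^ k) f) x"
    by (rule step_mono[OF unit_meas_bdd[OF u] step_pow_bdd_meas[OF unit_meas_bdd[OF assms] \<nu>] \<nu> Suc])
  finally show ?case by simp
qed simp

lemma hop_pow_const: "(hop p \<nu> ^^ k) (\<lambda>_. c) = (\<lambda>_. (hit p ^^ k) c)"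
  by (induction k) (auto simp: hop_def[abs_def] step_const[OF \<nu>])

lemma hop_pow_translate: "(hop p \<nu> ^^ k) (\<lambda>z. f (a + z)) x = (hop p \<nu> ^^ k) f (a + x)"
proof (induction k arbitrary: x)
  case (Suc k)
  then have "(hop p \<nu> ^^ k) (\<lambda>z. f (a + z)) = (\<lambda>z. (hop p \<nu> ^^ k) f (a + z))" by auto
  moreover have "hop p \<nu> (\<lambda>z. g (a + z)) x = hop p \<nu> g (a + x)" for g
    by (simp add: hop_def step_translate)
  ultimately show ?case by (simp only: funpow.simps comp_def)
qed simp

end

section \<open>Tail bounds for the displacement\<close>

text \<open>A first-order expansion whose remainder still loses a full power of \<open>a\<close>,
  because \<open>b\<close> is at most of the order of the square root of \<open>a\<close>. The
  induction closes since multiplication by \<open>a + b\<close> costs at most a factor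
  \<open>2 * a * m\<close>.\<close>

lemma power_add_le_second_order:
  fixes a b m :: real
  assumes a: "1 \<le> a" and ab: "0 \<le> a + b" "b\<^sup>2 \<le> a * m\<^sup>2" "a + b \<le> 2 * a * m" and m: "1 \<le> m"
  shows "(a + b) ^ Suc i \<le> a ^ Suc i + real (Suc i) * a ^ i * b + 4 ^ Suc i * m ^ Suc i * a ^ i"
proof (induction i)
  case 0 show ?case using m by simp
next
  case (Suc i)
  have pos: "0 \<le> a ^ i" "0 \<le> m ^ i" using a m by auto
  have "(a + b) ^ Suc (Suc i) \<le> (a ^ Suc i + real (Suc i) * a ^ i * b + 4 ^ Suc i * m ^ Suc i * a ^ i) * (a + b)"
    using mult_right_mono[OF Suc ab(1)] by (simp add: mult.commute)
  also have "\<dots> = a ^ Suc (Suc i) + real (Suc (Suc i)) * a ^ Suc i * b +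
      (real (Suc i) * a ^ i * b\<^sup>2 + 4 ^ Suc i * m ^ Suc i * a ^ i * (a + b))"
    by (simp add: algebra_simps power2_eq_square)
  also have "real (Suc i) * a ^ i * b\<^sup>2 \<le> real (Suc i) * a ^ i * (a * m\<^sup>2)"
    using pos by (intro mult_left_mono ab) auto
  also have "\<dots> \<le> (real (Suc i) * a ^ i * a) * m ^ Suc (Suc i)"
  proof -
    have "m\<^sup>2 \<le> m ^ Suc (Suc i)" using m by (intro power_increasing) auto
    then show ?thesis using pos a by (simp only: mult.assoc) (intro mult_left_mono; simp)
  qed
  also have "\<dots> \<le> (2 * 4 ^ Suc i * a ^ i * a) * m ^ Suc (Suc i)"
  proof -
    have "real (Suc i) \<le> 4 ^ Suc i" by (induction i) auto
    moreover have "(0::real) \<le> 4 ^ Suc i" by simp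
    ultimately have "real (Suc i) \<le> 2 * 4 ^ Suc i" by linarith
    then show ?thesis using pos a m by (intro mult_right_mono) auto
  qed
  also have "4 ^ Suc i * m ^ Suc i * a ^ i * (a + b) \<le> 4 ^ Suc i * m ^ Suc i * a ^ i * (2 * a * m)"
    using pos m by (intro mult_left_mono ab) auto
  finally show ?case by (simp add: algebra_simps)
qed

text \<open>Supplies the hypotheses of \<open>power_add_le_second_order\<close> for a jump
  \<open>z\<close> from \<open>x\<close>: with \<open>r = sqrt a\<close>, Cauchy-Schwarz bounds the
  change \<open>b\<close> of the squared norm by \<open>r * m\<close>.\<close>

lemma norm_square_shift_bounds:
  fixes x z :: "'a::euclidean_space" and c :: real
  assumes "1 \<le> c"
  defines "a \<equiv> (norm x)\<^sup>2 + c" and "b \<equiv> 2 * (x \<bullet> z) + (norm z)\<^sup>2" and "m \<equiv> (1 + norm z)\<^sup>2"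
  shows "(norm (x + z))\<^sup>2 + c = a + b" "b\<^sup>2 \<le> a * m\<^sup>2" "a + b \<le> 2 * a * m"
proof -
  show eq: "(norm (x + z))\<^sup>2 + c = a + b"
    by (simp add: a_def b_def power2_norm_eq_inner inner_add inner_commute)
  define r where "r = sqrt a"
  have a1: "1 \<le> a" using assms by (simp add: a_def add_increasing)
  have r: "r\<^sup>2 = a" "1 \<le> r" "norm x \<le> r"
    using a1 assms by (auto simp: r_def a_def intro: real_le_rsqrt)
  have "\<bar>b\<bar> \<le> 2 * (norm x * norm z) + (norm z)\<^sup>2"
    unfolding b_def using Cauchy_Schwarz_ineq2[of x z] zero_le_power2[of "norm z"]
    by (simp only: abs_le_iff) linarith
  also have "\<dots> \<le> 2 * (r * norm z) + r * (norm z)\<^sup>2"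
    using r mult_right_mono[of 1 r "(norm z)\<^sup>2"] by (intro add_mono mult_left_mono mult_right_mono) auto
  also have "\<dots> \<le> r * m"
    unfolding m_def using r by (simp add: power2_eq_square algebra_simps)
  finally have b: "\<bar>b\<bar> \<le> r * m" .
  have "\<bar>b\<bar>\<^sup>2 \<le> (r * m)\<^sup>2" by (intro power_mono b) auto
  then show "b\<^sup>2 \<le> a * m\<^sup>2" using r by (simp add: power_mult_distrib)
  have m1: "1 \<le> m" unfolding m_def by simp
  have "a + b \<le> a + r * m" using b by simp
  also have "\<dots> \<le> a * m + r * m" using m1 a1 by simp
  also have "r * m \<le> a * m" using r m1 by (intro mult_right_mono) (auto simp: power2_eq_square simp flip: r(1))
  finally show "a + b \<le> 2 * a * m" by simp
qed

text \<open>\<open>V k x\<close> is a Lyapunov function in space and time: averaging over one jump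
  is paid for by one unit of time, the term linear in the jump being cancelled by centring.
  Comparing \<open>V\<close> with the indicator, as in Markov's inequality, bounds the tail.\<close>

lemma random_walk_tail_bound:
  fixes \<nu> :: "'a::euclidean_space measure"
  assumes \<nu>: "borel_prob \<nu>" and i1: "integrable \<nu> (\<lambda>x. x)" and z: "(\<integral>x. x \<partial>\<nu>) = 0"
    and im: "integrable \<nu> (\<lambda>x. (1 + norm x) ^ (2 * Suc i))"
  obtains D where "1 \<le> D" "\<And>k \<rho>. 0 < k \<Longrightarrow> 0 < \<rho> \<Longrightarrow>
    (step \<nu> ^^ k) (indicator {x. \<rho> \<le> norm x}) 0 \<le> D * real k ^ Suc i / \<rho> ^ (2 * Suc i)"
proof -
  interpret prob_space \<nu> using \<nu> by (simp add: borel_prob_def)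
  have sets[measurable_cong]: "sets \<nu> = sets borel" using \<nu> by (simp add: borel_prob_def)
  have i2: "integrable \<nu> (\<lambda>z. (norm z)\<^sup>2)"
  proof (rule Bochner_Integration.integrable_bound[OF im])
    have "(norm z)\<^sup>2 \<le> (1 + norm z) ^ (2 * Suc i)" for z :: 'a
    proof -
      have "(norm z)\<^sup>2 \<le> (1 + norm z)\<^sup>2" by (intro power_mono) auto
      also have "\<dots> \<le> (1 + norm z) ^ (2 * Suc i)" by (intro power_increasing) auto
      finally show ?thesis .
    qed
    then show "AE z in \<nu>. norm ((norm z)\<^sup>2) \<le> norm ((1 + norm z) ^ (2 * Suc i))"
      by (intro AE_I2) (simp add: order_trans[OF _ abs_ge_self])
  qed simp
  define m where "m z = (1 + norm z)\<^sup>2" for z :: 'a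
  have im': "integrable \<nu> (\<lambda>z. m z ^ Suc i)" using im unfolding m_def power_mult[symmetric] .
  define s2 where "s2 = (\<integral>z. (norm z)\<^sup>2 \<partial>\<nu>)"
  define R where "R = (\<integral>z. m z ^ Suc i \<partial>\<nu>)"
  have R0: "0 \<le> R" unfolding R_def by (intro integral_nonneg_AE AE_I2) (simp add: m_def)
  have s0: "0 \<le> s2" unfolding s2_def by (intro integral_nonneg_AE AE_I2) simp
  \<comment> \<open>Chosen so that the second-order terms of one step add up to
    \<open>B * a ^ i\<close>, which is at most the growth of \<open>a ^ Suc i\<close> when
    \<open>a\<close> increases by \<open>B\<close>.\<close>
  define B where "B = real (Suc i) * s2 + 4 ^ Suc i * R"
  have B0: "0 \<le> B" using R0 s0 by (simp add: B_def)
  define V where "V k x = ((norm x)\<^sup>2 + (B * real k + 1)) ^ Suc i" for k and x :: 'a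
  have one_step: "integrable \<nu> (\<lambda>z. V k (x + z)) \<and> (\<integral>z. V k (x + z) \<partial>\<nu>) \<le> V (Suc k) x" for k x
  proof -
    define c where "c = B * real k + 1"
    define a where "a = (norm x)\<^sup>2 + c"
    have c1: "1 \<le> c" using B0 by (simp add: c_def)
    have a1: "1 \<le> a" using c1 by (simp add: a_def add_increasing)
    define U where "U z = a ^ Suc i + real (Suc i) * a ^ i * (2 * (x \<bullet> z) + (norm z)\<^sup>2) + 4 ^ Suc i * m z ^ Suc i * a ^ i" for z
    have VU: "V k (x + z) \<le> U z" for z
    proof -
      note n = norm_square_shift_bounds[OF c1, of x z]
      have n0: "0 \<le> a + (2 * (x \<bullet> z) + (norm z)\<^sup>2)" unfolding a_def n(1)[symmetric] using c1 by simp
      have m1: "1 \<le> (1 + norm z)\<^sup>2" by simp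
      show ?thesis unfolding V_def U_def m_def c_def[symmetric] n(1) a_def[symmetric]
        by (rule power_add_le_second_order[OF a1 n0 n(2)[folded a_def] n(3)[folded a_def] m1])
    qed
    have V0: "0 \<le> V k y" for y using c1 unfolding V_def c_def[symmetric] by (intro zero_le_power add_nonneg_nonneg) auto
    have Ui: "has_bochner_integral \<nu> U (a ^ Suc i + real (Suc i) * a ^ i * (2 * (x \<bullet> (\<integral>x. x \<partial>\<nu>)) + s2) + 4 ^ Suc i * R * a ^ i)"
      unfolding U_def s2_def R_def
      by (intro has_bochner_integral_add has_bochner_integral_mult_right has_bochner_integral_mult_left
            has_bochner_integral_inner_right has_bochner_integral_integrable i1 i2 im')
        (simp_all add: has_bochner_integral_iff prob_space)
    have Vi: "integrable \<nu> (\<lambda>z. V k (x + z))"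
    proof (rule Bochner_Integration.integrable_bound[OF integrable.intros[OF Ui]])
      show "AE z in \<nu>. norm (V k (x + z)) \<le> norm (U z)"
        using VU V0 by (intro AE_I2) (simp add: order_trans[OF _ abs_ge_self])
      show "(\<lambda>z. V k (x + z)) \<in> borel_measurable \<nu>" unfolding V_def by measurable
    qed
    have "(\<integral>z. V k (x + z) \<partial>\<nu>) \<le> integral\<^sup>L \<nu> U"
      by (intro integral_mono Vi integrable.intros[OF Ui] VU)
    also have "\<dots> = a ^ Suc i + real (Suc i) * a ^ i * s2 + 4 ^ Suc i * R * a ^ i"
      using has_bochner_integral_integral_eq[OF Ui] by (simp add: z)
    also have "\<dots> = a ^ i * (a + B)" by (simp add: B_def algebra_simps)
    also have "\<dots> \<le> (a + B) ^ i * (a + B)"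
      using a1 B0 by (intro mult_right_mono power_mono) auto
    also have "\<dots> = V (Suc k) x" by (simp add: V_def a_def c_def algebra_simps)
    finally show ?thesis using Vi by simp
  qed
  have ind: "bdd_meas 1 (indicator {x::'a. \<rho> \<le> norm x} :: 'a \<Rightarrow> real)" for \<rho>
  proof -
    have "{x::'a. \<rho> \<le> norm x} \<in> sets borel" by measurable
    then show ?thesis by (auto simp: bdd_meas_def indicator_def intro!: borel_measurable_indicator)
  qed
  have bound: "\<rho> ^ (2 * Suc i) * (step \<nu> ^^ k) (indicator {x. \<rho> \<le> norm x}) x \<le> V k x" if "0 < \<rho>" for \<rho> k x
  proof (induction k arbitrary: x)
    case 0
    show ?case
    proof (cases "\<rho> \<le> norm x")
      case True
      have "\<rho> ^ (2 * Suc i) \<le> norm x ^ (2 * Suc i)" using that True by (intro power_mono) auto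
      also have "\<dots> = ((norm x)\<^sup>2) ^ Suc i" by (rule power_mult)
      also have "\<dots> \<le> V 0 x" unfolding V_def by (intro power_mono) auto
      finally show ?thesis using True by simp
    next
      case False
      then show ?thesis by (simp add: V_def)
    qed
  next
    case (Suc k)
    let ?f = "(step \<nu> ^^ k) (indicator {x. \<rho> \<le> norm x})"
    have "\<rho> ^ (2 * Suc i) * step \<nu> ?f x = (\<integral>z. \<rho> ^ (2 * Suc i) * ?f (x + z) \<partial>\<nu>)"
      unfolding step_def by (rule integral_mult_right_zero[symmetric])
    also have "\<dots> \<le> (\<integral>z. V k (x + z) \<partial>\<nu>)"
      by (intro integral_mono integrable_mult_right bdd_meas_integrable_shift[OF step_pow_bdd_meas[OF ind \<nu>] \<nu>]
          conjunct1[OF one_step] Suc)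
    also have "\<dots> \<le> V (Suc k) x" using one_step by blast
    finally show ?case by simp
  qed
  show thesis
  proof (rule that[of "(B + 1) ^ Suc i"])
    show "1 \<le> (B + 1) ^ Suc i" using B0 by (intro one_le_power) auto
    fix k :: nat and \<rho> :: real assume k: "0 < k" and \<rho>: "0 < \<rho>"
    have V: "V k 0 \<le> ((B + 1) * real k) ^ Suc i"
      unfolding V_def using B0 k by (intro power_mono) (auto simp: algebra_simps)
    have "\<rho> ^ (2 * Suc i) * (step \<nu> ^^ k) (indicator {x. \<rho> \<le> norm x}) 0 \<le> (B + 1) ^ Suc i * real k ^ Suc i"
      unfolding power_mult_distrib[symmetric] by (rule order_trans[OF bound[OF \<rho>] V])
    then show "(step \<nu> ^^ k) (indicator {x. \<rho> \<le> norm x}) 0 \<le> (B + 1) ^ Suc i * real k ^ Suc i / \<rho> ^ (2 * Suc i)"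
      using \<rho> by (subst pos_le_divide_eq) (auto simp: mult.commute)
  qed
qed

lemma unit_meas_indicator: "A \<in> sets borel \<Longrightarrow> unit_meas (indicator A)"
  by (auto simp: unit_meas_def indicator_def)

context critical_stable
begin

text \<open>The moment of order \<open>2 * Suc l\<close> is finite, since \<open>2 * (\<beta> + 1) = 2 * \<alpha> / (\<alpha> - 1)\<close>, and \<open>\<beta> < Suc l\<close>
  makes the bound on the displacement of \<open>\<delta> * n\<close> generations, relative to \<open>n powr - \<beta>\<close>, vanish as
  \<open>\<delta> \<rightarrow> 0\<close>.\<close>

definition "l = nat \<lfloor>\<beta>\<rfloor>"

lemma l_bounds: "\<beta> < real (Suc l)" "real (Suc l) \<le> \<beta> + 1"
  using beta(1) by (auto simp: l_def) linarith+

lemma jump_power_integrable: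
  fixes \<nu> :: "(real ^ 'd) measure"
  assumes "jump_hyp \<alpha> \<nu>"
  shows "integrable \<nu> (\<lambda>x. (1 + norm x) ^ (2 * Suc l))"
proof -
  interpret prob_space \<nu> using assms by (simp add: jump_hyp_def)
  have sets[measurable_cong]: "sets \<nu> = sets borel" using assms by (simp add: jump_hyp_def)
  define q where "q = 2 * \<alpha> / (\<alpha> - 1)"
  have q: "q = 2 * (\<beta> + 1)" unfolding beta(3)[symmetric] by (simp add: q_def \<beta>_def)
  have i: "integrable \<nu> (\<lambda>x. 2 powr q * (1 + norm x powr q))"
    using assms unfolding jump_hyp_def q_def by auto
  show ?thesis
  proof (rule Bochner_Integration.integrable_bound[OF i])
    show "AE x in \<nu>. norm ((1 + norm x) ^ (2 * Suc l)) \<le> norm (2 powr q * (1 + norm x powr q))"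
    proof (rule AE_I2)
      fix x :: "real ^ 'd"
      have q0: "0 < q" using q beta(1) by simp
      have "(1 + norm x) ^ (2 * Suc l) = (1 + norm x) powr real (2 * Suc l)"
        by (rule powr_realpow[symmetric]) (simp add: add_pos_nonneg)
      also have "\<dots> \<le> (1 + norm x) powr q"
        using l_bounds unfolding q by (intro powr_mono) auto
      also have "\<dots> \<le> (2 * max 1 (norm x)) powr q"
        using q0 by (intro powr_mono2) auto
      also have "\<dots> = 2 powr q * max 1 (norm x) powr q" by (intro powr_mult)
      also have "max 1 (norm x) powr q \<le> 1 + norm x powr q" by (auto simp: max_def)
      finally show "norm ((1 + norm x) ^ (2 * Suc l)) \<le> norm (2 powr q * (1 + norm x powr q))"
        by simp
    qed
  qed measurable
qed

text \<open>Strong induction on \<open>m\<close>, with the generations split into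
  \<open>m1 + m2\<close>. For the probability \<open>\<tau>\<close> in question this bounds
  \<open>\<tau> m \<rho>\<close> by the survival probability over \<open>m2\<close> generations
  times a random walk tail, plus \<open>\<tau> m2 (\<theta> * \<rho>)\<close>; the exponent
  \<open>\<gamma> > 0\<close> makes the last term a contraction.\<close>

lemma displacement_tail_bound:
  fixes \<nu> :: "(real ^ 'd) measure"
  assumes j: "jump_hyp \<alpha> \<nu>"
  obtains A where "0 < A" "\<And>m \<rho>. 0 < \<rho> \<Longrightarrow>
    (hop p \<nu> ^^ m) (indicator {x. \<rho> \<le> norm x}) 0 \<le> A * real m powr (real (Suc l) - \<beta>) / \<rho> ^ (2 * Suc l)"
proof -
  have \<nu>: "borel_prob \<nu>" using j by (simp add: jump_hyp_def borel_prob_def)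
  obtain D where D: "1 \<le> D" "\<And>k \<rho>. 0 < k \<Longrightarrow> 0 < \<rho> \<Longrightarrow>
    (step \<nu> ^^ k) (indicator {x. \<rho> \<le> norm x}) 0 \<le> D * real k ^ Suc l / \<rho> ^ (2 * Suc l)"
    by (rule random_walk_tail_bound[OF \<nu> _ _ jump_power_integrable[OF j]]) (use j in \<open>auto simp: jump_hyp_def\<close>)
  obtain c where c: "0 < c" "\<And>m. 0 < m \<Longrightarrow> (hit p ^^ m) 1 \<le> c * real m powr (- \<beta>)"
    by (rule survival_bound, rule that)
  define \<gamma> where "\<gamma> = real (Suc l) - \<beta>"
  have \<gamma>: "0 < \<gamma>" using l_bounds by (simp add: \<gamma>_def)
  \<comment> \<open>Shrinking the distance by \<open>\<theta>\<close> costs the factor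
    \<open>2 powr (\<gamma> / 2)\<close>, while halving the time gains
    \<open>2 powr - \<gamma>\<close>; the net factor is \<open>r = 2 powr - (\<gamma> / 2)\<close>,
    below \<open>1\<close>.\<close>
  define \<theta> where "\<theta> = 2 powr (- \<gamma> / (4 * real (Suc l)))"
  have \<theta>: "0 < \<theta>" "\<theta> < 1"
    unfolding \<theta>_def using \<gamma> powr_less_mono[of "- \<gamma> / (4 * real (Suc l))" 0 2] by (auto simp: divide_neg_pos)
  have \<theta>l: "\<theta> ^ (2 * Suc l) = 2 powr (- \<gamma> / 2)"
  proof -
    have "\<theta> ^ (2 * Suc l) = \<theta> powr real (2 * Suc l)" by (rule powr_realpow[OF \<theta>(1), symmetric])
    also have "\<dots> = 2 powr (- \<gamma> / (4 * real (Suc l)) * real (2 * Suc l))" unfolding \<theta>_def by (rule powr_powr)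
    also have "- \<gamma> / (4 * real (Suc l)) * real (2 * Suc l) = - \<gamma> / 2" by (simp add: field_simps)
    finally show ?thesis .
  qed
  define r where "r = 2 powr (- \<gamma> / 2)"
  have r: "0 < r" "r < 1"
    unfolding r_def using \<gamma> powr_less_mono[of "- \<gamma> / 2" 0 2] by auto
  define E where "E = c * 3 powr \<beta> * D / (1 - \<theta>) ^ (2 * Suc l)"
  have E0: "0 < E" unfolding E_def using c D \<theta> by simp
  \<comment> \<open>\<open>D\<close> covers a single generation, and the second entry makes
    \<open>A * r + E \<le> A\<close>, where \<open>E\<close> is the price of being far out at
    mid-time.\<close>
  define A where "A = max D (E / (1 - r))"
  have A0: "0 < A" using D by (simp add: A_def)
  have AD: "D \<le> A" by (simp add: A_def)
  have "E / (1 - r) \<le> A" by (simp add: A_def)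
  then have AE: "A * r + E \<le> A" using r by (simp add: field_simps)
  define \<tau> where "\<tau> m \<rho> = (hop p \<nu> ^^ m) (indicator {x. \<rho> \<le> norm x}) 0" for m and \<rho> :: real
  have ms: "{x::real^'d. \<rho> \<le> norm x} \<in> sets borel" for \<rho> by measurable
  note u = unit_meas_indicator[OF ms]
  have uc: "unit_meas (\<lambda>_::real^'d. 1)" by (simp add: unit_meas_def)
  have "\<tau> m \<rho> \<le> A * real m powr \<gamma> / \<rho> ^ (2 * Suc l)" if "0 < \<rho>" for m \<rho>
    using that
  proof (induction m arbitrary: \<rho> rule: less_induct)
    case (less m)
    note \<rho> = \<open>0 < \<rho>\<close>
    consider "m = 0" | "m = 1" | "2 \<le> m" by linarith
    then show ?case
    proof cases
      case 1
      then show ?thesis using \<rho> by (simp add: \<tau>_def)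
    next
      case 2
      have "\<tau> 1 \<rho> \<le> (step \<nu> ^^ 1) (indicator {x. \<rho> \<le> norm x}) 0"
        unfolding \<tau>_def by (rule hop_pow_le_step_pow[OF mean \<nu> u])
      also have "\<dots> \<le> D * real 1 ^ Suc l / \<rho> ^ (2 * Suc l)" by (rule D) (use \<rho> in auto)
      also have "\<dots> \<le> A / \<rho> ^ (2 * Suc l)" using AD \<rho> by (simp add: divide_right_mono)
      finally show ?thesis using 2 by simp
    next
      case 3
      define m2 where "m2 = m div 2"
      define m1 where "m1 = m - m2"
      have m: "0 < m2" "m2 < m" "0 < m1" "m = m1 + m2" "m \<le> 3 * m2" "2 * m2 \<le> m" "m1 \<le> m"
        using 3 by (auto simp: m1_def m2_def)
      define s where "s = (hit p ^^ m2) 1"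
      define t where "t = \<tau> m2 (\<theta> * \<rho>)"
      have s: "0 < s" "s \<le> 1" using iterate_bounds[of 1 m2] by (auto simp: s_def)
      have t: "0 \<le> t" using hop_pow_unit[OF mean \<nu> u] by (simp add: t_def \<tau>_def unit_meas_def)
      define \<rho>' where "\<rho>' = (1 - \<theta>) * \<rho>"
      have \<rho>': "0 < \<rho>'" using \<rho> \<theta> by (simp add: \<rho>'_def)
      define g where "g = (hop p \<nu> ^^ m2) (indicator {x. \<rho> \<le> norm x})"
      \<comment> \<open>From a point of norm below \<open>\<rho>'\<close> the remaining distance is
        at least \<open>\<theta> * \<rho>\<close>; from farther out only survival for
        \<open>m2\<close> generations is used.\<close>
      have g_le: "g x \<le> s * indicator {x. \<rho>' \<le> norm x} x + t" for x
      proof (cases "\<rho>' \<le> norm x")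
        case True
        have "g x \<le> (hop p \<nu> ^^ m2) (\<lambda>_. 1) x"
          unfolding g_def by (rule hop_pow_mono[OF mean \<nu> u uc]) (simp add: indicator_def)
        also have "\<dots> = s" by (simp add: hop_pow_const[OF mean \<nu>] s_def)
        finally show ?thesis using True t by simp
      next
        case False
        have "g x = (hop p \<nu> ^^ m2) (\<lambda>z. indicator {x. \<rho> \<le> norm x} (x + z)) 0"
          unfolding g_def by (simp add: hop_pow_translate[OF mean \<nu>])
        also have "\<dots> \<le> t"
          unfolding t_def \<tau>_def
        proof (rule hop_pow_mono[OF mean \<nu> _ u])
          show "unit_meas (\<lambda>z. indicator {x. \<rho> \<le> norm x} (x + z) :: real)"
            using bdd_meas_shift[OF unit_meas_bdd[OF u[of \<rho>]], of x]
            by (auto simp: unit_meas_def bdd_meas_def)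
          show "indicator {x. \<rho> \<le> norm x} (x + z) \<le> (indicator {x. \<theta> * \<rho> \<le> norm x} z :: real)" for z
            using False norm_triangle_ineq[of x z] by (auto simp: indicator_def \<rho>'_def algebra_simps)
        qed
        finally show ?thesis using False by simp
      qed
      have gu: "unit_meas g" unfolding g_def by (rule hop_pow_unit[OF mean \<nu> u])
      have bm: "bdd_meas (s + t) (\<lambda>x. s * indicator {x. \<rho>' \<le> norm x} x + t)"
        using s t u[of \<rho>'] by (auto simp: bdd_meas_def unit_meas_def indicator_def)
      have "\<tau> m \<rho> = (hop p \<nu> ^^ m1) g 0"
        unfolding \<tau>_def g_def m(4) funpow_add by simp
      also have "\<dots> \<le> (step \<nu> ^^ m1) g 0" by (rule hop_pow_le_step_pow[OF mean \<nu> gu])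
      also have "\<dots> \<le> (step \<nu> ^^ m1) (\<lambda>x. s * indicator {x. \<rho>' \<le> norm x} x + t) 0"
        by (rule step_pow_mono[OF unit_meas_bdd[OF gu] bm \<nu> g_le])
      also have "\<dots> = s * (step \<nu> ^^ m1) (indicator {x. \<rho>' \<le> norm x}) 0 + t"
        by (simp add: step_pow_affine[OF unit_meas_bdd[OF u] \<nu>])
      also have "\<dots> \<le> (c * 3 powr \<beta> * real m powr (- \<beta>)) * (D * real m ^ Suc l / \<rho>' ^ (2 * Suc l)) +
          A * (real m / 2) powr \<gamma> / (\<theta> * \<rho>) ^ (2 * Suc l)"
      proof (intro add_mono mult_mono)
        have "s \<le> c * real m2 powr (- \<beta>)" unfolding s_def by (rule c(2)[OF m(1)])
        also have "\<dots> \<le> c * (real m / 3) powr (- \<beta>)"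
          using c m beta(1) by (intro mult_left_mono powr_mono2') auto
        also have "(real m / 3) powr (- \<beta>) = 3 powr \<beta> * real m powr (- \<beta>)"
          using m by (simp add: powr_divide powr_minus field_simps)
        finally show "s \<le> c * 3 powr \<beta> * real m powr (- \<beta>)" by simp
        have "(step \<nu> ^^ m1) (indicator {x. \<rho>' \<le> norm x}) 0 \<le> D * real m1 ^ Suc l / \<rho>' ^ (2 * Suc l)"
          by (rule D(2)[OF m(3) \<rho>'])
        also have "\<dots> \<le> D * real m ^ Suc l / \<rho>' ^ (2 * Suc l)"
          using m D \<rho>' by (intro divide_right_mono mult_left_mono power_mono) auto
        finally show "(step \<nu> ^^ m1) (indicator {x. \<rho>' \<le> norm x}) 0 \<le> D * real m ^ Suc l / \<rho>' ^ (2 * Suc l)" .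
        show "0 \<le> (step \<nu> ^^ m1) (indicator {x. \<rho>' \<le> norm x}) 0"
          using hop_pow_unit[OF mean \<nu> u, of m1 \<rho>'] hop_pow_le_step_pow[OF mean \<nu> u, of m1 \<rho>' 0]
          by (auto simp: unit_meas_def intro: order_trans)
        have "t \<le> A * real m2 powr \<gamma> / (\<theta> * \<rho>) ^ (2 * Suc l)"
          unfolding t_def by (rule less.IH[OF m(2)]) (use \<rho> \<theta> in auto)
        also have "\<dots> \<le> A * (real m / 2) powr \<gamma> / (\<theta> * \<rho>) ^ (2 * Suc l)"
          using A0 \<gamma> \<rho> \<theta> m by (intro divide_right_mono mult_left_mono powr_mono2) auto
        finally show "t \<le> A * (real m / 2) powr \<gamma> / (\<theta> * \<rho>) ^ (2 * Suc l)" .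
      qed (use c in auto)
      also have "(c * 3 powr \<beta> * real m powr (- \<beta>)) * (D * real m ^ Suc l / \<rho>' ^ (2 * Suc l)) =
          E * (real m powr (- \<beta>) * real m ^ Suc l) / \<rho> ^ (2 * Suc l)"
        unfolding E_def \<rho>'_def power_mult_distrib by simp
      also have "real m powr (- \<beta>) * real m ^ Suc l = real m powr \<gamma>"
        using m by (subst powr_realpow[symmetric]) (auto simp: powr_add[symmetric] \<gamma>_def simp flip: powr_add)
      also have "A * (real m / 2) powr \<gamma> / (\<theta> * \<rho>) ^ (2 * Suc l) = (A * r) * real m powr \<gamma> / \<rho> ^ (2 * Suc l)"
      proof -
        have h: "2 powr \<gamma> * (r * r) = 1"
          unfolding r_def by (simp flip: powr_add)
        have "(real m / 2) powr \<gamma> / (\<theta> * \<rho>) ^ (2 * Suc l) = real m powr \<gamma> / (2 powr \<gamma> * r * \<rho> ^ (2 * Suc l))"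
          unfolding power_mult_distrib \<theta>l r_def[symmetric] by (simp add: powr_divide)
        also have "1 / (2 powr \<gamma> * r) = r" using h r by (simp add: field_simps)
        then have "real m powr \<gamma> / (2 powr \<gamma> * r * \<rho> ^ (2 * Suc l)) = r * real m powr \<gamma> / \<rho> ^ (2 * Suc l)"
          by (metis (no_types, lifting) divide_divide_eq_left mult.commute mult.right_neutral times_divide_eq_right)
        finally show ?thesis by (simp only: mult.assoc flip: times_divide_eq_right)
      qed
      also have "E * real m powr \<gamma> / \<rho> ^ (2 * Suc l) + (A * r) * real m powr \<gamma> / \<rho> ^ (2 * Suc l) =
          (A * r + E) * (real m powr \<gamma> / \<rho> ^ (2 * Suc l))"
        by (simp add: add_divide_distrib[symmetric] algebra_simps)
      also have "\<dots> \<le> A * (real m powr \<gamma> / \<rho> ^ (2 * Suc l))"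
        using AE \<rho> by (intro mult_right_mono) auto
      finally show ?thesis by simp
    qed
  qed
  then show thesis using that[OF A0] unfolding \<tau>_def \<gamma>_def by blast
qed

end

section \<open>Gaussian smoothing and the Lindeberg replacement\<close>

definition gauss_kernel :: "'a::euclidean_space \<Rightarrow> real" where
  "gauss_kernel z = exp (- (norm z)\<^sup>2 / 2)"

lemma gauss_kernel_pos: "0 < gauss_kernel z"
  by (simp add: gauss_kernel_def)

lemma gauss_kernel_measurable [measurable]: "gauss_kernel \<in> borel_measurable borel"
  unfolding gauss_kernel_def[abs_def] by measurable

lemma integrable_exp_norm_square:
  fixes c :: real
  assumes "0 < c"
  shows "integrable lborel (\<lambda>z::'a::euclidean_space. exp (- c * (norm z)\<^sup>2))"
proof -
  define \<sigma> where "\<sigma> = sqrt (1 / (2 * c))"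
  have s: "0 < \<sigma>" "\<sigma>\<^sup>2 = 1 / (2 * c)" using assms by (auto simp: \<sigma>_def)
  have "integrable lborel (\<lambda>t. sqrt (2 * pi * \<sigma>\<^sup>2) * normal_density 0 \<sigma> t)"
    using s by simp
  moreover have "sqrt (2 * pi * \<sigma>\<^sup>2) * normal_density 0 \<sigma> t = exp (- c * t\<^sup>2)" for t
    using s assms by (simp add: normal_density_def real_sqrt_mult real_sqrt_divide)
  ultimately have 1: "integrable lborel (\<lambda>t. exp (- c * t\<^sup>2))" by simp
  have "(\<integral>\<^sup>+z. ennreal (exp (- c * (norm (z :: 'a))\<^sup>2)) \<partial>lborel) =
      (\<integral>\<^sup>+z. (\<Prod>b\<in>Basis. ennreal (exp (- c * ((z :: 'a) \<bullet> b)\<^sup>2))) \<partial>lborel)"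
  proof (rule nn_integral_cong)
    fix z :: 'a
    have "(norm z)\<^sup>2 = (\<Sum>b\<in>Basis. (z \<bullet> b)\<^sup>2)"
      unfolding power2_norm_eq_inner euclidean_inner[of z z] by (simp add: power2_eq_square)
    then have "exp (- c * (norm z)\<^sup>2) = exp (\<Sum>b\<in>Basis. - c * (z \<bullet> b)\<^sup>2)"
      by (simp add: sum_distrib_left sum_negf)
    also have "\<dots> = (\<Prod>b\<in>Basis. exp (- c * (z \<bullet> b)\<^sup>2))" by (rule exp_sum) simp
    finally show "ennreal (exp (- c * (norm z)\<^sup>2)) = (\<Prod>b\<in>Basis. ennreal (exp (- c * (z \<bullet> b)\<^sup>2)))"
      by (simp add: prod_ennreal)
  qed
  also have "\<dots> = (\<Prod>b\<in>(Basis::'a set). (\<integral>\<^sup>+t. ennreal (exp (- c * t\<^sup>2)) \<partial>lborel))"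
    by (rule nn_integral_lborel_prod) auto
  also have "\<dots> < \<infinity>"
    using 1 by (simp add: nn_integral_eq_integral power_less_top_ennreal)
  finally show ?thesis
    by (intro integrableI_bounded) (auto simp: less_top)
qed

lemma polynomial_gauss_bound:
  fixes r :: real
  assumes "0 \<le> r"
  shows "(1 + r) ^ 4 * exp (- r\<^sup>2 / 4) \<le> 1024 * exp (- (1 / 8) * r\<^sup>2)"
proof -
  have "(1 + r)\<^sup>2 \<le> 2 * (1 + r\<^sup>2)"
    using zero_le_power2[of "1 - r"] by (simp add: power2_eq_square algebra_simps)
  also have "\<dots> \<le> 32 * (1 + r\<^sup>2 / 16)" by (simp add: algebra_simps)
  also have "\<dots> \<le> 32 * exp (r\<^sup>2 / 16)" by (intro mult_left_mono exp_ge_add_one_self) auto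
  finally have "((1 + r)\<^sup>2)\<^sup>2 \<le> (32 * exp (r\<^sup>2 / 16))\<^sup>2" by (intro power_mono) auto
  also have "\<dots> = 1024 * exp (r\<^sup>2 / 8)" by (simp add: power_mult_distrib exp_double[symmetric])
  finally have "(1 + r) ^ 4 \<le> 1024 * exp (r\<^sup>2 / 8)" by simp
  then have "(1 + r) ^ 4 * exp (- r\<^sup>2 / 4) \<le> 1024 * exp (r\<^sup>2 / 8) * exp (- r\<^sup>2 / 4)"
    by (intro mult_right_mono) auto
  also have "\<dots> = 1024 * exp (- (1 / 8) * r\<^sup>2)" by (simp flip: exp_add mult.assoc)
  finally show ?thesis .
qed

text \<open>Integrable majorant of the third-order Taylor remainder of the kernel for
  \<open>norm h \<le> 1\<close>: the cubic polynomial factor is absorbed by the fourth power, and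
  the weaker exponent allows for evaluation at an intermediate point at distance at most
  \<open>1\<close> from \<open>y\<close>.\<close>

definition gauss_majorant :: "'a::euclidean_space \<Rightarrow> real" where
  "gauss_majorant y = 2 * ((1 + norm y) ^ 4 * exp (- (norm y)\<^sup>2 / 4))"

lemma gauss_majorant_integrable: "integrable lborel (gauss_majorant :: 'a::euclidean_space \<Rightarrow> real)"
proof -
  have i: "integrable lborel (\<lambda>z::'a. 2048 * exp (- (1 / 8) * (norm z)\<^sup>2))"
    by (intro integrable_mult_right integrable_exp_norm_square) simp
  show ?thesis
    by (rule Bochner_Integration.integrable_bound[OF i])
      (use polynomial_gauss_bound in \<open>auto simp: gauss_majorant_def[abs_def]\<close>)
qed

lemma gauss_kernel_majorant:
  "gauss_kernel y * (1 + norm y) ^ 4 \<le> gauss_majorant y"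
proof -
  have "gauss_kernel y \<le> exp (- (norm y)\<^sup>2 / 4)" unfolding gauss_kernel_def by simp
  then have "gauss_kernel y * (1 + norm y) ^ 4 \<le> exp (- (norm y)\<^sup>2 / 4) * (1 + norm y) ^ 4"
    by (intro mult_right_mono) auto
  also have "\<dots> \<le> gauss_majorant y" by (simp add: gauss_majorant_def)
  finally show ?thesis .
qed

lemma gauss_kernel_mult_integrable:
  fixes f g :: "'a::euclidean_space \<Rightarrow> real"
  assumes f: "bdd_meas K f" and g: "g \<in> borel_measurable borel" "\<And>y. \<bar>g y\<bar> \<le> c * (1 + norm y) ^ 4"
  shows "integrable lborel (\<lambda>y. f y * (g y * gauss_kernel y))"
proof -
  have i: "integrable lborel (\<lambda>y::'a. K * (c * gauss_majorant y))"
    by (intro integrable_mult_right gauss_majorant_integrable)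
  show ?thesis
  proof (rule Bochner_Integration.integrable_bound[OF i])
    have [measurable]: "f \<in> borel_measurable borel" "g \<in> borel_measurable borel" using f g by (auto simp: bdd_meas_def)
    show "(\<lambda>y. f y * (g y * gauss_kernel y)) \<in> borel_measurable lborel" by measurable
    show "AE y in lborel. norm (f y * (g y * gauss_kernel y)) \<le> norm (K * (c * gauss_majorant y))"
    proof (rule AE_I2)
      fix y :: 'a
      have c: "0 \<le> c" using g(2)[of 0] by (simp add: order_trans[OF abs_ge_zero])
      have "\<bar>g y\<bar> * gauss_kernel y \<le> c * (1 + norm y) ^ 4 * gauss_kernel y"
        using gauss_kernel_pos[of y] g by (intro mult_right_mono) auto
      also have "\<dots> \<le> c * gauss_majorant y"
        using gauss_kernel_majorant[of y] c by (simp add: mult.assoc mult.commute[of "gauss_kernel y"] mult_left_mono)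
      finally have 1: "\<bar>g y\<bar> * gauss_kernel y \<le> c * gauss_majorant y" .
      have "\<bar>f y\<bar> * (\<bar>g y\<bar> * gauss_kernel y) \<le> K * (c * gauss_majorant y)"
        using f gauss_kernel_pos[of y] by (intro mult_mono 1) (auto simp: bdd_meas_def intro: order_trans[OF abs_ge_zero])
      then show "norm (f y * (g y * gauss_kernel y)) \<le> norm (K * (c * gauss_majorant y))"
        using gauss_kernel_pos[of y] by (simp add: abs_mult) (metis abs_ge_self abs_mult order_trans)
    qed
  qed
qed

lemma gauss_kernel_taylor_small:
  fixes y h :: "'a::euclidean_space"
  assumes h: "norm h \<le> 1"
  shows "\<bar>gauss_kernel (y - h) - gauss_kernel y * (1 + y \<bullet> h + ((y \<bullet> h)\<^sup>2 - (norm h)\<^sup>2) / 2)\<bar> \<le> norm h ^ 3 * gauss_majorant y"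
proof -
  define s q where "s = y \<bullet> h" and "q = (norm h)\<^sup>2"
  define \<phi> where "\<phi> t = gauss_kernel (y - t *\<^sub>R h)" for t :: real
  have \<phi>_eq: "\<phi> t = exp (- (norm y)\<^sup>2 / 2 + t * s - t\<^sup>2 * q / 2)" for t
  proof -
    have "(norm (y - t *\<^sub>R h))\<^sup>2 = (norm y)\<^sup>2 - 2 * t * s + t\<^sup>2 * q"
      unfolding power2_norm_eq_inner s_def q_def
      by (simp add: inner_diff inner_commute algebra_simps power2_eq_square[of t])
    then show ?thesis by (simp add: \<phi>_def gauss_kernel_def field_simps)
  qed
  \<comment> \<open>Successive derivatives of the kernel along the segment from \<open>y\<close> to
    \<open>y - h\<close>: Hermite-type polynomials in \<open>s - t * q\<close>, since the exponent
    is quadratic in \<open>t\<close>.\<close>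
  define d where "d m t = (if m = 0 then \<phi> t else if m = 1 then (s - t * q) * \<phi> t
    else if m = 2 then ((s - t * q)\<^sup>2 - q) * \<phi> t else ((s - t * q) ^ 3 - 3 * q * (s - t * q)) * \<phi> t)" for m :: nat and t
  have D: "(\<phi> has_real_derivative (s - t * q) * \<phi> t) (at t)" for t
    unfolding \<phi>_eq[abs_def] by (rule derivative_eq_intros refl | simp add: algebra_simps)+
  have "\<exists>t::real. 0 < t \<and> t < 1 \<and> \<phi> 1 = sum (\<lambda>m. (d m 0 / fact m) * 1 ^ m) {..<3} + (d 3 t / fact 3) * 1 ^ 3"
  proof (rule Maclaurin)
    show "d 0 = \<phi>" by (simp add: d_def fun_eq_iff)
    show "\<forall>m t. m < 3 \<and> 0 \<le> t \<and> t \<le> 1 \<longrightarrow> (d m has_real_derivative d (Suc m) t) (at t)"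
    proof (intro allI impI)
      fix m :: nat and t :: real assume m: "m < 3 \<and> 0 \<le> t \<and> t \<le> 1"
      then consider "m = 0" | "m = 1" | "m = 2" by linarith
      then show "(d m has_real_derivative d (Suc m) t) (at t)"
      proof cases
        case 1 then show ?thesis using D by (simp add: d_def[abs_def])
      next
        case 2
        have "((\<lambda>t. (s - t * q) * \<phi> t) has_real_derivative ((s - t * q)\<^sup>2 - q) * \<phi> t) (at t)"
          by (rule derivative_eq_intros D refl | simp add: algebra_simps power2_eq_square)+
        then show ?thesis using 2 by (simp add: d_def[abs_def] numeral_2_eq_2)
      next
        case 3
        have "((\<lambda>t. ((s - t * q)\<^sup>2 - q) * \<phi> t) has_real_derivative ((s - t * q) ^ 3 - 3 * q * (s - t * q)) * \<phi> t) (at t)"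
          by (rule derivative_eq_intros D refl | simp add: algebra_simps power2_eq_square power3_eq_cube)+
        then show ?thesis using 3 by (simp add: d_def[abs_def])
      qed
    qed
  qed auto
  then obtain t where t: "0 < t" "t < 1" "\<phi> 1 = \<phi> 0 + s * \<phi> 0 + (s\<^sup>2 - q) * \<phi> 0 / 2 +
      ((s - t * q) ^ 3 - 3 * q * (s - t * q)) * \<phi> t / 6"
    by (auto simp: d_def eval_nat_numeral)
  have "gauss_kernel (y - h) - gauss_kernel y * (1 + y \<bullet> h + ((y \<bullet> h)\<^sup>2 - (norm h)\<^sup>2) / 2) =
      ((s - t * q) ^ 3 - 3 * q * (s - t * q)) * \<phi> t / 6"
    using t(3) by (simp add: \<phi>_def s_def q_def algebra_simps)
  moreover have "\<bar>((s - t * q) ^ 3 - 3 * q * (s - t * q)) * \<phi> t / 6\<bar> \<le> norm h ^ 3 * gauss_majorant y"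
  proof -
    define r where "r = 1 + norm y"
    have r: "1 \<le> r" by (simp add: r_def)
    have "\<bar>s - t * q\<bar> \<le> norm y * norm h + 1 * (norm h * 1)"
    proof -
      have "\<bar>s\<bar> \<le> norm y * norm h" unfolding s_def by (rule Cauchy_Schwarz_ineq2)
      moreover have "\<bar>t * q\<bar> \<le> 1 * (norm h * 1)"
        unfolding abs_mult q_def power2_eq_square using t h by (intro mult_mono) auto
      ultimately show ?thesis by linarith
    qed
    then have a: "\<bar>s - t * q\<bar> \<le> norm h * r" by (simp add: r_def algebra_simps)
    have "\<bar>(s - t * q) ^ 3 - 3 * q * (s - t * q)\<bar> \<le> \<bar>s - t * q\<bar> ^ 3 + 3 * q * \<bar>s - t * q\<bar>"
      using abs_triangle_ineq4[of "(s - t * q) ^ 3" "3 * q * (s - t * q)"] by (simp add: power_abs abs_mult q_def)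
    also have "\<dots> \<le> (norm h * r) ^ 3 + 3 * (norm h)\<^sup>2 * (norm h * r)"
      using a unfolding q_def by (intro add_mono power_mono mult_left_mono) auto
    also have "\<dots> = norm h ^ 3 * (r ^ 3 + 3 * r)" by (simp add: algebra_simps power2_eq_square power3_eq_cube)
    also have "\<dots> \<le> norm h ^ 3 * (4 * r ^ 4)"
    proof -
      have "r ^ 3 \<le> r ^ 4" "r ^ 1 \<le> r ^ 4" using r by (intro power_increasing; simp)+
      then show ?thesis by (intro mult_left_mono) auto
    qed
    finally have A: "\<bar>(s - t * q) ^ 3 - 3 * q * (s - t * q)\<bar> \<le> norm h ^ 3 * (4 * r ^ 4)" .
    have "\<phi> t \<le> exp (1 - (norm y)\<^sup>2 / 4)"
    proof -
      have "norm y \<le> norm (y - t *\<^sub>R h) + norm (t *\<^sub>R h)"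
        using norm_triangle_ineq[of "y - t *\<^sub>R h" "t *\<^sub>R h"] by simp
      also have "norm (t *\<^sub>R h) \<le> 1" using t h by (simp add: mult_le_one)
      finally have "(norm y)\<^sup>2 \<le> (norm (y - t *\<^sub>R h) + 1)\<^sup>2" by (intro power_mono) auto
      also have "\<dots> \<le> 2 * (norm (y - t *\<^sub>R h))\<^sup>2 + 2"
        using zero_le_power2[of "norm (y - t *\<^sub>R h) - 1"] by (simp add: power2_eq_square algebra_simps)
      finally show ?thesis unfolding \<phi>_def gauss_kernel_def by simp
    qed
    also have "\<dots> \<le> 3 * exp (- (norm y)\<^sup>2 / 4)"
    proof -
      have "exp (1 - (norm y)\<^sup>2 / 4) = exp 1 * exp (- (norm y)\<^sup>2 / 4)" by (simp flip: exp_add)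
      then show ?thesis using exp_le by simp
    qed
    finally have B: "\<phi> t \<le> 3 * exp (- (norm y)\<^sup>2 / 4)" .
    have "\<bar>((s - t * q) ^ 3 - 3 * q * (s - t * q)) * \<phi> t / 6\<bar> =
        \<bar>(s - t * q) ^ 3 - 3 * q * (s - t * q)\<bar> * \<phi> t / 6"
      using gauss_kernel_pos[of "y - t *\<^sub>R h"] by (simp add: abs_mult \<phi>_def)
    also have "\<dots> \<le> (norm h ^ 3 * (4 * r ^ 4)) * (3 * exp (- (norm y)\<^sup>2 / 4)) / 6"
      using A B gauss_kernel_pos[of "y - t *\<^sub>R h"] by (intro divide_right_mono mult_mono) (auto simp: \<phi>_def)
    also have "\<dots> = norm h ^ 3 * gauss_majorant y" by (simp add: gauss_majorant_def r_def)
    finally show ?thesis .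
  qed
  ultimately show ?thesis by simp
qed

text \<open>For \<open>norm h > 1\<close> no cancellation is sought: the kernel and its Taylor
  polynomial are bounded separately, using \<open>norm h ^ 3 \<ge> 1\<close>. The kernel at
  \<open>y - h\<close> is kept in the bound because its integral over \<open>y\<close> is the same
  for all \<open>h\<close>.\<close>

lemma gauss_kernel_taylor:
  fixes y h :: "'a::euclidean_space"
  shows "\<bar>gauss_kernel (y - h) - gauss_kernel y * (1 + y \<bullet> h + ((y \<bullet> h)\<^sup>2 - (norm h)\<^sup>2) / 2)\<bar>
    \<le> norm h ^ 3 * (gauss_majorant y + gauss_kernel (y - h))"
proof (cases "norm h \<le> 1")
  case True
  then show ?thesis
    using gauss_kernel_taylor_small[OF True, of y] gauss_kernel_pos[of "y - h"]
    by (smt (verit, best) mult_left_mono norm_ge_zero zero_le_power)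
next
  case False
  define n r where "n = norm h" and "r = 1 + norm y"
  have n: "1 \<le> n" and r: "1 \<le> r" using False by (auto simp: n_def r_def)
  have n3: "n \<le> n ^ 3" "n\<^sup>2 \<le> n ^ 3" "1 \<le> n ^ 3" using n power_increasing[of 1 3 n] power_increasing[of 2 3 n] by auto
  have "\<bar>1 + y \<bullet> h + ((y \<bullet> h)\<^sup>2 - (norm h)\<^sup>2) / 2\<bar> \<le> 1 + \<bar>y \<bullet> h\<bar> + ((y \<bullet> h)\<^sup>2 + n\<^sup>2) / 2"
  proof -
    have "\<bar>1 + a + (b - c) / 2\<bar> \<le> 1 + \<bar>a\<bar> + (b + c) / 2" if "0 \<le> b" "0 \<le> c" for a b c :: real
      using that abs_ge_self[of a] abs_ge_minus_self[of a] by (intro abs_leI) (simp_all add: field_simps)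
    then show ?thesis unfolding n_def by simp
  qed
  also have "\<dots> \<le> 1 + norm y * n + ((norm y * n)\<^sup>2 + n\<^sup>2) / 2"
    using Cauchy_Schwarz_ineq2[of y h] power_mono[OF Cauchy_Schwarz_ineq2[of y h], of 2]
    unfolding n_def by (intro add_mono divide_right_mono) auto
  also have "\<dots> \<le> n ^ 3 + norm y * n ^ 3 + ((norm y)\<^sup>2 * n ^ 3 + n ^ 3) / 2"
    unfolding power_mult_distrib using n3 by (intro add_mono divide_right_mono mult_left_mono) auto
  also have "\<dots> \<le> n ^ 3 * (2 * r\<^sup>2)"
  proof -
    have "0 \<le> n ^ 3 * (1 + 6 * norm y + 3 * (norm y)\<^sup>2)"
      using n by (intro mult_nonneg_nonneg add_nonneg_nonneg) auto
    then show ?thesis by (simp add: r_def power2_eq_square algebra_simps)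
  qed
  also have "\<dots> \<le> n ^ 3 * (2 * r ^ 4)"
    using n n3 r by (intro mult_left_mono power_increasing) auto
  finally have A: "\<bar>1 + y \<bullet> h + ((y \<bullet> h)\<^sup>2 - (norm h)\<^sup>2) / 2\<bar> \<le> n ^ 3 * (2 * r ^ 4)" .
  have "gauss_kernel y \<le> exp (- (norm y)\<^sup>2 / 4)" unfolding gauss_kernel_def by simp
  then have "gauss_kernel y * \<bar>1 + y \<bullet> h + ((y \<bullet> h)\<^sup>2 - (norm h)\<^sup>2) / 2\<bar> \<le> exp (- (norm y)\<^sup>2 / 4) * (n ^ 3 * (2 * r ^ 4))"
    using A gauss_kernel_pos[of y] by (intro mult_mono) auto
  also have "\<dots> = n ^ 3 * gauss_majorant y" by (simp add: gauss_majorant_def r_def)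
  finally have B: "\<bar>gauss_kernel y * (1 + y \<bullet> h + ((y \<bullet> h)\<^sup>2 - (norm h)\<^sup>2) / 2)\<bar> \<le> n ^ 3 * gauss_majorant y"
    using gauss_kernel_pos[of y] by (simp add: abs_mult)
  have "\<bar>gauss_kernel (y - h)\<bar> \<le> n ^ 3 * gauss_kernel (y - h)"
    using n3 gauss_kernel_pos[of "y - h"] by simp
  with B show ?thesis unfolding n_def[symmetric] by (simp only: distrib_left)
qed

definition gauss_smooth :: "('a::euclidean_space \<Rightarrow> real) \<Rightarrow> 'a \<Rightarrow> real" where
  "gauss_smooth f x = (\<integral>z. f (x + z) * gauss_kernel z \<partial>lborel)"

definition taylor_const :: "'a::euclidean_space itself \<Rightarrow> real" where
  "taylor_const _ = (\<integral>y. gauss_majorant (y :: 'a) \<partial>lborel) + (\<integral>y. gauss_kernel (y :: 'a) \<partial>lborel)"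

lemma integrable_lborel_shift:
  fixes f :: "'a::euclidean_space \<Rightarrow> real"
  assumes "integrable lborel f"
  shows "integrable lborel (\<lambda>y. f (c + y))" "(\<integral>y. f (c + y) \<partial>lborel) = (\<integral>y. f y \<partial>lborel)"
proof -
  have m: "f \<in> borel_measurable borel" using assms by (simp add: borel_measurable_integrable)
  have d: "distr lborel borel ((+) c) = (lborel :: 'a measure)" by (rule lborel_distr_plus)
  show "integrable lborel (\<lambda>y. f (c + y))"
    using assms integrable_distr_eq[of "(+) c" lborel borel f] m unfolding d by simp
  show "(\<integral>y. f (c + y) \<partial>lborel) = (\<integral>y. f y \<partial>lborel)"
    using integral_distr[of "(+) c" lborel borel f] m unfolding d by simp
qed

lemma gauss_kernel_integrable: "integrable lborel (gauss_kernel :: 'a::euclidean_space \<Rightarrow> real)"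
proof -
  have "gauss_kernel = (\<lambda>z::'a. exp (- (1 / 2) * (norm z)\<^sup>2))"
    by (simp add: fun_eq_iff gauss_kernel_def)
  then show ?thesis using integrable_exp_norm_square[of "1 / 2", where ?'a = 'a] by simp
qed

lemma gauss_smooth_shift:
  fixes f :: "'a::euclidean_space \<Rightarrow> real"
  assumes "bdd_meas K f"
  shows "gauss_smooth f (x + h) = (\<integral>y. f (x + y) * gauss_kernel (y - h) \<partial>lborel)"
    "integrable lborel (\<lambda>y. f (x + y) * gauss_kernel (y - h))"
proof -
  have i: "integrable lborel (\<lambda>y. f (x + h + y) * (1 * gauss_kernel y))"
    by (rule gauss_kernel_mult_integrable[OF bdd_meas_shift[OF assms], where c = 1]) auto
  show "integrable lborel (\<lambda>y. f (x + y) * gauss_kernel (y - h))"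
    using integrable_lborel_shift(1)[OF i, of "- h"] by (simp add: add.assoc)
  show "gauss_smooth f (x + h) = (\<integral>y. f (x + y) * gauss_kernel (y - h) \<partial>lborel)"
    using integrable_lborel_shift(2)[OF i, of "- h"] unfolding gauss_smooth_def
    by (simp add: add.assoc)
qed

text \<open>Only the sup norm of \<open>f\<close> enters the remainder, because the derivatives fall on the kernel.\<close>

lemma gauss_smooth_taylor:
  fixes f :: "'a::euclidean_space \<Rightarrow> real"
  assumes f: "bdd_meas K f"
  obtains c0 c1 c2 where "\<And>h. \<bar>gauss_smooth f (x + h) -
      (c0 + (\<Sum>b\<in>Basis. c1 b * (h \<bullet> b)) + (\<Sum>b\<in>Basis. \<Sum>b'\<in>Basis. c2 b b' * ((h \<bullet> b) * (h \<bullet> b'))))\<bar>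
      \<le> K * taylor_const TYPE('a) * norm h ^ 3"
proof -
  define g where "g y = f (x + y)" for y
  have g: "bdd_meas K g" unfolding g_def by (rule bdd_meas_shift[OF f])
  define c0 where "c0 = (\<integral>y. g y * (1 * gauss_kernel y) \<partial>lborel)"
  define c1 where "c1 b = (\<integral>y. g y * ((y \<bullet> b) * gauss_kernel y) \<partial>lborel)" for b
  \<comment> \<open>The quadratic Hermite polynomial of the kernel. The squared norm of
    \<open>h\<close> is written as a double sum with Kronecker deltas, so that both parts become
    coefficients of \<open>(h \<bullet> b) * (h \<bullet> b')\<close>.\<close>
  define c2 where "c2 b b' = (\<integral>y. g y * ((((y \<bullet> b) * (y \<bullet> b') - (if b = b' then 1 else 0)) / 2) * gauss_kernel y) \<partial>lborel)" for b b'
  have nb: "\<bar>y \<bullet> b\<bar> \<le> norm y" if "b \<in> Basis" for y b :: 'a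
    using that by (rule Basis_le_norm)
  have r4: "1 \<le> (1 + norm y) ^ 4" "norm y \<le> (1 + norm y) ^ 4" "(norm y)\<^sup>2 \<le> (1 + norm y) ^ 4" for y :: 'a
  proof -
    show "1 \<le> (1 + norm y) ^ 4" by (rule one_le_power) simp
    show "norm y \<le> (1 + norm y) ^ 4"
      using power_increasing[of 1 4 "1 + norm y"] by simp
    have "(norm y)\<^sup>2 \<le> (1 + norm y)\<^sup>2" by (intro power_mono) auto
    also have "\<dots> \<le> (1 + norm y) ^ 4" by (intro power_increasing) auto
    finally show "(norm y)\<^sup>2 \<le> (1 + norm y) ^ 4" .
  qed
  have i0: "integrable lborel (\<lambda>y. g y * (1 * gauss_kernel y))"
    by (rule gauss_kernel_mult_integrable[OF g, where c = 1]) (use r4 in auto)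
  have i1: "integrable lborel (\<lambda>y. g y * ((y \<bullet> b) * gauss_kernel y))" if "b \<in> Basis" for b
    by (rule gauss_kernel_mult_integrable[OF g, where c = 1]) (use r4 nb[OF that] in \<open>auto intro: order_trans\<close>)
  have i2: "integrable lborel (\<lambda>y. g y * ((((y \<bullet> b) * (y \<bullet> b') - (if b = b' then 1 else 0)) / 2) * gauss_kernel y))"
    if b: "b \<in> Basis" "b' \<in> Basis" for b b'
  proof (rule gauss_kernel_mult_integrable[OF g, where c = 1])
    show "\<bar>((y \<bullet> b) * (y \<bullet> b') - (if b = b' then 1 else 0)) / 2\<bar> \<le> 1 * (1 + norm y) ^ 4" for y
    proof -
      have "\<bar>(y \<bullet> b) * (y \<bullet> b')\<bar> \<le> (norm y)\<^sup>2"
        unfolding abs_mult power2_eq_square using nb[OF b(1)] nb[OF b(2)] by (intro mult_mono) auto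
      then have "\<bar>(y \<bullet> b) * (y \<bullet> b')\<bar> \<le> (1 + norm y) ^ 4" using r4(3)[of y] by linarith
      moreover have "\<bar>(u - d) / 2\<bar> \<le> v" if "\<bar>u\<bar> \<le> v" "1 \<le> v" "d = 0 \<or> d = 1" for u d v :: real
        using that by (auto simp: abs_if field_simps split: if_splits)
      ultimately show ?thesis using r4(1)[of y] by simp
    qed
  qed measurable
  show thesis
  proof (rule that[of c0 c1 c2])
    fix h :: 'a
    let ?T = "\<lambda>y. 1 + y \<bullet> h + ((y \<bullet> h)\<^sup>2 - (norm h)\<^sup>2) / 2"
    have yh: "y \<bullet> h = (\<Sum>b\<in>Basis. (y \<bullet> b) * (h \<bullet> b))" for y by (rule euclidean_inner)
    have hh: "(norm h)\<^sup>2 = (\<Sum>b\<in>Basis. \<Sum>b'\<in>Basis. (if b = b' then 1 else 0) * ((h \<bullet> b) * (h \<bullet> b')))"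
      unfolding power2_norm_eq_inner euclidean_inner[of h h]
      by (intro sum.cong refl) (simp add: if_distrib[of "\<lambda>c. c * _"] cong: if_cong)
    have T: "g y * (gauss_kernel y * ?T y) = g y * (1 * gauss_kernel y) +
        (\<Sum>b\<in>Basis. g y * ((y \<bullet> b) * gauss_kernel y) * (h \<bullet> b)) +
        (\<Sum>b\<in>Basis. \<Sum>b'\<in>Basis. g y * ((((y \<bullet> b) * (y \<bullet> b') - (if b = b' then 1 else 0)) / 2) * gauss_kernel y) * ((h \<bullet> b) * (h \<bullet> b')))" for y
    proof -
      have "(y \<bullet> h)\<^sup>2 = (\<Sum>b\<in>Basis. \<Sum>b'\<in>Basis. ((y \<bullet> b) * (y \<bullet> b')) * ((h \<bullet> b) * (h \<bullet> b')))"
        unfolding power2_eq_square yh sum_product by (simp add: ac_simps)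
      then have "(y \<bullet> h)\<^sup>2 - (norm h)\<^sup>2 = (\<Sum>b\<in>Basis. \<Sum>b'\<in>Basis. ((y \<bullet> b) * (y \<bullet> b') - (if b = b' then 1 else 0)) * ((h \<bullet> b) * (h \<bullet> b')))"
        unfolding hh by (simp add: left_diff_distrib sum_subtractf)
      then show ?thesis
        unfolding yh[of y] by (simp add: distrib_left sum_distrib_left sum_divide_distrib ac_simps)
    qed
    have hT: "has_bochner_integral lborel (\<lambda>y. g y * (gauss_kernel y * ?T y))
        (c0 + (\<Sum>b\<in>Basis. c1 b * (h \<bullet> b)) + (\<Sum>b\<in>Basis. \<Sum>b'\<in>Basis. c2 b b' * ((h \<bullet> b) * (h \<bullet> b'))))"
      unfolding T c0_def c1_def c2_def
      by (intro has_bochner_integral_add has_bochner_integral_sum has_bochner_integral_mult_left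
          has_bochner_integral_integrable i0 i1 i2)
    let ?P = "c0 + (\<Sum>b\<in>Basis. c1 b * (h \<bullet> b)) + (\<Sum>b\<in>Basis. \<Sum>b'\<in>Basis. c2 b b' * ((h \<bullet> b) * (h \<bullet> b')))"
    have iS: "integrable lborel (\<lambda>y. g y * gauss_kernel (y - h))"
      unfolding g_def by (rule gauss_smooth_shift(2)[OF f])
    have "gauss_smooth f (x + h) - ?P = (\<integral>y. g y * gauss_kernel (y - h) - g y * (gauss_kernel y * ?T y) \<partial>lborel)"
      using iS hT gauss_smooth_shift(1)[OF f, of x h] unfolding has_bochner_integral_iff
      by (simp add: g_def)
    also have "\<bar>\<dots>\<bar> \<le> (\<integral>y. K * (norm h ^ 3 * (gauss_majorant y + gauss_kernel (y - h))) \<partial>lborel)"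
    proof (rule integral_abs_bound_integral)
      show "integrable lborel (\<lambda>y. g y * gauss_kernel (y - h) - g y * (gauss_kernel y * ?T y))"
        using iS hT by (intro Bochner_Integration.integrable_diff) (auto simp: has_bochner_integral_iff)
      show "integrable lborel (\<lambda>y. K * (norm h ^ 3 * (gauss_majorant y + gauss_kernel (y - h))))"
        using integrable_lborel_shift(1)[OF gauss_kernel_integrable, of "- h"]
        by (intro integrable_mult_right Bochner_Integration.integrable_add gauss_majorant_integrable) simp
      fix y :: 'a
      have "\<bar>g y * gauss_kernel (y - h) - g y * (gauss_kernel y * ?T y)\<bar> = \<bar>g y\<bar> * \<bar>gauss_kernel (y - h) - gauss_kernel y * ?T y\<bar>"
        by (simp only: abs_mult[symmetric] right_diff_distrib)
      also have "\<dots> \<le> K * (norm h ^ 3 * (gauss_majorant y + gauss_kernel (y - h)))"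
        using g by (intro mult_mono gauss_kernel_taylor) (auto simp: bdd_meas_def intro: order_trans[OF abs_ge_zero])
      finally show "\<bar>g y * gauss_kernel (y - h) - g y * (gauss_kernel y * ?T y)\<bar> \<le> K * (norm h ^ 3 * (gauss_majorant y + gauss_kernel (y - h)))" .
    qed
    also have "\<dots> = K * (norm h ^ 3 * taylor_const TYPE('a))"
    proof -
      have "(\<integral>y. gauss_majorant y + gauss_kernel (- h + y) \<partial>lborel) = taylor_const TYPE('a)"
        unfolding taylor_const_def
        using Bochner_Integration.integral_add[OF gauss_majorant_integrable integrable_lborel_shift(1)[OF gauss_kernel_integrable, of "- h"]]
          integrable_lborel_shift(2)[OF gauss_kernel_integrable, of "- h"] by simp
      then show ?thesis by simp
    qed
    finally show "\<bar>gauss_smooth f (x + h) - ?P\<bar> \<le> K * taylor_const TYPE('a) * norm h ^ 3"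
      by (simp add: ac_simps)
  qed
qed

lemma taylor_const_nonneg: "0 \<le> taylor_const TYPE('a::euclidean_space)"
  unfolding taylor_const_def
  by (intro add_nonneg_nonneg integral_nonneg_AE AE_I2) (auto simp: gauss_majorant_def gauss_kernel_def)

section \<open>Comparing two laws with equal first and second moments\<close>

definition same_moments :: "'a::euclidean_space measure \<Rightarrow> 'a measure \<Rightarrow> bool" where
  "same_moments \<mu> \<mu>' \<longleftrightarrow> (\<forall>\<theta>. (\<integral>h. h \<bullet> \<theta> \<partial>\<mu>) = (\<integral>h. h \<bullet> \<theta> \<partial>\<mu>') \<and>
     (\<integral>h. (h \<bullet> \<theta>)\<^sup>2 \<partial>\<mu>) = (\<integral>h. (h \<bullet> \<theta>)\<^sup>2 \<partial>\<mu>'))"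

lemma integrable_of_third_moment:
  fixes \<mu> :: "'a::euclidean_space measure"
  assumes \<mu>: "borel_prob \<mu>" and i3: "integrable \<mu> (\<lambda>h. norm h ^ 3)"
    and f: "f \<in> borel_measurable borel" "\<And>h. \<bar>f h\<bar> \<le> c * (1 + norm h ^ 3)"
  shows "integrable \<mu> (f :: 'a \<Rightarrow> real)"
proof (rule Bochner_Integration.integrable_bound)
  interpret prob_space \<mu> using \<mu> by (simp add: borel_prob_def)
  show "integrable \<mu> (\<lambda>h. c * (1 + norm h ^ 3))" using i3 by simp
  show "f \<in> borel_measurable \<mu>" using borel_prob_measurable[OF \<mu> f(1)] .
  show "AE x in \<mu>. norm (f x) \<le> norm (c * (1 + norm x ^ 3))"
    using f(2) by (intro AE_I2) (simp add: order_trans[OF _ abs_ge_self])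
qed

lemma power_le_one_plus_cube:
  fixes r :: real
  assumes "0 \<le> r"
  shows "r \<le> 1 + r ^ 3" "r\<^sup>2 \<le> 1 + r ^ 3"
proof -
  show "r \<le> 1 + r ^ 3"
    using assms power_increasing[of 1 3 r] zero_le_power[of r 3] unfolding power_one_right
    by (cases "r \<le> 1") (linarith, simp)
  show "r\<^sup>2 \<le> 1 + r ^ 3"
  proof (cases "r \<le> 1")
    case True
    then have "r\<^sup>2 \<le> 1" using assms by (rule power_le_one[rotated])
    then show ?thesis using zero_le_power[OF assms, of 3] by linarith
  next
    case False
    then have "r\<^sup>2 \<le> r ^ 3" by (intro power_increasing) auto
    then show ?thesis by simp
  qed
qed

lemma moment_integrable:
  fixes \<mu> :: "'a::euclidean_space measure"
  assumes \<mu>: "borel_prob \<mu>" and i3: "integrable \<mu> (\<lambda>h. norm h ^ 3)"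
  shows "integrable \<mu> (\<lambda>h. h \<bullet> \<theta>)" "integrable \<mu> (\<lambda>h. (h \<bullet> \<theta>) * (h \<bullet> \<theta>'))"
proof -
  have b: "\<bar>h \<bullet> \<theta>\<bar> \<le> norm \<theta> * (1 + norm h ^ 3)" for h \<theta> :: 'a
  proof -
    have "\<bar>h \<bullet> \<theta>\<bar> \<le> norm h * norm \<theta>" by (rule Cauchy_Schwarz_ineq2)
    also have "\<dots> \<le> (1 + norm h ^ 3) * norm \<theta>" by (intro mult_right_mono power_le_one_plus_cube) auto
    finally show ?thesis by (simp add: mult.commute)
  qed
  show "integrable \<mu> (\<lambda>h. h \<bullet> \<theta>)"
    by (rule integrable_of_third_moment[OF \<mu> i3 _ b]) measurable
  show "integrable \<mu> (\<lambda>h. (h \<bullet> \<theta>) * (h \<bullet> \<theta>'))"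
  proof (rule integrable_of_third_moment[OF \<mu> i3])
    fix h :: 'a
    have "\<bar>(h \<bullet> \<theta>) * (h \<bullet> \<theta>')\<bar> \<le> (norm h * norm \<theta>) * (norm h * norm \<theta>')"
      unfolding abs_mult by (intro mult_mono Cauchy_Schwarz_ineq2) auto
    also have "\<dots> = (norm \<theta> * norm \<theta>') * (norm h)\<^sup>2" by (simp add: power2_eq_square)
    also have "\<dots> \<le> (norm \<theta> * norm \<theta>') * (1 + norm h ^ 3)"
      by (intro mult_left_mono power_le_one_plus_cube) auto
    finally show "\<bar>(h \<bullet> \<theta>) * (h \<bullet> \<theta>')\<bar> \<le> (norm \<theta> * norm \<theta>') * (1 + norm h ^ 3)" .
  qed measurable
qed

text \<open>Polarisation. Moments are matched along single directions because Brownian increments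
  are specified by their one-dimensional projections.\<close>

lemma same_moments_mixed:
  fixes \<mu> \<mu>' :: "'a::euclidean_space measure"
  assumes \<mu>: "borel_prob \<mu>" "integrable \<mu> (\<lambda>h. norm h ^ 3)"
    and \<mu>': "borel_prob \<mu>'" "integrable \<mu>' (\<lambda>h. norm h ^ 3)" and s: "same_moments \<mu> \<mu>'"
  shows "(\<integral>h. (h \<bullet> \<theta>) * (h \<bullet> \<theta>') \<partial>\<mu>) = (\<integral>h. (h \<bullet> \<theta>) * (h \<bullet> \<theta>') \<partial>\<mu>')"
proof -
  have "(\<integral>h. (h \<bullet> (\<theta> + \<theta>'))\<^sup>2 \<partial>\<mu>) = (\<integral>h. (h \<bullet> \<theta>)\<^sup>2 \<partial>\<mu>) + 2 * (\<integral>h. (h \<bullet> \<theta>) * (h \<bullet> \<theta>') \<partial>\<mu>) + (\<integral>h. (h \<bullet> \<theta>')\<^sup>2 \<partial>\<mu>)"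
    if \<mu>: "borel_prob \<mu>" "integrable \<mu> (\<lambda>h. norm h ^ 3)" for \<mu> :: "'a measure"
  proof -
    have e: "(h \<bullet> (\<theta> + \<theta>'))\<^sup>2 = (h \<bullet> \<theta>) * (h \<bullet> \<theta>) + 2 * ((h \<bullet> \<theta>) * (h \<bullet> \<theta>')) + (h \<bullet> \<theta>') * (h \<bullet> \<theta>')" for h
      by (simp add: inner_add_right power2_eq_square algebra_simps)
    note m = moment_integrable(2)[OF \<mu>]
    show ?thesis unfolding e
      by (subst Bochner_Integration.integral_add, intro Bochner_Integration.integrable_add integrable_mult_right m, rule m,
          subst Bochner_Integration.integral_add, rule m, intro integrable_mult_right m)
        (simp add: power2_eq_square)
  qed
  from this[OF \<mu>] this[OF \<mu>'] show ?thesis using s unfolding same_moments_def by simp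
qed

lemma gauss_smooth_measurable:
  assumes [measurable]: "f \<in> borel_measurable borel"
  shows "gauss_smooth f \<in> borel_measurable borel"
  unfolding gauss_smooth_def[abs_def] by measurable

text \<open>One Lindeberg replacement: both averages equal that of the same quadratic polynomial
  \<open>P\<close> up to the cubic Taylor remainder, and the averages of \<open>P\<close> agree by
  the moment conditions.\<close>

lemma step_gauss_smooth_compare:
  fixes f :: "'a::euclidean_space \<Rightarrow> real"
  assumes f: "bdd_meas K f"
    and \<mu>: "borel_prob \<mu>" "integrable \<mu> (\<lambda>h. norm h ^ 3)"
    and \<mu>': "borel_prob \<mu>'" "integrable \<mu>' (\<lambda>h. norm h ^ 3)" and s: "same_moments \<mu> \<mu>'"
  shows "\<bar>step \<mu> (gauss_smooth f) x - step \<mu>' (gauss_smooth f) x\<bar>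
    \<le> K * taylor_const TYPE('a) * ((\<integral>h. norm h ^ 3 \<partial>\<mu>) + (\<integral>h. norm h ^ 3 \<partial>\<mu>'))"
proof -
  obtain c0 c1 c2 where P: "\<And>h. \<bar>gauss_smooth f (x + h) -
      (c0 + (\<Sum>b\<in>Basis. c1 b * (h \<bullet> b)) + (\<Sum>b\<in>Basis. \<Sum>b'\<in>Basis. c2 b b' * ((h \<bullet> b) * (h \<bullet> b'))))\<bar>
      \<le> K * taylor_const TYPE('a) * norm h ^ 3"
    using gauss_smooth_taylor[OF f, of x] by blast
  define P where "P h = c0 + (\<Sum>b\<in>Basis. c1 b * (h \<bullet> b)) + (\<Sum>b\<in>Basis. \<Sum>b'\<in>Basis. c2 b b' * ((h \<bullet> b) * (h \<bullet> b')))" for h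
  define M where "M = K * taylor_const TYPE('a)"
  have P': "\<bar>gauss_smooth f (x + h) - P h\<bar> \<le> M * norm h ^ 3" for h
    using P[of h] by (simp add: P_def M_def)
  have one: "\<bar>step \<mu> (gauss_smooth f) x - integral\<^sup>L \<mu> P\<bar> \<le> M * (\<integral>h. norm h ^ 3 \<partial>\<mu>) \<and>
      integral\<^sup>L \<mu> P = c0 + (\<Sum>b\<in>Basis. c1 b * (\<integral>h. h \<bullet> b \<partial>\<mu>)) +
        (\<Sum>b\<in>Basis. \<Sum>b'\<in>Basis. c2 b b' * (\<integral>h. (h \<bullet> b) * (h \<bullet> b') \<partial>\<mu>))"
    if \<mu>: "borel_prob \<mu>" "integrable \<mu> (\<lambda>h. norm h ^ 3)" for \<mu>
  proof -
    interpret prob_space \<mu> using \<mu> by (simp add: borel_prob_def)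
    have c: "has_bochner_integral \<mu> (\<lambda>_. c0) c0" by (simp add: has_bochner_integral_iff prob_space)
    have hP: "has_bochner_integral \<mu> P (c0 + (\<Sum>b\<in>Basis. c1 b * (\<integral>h. h \<bullet> b \<partial>\<mu>)) +
        (\<Sum>b\<in>Basis. \<Sum>b'\<in>Basis. c2 b b' * (\<integral>h. (h \<bullet> b) * (h \<bullet> b') \<partial>\<mu>)))"
      unfolding P_def
      by (intro has_bochner_integral_add has_bochner_integral_sum has_bochner_integral_mult_right
          has_bochner_integral_integrable c moment_integrable[OF \<mu>])
    have m: "(\<lambda>h. gauss_smooth f (x + h) - P h) \<in> borel_measurable borel"
    proof -
      note gauss_smooth_measurable[measurable]
      have [measurable]: "f \<in> borel_measurable borel" using f by (simp add: bdd_meas_def)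
      show ?thesis unfolding P_def by measurable
    qed
    have iD: "integrable \<mu> (\<lambda>h. gauss_smooth f (x + h) - P h)"
    proof (rule integrable_of_third_moment[OF \<mu> m])
      have "0 \<le> M" using f taylor_const_nonneg[where ?'a = 'a]
        unfolding M_def bdd_meas_def by (auto intro!: mult_nonneg_nonneg intro: order_trans[OF abs_ge_zero])
      then show "\<bar>gauss_smooth f (x + h) - P h\<bar> \<le> M * (1 + norm h ^ 3)" for h
        using P'[of h] by (simp add: distrib_left)
    qed
    have iF: "integrable \<mu> (\<lambda>h. gauss_smooth f (x + h))"
      using Bochner_Integration.integrable_add[OF iD integrable.intros[OF hP]] by simp
    have "step \<mu> (gauss_smooth f) x - integral\<^sup>L \<mu> P = (\<integral>h. gauss_smooth f (x + h) - P h \<partial>\<mu>)"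
      unfolding step_def using iF integrable.intros[OF hP] by simp
    also have "\<bar>\<dots>\<bar> \<le> (\<integral>h. M * norm h ^ 3 \<partial>\<mu>)"
      by (rule integral_abs_bound_integral[OF iD _ P']) (use \<mu> in simp)
    finally show ?thesis using has_bochner_integral_integral_eq[OF hP] by simp
  qed
  have "integral\<^sup>L \<mu> P = integral\<^sup>L \<mu>' P"
    using one[OF \<mu>] one[OF \<mu>'] same_moments_mixed[OF \<mu> \<mu>' s] s by (simp add: same_moments_def)
  then show ?thesis using one[OF \<mu>] one[OF \<mu>'] unfolding M_def distrib_left by linarith
qed

section \<open>The smoothing law at scale \<open>\<epsilon>\<close>\<close>

definition gauss_law :: "real \<Rightarrow> 'a::euclidean_space measure" where
  "gauss_law \<epsilon> = distr (density lborel (\<lambda>z. ennreal (gauss_kernel z / (\<integral>z. gauss_kernel (z :: 'a) \<partial>lborel)))) borel (\<lambda>z. \<epsilon> *\<^sub>R z)"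

lemma gauss_mass_pos: "0 < (\<integral>z. gauss_kernel (z :: 'a::euclidean_space) \<partial>lborel)"
proof -
  have iff: "(\<integral>z. gauss_kernel (z :: 'a) \<partial>lborel) = 0 \<longleftrightarrow> (AE z in lborel. gauss_kernel (z :: 'a) = 0)"
    by (rule integral_nonneg_eq_0_iff_AE[OF gauss_kernel_integrable AE_I2[OF less_imp_le[OF gauss_kernel_pos]]])
  have "(\<integral>z. gauss_kernel (z :: 'a) \<partial>lborel) \<noteq> 0"
  proof
    assume "(\<integral>z. gauss_kernel (z :: 'a) \<partial>lborel) = 0"
    then have "AE z in lborel. gauss_kernel (z :: 'a) = 0"
      unfolding iff .
    then have "AE z in (lborel :: 'a measure). False"
    proof eventually_elim
      case (elim z)
      then show False using gauss_kernel_pos[of z] by simp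
    qed
    then show False by (simp add: AE_iff_measurable[OF _ refl])
  qed
  moreover have "0 \<le> (\<integral>z. gauss_kernel (z :: 'a) \<partial>lborel)"
    by (intro integral_nonneg_AE AE_I2 less_imp_le gauss_kernel_pos)
  ultimately show ?thesis by simp
qed

lemma gauss_density_prob:
  "prob_space (density lborel (\<lambda>z. ennreal (gauss_kernel (z :: 'a::euclidean_space) / (\<integral>z. gauss_kernel (z :: 'a) \<partial>lborel))))"
proof (rule prob_spaceI)
  let ?I = "\<integral>z. gauss_kernel (z :: 'a) \<partial>lborel"
  have "(\<integral>\<^sup>+z. ennreal (gauss_kernel (z :: 'a) / ?I) \<partial>lborel) = ennreal (\<integral>z. gauss_kernel (z :: 'a) / ?I \<partial>lborel)"
    using gauss_mass_pos[where ?'a = 'a] less_imp_le[OF gauss_kernel_pos]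
    by (intro nn_integral_eq_integral AE_I2 divide_nonneg_pos integrable_divide gauss_kernel_integrable) auto
  also have "\<dots> = 1" using gauss_mass_pos[where ?'a = 'a] by simp
  finally show "emeasure (density lborel (\<lambda>z. ennreal (gauss_kernel (z :: 'a) / ?I)))
      (space (density lborel (\<lambda>z. ennreal (gauss_kernel (z :: 'a) / ?I)))) = 1"
    by (simp add: emeasure_density)
qed

lemma gauss_law_prob: "borel_prob (gauss_law \<epsilon> :: 'a::euclidean_space measure)"
  unfolding gauss_law_def by (rule borel_prob_distr[OF gauss_density_prob]) measurable

lemma step_gauss_law:
  fixes f :: "'a::euclidean_space \<Rightarrow> real"
  assumes [measurable]: "f \<in> borel_measurable borel"
  shows "step (gauss_law \<epsilon>) f x = (\<integral>z. f (x + \<epsilon> *\<^sub>R z) * gauss_kernel z \<partial>lborel) / (\<integral>z. gauss_kernel (z :: 'a) \<partial>lborel)"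
  unfolding step_def gauss_law_def
  by (subst integral_distr, measurable, subst integral_density)
    (use gauss_mass_pos[where ?'a = 'a] less_imp_le[OF gauss_kernel_pos] in
      \<open>auto simp: mult.commute intro!: AE_I2 divide_nonneg_pos\<close>)

lemma step_gauss_law_smooth:
  fixes f :: "'a::euclidean_space \<Rightarrow> real"
  assumes "f \<in> borel_measurable borel" "0 < \<epsilon>"
  shows "step (gauss_law \<epsilon>) f x =
    gauss_smooth (\<lambda>y. f (\<epsilon> *\<^sub>R y)) (x /\<^sub>R \<epsilon>) / (\<integral>z. gauss_kernel (z :: 'a) \<partial>lborel)"
  using assms by (simp add: step_gauss_law gauss_smooth_def scaleR_add_right)

definition third_moment :: "'a::euclidean_space measure \<Rightarrow> real" where
  "third_moment \<mu> = (\<integral>h. norm h ^ 3 \<partial>\<mu>)"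

lemma scaled_measure:
  fixes \<mu> :: "'a::euclidean_space measure" and c :: real
  assumes \<mu>: "borel_prob \<mu>"
  defines "\<mu>' \<equiv> distr \<mu> borel (\<lambda>h. h /\<^sub>R c)"
  shows "borel_prob \<mu>'"
    and "integrable \<mu> (\<lambda>h. norm h ^ 3) \<Longrightarrow> integrable \<mu>' (\<lambda>h. norm h ^ 3)"
    and "0 < c \<Longrightarrow> third_moment \<mu>' = third_moment \<mu> / c ^ 3"
    and "(\<integral>h. h \<bullet> \<theta> \<partial>\<mu>') = (\<integral>h. h \<bullet> \<theta> \<partial>\<mu>) / c"
    and "(\<integral>h. (h \<bullet> \<theta>)\<^sup>2 \<partial>\<mu>') = (\<integral>h. (h \<bullet> \<theta>)\<^sup>2 \<partial>\<mu>) / c\<^sup>2"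
    and "f \<in> borel_measurable borel \<Longrightarrow> step \<mu>' f x = (\<integral>h. f (x + h /\<^sub>R c) \<partial>\<mu>)"
proof -
  have [measurable_cong]: "sets \<mu> = sets borel" using \<mu> by (simp add: borel_prob_def)
  show "borel_prob \<mu>'" unfolding \<mu>'_def by (rule borel_prob_distr) (use \<mu> in \<open>auto simp: borel_prob_def\<close>)
  have n: "norm (h /\<^sub>R c) ^ 3 = norm h ^ 3 * (inverse \<bar>c\<bar>) ^ 3" for h :: 'a
    by (simp add: power_mult_distrib)
  show "integrable \<mu>' (\<lambda>h. norm h ^ 3)" if "integrable \<mu> (\<lambda>h. norm h ^ 3)"
    unfolding \<mu>'_def by (subst integrable_distr_eq, measurable) (use that in \<open>simp add: n del: norm_scaleR\<close>)
  show "third_moment \<mu>' = third_moment \<mu> / c ^ 3" if "0 < c"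
    unfolding \<mu>'_def third_moment_def
    by (subst integral_distr, measurable) (use that in \<open>simp add: n power_inverse divide_inverse del: norm_scaleR\<close>)
  show "(\<integral>h. h \<bullet> \<theta> \<partial>\<mu>') = (\<integral>h. h \<bullet> \<theta> \<partial>\<mu>) / c"
    unfolding \<mu>'_def by (subst integral_distr, measurable) (simp add: divide_inverse)
  show "(\<integral>h. (h \<bullet> \<theta>)\<^sup>2 \<partial>\<mu>') = (\<integral>h. (h \<bullet> \<theta>)\<^sup>2 \<partial>\<mu>) / c\<^sup>2"
    unfolding \<mu>'_def by (subst integral_distr, measurable) (simp add: power_mult_distrib divide_inverse power_inverse)
  show "step \<mu>' f x = (\<integral>h. f (x + h /\<^sub>R c) \<partial>\<mu>)" if [measurable]: "f \<in> borel_measurable borel"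
    unfolding \<mu>'_def step_def by (subst integral_distr, measurable)
qed

text \<open>Dividing space by \<open>\<epsilon>\<close> reduces this to smoothing at unit scale;
  third moments are thereby divided by \<open>\<epsilon> ^ 3\<close>, while the bound
  \<open>K\<close> is unchanged.\<close>

lemma step_gauss_law_compare:
  fixes f :: "'a::euclidean_space \<Rightarrow> real"
  assumes f: "bdd_meas K f" and \<epsilon>: "0 < \<epsilon>"
    and \<mu>: "borel_prob \<mu>" "integrable \<mu> (\<lambda>h. norm h ^ 3)"
    and \<mu>': "borel_prob \<mu>'" "integrable \<mu>' (\<lambda>h. norm h ^ 3)" and s: "same_moments \<mu> \<mu>'"
  shows "\<bar>step \<mu> (step (gauss_law \<epsilon>) f) x - step \<mu>' (step (gauss_law \<epsilon>) f) x\<bar>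
    \<le> K * (taylor_const TYPE('a) / (\<integral>z. gauss_kernel (z :: 'a) \<partial>lborel)) * (third_moment \<mu> + third_moment \<mu>') / \<epsilon> ^ 3"
proof -
  let ?I = "\<integral>z. gauss_kernel (z :: 'a) \<partial>lborel"
  have I: "0 < ?I" by (rule gauss_mass_pos)
  have fm: "f \<in> borel_measurable borel" using f by (simp add: bdd_meas_def)
  define g where "g y = f (\<epsilon> *\<^sub>R y)" for y
  have g: "bdd_meas K g"
  proof -
    have "g \<in> borel_measurable borel" unfolding g_def using fm by measurable
    then show ?thesis using f by (simp add: bdd_meas_def g_def)
  qed
  have gm: "gauss_smooth g \<in> borel_measurable borel"
    by (rule gauss_smooth_measurable) (use g in \<open>simp add: bdd_meas_def\<close>)
  define S where "S \<mu> = distr \<mu> borel (\<lambda>h. h /\<^sub>R \<epsilon>)" for \<mu> :: "'a measure"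
  have eq: "step \<mu> (step (gauss_law \<epsilon>) f) x = step (S \<mu>) (gauss_smooth g) (x /\<^sub>R \<epsilon>) / ?I" if \<mu>: "borel_prob \<mu>" for \<mu>
  proof -
    have "step \<mu> (step (gauss_law \<epsilon>) f) x = (\<integral>h. gauss_smooth g ((x + h) /\<^sub>R \<epsilon>) / ?I \<partial>\<mu>)"
      unfolding step_def[of \<mu>] step_gauss_law_smooth[OF fm \<epsilon>] g_def[abs_def] ..
    also have "\<dots> = step (S \<mu>) (gauss_smooth g) (x /\<^sub>R \<epsilon>) / ?I"
      unfolding S_def scaled_measure(6)[OF \<mu> gm] by (simp add: scaleR_add_right)
    finally show ?thesis .
  qed
  have sm: "same_moments (S \<mu>) (S \<mu>')"
    using s unfolding same_moments_def S_def scaled_measure(4)[OF \<mu>(1)] scaled_measure(4)[OF \<mu>'(1)]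
      scaled_measure(5)[OF \<mu>(1)] scaled_measure(5)[OF \<mu>'(1)] by simp
  have "\<bar>step (S \<mu>) (gauss_smooth g) (x /\<^sub>R \<epsilon>) - step (S \<mu>') (gauss_smooth g) (x /\<^sub>R \<epsilon>)\<bar>
      \<le> K * taylor_const TYPE('a) * (third_moment (S \<mu>) + third_moment (S \<mu>'))"
    unfolding third_moment_def
    by (rule step_gauss_smooth_compare[OF g _ _ _ _ sm])
      (use scaled_measure(1,2) \<mu> \<mu>' in \<open>auto simp: S_def\<close>)
  also have "\<dots> = K * taylor_const TYPE('a) * ((third_moment \<mu> + third_moment \<mu>') / \<epsilon> ^ 3)"
    unfolding S_def using scaled_measure(3)[OF \<mu>(1) \<epsilon>] scaled_measure(3)[OF \<mu>'(1) \<epsilon>] by (simp add: add_divide_distrib)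
  finally have "\<bar>step (S \<mu>) (gauss_smooth g) (x /\<^sub>R \<epsilon>) - step (S \<mu>') (gauss_smooth g) (x /\<^sub>R \<epsilon>)\<bar> / ?I
      \<le> K * taylor_const TYPE('a) * ((third_moment \<mu> + third_moment \<mu>') / \<epsilon> ^ 3) / ?I"
    using I by (intro divide_right_mono) auto
  then show ?thesis unfolding eq[OF \<mu>(1)] eq[OF \<mu>'(1)] diff_divide_distrib[symmetric] abs_divide
    using I by (simp add: mult.commute)
qed

definition gauss_first :: "'a::euclidean_space itself \<Rightarrow> real" where
  "gauss_first _ = (\<integral>z. norm (z :: 'a) * gauss_kernel z \<partial>lborel) / (\<integral>z. gauss_kernel (z :: 'a) \<partial>lborel)"

lemma step_gauss_law_close:
  fixes f :: "'a::euclidean_space \<Rightarrow> real"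
  assumes f: "bdd_meas K f" "lip L f" and \<epsilon>: "0 < \<epsilon>"
  shows "\<bar>step (gauss_law \<epsilon>) f x - f x\<bar> \<le> L * \<epsilon> * gauss_first TYPE('a)"
proof -
  let ?I = "\<integral>z. gauss_kernel (z :: 'a) \<partial>lborel"
  have I: "0 < ?I" by (rule gauss_mass_pos)
  have fm: "f \<in> borel_measurable borel" using f by (simp add: bdd_meas_def)
  have g: "bdd_meas K (\<lambda>y. f (x + \<epsilon> *\<^sub>R y))"
    using f fm by (auto simp: bdd_meas_def)
  have i1: "integrable lborel (\<lambda>z. f (x + \<epsilon> *\<^sub>R z) * gauss_kernel z)"
    using gauss_kernel_mult_integrable[OF g, of "\<lambda>_. 1" 1] by simp
  have i2: "integrable lborel (\<lambda>z::'a. norm z * gauss_kernel z)"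
  proof -
    have "norm y \<le> (1 + norm y) ^ 4" for y :: 'a
      using power_increasing[of 1 4 "1 + norm y"] by simp
    then have "integrable lborel (\<lambda>z::'a. 1 * (norm z * gauss_kernel z))"
      by (intro gauss_kernel_mult_integrable[where K = 1 and c = 1]) (auto simp: bdd_meas_def)
    then show ?thesis by simp
  qed
  have "step (gauss_law \<epsilon>) f x - f x = ((\<integral>z. f (x + \<epsilon> *\<^sub>R z) * gauss_kernel z \<partial>lborel) - f x * ?I) / ?I"
    using I by (simp add: step_gauss_law[OF fm] diff_divide_distrib)
  also have "(\<integral>z. f (x + \<epsilon> *\<^sub>R z) * gauss_kernel z \<partial>lborel) - f x * ?I =
      (\<integral>z. (f (x + \<epsilon> *\<^sub>R z) - f x) * gauss_kernel z \<partial>lborel)"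
    using Bochner_Integration.integral_diff[OF i1 integrable_mult_right[OF gauss_kernel_integrable, of "f x"]]
    by (simp add: left_diff_distrib)
  finally have "\<bar>step (gauss_law \<epsilon>) f x - f x\<bar> = \<bar>\<integral>z. (f (x + \<epsilon> *\<^sub>R z) - f x) * gauss_kernel z \<partial>lborel\<bar> / ?I"
    using I by (simp add: abs_divide)
  also have "\<bar>\<integral>z. (f (x + \<epsilon> *\<^sub>R z) - f x) * gauss_kernel z \<partial>lborel\<bar> \<le> (\<integral>z. (L * \<epsilon>) * (norm (z :: 'a) * gauss_kernel z) \<partial>lborel)"
  proof (rule integral_abs_bound_integral)
    show "integrable lborel (\<lambda>z. (f (x + \<epsilon> *\<^sub>R z) - f x) * gauss_kernel z)"
      unfolding left_diff_distrib
      by (intro Bochner_Integration.integrable_diff i1 integrable_mult_right gauss_kernel_integrable)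
    show "integrable lborel (\<lambda>z::'a. (L * \<epsilon>) * (norm z * gauss_kernel z))" by (intro integrable_mult_right i2)
    fix z :: 'a
    have "\<bar>f (x + \<epsilon> *\<^sub>R z) - f x\<bar> \<le> L * norm ((x + \<epsilon> *\<^sub>R z) - x)"
      using f(2) unfolding lip_def by blast
    then show "\<bar>(f (x + \<epsilon> *\<^sub>R z) - f x) * gauss_kernel z\<bar> \<le> (L * \<epsilon>) * (norm z * gauss_kernel z)"
      using gauss_kernel_pos[of z] \<epsilon> by (simp add: abs_mult mult.assoc[symmetric])
  qed
  finally show ?thesis using I by (simp add: gauss_first_def divide_right_mono)
qed

text \<open>Jumps are replaced one at a time. The laws \<open>m j\<close> may vary with
  \<open>j\<close>, so the other side is given by a sequence \<open>P\<close> of total increments.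
  As smoothing commutes with averaging over \<open>P j\<close>, every replacement acts on a smoothed
  function with the original bound \<open>K\<close>.\<close>

lemma lindeberg_iteration:
  fixes g :: "'a::euclidean_space \<Rightarrow> real"
  assumes A: "borel_prob A" "integrable A (\<lambda>h. norm h ^ 3)"
    and m: "\<And>j. borel_prob (m j)" "\<And>j. integrable (m j) (\<lambda>h. norm h ^ 3)" "\<And>j. third_moment (m j) \<le> c"
    and sm: "\<And>j. same_moments A (m j)"
    and P: "\<And>j. borel_prob (P j)" "\<And>f x. bdd_meas K f \<Longrightarrow> step (P 0) f x = f x"
      "\<And>j f x. bdd_meas K f \<Longrightarrow> step (P (Suc j)) f x = step (m j) (step (P j) f) x"
    and g: "bdd_meas K g" and \<epsilon>: "0 < \<epsilon>"
  shows "\<bar>(step A ^^ j) (step (gauss_law \<epsilon>) g) x - step (P j) (step (gauss_law \<epsilon>) g) x\<bar>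
    \<le> real j * (K * (taylor_const TYPE('a) / (\<integral>z. gauss_kernel (z :: 'a) \<partial>lborel)) * (third_moment A + c) / \<epsilon> ^ 3)"
proof (induction j arbitrary: x)
  case 0
  show ?case using P(2)[OF step_bdd_meas[OF g gauss_law_prob]] by simp
next
  case (Suc j)
  let ?S = "step (gauss_law \<epsilon>)" and ?I = "\<integral>z. gauss_kernel (z :: 'a) \<partial>lborel"
  let ?b = "K * (taylor_const TYPE('a) / ?I) * (third_moment A + c) / \<epsilon> ^ 3"
  have K0: "0 \<le> K" using g by (auto simp: bdd_meas_def intro: order_trans[OF abs_ge_zero])
  have Sg: "bdd_meas K (?S g)" by (rule step_bdd_meas[OF g gauss_law_prob])
  have 1: "\<bar>step A ((step A ^^ j) (?S g)) x - step A (step (P j) (?S g)) x\<bar> \<le> real j * ?b"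
    by (rule step_diff_le[OF step_pow_bdd_meas[OF Sg A(1)] step_bdd_meas[OF Sg P(1)] A(1) Suc])
  have comm: "step (P j) (?S g) = ?S (step (P j) g)"
    using step_commute[OF g P(1) gauss_law_prob] by auto
  have "\<bar>step A (?S (step (P j) g)) x - step (m j) (?S (step (P j) g)) x\<bar> \<le>
      K * (taylor_const TYPE('a) / ?I) * (third_moment A + third_moment (m j)) / \<epsilon> ^ 3"
    by (rule step_gauss_law_compare[OF step_bdd_meas[OF g P(1)] \<epsilon> A m(1,2) sm])
  also have "\<dots> \<le> ?b"
    using m(3)[of j] K0 \<epsilon> taylor_const_nonneg[where ?'a = 'a] gauss_mass_pos[where ?'a = 'a]
    by (intro divide_right_mono mult_left_mono mult_nonneg_nonneg) auto
  finally have 2: "\<bar>step A (step (P j) (?S g)) x - step (P (Suc j)) (?S g) x\<bar> \<le> ?b"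
    unfolding P(3)[OF Sg] comm .
  have "\<bar>(step A ^^ Suc j) (?S g) x - step (P (Suc j)) (?S g) x\<bar> \<le> real j * ?b + ?b"
    using 1 2 by simp
  also have "\<dots> = real (Suc j) * ?b" by (simp only: of_nat_Suc distrib_right mult_1_left add.commute)
  finally show ?case .
qed

section \<open>Brownian motion as the limit of scaled jumps\<close>

lemma centred_normal_moments:
  assumes "0 \<le> v"
  shows "prob_space (centred_normal v)" "sets (centred_normal v) = sets borel"
    "integrable (centred_normal v) (\<lambda>x. \<bar>x\<bar> ^ 3)" "(\<integral>x. \<bar>x\<bar> ^ 3 \<partial>centred_normal v) \<le> 2 * sqrt v ^ 3"
    "integrable (centred_normal v) (\<lambda>x. \<bar>x\<bar>)" "(\<integral>x. \<bar>x\<bar> \<partial>centred_normal v) \<le> sqrt v"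
    "(\<integral>x. x \<partial>centred_normal v) = 0" "(\<integral>x. x\<^sup>2 \<partial>centred_normal v) = v"
proof -
  have "prob_space (centred_normal v) \<and> sets (centred_normal v) = sets borel \<and>
    integrable (centred_normal v) (\<lambda>x. \<bar>x\<bar> ^ 3) \<and> (\<integral>x. \<bar>x\<bar> ^ 3 \<partial>centred_normal v) \<le> 2 * sqrt v ^ 3 \<and>
    integrable (centred_normal v) (\<lambda>x. \<bar>x\<bar>) \<and> (\<integral>x. \<bar>x\<bar> \<partial>centred_normal v) \<le> sqrt v \<and>
    (\<integral>x. x \<partial>centred_normal v) = 0 \<and> (\<integral>x. x\<^sup>2 \<partial>centred_normal v) = v"
  proof (cases "v = 0")
    case True
    interpret prob_space "return borel (0::real)" by (rule prob_space_return) simp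
    have r: "integrable (return borel (0::real)) f \<and> (\<integral>x. f x \<partial>return borel 0) = f 0"
      if [measurable]: "f \<in> borel_measurable borel" for f :: "real \<Rightarrow> real"
    proof -
      have "AE x in return borel (0::real). f x = f 0" by (simp add: AE_return)
      then show ?thesis
        using integral_return[of 0 borel f] integrable_cong_AE[of f "return borel 0" "\<lambda>_. f 0"] by simp
    qed
    show ?thesis using True r[of "\<lambda>x. \<bar>x\<bar> ^ 3"] r[of abs] r[of "\<lambda>x. x"] r[of "\<lambda>x. x\<^sup>2"]
      by (simp add: centred_normal_def prob_space_axioms)
  next
    case False
    define \<sigma> where "\<sigma> = sqrt v"
    have s: "0 < \<sigma>" "\<sigma>\<^sup>2 = v" using False assms by (auto simp: \<sigma>_def)
    have cn: "centred_normal v = density lborel (normal_density 0 \<sigma>)"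
      using False by (simp add: centred_normal_def \<sigma>_def)
    have tr: "has_bochner_integral (centred_normal v) f c"
      if "has_bochner_integral lborel (\<lambda>x. normal_density 0 \<sigma> x * f x) c" "f \<in> borel_measurable borel" for f :: "real \<Rightarrow> real" and c
      unfolding cn using that by (intro has_bochner_integral_density) (auto simp: normal_density_nonneg)
    have p2: "sqrt (2 / pi) \<le> 1" using pi_ge_two by simp
    have 3: "has_bochner_integral (centred_normal v) (\<lambda>x. \<bar>x\<bar> ^ 3) (2 * \<sigma> ^ 3 * sqrt (2 / pi))"
      using normal_moment_abs_odd[OF s(1), of 0 1] by (intro tr) (simp_all add: eval_nat_numeral)
    have 1: "has_bochner_integral (centred_normal v) (\<lambda>x. \<bar>x\<bar>) (\<sigma> * sqrt (2 / pi))"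
      using normal_moment_abs_odd[OF s(1), of 0 0] by (intro tr) simp_all
    have 0: "has_bochner_integral (centred_normal v) (\<lambda>x. x) 0"
      using normal_moment_nz_1[OF s(1), of 0] by (intro tr) simp_all
    have 2: "has_bochner_integral (centred_normal v) (\<lambda>x. x\<^sup>2) (\<sigma>\<^sup>2)"
      using normal_moment_even[OF s(1), of 0 1] by (intro tr) (simp_all add: fact_numeral)
    have "2 * \<sigma> ^ 3 * sqrt (2 / pi) \<le> 2 * \<sigma> ^ 3" "\<sigma> * sqrt (2 / pi) \<le> \<sigma>"
      using s(1) p2 by (simp_all add: mult_left_le)
    then show ?thesis using 0 1 2 3 prob_space_normal_density[OF s(1)] s
      by (simp add: has_bochner_integral_iff cn \<sigma>_def)
  qed
  then show "prob_space (centred_normal v)" "sets (centred_normal v) = sets borel"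
    "integrable (centred_normal v) (\<lambda>x. \<bar>x\<bar> ^ 3)" "(\<integral>x. \<bar>x\<bar> ^ 3 \<partial>centred_normal v) \<le> 2 * sqrt v ^ 3"
    "integrable (centred_normal v) (\<lambda>x. \<bar>x\<bar>)" "(\<integral>x. \<bar>x\<bar> \<partial>centred_normal v) \<le> sqrt v"
    "(\<integral>x. x \<partial>centred_normal v) = 0" "(\<integral>x. x\<^sup>2 \<partial>centred_normal v) = v" by auto
qed

lemma norm_le_max_component:
  fixes h :: "real ^ 'd"
  shows "\<exists>i. norm h \<le> real CARD('d) * \<bar>h $ i\<bar>"
proof -
  have "Max (range (\<lambda>j. \<bar>h $ j\<bar>)) \<in> range (\<lambda>j. \<bar>h $ j\<bar>)" by (rule Max_in) auto
  then obtain i where "Max (range (\<lambda>j. \<bar>h $ j\<bar>)) = \<bar>h $ i\<bar>" by blast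
  then have i: "\<bar>h $ j\<bar> \<le> \<bar>h $ i\<bar>" for j
    using Max_ge[of "range (\<lambda>j. \<bar>h $ j\<bar>)" "\<bar>h $ j\<bar>"] by simp
  have "norm h \<le> (\<Sum>j\<in>UNIV. \<bar>h $ j\<bar>)" by (rule norm_le_l1_cart)
  also have "\<dots> \<le> (\<Sum>j\<in>(UNIV::'d set). \<bar>h $ i\<bar>)" by (intro sum_mono i)
  finally show ?thesis by auto
qed

lemma norm_cube_le_components:
  fixes h :: "real ^ 'd"
  shows "norm h ^ 3 \<le> real CARD('d) ^ 3 * (\<Sum>i\<in>UNIV. \<bar>h $ i\<bar> ^ 3)"
proof -
  obtain i where "norm h \<le> real CARD('d) * \<bar>h $ i\<bar>" using norm_le_max_component by blast
  then have "norm h ^ 3 \<le> (real CARD('d) * \<bar>h $ i\<bar>) ^ 3" by (intro power_mono) auto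
  also have "\<dots> = real CARD('d) ^ 3 * \<bar>h $ i\<bar> ^ 3" by (rule power_mult_distrib)
  also have "\<dots> \<le> real CARD('d) ^ 3 * (\<Sum>i\<in>UNIV. \<bar>h $ i\<bar> ^ 3)"
    by (intro mult_left_mono member_le_sum) auto
  finally show ?thesis .
qed

text \<open>For \<open>\<alpha> \<le> 2\<close> the moment exponent
  \<open>2 * \<alpha> / (\<alpha> - 1)\<close> is at least \<open>4\<close>, which leaves room for
  the third moment required by the Lindeberg replacement.\<close>

lemma jump_third_moment:
  fixes \<nu> :: "(real ^ 'd) measure"
  assumes "jump_hyp \<alpha> \<nu>" "1 < \<alpha>" "\<alpha> \<le> 2"
  shows "integrable \<nu> (\<lambda>h. norm h ^ 3)"
proof -
  interpret prob_space \<nu> using assms by (simp add: jump_hyp_def)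
  have sets[measurable_cong]: "sets \<nu> = sets borel" using assms by (simp add: jump_hyp_def)
  define q where "q = 2 * \<alpha> / (\<alpha> - 1)"
  have q: "3 \<le> q" using assms by (simp add: q_def le_divide_eq)
  have i: "integrable \<nu> (\<lambda>x. 1 + norm x powr q)"
    using assms unfolding jump_hyp_def q_def by auto
  show ?thesis
  proof (rule Bochner_Integration.integrable_bound[OF i])
    show "AE x in \<nu>. norm (norm x ^ 3) \<le> norm (1 + norm x powr q)"
    proof (rule AE_I2)
      fix x :: "real ^ 'd"
      have "norm x ^ 3 \<le> 1 + norm x powr q"
      proof (cases "norm x \<le> 1")
        case True
        then have "norm x ^ 3 \<le> 1" by (intro power_le_one) auto
        then show ?thesis by (simp add: add_increasing2)
      next
        case False
        then have "norm x ^ 3 = norm x powr real 3" by (intro powr_realpow[symmetric]) linarith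
        also have "\<dots> \<le> norm x powr q" using False q by (intro powr_mono) auto
        finally show ?thesis by simp
      qed
      then show "norm (norm x ^ 3) \<le> norm (1 + norm x powr q)" by simp
    qed
  qed measurable
qed

lemma jump_cov_quadratic:
  fixes \<nu> :: "(real ^ 'd) measure"
  assumes "jump_hyp \<alpha> \<nu>" "integrable \<nu> (\<lambda>h. norm h ^ 3)"
  shows "(\<integral>h. (h \<bullet> \<theta>)\<^sup>2 \<partial>\<nu>) = \<theta> \<bullet> (jump_cov \<nu> *v \<theta>)"
proof -
  have \<nu>: "borel_prob \<nu>" using assms by (simp add: jump_hyp_def borel_prob_def)
  have i: "integrable \<nu> (\<lambda>h. h $ i * h $ j)" for i j
    using moment_integrable(2)[OF \<nu> assms(2), of "axis i 1" "axis j 1"]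
    by (simp add: inner_axis)
  have "(h \<bullet> \<theta>)\<^sup>2 = (\<Sum>i\<in>UNIV. \<Sum>j\<in>UNIV. \<theta> $ i * \<theta> $ j * (h $ i * h $ j))" for h
    unfolding power2_eq_square inner_vec_def sum_product by (simp add: ac_simps)
  then have "(\<integral>h. (h \<bullet> \<theta>)\<^sup>2 \<partial>\<nu>) = (\<Sum>i\<in>UNIV. \<Sum>j\<in>UNIV. \<theta> $ i * \<theta> $ j * (\<integral>h. h $ i * h $ j \<partial>\<nu>))"
    using i by simp
  also have "\<dots> = \<theta> \<bullet> (jump_cov \<nu> *v \<theta>)"
    by (simp add: inner_vec_def matrix_vector_mult_def jump_cov_def sum_distrib_left ac_simps)
  finally show ?thesis .
qed

locale brownian_limit =
  fixes \<nu> :: "(real ^ 'd) measure" and B :: "'b measure" and W :: "real \<Rightarrow> 'b \<Rightarrow> real ^ 'd" and \<alpha> :: real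
  assumes jump: "jump_hyp \<alpha> \<nu>" and alpha12: "1 < \<alpha>" "\<alpha> \<le> 2"
    and brownian: "brownian_motion B (jump_cov \<nu>) W"
begin

lemma \<nu>_prob: "borel_prob \<nu>"
  using jump by (simp add: jump_hyp_def borel_prob_def)

lemma \<nu>_third: "integrable \<nu> (\<lambda>h. norm h ^ 3)"
  using jump_third_moment[OF jump alpha12] .

sublocale B: prob_space B
  using brownian by (simp add: brownian_motion_def)

lemma W_measurable: "0 \<le> t \<Longrightarrow> W t \<in> borel_measurable B"
  using brownian by (simp add: brownian_motion_def)

lemma W_zero: "\<omega> \<in> space B \<Longrightarrow> W 0 \<omega> = 0"
  using brownian by (simp add: brownian_motion_def)

definition law :: "real \<Rightarrow> real \<Rightarrow> (real ^ 'd) measure" where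
  "law s t = distr B borel (\<lambda>\<omega>. W t \<omega> - W s \<omega>)"

lemma incr_measurable: "0 \<le> s \<Longrightarrow> s \<le> t \<Longrightarrow> (\<lambda>\<omega>. W t \<omega> - W s \<omega>) \<in> borel_measurable B"
  using W_measurable[of s] W_measurable[of t] by simp

lemma law_prob: "0 \<le> s \<Longrightarrow> s \<le> t \<Longrightarrow> borel_prob (law s t)"
  unfolding law_def using borel_prob_distr[OF B.prob_space_axioms incr_measurable] .

lemma step_law_zero:
  assumes "0 \<le> t" "f \<in> borel_measurable borel"
  shows "step (law 0 t) f x = (\<integral>\<omega>. f (x + W t \<omega>) \<partial>B)"
proof -
  have "step (law 0 t) f x = (\<integral>\<omega>. f (x + (W t \<omega> - W 0 \<omega>)) \<partial>B)"
    unfolding step_def law_def using incr_measurable[of 0 t] assms by (subst integral_distr) auto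
  also have "\<dots> = (\<integral>\<omega>. f (x + W t \<omega>) \<partial>B)"
    by (rule Bochner_Integration.integral_cong) (auto simp: W_zero)
  finally show ?thesis .
qed

definition variance :: "real ^ 'd \<Rightarrow> real" where
  "variance \<theta> = (\<integral>h. (h \<bullet> \<theta>)\<^sup>2 \<partial>\<nu>)"

lemma variance_nonneg: "0 \<le> variance \<theta>"
  unfolding variance_def by simp

lemma law_projection:
  assumes "0 \<le> s" "s \<le> t"
  shows "distr (law s t) borel (\<lambda>h. h \<bullet> \<theta>) = centred_normal ((t - s) * variance \<theta>)"
proof -
  have "distr B borel (\<lambda>\<omega>. \<theta> \<bullet> (W t \<omega> - W s \<omega>)) = centred_normal ((t - s) * (\<theta> \<bullet> (jump_cov \<nu> *v \<theta>)))"
    using brownian assms unfolding brownian_motion_def by blast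
  then show ?thesis
    unfolding law_def variance_def jump_cov_quadratic[OF jump \<nu>_third]
    using incr_measurable[OF assms] by (subst distr_distr) (auto simp: comp_def inner_commute)
qed

lemma law_integral:
  assumes st: "0 \<le> s" "s \<le> t" and [measurable]: "f \<in> borel_measurable borel"
  shows "(\<integral>h. f (h \<bullet> \<theta>) \<partial>law s t) = (\<integral>x. f x \<partial>centred_normal ((t - s) * variance \<theta>))"
    "integrable (law s t) (\<lambda>h. f (h \<bullet> \<theta>)) \<longleftrightarrow> integrable (centred_normal ((t - s) * variance \<theta>)) (f :: real \<Rightarrow> real)"
proof -
  have [measurable_cong]: "sets (law s t) = sets borel" by (simp add: law_def)
  show "(\<integral>h. f (h \<bullet> \<theta>) \<partial>law s t) = (\<integral>x. f x \<partial>centred_normal ((t - s) * variance \<theta>))"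
    unfolding law_projection[OF st, symmetric] by (subst integral_distr) auto
  show "integrable (law s t) (\<lambda>h. f (h \<bullet> \<theta>)) \<longleftrightarrow> integrable (centred_normal ((t - s) * variance \<theta>)) f"
    unfolding law_projection[OF st, symmetric] by (subst integrable_distr_eq) auto
qed

definition "third_const = real CARD('d) ^ 3 * (\<Sum>i\<in>UNIV. 2 * sqrt (variance (axis i 1 :: real ^ 'd)) ^ 3)"
definition "first_const = (\<Sum>i\<in>UNIV. sqrt (variance (axis i 1 :: real ^ 'd)))"

lemma law_third:
  assumes st: "0 \<le> s" "s \<le> t"
  shows "integrable (law s t) (\<lambda>h. norm h ^ 3)" "third_moment (law s t) \<le> third_const * sqrt (t - s) ^ 3"
proof -
  have sets[measurable_cong]: "sets (law s t) = sets borel" by (simp add: law_def)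
  have v: "0 \<le> (t - s) * variance \<theta>" for \<theta> using st variance_nonneg by simp
  have c: "integrable (law s t) (\<lambda>h. \<bar>h $ i\<bar> ^ 3)" "(\<integral>h. \<bar>h $ i\<bar> ^ 3 \<partial>law s t) \<le> 2 * sqrt (variance (axis i 1)) ^ 3 * sqrt (t - s) ^ 3" for i
    using law_integral[OF st, of "\<lambda>x. \<bar>x\<bar> ^ 3" "axis i 1"] centred_normal_moments(3,4)[OF v, of "axis i 1"]
    by (simp_all add: inner_axis real_sqrt_mult power_mult_distrib mult.commute)
  have i: "integrable (law s t) (\<lambda>h. real CARD('d) ^ 3 * (\<Sum>i\<in>UNIV. \<bar>h $ i\<bar> ^ 3))" using c by simp
  show 1: "integrable (law s t) (\<lambda>h. norm h ^ 3)"
    by (rule Bochner_Integration.integrable_bound[OF i])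
      (use norm_cube_le_components in \<open>auto simp: sum_nonneg\<close>)
  have "third_moment (law s t) \<le> (\<integral>h. real CARD('d) ^ 3 * (\<Sum>i\<in>UNIV. \<bar>h $ i\<bar> ^ 3) \<partial>law s t)"
    unfolding third_moment_def by (rule integral_mono[OF 1 i norm_cube_le_components])
  also have "\<dots> = real CARD('d) ^ 3 * (\<Sum>i\<in>UNIV. \<integral>h. \<bar>h $ i\<bar> ^ 3 \<partial>law s t)" using c by simp
  also have "\<dots> \<le> real CARD('d) ^ 3 * (\<Sum>i\<in>UNIV. 2 * sqrt (variance (axis i 1)) ^ 3 * sqrt (t - s) ^ 3)"
    by (intro mult_left_mono sum_mono c) auto
  also have "\<dots> = third_const * sqrt (t - s) ^ 3"
    by (simp add: third_const_def sum_distrib_right mult.assoc)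
  finally show "third_moment (law s t) \<le> third_const * sqrt (t - s) ^ 3" .
qed

lemma law_first:
  assumes st: "0 \<le> s" "s \<le> t"
  shows "integrable (law s t) norm" "(\<integral>h. norm h \<partial>law s t) \<le> first_const * sqrt (t - s)"
proof -
  have sets[measurable_cong]: "sets (law s t) = sets borel" by (simp add: law_def)
  have v: "0 \<le> (t - s) * variance \<theta>" for \<theta> using st variance_nonneg by simp
  have c: "integrable (law s t) (\<lambda>h. \<bar>h $ i\<bar>)" "(\<integral>h. \<bar>h $ i\<bar> \<partial>law s t) \<le> sqrt (variance (axis i 1)) * sqrt (t - s)" for i
    using law_integral[OF st, of abs "axis i 1"] centred_normal_moments(5,6)[OF v, of "axis i 1"]
    by (simp_all add: inner_axis real_sqrt_mult mult.commute)
  have i: "integrable (law s t) (\<lambda>h. \<Sum>i\<in>UNIV. \<bar>h $ i\<bar>)" using c by simp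
  show 1: "integrable (law s t) norm"
    by (rule Bochner_Integration.integrable_bound[OF i])
      (use norm_le_l1_cart in \<open>auto simp: sum_nonneg\<close>)
  have "(\<integral>h. norm h \<partial>law s t) \<le> (\<integral>h. (\<Sum>i\<in>UNIV. \<bar>h $ i\<bar>) \<partial>law s t)"
    by (rule integral_mono[OF 1 i norm_le_l1_cart])
  also have "\<dots> = (\<Sum>i\<in>UNIV. \<integral>h. \<bar>h $ i\<bar> \<partial>law s t)" using c by simp
  also have "\<dots> \<le> (\<Sum>i\<in>UNIV. sqrt (variance (axis i 1)) * sqrt (t - s))" by (intro sum_mono c)
  also have "\<dots> = first_const * sqrt (t - s)" by (simp add: first_const_def sum_distrib_right)
  finally show "(\<integral>h. norm h \<partial>law s t) \<le> first_const * sqrt (t - s)" .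
qed

text \<open>Stationarity of the increments is available only for one-dimensional projections, so the
  convolution identity keeps the two laws apart.\<close>

lemma step_law_compose:
  assumes st: "0 \<le> s" "s \<le> t" and f: "bdd_meas K f"
  shows "step (law 0 t) f x = step (law s t) (step (law 0 s) f) x"
proof -
  \<comment> \<open>Independence of increments is stated along nondecreasing sequences of times;
    here the sequence is \<open>0\<close>, \<open>s\<close>, \<open>t\<close>, \<open>t\<close>, and
    so on, and its first two increments are used.\<close>
  define \<tau> :: "nat \<Rightarrow> real" where "\<tau> i = (if i = 0 then 0 else if i = 1 then s else t)" for i
  have "0 \<le> \<tau> 0" by (simp add: \<tau>_def)
  moreover have "mono \<tau>" using st by (intro monoI) (auto simp: \<tau>_def)
  ultimately have "B.indep_vars (\<lambda>_. borel) (\<lambda>i \<omega>. W (\<tau> (Suc i)) \<omega> - W (\<tau> i) \<omega>) {..<2}"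
    using brownian unfolding brownian_motion_def by blast
  from B.indep_var_compose[OF B.indep_var_restrict[OF this, of "{0}" "{1}"], of "\<lambda>g. g 0" borel "\<lambda>g. g 1" borel]
  have ind: "B.indep_var borel (\<lambda>\<omega>. W s \<omega> - W 0 \<omega>) borel (\<lambda>\<omega>. W t \<omega> - W s \<omega>)"
    by (simp add: \<tau>_def comp_def measurable_component_singleton)
  have m: "(\<lambda>\<omega>. W s \<omega> - W 0 \<omega>) \<in> borel_measurable B" "(\<lambda>\<omega>. W t \<omega> - W s \<omega>) \<in> borel_measurable B"
    using st by (auto intro: incr_measurable)
  have pr: "law 0 s \<Otimes>\<^sub>M law s t = distr B (borel \<Otimes>\<^sub>M borel) (\<lambda>\<omega>. (W s \<omega> - W 0 \<omega>, W t \<omega> - W s \<omega>))"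
    using B.indep_var_distribution_eq[THEN iffD1, OF ind] by (simp add: law_def)
  interpret M: prob_space "law 0 s" using law_prob[of 0 s] st by (simp add: borel_prob_def)
  interpret N: prob_space "law s t" using law_prob[of s t] st by (simp add: borel_prob_def)
  interpret pair_prob_space "law 0 s" "law s t" ..
  have [measurable_cong]: "sets (law s t) = sets borel" for s t by (simp add: law_def)
  have [measurable]: "f \<in> borel_measurable borel" using f by (simp add: bdd_meas_def)
  have i: "integrable (law 0 s \<Otimes>\<^sub>M law s t) (\<lambda>(u, v). f (x + v + u))"
    by (rule integrable_const_bound[where B = K]) (use f in \<open>auto simp: bdd_meas_def split_beta\<close>)
  have "step (law s t) (step (law 0 s) f) x = (\<integral>v. \<integral>u. f (x + v + u) \<partial>law 0 s \<partial>law s t)"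
    by (simp add: step_def)
  also have "\<dots> = (\<integral>(u, v). f (x + v + u) \<partial>(law 0 s \<Otimes>\<^sub>M law s t))"
    using integral_snd[OF i] by simp
  also have "\<dots> = (\<integral>\<omega>. f (x + (W t \<omega> - W s \<omega>) + (W s \<omega> - W 0 \<omega>)) \<partial>B)"
    unfolding pr using m by (subst integral_distr) (auto simp: split_beta)
  also have "\<dots> = step (law 0 t) f x"
    unfolding step_def law_def using incr_measurable[of 0 t] st
    by (subst integral_distr) (auto simp: algebra_simps)
  finally show ?thesis by simp
qed

definition scaled_jump :: "nat \<Rightarrow> (real ^ 'd) measure" where
  "scaled_jump n = distr \<nu> borel (\<lambda>h. h /\<^sub>R sqrt (real n))"

lemma scaled_jump_prob: "borel_prob (scaled_jump n)"
  unfolding scaled_jump_def by (rule scaled_measure(1)[OF \<nu>_prob])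

text \<open>At a fixed smoothing scale at most \<open>n\<close> replacements cost a multiple of
  \<open>n powr - (3 / 2)\<close> each, hence at most \<open>D / sqrt n\<close> in total; removing
  the smoothing on both sides costs a multiple of \<open>L * \<epsilon>\<close>. Both bounds depend
  on \<open>f\<close> only through \<open>K\<close> and \<open>L\<close>.\<close>

lemma clt_uniform:
  assumes L: "0 \<le> L" and e: "0 < e"
  shows "\<forall>\<^sub>F n in sequentially. \<forall>j\<le>n. \<forall>f x. bdd_meas K f \<longrightarrow> lip L f \<longrightarrow>
    \<bar>(step (scaled_jump n) ^^ j) f x - step (law 0 (real j / real n)) f x\<bar> \<le> e"
proof -
  let ?I = "\<integral>z. gauss_kernel (z :: real ^ 'd) \<partial>lborel"
  define m1 where "m1 = gauss_first TYPE(real ^ 'd)"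
  \<comment> \<open>Makes each of the two removals of the smoothing cost at most
    \<open>e / 4\<close>; the \<open>+ 1\<close> keeps the denominator positive.\<close>
  define \<epsilon> where "\<epsilon> = e / (4 * (L * \<bar>m1\<bar> + 1))"
  have \<epsilon>: "0 < \<epsilon>" using L e by (auto simp: \<epsilon>_def intro!: divide_pos_pos add_nonneg_pos)
  have \<epsilon>L: "L * \<epsilon> * m1 \<le> e / 4"
  proof -
    have "L * \<epsilon> * m1 \<le> L * \<epsilon> * \<bar>m1\<bar>" using L \<epsilon> by (intro mult_left_mono) auto
    also have "\<dots> \<le> \<epsilon> * (L * \<bar>m1\<bar> + 1)" using \<epsilon> by (simp add: algebra_simps)
    also have "\<dots> = e / 4"
    proof -
      have "e / (4 * q) * q = e / 4" if "0 < q" for q :: real using that by simp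
      moreover have "0 < L * \<bar>m1\<bar> + 1" using L by (intro add_nonneg_pos) auto
      ultimately show ?thesis unfolding \<epsilon>_def by blast
    qed
    finally show ?thesis .
  qed
  define D where "D = K * (taylor_const TYPE(real ^ 'd) / ?I) * (third_moment \<nu> + third_const) / \<epsilon> ^ 3"
  have "(\<lambda>n. D / sqrt (real n)) \<longlonglongrightarrow> 0" by real_asymp
  then have "\<forall>\<^sub>F n in sequentially. D / sqrt (real n) < e / 2" by (rule order_tendstoD(2)) (use e in auto)
  then show ?thesis using eventually_gt_at_top[of 0]
  proof eventually_elim
    case (elim n)
    define \<rho> where "\<rho> = sqrt (real n)"
    have \<rho>: "0 < \<rho>" "\<rho>\<^sup>2 = real n" using elim by (auto simp: \<rho>_def)
    define m where "m j = law (real j / real n) (real (Suc j) / real n)" for j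
    define P where "P j = law 0 (real j / real n)" for j
    have le: "0 \<le> real j / real n" "real j / real n \<le> real (Suc j) / real n" for j
      by (auto intro: divide_right_mono)
    have d: "real (Suc j) / real n - real j / real n = 1 / \<rho>\<^sup>2" for j
      using \<rho> by (simp add: diff_divide_distrib[symmetric])
    have A: "borel_prob (scaled_jump n)" "integrable (scaled_jump n) (\<lambda>h. norm h ^ 3)"
      "third_moment (scaled_jump n) = third_moment \<nu> / \<rho> ^ 3"
      unfolding scaled_jump_def \<rho>_def[symmetric]
      using scaled_measure(1-3)[OF \<nu>_prob, where c = \<rho>] \<nu>_third \<rho> by auto
    have m3: "third_moment (m j) \<le> third_const / \<rho> ^ 3" for j
    proof -
      have sq: "sqrt (1 / \<rho>\<^sup>2) = 1 / \<rho>" using \<rho>(1) by (simp add: real_sqrt_divide)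
      show ?thesis using law_third(2)[OF le, of j] unfolding m_def d sq by (simp add: power_divide)
    qed
    have sm: "same_moments (scaled_jump n) (m j)" for j
      unfolding same_moments_def
    proof (intro allI conjI)
      fix \<theta> :: "real ^ 'd"
      have v: "0 \<le> (real (Suc j) / real n - real j / real n) * variance \<theta>"
        using variance_nonneg[of \<theta>] le(2)[of j] by (intro mult_nonneg_nonneg) auto
      have "(\<integral>h. h \<bullet> \<theta> \<partial>m j) = 0" "(\<integral>h. (h \<bullet> \<theta>)\<^sup>2 \<partial>m j) = variance \<theta> / \<rho>\<^sup>2"
        unfolding m_def using law_integral(1)[OF le, of "\<lambda>x. x"] law_integral(1)[OF le, of "\<lambda>x. x\<^sup>2"]
          centred_normal_moments(7,8)[OF v]
        by (simp_all add: d del: of_nat_Suc)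
      moreover have "integrable \<nu> (\<lambda>x. x)" "(\<integral>x. x \<partial>\<nu>) = 0" using jump by (auto simp: jump_hyp_def)
      then have "(\<integral>h. h \<bullet> \<theta> \<partial>\<nu>) = 0" by simp
      ultimately show "(\<integral>h. h \<bullet> \<theta> \<partial>scaled_jump n) = (\<integral>h. h \<bullet> \<theta> \<partial>m j)"
        "(\<integral>h. (h \<bullet> \<theta>)\<^sup>2 \<partial>scaled_jump n) = (\<integral>h. (h \<bullet> \<theta>)\<^sup>2 \<partial>m j)"
        unfolding scaled_jump_def \<rho>_def[symmetric]
        using scaled_measure(4,5)[OF \<nu>_prob, where c = \<rho>] by (simp_all add: variance_def)
    qed
    show ?case
    proof (intro allI impI)
      fix j and f :: "real ^ 'd \<Rightarrow> real" and x assume j: "j \<le> n" and f: "bdd_meas K f" "lip L f"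
      let ?S = "step (gauss_law \<epsilon>)" and ?A = "step (scaled_jump n)"
      have Sf: "bdd_meas K (?S f)" by (rule step_bdd_meas[OF f(1) gauss_law_prob])
      have cl: "\<bar>?S f z - f z\<bar> \<le> e / 4" for z
        using step_gauss_law_close[OF f \<epsilon>, of z] \<epsilon>L unfolding m1_def by linarith
      have Pj: "borel_prob (P j)" for j unfolding P_def by (rule law_prob) (use le in auto)
      have "\<bar>(?A ^^ j) (?S f) x - step (P j) (?S f) x\<bar>
        \<le> real j * (K * (taylor_const TYPE(real ^ 'd) / ?I) * (third_moment (scaled_jump n) + third_const / \<rho> ^ 3) / \<epsilon> ^ 3)"
      proof (rule lindeberg_iteration[where m = m, OF A(1,2) _ _ m3 sm Pj _ _ f(1) \<epsilon>])
        show "borel_prob (m j)" for j unfolding m_def by (rule law_prob[OF le])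
        show "integrable (m j) (\<lambda>h. norm h ^ 3)" for j unfolding m_def by (rule law_third(1)[OF le])
        show "step (P 0) f x = f x" if "bdd_meas K f" for f x
        proof -
          have "step (P 0) f x = (\<integral>\<omega>. f (x + W 0 \<omega>) \<partial>B)"
            unfolding P_def using that by (simp add: step_law_zero bdd_meas_def)
          also have "\<dots> = (\<integral>\<omega>. f x \<partial>B)" by (rule Bochner_Integration.integral_cong) (auto simp: W_zero)
          finally show ?thesis by (simp add: B.prob_space)
        qed
        show "step (P (Suc j)) f x = step (m j) (step (P j) f) x" if "bdd_meas K f" for j f x
          unfolding P_def m_def by (rule step_law_compose[OF le that])
      qed
      also have "\<dots> = real j * (D / \<rho> ^ 3)"
        unfolding D_def A(3) by (simp add: add_divide_distrib[symmetric] mult.commute)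
      also have "\<dots> \<le> e / 2"
      proof -
        have K0: "0 \<le> K" using f by (auto simp: bdd_meas_def intro: order_trans[OF abs_ge_zero])
        have "0 \<le> third_const" unfolding third_const_def by (intro mult_nonneg_nonneg sum_nonneg) (auto simp: variance_nonneg)
        moreover have "0 \<le> third_moment \<nu>" unfolding third_moment_def by simp
        ultimately have "0 \<le> D" unfolding D_def
          using K0 taylor_const_nonneg[where ?'a = "real ^ 'd"] gauss_mass_pos[where ?'a = "real ^ 'd"] \<epsilon>
          by (intro divide_nonneg_nonneg mult_nonneg_nonneg) auto
        then have "real j * (D / \<rho> ^ 3) \<le> real n * (D / \<rho> ^ 3)"
          using j \<rho> by (intro mult_right_mono) auto
        also have "\<dots> = D / \<rho>" using \<rho> by (simp add: \<rho>(2)[symmetric] power2_eq_square power3_eq_cube)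
        also have "\<dots> \<le> e / 2" using elim(1) by (simp add: \<rho>_def)
        finally show ?thesis .
      qed
      finally have 1: "\<bar>(?A ^^ j) (?S f) x - step (P j) (?S f) x\<bar> \<le> e / 2" .
      have 2: "\<bar>(?A ^^ j) (?S f) x - (?A ^^ j) f x\<bar> \<le> e / 4"
        by (rule step_pow_diff_le[OF Sf f(1) A(1) cl])
      have 3: "\<bar>step (P j) (?S f) x - step (P j) f x\<bar> \<le> e / 4"
        by (rule step_diff_le[OF Sf f(1) Pj cl])
      show "\<bar>(?A ^^ j) f x - step (law 0 (real j / real n)) f x\<bar> \<le> e"
        using 1 2 3 unfolding P_def by linarith
    qed
  qed
qed

end

section \<open>The log-Laplace equation as a scaling limit\<close>

lemma powr_diff_le:
  fixes \<alpha> K v w :: real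
  assumes "1 \<le> \<alpha>" "0 \<le> v" "v \<le> K" "0 \<le> w" "w \<le> K"
  shows "\<bar>v powr \<alpha> - w powr \<alpha>\<bar> \<le> \<alpha> * K powr (\<alpha> - 1) * \<bar>v - w\<bar>"
proof -
  have le: "w powr \<alpha> - v powr \<alpha> \<le> \<alpha> * K powr (\<alpha> - 1) * (w - v)" if vw: "0 \<le> v" "v \<le> w" "w \<le> K" for v w :: real
  \<comment> \<open>The mean value theorem is applied only away from \<open>0\<close>, where
    \<open>powr\<close> is differentiable; for \<open>v = 0\<close> one factor of
    \<open>w powr \<alpha>\<close> is split off instead.\<close>
  proof (cases "v = 0 \<or> v = w")
    case True
    have "w powr \<alpha> \<le> \<alpha> * K powr (\<alpha> - 1) * w" if "0 < w"
    proof -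
      have "w powr \<alpha> = w powr (\<alpha> - 1) * w" using that by (simp add: powr_diff)
      also have "\<dots> \<le> K powr (\<alpha> - 1) * w" using that vw assms by (intro mult_right_mono powr_mono2) auto
      also have "\<dots> \<le> \<alpha> * (K powr (\<alpha> - 1) * w)" using assms that by (intro mult_right_mono[of 1 \<alpha>, simplified]) auto
      finally show ?thesis by (simp add: mult.assoc)
    qed
    then show ?thesis using True vw by (cases "w = 0") auto
  next
    case False
    then have "0 < v" "v < w" using vw by auto
    have d: "((\<lambda>x. x powr \<alpha>) has_real_derivative \<alpha> * x powr (\<alpha> - 1)) (at x)" if "v \<le> x" "x \<le> w" for x
      using that \<open>0 < v\<close> by (intro has_real_derivative_powr) auto
    from MVT2[OF \<open>v < w\<close> d]
    obtain z where z: "v < z" "z < w" "w powr \<alpha> - v powr \<alpha> = (w - v) * (\<alpha> * z powr (\<alpha> - 1))" by blast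
    have "z powr (\<alpha> - 1) \<le> K powr (\<alpha> - 1)" using z \<open>0 < v\<close> vw assms by (intro powr_mono2) auto
    then have "(w - v) * (\<alpha> * z powr (\<alpha> - 1)) \<le> (w - v) * (\<alpha> * K powr (\<alpha> - 1))"
      using vw assms by (intro mult_left_mono) auto
    then show ?thesis using z by (simp add: ac_simps)
  qed
  have mono: "v powr \<alpha> \<le> w powr \<alpha>" if "0 \<le> v" "v \<le> w" for v w :: real
    using that assms by (intro powr_mono2) auto
  show ?thesis
  proof (cases "v \<le> w")
    case True
    then show ?thesis using le[of v w] mono[of v w] assms by simp
  next
    case False
    then show ?thesis using le[of w v] mono[of w v] assms by simp
  qed
qed

lemma abs_integral_le_integral:
  fixes f g :: "'b \<Rightarrow> real"
  assumes "integrable M f" "integrable M g" "\<And>x. \<bar>f x\<bar> \<le> g x"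
  shows "\<bar>\<integral>x. f x \<partial>M\<bar> \<le> (\<integral>x. g x \<partial>M)"
  by (rule order_trans[OF integral_abs_bound integral_mono[OF integrable_abs[OF assms(1)] assms(2,3)]])

lemma step_sum:
  assumes "finite J" "\<And>j. j \<in> J \<Longrightarrow> bdd_meas (K j) (f j)" "borel_prob \<mu>"
  shows "step \<mu> (\<lambda>x. \<Sum>j\<in>J. f j x) x = (\<Sum>j\<in>J. step \<mu> (f j) x)"
  unfolding step_def using assms by (intro Bochner_Integration.integral_sum bdd_meas_integrable_shift) auto

lemma bdd_meas_sum:
  assumes "finite J" "\<And>j. j \<in> J \<Longrightarrow> bdd_meas (K j) (f j)"
  shows "bdd_meas (\<Sum>j\<in>J. K j) (\<lambda>x. \<Sum>j\<in>J. f j x)"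
  using assms unfolding bdd_meas_def
  by (auto intro!: borel_measurable_sum order_trans[OF sum_abs] sum_mono)

text \<open>The rescaled iteration in abstract form: average over one jump, then apply a branching
  map \<open>G\<close>. As \<open>G\<close> is monotone, nonexpansive and zero at \<open>0\<close>,
  the range and the Lipschitz constant of \<open>\<phi>\<close> persist through all steps.\<close>

locale scheme =
  fixes G :: "real \<Rightarrow> real" and K L :: real and A :: "'a::euclidean_space measure" and \<phi> :: "'a \<Rightarrow> real"
    and U :: "nat \<Rightarrow> 'a \<Rightarrow> real"
  assumes A: "borel_prob A" and G0: "G 0 = 0"
    and G: "\<And>v w. 0 \<le> v \<Longrightarrow> v \<le> w \<Longrightarrow> w \<le> K \<Longrightarrow> 0 \<le> G w - G v \<and> G w - G v \<le> w - v"
    and U0: "U 0 = \<phi>" and USuc: "\<And>k x. U (Suc k) x = G (step A (U k) x)"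
    and \<phi>: "\<And>x. 0 \<le> \<phi> x \<and> \<phi> x \<le> K" "lip L \<phi>"
begin

lemma U_props: "(\<forall>x. 0 \<le> U k x \<and> U k x \<le> K) \<and> lip L (U k)"
proof (induction k)
  case 0 show ?case using \<phi> by (simp add: U0)
next
  case (Suc k)
  have bm: "bdd_meas K (U k)" using Suc lip_measurable[of L "U k"] by (auto simp: bdd_meas_def abs_le_iff intro: order_trans)
  have s: "0 \<le> step A (U k) x" "step A (U k) x \<le> K" for x
  proof -
    have "bdd_meas 0 (\<lambda>_::'a. 0)" by (simp add: bdd_meas_def)
    from step_mono[OF this bm A] show "0 \<le> step A (U k) x" using Suc by (simp add: step_const[OF A])
    show "step A (U k) x \<le> K" using step_bdd_meas[OF bm A] by (auto simp: bdd_meas_def abs_le_iff)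
  qed
  have "\<bar>G v - G w\<bar> \<le> \<bar>v - w\<bar>" if "0 \<le> v" "v \<le> K" "0 \<le> w" "w \<le> K" for v w
    using G[of v w] G[of w v] that by (cases "v \<le> w") auto
  then have "\<bar>U (Suc k) x - U (Suc k) y\<bar> \<le> \<bar>step A (U k) x - step A (U k) y\<bar>" for x y
    unfolding USuc using s by blast
  then have "lip L (U (Suc k))"
    using step_lip[OF bm _ A, of L] Suc unfolding lip_def by (meson order_trans)
  moreover have "0 \<le> U (Suc k) x \<and> U (Suc k) x \<le> K" for x
    unfolding USuc using G[of 0 "step A (U k) x"] s[of x] G0 by simp
  ultimately show ?case by blast
qed

lemma U_range: "0 \<le> U k x" "U k x \<le> K" and U_lip: "lip L (U k)"
  using U_props by auto

lemma U_bdd: "bdd_meas K (U k)"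
  using U_range lip_measurable[OF U_lip] by (auto simp: bdd_meas_def abs_le_iff intro: order_trans)

lemma AU_range: "0 \<le> step A (U k) x" "step A (U k) x \<le> K"
proof -
  have "bdd_meas 0 (\<lambda>_::'a. 0)" by (simp add: bdd_meas_def)
  from step_mono[OF this U_bdd A] show "0 \<le> step A (U k) x" using U_range by (simp add: step_const[OF A])
  show "step A (U k) x \<le> K" using step_bdd_meas[OF U_bdd A] by (auto simp: bdd_meas_def abs_le_iff)
qed

definition "g m x = step A (U m) x - U (Suc m) x"

lemma g_range: "0 \<le> g m x" "g m x \<le> K"
  using G[of 0 "step A (U m) x"] AU_range[of m x] G0 U_range[of "Suc m" x] unfolding g_def USuc by auto

lemma g_bdd: "bdd_meas K (g m)"
proof -
  have "g m \<in> borel_measurable borel"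
    unfolding g_def[abs_def] using step_bdd_meas[OF U_bdd A, of m] U_bdd[of "Suc m"] by (auto simp: bdd_meas_def)
  then show ?thesis using g_range[of m] by (auto simp: bdd_meas_def abs_le_iff intro: order_trans)
qed

text \<open>Variation of constants in discrete time: the loss \<open>g i\<close> of step
  \<open>i\<close> is transported by the remaining \<open>k - 1 - i\<close> jumps, so
  \<open>j\<close> counts the jumps that follow the loss.\<close>

lemma duhamel: "U k x = (step A ^^ k) \<phi> x - (\<Sum>j<k. (step A ^^ j) (g (k - 1 - j)) x)"
proof (induction k arbitrary: x)
  case 0 show ?case by (simp add: U0)
next
  case (Suc k)
  have \<phi>b: "bdd_meas K \<phi>" using U_bdd[of 0] by (simp add: U0)
  let ?S = "\<lambda>x. \<Sum>j<k. (step A ^^ j) (g (k - 1 - j)) x"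
  have b1: "bdd_meas (\<Sum>j<k. K) ?S" by (rule bdd_meas_sum) (auto intro: step_pow_bdd_meas g_bdd A)
  have "step A (U k) x = step A (\<lambda>x. (step A ^^ k) \<phi> x - ?S x) x"
  proof -
    have "U k = (\<lambda>x. (step A ^^ k) \<phi> x - ?S x)" using Suc by auto
    then show ?thesis by (rule arg_cong[where f = "\<lambda>f. step A f x"])
  qed
  also have "\<dots> = step A ((step A ^^ k) \<phi>) x - step A ?S x"
    by (rule step_diff[OF step_pow_bdd_meas[OF \<phi>b A] b1 A])
  also have "step A ?S x = (\<Sum>j<k. step A ((step A ^^ j) (g (k - 1 - j))) x)"
    by (rule step_sum) (auto intro: step_pow_bdd_meas g_bdd A)
  finally have "U (Suc k) x = (step A ^^ Suc k) \<phi> x - (\<Sum>j<k. (step A ^^ Suc j) (g (k - 1 - j)) x) - g k x"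
    by (simp add: g_def)
  moreover have "(\<Sum>j<Suc k. (step A ^^ j) (g (k - j)) x) = g k x + (\<Sum>j<k. (step A ^^ Suc j) (g (k - 1 - j)) x)"
    unfolding sum.lessThan_Suc_shift by simp
  ultimately show ?case by simp
qed

end

section \<open>Measurability in time and moduli of continuity\<close>

context brownian_limit
begin

text \<open>Measurability at each fixed time becomes joint measurability by continuity of the paths,
  with time approximated from below on the grid of mesh \<open>1 / Suc n\<close>. The
  \<open>max 0\<close> extends a path constantly to negative times, so that integrands live on the
  whole line.\<close>

lemma W_joint_measurable: "(\<lambda>(s, \<omega>). W (max 0 s) \<omega>) \<in> borel_measurable (borel \<Otimes>\<^sub>M B)"
proof (rule borel_measurable_LIMSEQ_metric)
  fix n :: nat
  show "(\<lambda>(s, \<omega>). W (real (nat \<lfloor>real (Suc n) * max 0 s\<rfloor>) / real (Suc n)) \<omega>) \<in> borel_measurable (borel \<Otimes>\<^sub>M B)"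
  proof -
    have "(\<lambda>x. W (real (nat \<lfloor>real (Suc n) * max 0 (fst x)\<rfloor>) / real (Suc n)) (snd x)) \<in> borel_measurable (borel \<Otimes>\<^sub>M B)"
    proof (rule measurable_compose_countable[where f = "\<lambda>i x. W (real i / real (Suc n)) (snd x)"])
      fix i :: nat
      have [measurable]: "W (real i / real (Suc n)) \<in> borel_measurable B" by (rule W_measurable) simp
      show "(\<lambda>x. W (real i / real (Suc n)) (snd x)) \<in> borel_measurable (borel \<Otimes>\<^sub>M B)" by measurable
    next
      show "(\<lambda>x. nat \<lfloor>real (Suc n) * max 0 (fst x)\<rfloor>) \<in> (borel \<Otimes>\<^sub>M B) \<rightarrow>\<^sub>M count_space UNIV" by measurable
    qed
    then show ?thesis by (simp add: split_beta)
  qed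
next
  fix x :: "real \<times> 'b" assume x: "x \<in> space (borel \<Otimes>\<^sub>M B)"
  obtain s \<omega> where [simp]: "x = (s, \<omega>)" by (cases x)
  have \<omega>: "\<omega> \<in> space B" using x by (simp add: space_pair_measure)
  define r where "r = max 0 s"
  have cont: "continuous_on {0..} (\<lambda>t. W t \<omega>)" using brownian \<omega> by (simp add: brownian_motion_def)
  have "(\<lambda>n. real (nat \<lfloor>real (Suc n) * r\<rfloor>) / real (Suc n)) \<longlonglongrightarrow> r"
  proof (rule tendsto_sandwich[OF _ _ _ tendsto_const])
    show "(\<lambda>n. r - 1 / real (Suc n)) \<longlonglongrightarrow> r" by real_asymp
    have b: "real (nat \<lfloor>real (Suc n) * r\<rfloor>) \<le> real (Suc n) * r" "real (Suc n) * r - 1 \<le> real (nat \<lfloor>real (Suc n) * r\<rfloor>)" for n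
    proof -
      have "0 \<le> real (Suc n) * r" by (simp add: r_def)
      then show "real (nat \<lfloor>real (Suc n) * r\<rfloor>) \<le> real (Suc n) * r" "real (Suc n) * r - 1 \<le> real (nat \<lfloor>real (Suc n) * r\<rfloor>)"
        by linarith+
    qed
    have c: "r - 1 / m \<le> y / m" "y' / m \<le> r" if "0 < m" "m * r - 1 \<le> y" "y' \<le> m * r" for m y y' :: real
    proof -
      have "r - 1 / m = (m * r - 1) / m" using that by (simp add: diff_divide_distrib)
      then show "r - 1 / m \<le> y / m" using that by (simp add: divide_right_mono)
      show "y' / m \<le> r" using that by (simp add: divide_le_eq mult.commute)
    qed
    show "\<forall>\<^sub>F n in sequentially. r - 1 / real (Suc n) \<le> real (nat \<lfloor>real (Suc n) * r\<rfloor>) / real (Suc n)"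
      by (intro always_eventually allI c(1)[OF _ b(2) b(1)]) simp
    show "\<forall>\<^sub>F n in sequentially. real (nat \<lfloor>real (Suc n) * r\<rfloor>) / real (Suc n) \<le> r"
      by (intro always_eventually allI c(2)[OF _ b(2) b(1)]) simp
  qed
  from continuous_on_tendsto_compose[OF cont this]
  have "(\<lambda>n. W (real (nat \<lfloor>real (Suc n) * r\<rfloor>) / real (Suc n)) \<omega>) \<longlonglongrightarrow> W r \<omega>"
    by (simp add: r_def)
  then show "(\<lambda>n. case x of (s, \<omega>) \<Rightarrow> W (real (nat \<lfloor>real (Suc n) * max 0 s\<rfloor>) / real (Suc n)) \<omega>)
      \<longlonglongrightarrow> (case x of (s, \<omega>) \<Rightarrow> W (max 0 s) \<omega>)"
    by (simp add: r_def)
qed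

lemma W_integral_measurable:
  fixes v :: "real \<Rightarrow> real ^ 'd \<Rightarrow> real"
  assumes "(\<lambda>(r, z). v r z) \<in> borel_measurable (borel \<Otimes>\<^sub>M borel)"
  shows "(\<lambda>s. \<integral>\<omega>. v s (x + W (max 0 s) \<omega>) \<partial>B) \<in> borel_measurable (borel :: real measure)"
proof -
  have [measurable]: "(\<lambda>(s, \<omega>). W (max 0 s) \<omega>) \<in> borel_measurable (borel \<Otimes>\<^sub>M B)" by (rule W_joint_measurable)
  have "(\<lambda>y. (\<lambda>(r, z). v r z) (fst y, x + (\<lambda>(s, \<omega>). W (max 0 s) \<omega>) y)) \<in> borel_measurable (borel \<Otimes>\<^sub>M B)"
    by (rule measurable_compose[OF _ assms]) measurable
  then have [measurable]: "(\<lambda>(s, \<omega>). v s (x + W (max 0 s) \<omega>)) \<in> borel_measurable (borel \<Otimes>\<^sub>M B)"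
    by (simp add: split_beta)
  show ?thesis by (rule B.borel_measurable_lebesgue_integral) measurable
qed

definition "jump_first = (\<integral>z. norm z \<partial>\<nu>)"

lemma step_scaled_close:
  assumes f: "bdd_meas K f" "lip L f" and n: "0 < n"
  shows "\<bar>step (scaled_jump n) f x - f x\<bar> \<le> L * jump_first / sqrt (real n)"
proof -
  interpret N: prob_space \<nu> using \<nu>_prob by (simp add: borel_prob_def)
  have sets[measurable_cong]: "sets \<nu> = sets borel" using \<nu>_prob by (simp add: borel_prob_def)
  have fm[measurable]: "f \<in> borel_measurable borel" using f by (simp add: bdd_meas_def)
  have i1: "integrable \<nu> (\<lambda>h. f (x + h /\<^sub>R sqrt (real n)))"
    by (rule N.integrable_const_bound[where B = K]) (use f in \<open>auto simp: bdd_meas_def\<close>)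
  have i2: "integrable \<nu> norm"
    using jump by (auto simp: jump_hyp_def intro: integrable_norm)
  have "step (scaled_jump n) f x - f x = (\<integral>h. f (x + h /\<^sub>R sqrt (real n)) - f x \<partial>\<nu>)"
    unfolding scaled_jump_def scaled_measure(6)[OF \<nu>_prob fm] using i1 by (simp add: N.prob_space)
  also have "\<bar>\<dots>\<bar> \<le> (\<integral>h. L / sqrt (real n) * norm h \<partial>\<nu>)"
  proof (rule integral_abs_bound_integral)
    show "integrable \<nu> (\<lambda>h. f (x + h /\<^sub>R sqrt (real n)) - f x)" using i1 by simp
    show "integrable \<nu> (\<lambda>h. L / sqrt (real n) * norm h)" using i2 by simp
    fix h :: "real ^ 'd"
    have "\<bar>f (x + h /\<^sub>R sqrt (real n)) - f x\<bar> \<le> L * norm ((x + h /\<^sub>R sqrt (real n)) - x)"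
      using f(2) unfolding lip_def by blast
    then show "\<bar>f (x + h /\<^sub>R sqrt (real n)) - f x\<bar> \<le> L / sqrt (real n) * norm h" by (simp add: divide_inverse)
  qed
  finally show ?thesis by (simp add: jump_first_def)
qed

lemma step_law_time:
  assumes f: "bdd_meas K f" "lip L f" and st: "0 \<le> s" "s \<le> t"
  shows "\<bar>step (law 0 t) f x - step (law 0 s) f x\<bar> \<le> L * (first_const * sqrt (t - s))"
proof -
  have fm[measurable]: "f \<in> borel_measurable borel" using f by (simp add: bdd_meas_def)
  have [measurable]: "W s \<in> borel_measurable B" "W t \<in> borel_measurable B" using st by (auto intro: W_measurable)
  have i: "integrable B (\<lambda>\<omega>. f (x + W r \<omega>))" if "0 \<le> r" for r
    by (rule B.integrable_const_bound[where B = K])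
      (use f W_measurable[OF that] in \<open>auto simp: bdd_meas_def\<close>)
  have i2: "integrable B (\<lambda>\<omega>. norm (W t \<omega> - W s \<omega>))" "(\<integral>\<omega>. norm (W t \<omega> - W s \<omega>) \<partial>B) \<le> first_const * sqrt (t - s)"
    using law_first[OF st] unfolding law_def by (simp_all add: integrable_distr_eq integral_distr)
  have "step (law 0 t) f x - step (law 0 s) f x = (\<integral>\<omega>. f (x + W t \<omega>) - f (x + W s \<omega>) \<partial>B)"
    using i[of s] i[of t] st by (simp add: step_law_zero[OF _ fm])
  also have "\<bar>\<dots>\<bar> \<le> (\<integral>\<omega>. L * norm (W t \<omega> - W s \<omega>) \<partial>B)"
  proof (rule abs_integral_le_integral)
    show "integrable B (\<lambda>\<omega>. f (x + W t \<omega>) - f (x + W s \<omega>))" using i st by simp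
    show "integrable B (\<lambda>\<omega>. L * norm (W t \<omega> - W s \<omega>))" using i2 by simp
    fix \<omega>
    have "\<bar>f (x + W t \<omega>) - f (x + W s \<omega>)\<bar> \<le> L * norm ((x + W t \<omega>) - (x + W s \<omega>))"
      using f(2) unfolding lip_def by blast
    then show "\<bar>f (x + W t \<omega>) - f (x + W s \<omega>)\<bar> \<le> L * norm (W t \<omega> - W s \<omega>)" by simp
  qed
  also have "\<dots> \<le> L * (first_const * sqrt (t - s))"
    using i2 f(2) by (simp add: lip_def mult_left_mono)
  finally show ?thesis .
qed

end

lemma exp_kernel_integral:
  fixes t r :: real
  assumes "0 \<le> t" "0 < r"
  shows "has_bochner_integral lborel (\<lambda>s. exp (r * (t - s)) * indicator {0..t} s) ((exp (r * t) - 1) / r)"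
proof -
  have "has_bochner_integral lborel (\<lambda>s. exp (r * (t - s)) * indicator {0..t} s)
      ((- exp (r * (t - t)) / r) - (- exp (r * (t - 0)) / r))"
  proof (rule has_bochner_integral_FTC_Icc_real[OF assms(1)])
    show "((\<lambda>s. - exp (r * (t - s)) / r) has_real_derivative exp (r * (t - x))) (at x)" for x
      using assms by (auto intro!: derivative_eq_intros)
  qed (intro continuous_intros)
  then show ?thesis by (simp add: diff_divide_distrib)
qed

lemma bounded_on_Icc_integrable:
  fixes f :: "real \<Rightarrow> real"
  assumes [measurable]: "f \<in> borel_measurable borel" and b: "\<And>s. 0 \<le> s \<Longrightarrow> s \<le> t \<Longrightarrow> \<bar>f s\<bar> \<le> K"
  shows "integrable lborel (\<lambda>s. indicator {0..t} s * f s)"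
proof (rule Bochner_Integration.integrable_bound)
  show "integrable lborel (\<lambda>s. \<bar>K\<bar> * indicator {0..t} s)"
    by (intro integrable_mult_right integrable_real_indicator) (auto simp: emeasure_lborel_Icc_eq)
  show "AE s in lborel. norm (indicator {0..t} s * f s) \<le> norm (\<bar>K\<bar> * indicator {0..t} s)"
    using b by (intro AE_I2) (force simp: indicator_def)
qed measurable

lemma floor_interval_indicator:
  assumes "0 < n" "0 \<le> s"
  shows "indicator {real j / real n..<real (Suc j) / real n} s = (if j = nat \<lfloor>real n * s\<rfloor> then 1 else 0 :: real)"
proof -
  have "s \<in> {real j / real n..<real (Suc j) / real n} \<longleftrightarrow> real j \<le> real n * s \<and> real n * s < real j + 1"
    using assms by (auto simp: divide_le_eq less_divide_eq mult.commute)
  also have "\<dots> \<longleftrightarrow> \<lfloor>real n * s\<rfloor> = int j" by (simp add: floor_eq_iff)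
  also have "\<dots> \<longleftrightarrow> j = nat \<lfloor>real n * s\<rfloor>" using assms by auto
  finally show ?thesis by (simp add: indicator_def)
qed

section \<open>Consistency and stability of the mild equation\<close>

context brownian_limit
begin

lemma first_const_nonneg: "0 \<le> first_const"
  unfolding first_const_def by (intro sum_nonneg) (simp add: variance_nonneg)

lemma jump_first_nonneg: "0 \<le> jump_first"
  unfolding jump_first_def by simp

text \<open>The sum in \<open>duhamel\<close> is the integral of the step function \<open>F\<close>,
  which is compared cell by cell with the integrand \<open>H\<close> of the mild equation;
  \<open>Gc\<close> replaces the loss of one step by the power
  \<open>c * v powr \<alpha>\<close>.\<close>

lemma scheme_mild_error:
  fixes U :: "nat \<Rightarrow> real ^ 'd \<Rightarrow> real"
  assumes sch: "scheme G K L (scaled_jump n) \<phi> U" and n: "0 < n" and c: "0 \<le> c" and e1: "0 \<le> e1"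
    and Gc: "\<And>v. 0 \<le> v \<Longrightarrow> v \<le> K \<Longrightarrow> \<bar>real n * (v - G v) - c * v powr \<alpha>\<bar> \<le> e1"
    and clt1: "\<And>j f x. j \<le> n \<Longrightarrow> bdd_meas K f \<Longrightarrow> lip L f \<Longrightarrow>
      \<bar>(step (scaled_jump n) ^^ j) f x - step (law 0 (real j / real n)) f x\<bar> \<le> e1"
    and clt2: "\<And>j f x. j \<le> n \<Longrightarrow> bdd_meas (c * K powr \<alpha>) f \<Longrightarrow> lip (c * \<alpha> * K powr (\<alpha> - 1) * L) f \<Longrightarrow>
      \<bar>(step (scaled_jump n) ^^ j) f x - step (law 0 (real j / real n)) f x\<bar> \<le> e1"
    and t: "0 \<le> t" "t \<le> 1"
  defines "q \<equiv> c * \<alpha> * K powr (\<alpha> - 1)"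
  shows "\<bar>U (nat \<lfloor>real n * t\<rfloor>) x - (step (law 0 t) \<phi> x -
      (\<integral>s. indicator {0..t} s * (\<integral>\<omega>. c * U (nat \<lfloor>real n * (t - s)\<rfloor>) (x + W (max 0 s) \<omega>) powr \<alpha> \<partial>B) \<partial>lborel))\<bar>
    \<le> 3 * e1 + L * first_const / sqrt (real n) + q * L * first_const / sqrt (real n) +
      q * (L * jump_first / sqrt (real n) + (c * K powr \<alpha> + e1) / real n) + c * K powr \<alpha> / real n"
proof -
  interpret scheme G K L "scaled_jump n" \<phi> U by (rule sch)
  let ?A = "step (scaled_jump n)"
  have L0: "0 \<le> L" using \<phi> by (simp add: lip_def)
  have K0: "0 \<le> K" using \<phi>(1)[of 0] by simp
  have al: "1 \<le> \<alpha>" using alpha12 by simp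
  have q0: "0 \<le> q" using c al by (simp add: q_def)
  have powr_le: "v powr \<alpha> \<le> K powr \<alpha>" if "0 \<le> v" "v \<le> K" for v using that al by (intro powr_mono2) auto
  have pd: "\<bar>c * v powr \<alpha> - c * w powr \<alpha>\<bar> \<le> q * \<bar>v - w\<bar>" if "0 \<le> v" "v \<le> K" "0 \<le> w" "w \<le> K" for v w
  proof -
    have "\<bar>c * v powr \<alpha> - c * w powr \<alpha>\<bar> = c * \<bar>v powr \<alpha> - w powr \<alpha>\<bar>"
      using c by (simp add: right_diff_distrib[symmetric] abs_mult)
    also have "\<dots> \<le> c * (\<alpha> * K powr (\<alpha> - 1) * \<bar>v - w\<bar>)" using powr_diff_le[OF al that] c by (intro mult_left_mono)
    finally show ?thesis by (simp add: q_def mult.assoc)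
  qed
  define k where "k = nat \<lfloor>real n * t\<rfloor>"
  have k: "real k \<le> real n * t" "real n * t < real k + 1"
  proof -
    have "0 \<le> real n * t" using t by simp
    then show "real k \<le> real n * t" "real n * t < real k + 1" unfolding k_def by linarith+
  qed
  have kn: "k \<le> n"
  proof -
    have "real n * t \<le> real n" using t by (simp add: mult_left_le)
    then show ?thesis using k by linarith
  qed
  have kt: "real k / real n \<le> t" "t - real k / real n \<le> 1 / real n"
  proof -
    show "real k / real n \<le> t" using k n by (simp add: divide_le_eq mult.commute)
    have "t \<le> (real k + 1) / real n" using k n by (simp add: le_divide_eq mult.commute)
    then show "t - real k / real n \<le> 1 / real n" by (simp add: add_divide_distrib)
  qed
  define V where "V r z = c * U (nat \<lfloor>real n * r\<rfloor>) z powr \<alpha>" for r z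
  have V_range: "0 \<le> V r z" "V r z \<le> c * K powr \<alpha>" for r z
    unfolding V_def using c powr_le[OF U_range] by (auto intro: mult_left_mono)
  have Um: "U i \<in> borel_measurable borel" for i using U_bdd by (simp add: bdd_meas_def)
  have V_bdd: "bdd_meas (c * K powr \<alpha>) (V r)" for r
    unfolding bdd_meas_def using V_range[of r] Um unfolding V_def by auto
  have V_meas: "(\<lambda>(s, z). V (t - s) z) \<in> borel_measurable (borel \<Otimes>\<^sub>M borel)"
  proof -
    have "(\<lambda>y. U (nat \<lfloor>real n * (t - fst y)\<rfloor>) (snd y)) \<in> borel_measurable ((borel :: real measure) \<Otimes>\<^sub>M borel)"
      by (rule measurable_compose_countable[where f = "\<lambda>i y. U i (snd y)"])
        (use measurable_compose[OF measurable_snd Um] in \<open>measurable\<close>)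
    then show ?thesis unfolding V_def split_beta by measurable
  qed
  define H where "H s = (\<integral>\<omega>. V (t - s) (x + W (max 0 s) \<omega>) \<partial>B)" for s
  have H_meas[measurable]: "H \<in> borel_measurable borel"
    unfolding H_def[abs_def] by (rule W_integral_measurable[OF V_meas])
  have H_step: "H s = step (law 0 s) (V (t - s)) x" if "0 \<le> s" for s
    unfolding H_def using that V_bdd by (subst step_law_zero) (auto simp: bdd_meas_def)
  have H_bound: "\<bar>H s\<bar> \<le> c * K powr \<alpha>" if "0 \<le> s" for s
    unfolding H_step[OF that] using step_bdd_meas[OF V_bdd law_prob[OF order_refl that]] by (simp add: bdd_meas_def)
  have H_int: "integrable lborel (\<lambda>s. indicator {0..t} s * H s)"
    by (rule bounded_on_Icc_integrable[OF H_meas H_bound])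
  define a where "a j = (?A ^^ j) (g (k - 1 - j)) x" for j
  \<comment> \<open>Error on a full cell: \<open>Gc\<close> and the limit theorem cost
    \<open>e1\<close> each, moving the time from \<open>j / n\<close> to \<open>s\<close> costs the
    second summand, and exchanging the averaged iterate for the scheme at time \<open>t - s\<close>
    the third.\<close>
  define \<eta> where "\<eta> = 2 * e1 + q * L * first_const / sqrt (real n) + q * (L * jump_first / sqrt (real n) + (c * K powr \<alpha> + e1) / real n)"
  have \<eta>0: "0 \<le> \<eta>" unfolding \<eta>_def using e1 q0 L0 c first_const_nonneg jump_first_nonneg
    by (intro add_nonneg_nonneg mult_nonneg_nonneg divide_nonneg_nonneg) auto
  have local: "\<bar>real n * a j - H s\<bar> \<le> \<eta>" if s: "0 \<le> s" "s \<le> t" and j: "j = nat \<lfloor>real n * s\<rfloor>" "j < k" for s j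
  proof -
    have js: "real j \<le> real n * s" "real n * s < real j + 1" 
    proof -
      have "0 \<le> real n * s" using s by simp
      then show "real j \<le> real n * s" "real n * s < real j + 1" unfolding j(1) by linarith+
    qed
    define m where "m = k - 1 - j"
    define m' where "m' = nat \<lfloor>real n * (t - s)\<rfloor>"
    have "0 \<le> real n * (t - s)" using s by simp
    then have "real m' \<le> real n * (t - s)" "real n * (t - s) < real m' + 1" unfolding m'_def by linarith+
    then have "real m' \<le> real n * t - real n * s" "real n * t - real n * s < real m' + 1"
      by (simp_all add: right_diff_distrib)
    then have "real m' < real k + 1 - real j" "real k - real j - 1 < real m' + 1" using js k by linarith+
    \<comment> \<open>Rounding \<open>n * t\<close>, \<open>n * s\<close> and their difference
      leaves an ambiguity of one step. It is covered by the effect of one jump average if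
      \<open>m' = m\<close>, and by the branching loss of one step if
      \<open>m' = Suc m\<close>.\<close>
    then have m': "m' = m \<or> m' = Suc m" using j(2) unfolding m_def by linarith
    define f where "f z = c * ?A (U m) z powr \<alpha>" for z
    have Am: "?A (U m) \<in> borel_measurable borel" using step_bdd_meas[OF U_bdd A] by (simp add: bdd_meas_def)
    have f_range: "0 \<le> f z" "f z \<le> c * K powr \<alpha>" for z
      unfolding f_def using c powr_le[OF AU_range] by (auto intro: mult_left_mono)
    have f_bdd: "bdd_meas (c * K powr \<alpha>) f"
      unfolding bdd_meas_def using f_range Am unfolding f_def[abs_def] by auto
    have f_lip: "lip (q * L) f"
    proof -
      have "\<bar>f y - f z\<bar> \<le> q * L * norm (y - z)" for y z
      proof -
        have "\<bar>f y - f z\<bar> \<le> q * \<bar>?A (U m) y - ?A (U m) z\<bar>" unfolding f_def by (rule pd[OF AU_range AU_range])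
        also have "\<dots> \<le> q * (L * norm (y - z))"
          using step_lip[OF U_bdd U_lip A] q0 by (intro mult_left_mono) (auto simp: lip_def)
        finally show ?thesis by (simp add: mult.assoc)
      qed
      then show ?thesis using q0 L0 by (simp add: lip_def)
    qed
    have ga: "\<bar>real n * g m z - f z\<bar> \<le> e1" for z
      unfolding g_def USuc f_def by (rule Gc[OF AU_range])
    have ng: "bdd_meas (real n * K) (\<lambda>z. real n * g m z)"
      using g_bdd[of m] by (auto simp: bdd_meas_def abs_mult intro: mult_left_mono)
    have "\<bar>(?A ^^ j) (\<lambda>z. real n * g m z) x - (?A ^^ j) f x\<bar> \<le> e1"
      by (rule step_pow_diff_le[OF ng f_bdd A ga])
    then have 1: "\<bar>real n * a j - (?A ^^ j) f x\<bar> \<le> e1"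
      using step_pow_affine[OF g_bdd A, of j "real n" m 0] by (simp add: a_def m_def)
    have 2: "\<bar>(?A ^^ j) f x - step (law 0 (real j / real n)) f x\<bar> \<le> e1"
      by (rule clt2) (use j kn f_bdd f_lip in \<open>auto simp: q_def\<close>)
    have jn: "real j / real n \<le> s" "s - real j / real n \<le> 1 / real n"
    proof -
      show "real j / real n \<le> s" using js n by (simp add: divide_le_eq mult.commute)
      have "s \<le> (real j + 1) / real n" using js n by (simp add: le_divide_eq mult.commute)
      then show "s - real j / real n \<le> 1 / real n" by (simp add: add_divide_distrib)
    qed
    have "\<bar>step (law 0 s) f x - step (law 0 (real j / real n)) f x\<bar> \<le> q * L * (first_const * sqrt (s - real j / real n))"
      by (rule step_law_time[OF f_bdd f_lip _ jn(1)]) simp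
    also have "\<dots> \<le> q * L * (first_const * sqrt (1 / real n))"
      using q0 L0 first_const_nonneg jn by (intro mult_left_mono mult_nonneg_nonneg real_sqrt_le_mono) auto
    finally have 3: "\<bar>step (law 0 s) f x - step (law 0 (real j / real n)) f x\<bar> \<le> q * L * first_const / sqrt (real n)"
      by (simp add: real_sqrt_divide)
    have 4: "\<bar>step (law 0 s) f x - H s\<bar> \<le> q * (L * jump_first / sqrt (real n) + (c * K powr \<alpha> + e1) / real n)"
      unfolding H_step[OF s(1)]
    proof (rule step_diff_le[OF f_bdd V_bdd law_prob[OF order_refl s(1)]])
      fix z
      have "\<bar>f z - V (t - s) z\<bar> \<le> q * \<bar>?A (U m) z - U m' z\<bar>"
        unfolding f_def V_def m'_def by (rule pd[OF AU_range U_range])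
      also have "\<bar>?A (U m) z - U m' z\<bar> \<le> L * jump_first / sqrt (real n) + (c * K powr \<alpha> + e1) / real n"
      proof -
        have x1: "0 \<le> L * jump_first / sqrt (real n)" using L0 jump_first_nonneg by simp
        have x2: "0 \<le> (c * K powr \<alpha> + e1) / real n" using c e1 by simp
        have "\<bar>?A (U m) z - U m z\<bar> \<le> L * jump_first / sqrt (real n)"
          by (rule step_scaled_close[OF U_bdd U_lip n])
        moreover have "\<bar>?A (U m) z - U (Suc m) z\<bar> \<le> (c * K powr \<alpha> + e1) / real n"
        proof -
          have "real n * g m z \<le> c * K powr \<alpha> + e1" using ga[of z] f_range[of z] by linarith
          then have "g m z \<le> (c * K powr \<alpha> + e1) / real n" using n by (simp add: le_divide_eq mult.commute)
          then show ?thesis using g_range[of m z] by (simp add: g_def)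
        qed
        ultimately show ?thesis using m' x1 x2 by auto
      qed
      finally show "\<bar>f z - V (t - s) z\<bar> \<le> q * (L * jump_first / sqrt (real n) + (c * K powr \<alpha> + e1) / real n)"
        using q0 by (simp add: mult_left_mono)
    qed
    show ?thesis using 1 2 3 4 unfolding \<eta>_def by linarith
  qed
  define F where "F s = (\<Sum>j<k. real n * a j * indicator {real j / real n..<real (Suc j) / real n} s)" for s
  have F_hb: "has_bochner_integral lborel F (\<Sum>j<k. a j)"
  proof -
    have "has_bochner_integral lborel F (\<Sum>j<k. real n * a j * (1 / real n))"
      unfolding F_def
    proof (intro has_bochner_integral_sum has_bochner_integral_mult_right)
      fix j
      have "measure lborel {real j / real n..<real (Suc j) / real n} = 1 / real n"
        by (simp add: divide_right_mono diff_divide_distrib[symmetric])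
      moreover have "emeasure lborel {real j / real n..<real (Suc j) / real n} < \<infinity>"
        by (subst emeasure_lborel_Ico) (auto intro: divide_right_mono)
      ultimately show "has_bochner_integral lborel (indicat_real {real j / real n..<real (Suc j) / real n}) (1 / real n)"
        using has_bochner_integral_real_indicator[of "{real j / real n..<real (Suc j) / real n}" lborel] by simp
    qed
    then show ?thesis using n by simp
  qed
  \<comment> \<open>On the incomplete last cell from \<open>k / n\<close> to \<open>t\<close> the
    step function is \<open>0\<close>, and only the size of \<open>H\<close> is used.\<close>
  have point: "\<bar>F s - indicator {0..t} s * H s\<bar> \<le> \<eta> * indicator {0..t} s + c * K powr \<alpha> * indicator {real k / real n..t} s" for s
  proof -
    have zero: "F s = 0" if "s < 0 \<or> real k / real n \<le> s"
    proof -
      have "s \<notin> {real j / real n..<real (Suc j) / real n}" if "j < k" for j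
      proof -
        have "0 \<le> real j / real n" "real (Suc j) / real n \<le> real k / real n" using \<open>j < k\<close> by (auto intro: divide_right_mono)
        then have "s < real j / real n \<or> real (Suc j) / real n \<le> s"
          using \<open>s < 0 \<or> real k / real n \<le> s\<close> by linarith
        then show ?thesis by auto
      qed
      then show ?thesis unfolding F_def by simp
    qed
    consider "s < 0 \<or> t < s" | "0 \<le> s" "s \<le> t" "real k / real n \<le> s" | "0 \<le> s" "s \<le> t" "s < real k / real n" by linarith
    then show ?thesis
    proof cases
      case 1
      then have "F s = 0" using zero kt by auto
      moreover have "0 \<le> c * K powr \<alpha>" using c by simp
      ultimately show ?thesis using 1 by (auto simp: indicator_def)
    next
      case 2
      then have "F s = 0" using zero by auto
      then show ?thesis using 2 H_bound[of s] \<eta>0 by simp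
    next
      case 3
      define j where "j = nat \<lfloor>real n * s\<rfloor>"
      have "real n * s < real k" using 3 n by (simp add: less_divide_eq mult.commute)
      moreover have "real j \<le> real n * s" using 3 unfolding j_def by simp
      ultimately have jk: "j < k" by linarith
      have "F s = (\<Sum>i<k. real n * a i * (if i = j then 1 else 0))"
        unfolding F_def floor_interval_indicator[OF n 3(1)] j_def ..
      also have "\<dots> = real n * a j" using jk by (simp add: if_distrib cong: if_cong)
      finally show ?thesis using local[OF 3(1,2) j_def jk] 3 by simp
    qed
  qed
  have "\<bar>(\<Sum>j<k. a j) - (\<integral>s. indicator {0..t} s * H s \<partial>lborel)\<bar> = \<bar>\<integral>s. F s - indicator {0..t} s * H s \<partial>lborel\<bar>"
    using F_hb H_int by (simp add: has_bochner_integral_iff)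
  also have "\<dots> \<le> (\<integral>s. \<eta> * indicator {0..t} s + c * K powr \<alpha> * indicator {real k / real n..t} s \<partial>lborel)"
  proof (rule abs_integral_le_integral[OF _ _ point])
    show "integrable lborel (\<lambda>s. F s - indicator {0..t} s * H s)"
      using F_hb H_int by (auto simp: has_bochner_integral_iff)
    show "integrable lborel (\<lambda>s. \<eta> * indicator {0..t} s + c * K powr \<alpha> * indicator {real k / real n..t} s)"
      by (intro Bochner_Integration.integrable_add integrable_mult_right integrable_real_indicator)
        (auto simp: emeasure_lborel_Icc_eq)
  qed
  also have "\<dots> = \<eta> * t + c * K powr \<alpha> * (t - real k / real n)"
  proof -
    have i: "integrable lborel (indicat_real {a..b})" for a b :: real
      by (intro integrable_real_indicator) (auto simp: emeasure_lborel_Icc_eq)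
    show ?thesis
      by (subst Bochner_Integration.integral_add; (intro integrable_mult_right i)?) (use t kt in simp)
  qed
  also have "\<dots> \<le> \<eta> * 1 + c * K powr \<alpha> * (1 / real n)"
    using \<eta>0 t kt c by (intro add_mono mult_left_mono) auto
  finally have S: "\<bar>(\<Sum>j<k. a j) - (\<integral>s. indicator {0..t} s * H s \<partial>lborel)\<bar> \<le> \<eta> + c * K powr \<alpha> / real n" by simp
  have \<phi>b: "bdd_meas K \<phi>" using U_bdd[of 0] by (simp add: U0)
  have P1: "\<bar>(?A ^^ k) \<phi> x - step (law 0 (real k / real n)) \<phi> x\<bar> \<le> e1" by (rule clt1[OF kn \<phi>b \<phi>(2)])
  have "\<bar>step (law 0 t) \<phi> x - step (law 0 (real k / real n)) \<phi> x\<bar> \<le> L * (first_const * sqrt (t - real k / real n))"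
    by (rule step_law_time[OF \<phi>b \<phi>(2) _ kt(1)]) simp
  also have "\<dots> \<le> L * (first_const * sqrt (1 / real n))"
    using L0 first_const_nonneg kt by (intro mult_left_mono real_sqrt_le_mono) auto
  finally have P2: "\<bar>step (law 0 t) \<phi> x - step (law 0 (real k / real n)) \<phi> x\<bar> \<le> L * first_const / sqrt (real n)"
    by (simp add: real_sqrt_divide)
  have "U k x = (?A ^^ k) \<phi> x - (\<Sum>j<k. a j)" unfolding a_def by (rule duhamel)
  then have "\<bar>U k x - (step (law 0 t) \<phi> x - (\<integral>s. indicator {0..t} s * H s \<partial>lborel))\<bar>
      \<le> e1 + L * first_const / sqrt (real n) + (\<eta> + c * K powr \<alpha> / real n)"
    using P1 P2 S by linarith
  then show ?thesis unfolding k_def H_def V_def \<eta>_def by simp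
qed

text \<open>Gronwall's inequality in the norm weighted by \<open>exp (- r t)\<close>: for large \<open>r\<close> the integral
  term of the mild equation is a contraction with factor \<open>1 / 2\<close>.\<close>

lemma mild_solution_stability:
  fixes U u :: "real \<Rightarrow> real ^ 'd \<Rightarrow> real"
  assumes c: "0 \<le> c" and \<eta>: "0 \<le> \<eta>"
    and U: "\<And>r z. 0 \<le> r \<Longrightarrow> 0 \<le> U r z \<and> U r z \<le> K" and u: "\<And>r z. 0 \<le> r \<Longrightarrow> 0 \<le> u r z \<and> u r z \<le> K"
    and Um: "(\<lambda>(r, z). U (max 0 r) z) \<in> borel_measurable (borel \<Otimes>\<^sub>M borel)"
    and um: "(\<lambda>(r, z). u (max 0 r) z) \<in> borel_measurable (borel \<Otimes>\<^sub>M borel)"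
    and U_eq: "\<And>t x. 0 \<le> t \<Longrightarrow> t \<le> 1 \<Longrightarrow> \<bar>U t x - (p t x -
      (\<integral>s. indicator {0..t} s * (\<integral>\<omega>. c * U (max 0 (t - s)) (x + W (max 0 s) \<omega>) powr \<alpha> \<partial>B) \<partial>lborel))\<bar> \<le> \<eta>"
    and u_eq: "\<And>t x. 0 \<le> t \<Longrightarrow> t \<le> 1 \<Longrightarrow> u t x = p t x -
      (\<integral>s. indicator {0..t} s * (\<integral>\<omega>. c * u (max 0 (t - s)) (x + W (max 0 s) \<omega>) powr \<alpha> \<partial>B) \<partial>lborel)"
  shows "\<bar>U 1 x - u 1 x\<bar> \<le> 2 * \<eta> * exp (2 * (c * \<alpha> * K powr (\<alpha> - 1) + 1))"
proof -
  define q where "q = c * \<alpha> * K powr (\<alpha> - 1)"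
  \<comment> \<open>Gives \<open>q / r \<le> 1 / 2\<close>; the \<open>+ 1\<close> keeps
    \<open>r\<close> positive when \<open>q = 0\<close>.\<close>
  define r where "r = 2 * (q + 1)"
  have al: "1 \<le> \<alpha>" using alpha12 by simp
  have q0: "0 \<le> q" using c al by (simp add: q_def)
  have r: "0 < r" "q / r \<le> 1 / 2" using q0 by (auto simp: r_def divide_le_eq)
  have K0: "0 \<le> K" using U[of 0 0] by simp
  have powr_le: "v powr \<alpha> \<le> K powr \<alpha>" if "0 \<le> v" "v \<le> K" for v using that al by (intro powr_mono2) auto
  have sec: "v t \<in> borel_measurable borel" if "(\<lambda>(r, z). v (max 0 r) z) \<in> borel_measurable (borel \<Otimes>\<^sub>M borel)" "0 \<le> t"
    for v :: "real \<Rightarrow> real ^ 'd \<Rightarrow> real" and t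
    using measurable_compose[OF measurable_Pair1' that(1), of t] that(2) by simp
  have bd: "bdd_meas (c * K powr \<alpha>) (\<lambda>z. c * v t z powr \<alpha>)"
    if "(\<lambda>(r, z). v (max 0 r) z) \<in> borel_measurable (borel \<Otimes>\<^sub>M borel)" "\<And>r z. 0 \<le> r \<Longrightarrow> 0 \<le> v r z \<and> v r z \<le> K" "0 \<le> t"
    for v :: "real \<Rightarrow> real ^ 'd \<Rightarrow> real" and t
  proof -
    have "\<bar>c * v t z powr \<alpha>\<bar> \<le> c * K powr \<alpha>" for z
      using c powr_le[of "v t z"] that(2)[OF that(3), of z] by (simp add: abs_mult mult_left_mono)
    then show ?thesis using sec[OF that(1,3)] by (simp add: bdd_meas_def)
  qed
  have I_step: "(\<integral>\<omega>. c * v (max 0 (t - s)) (x + W (max 0 s) \<omega>) powr \<alpha> \<partial>B) = step (law 0 s) (\<lambda>z. c * v (t - s) z powr \<alpha>) x"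
    if "(\<lambda>(r, z). v (max 0 r) z) \<in> borel_measurable (borel \<Otimes>\<^sub>M borel)" "\<And>r z. 0 \<le> r \<Longrightarrow> 0 \<le> v r z \<and> v r z \<le> K" "0 \<le> s" "s \<le> t"
    for v :: "real \<Rightarrow> real ^ 'd \<Rightarrow> real" and t s x
    using that bd[OF that(1,2), of "t - s"] by (subst step_law_zero) (auto simp: bdd_meas_def)
  have I_int: "integrable lborel (\<lambda>s. indicator {0..t} s * (\<integral>\<omega>. c * v (max 0 (t - s)) (x + W (max 0 s) \<omega>) powr \<alpha> \<partial>B))"
    if v: "(\<lambda>(r, z). v (max 0 r) z) \<in> borel_measurable (borel \<Otimes>\<^sub>M borel)" "\<And>r z. 0 \<le> r \<Longrightarrow> 0 \<le> v r z \<and> v r z \<le> K" and t: "0 \<le> t"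
    for v :: "real \<Rightarrow> real ^ 'd \<Rightarrow> real" and t x
  proof (rule bounded_on_Icc_integrable)
    have "(\<lambda>y. (\<lambda>(r, z). v (max 0 r) z) (t - fst y, snd y)) \<in> borel_measurable ((borel :: real measure) \<Otimes>\<^sub>M borel)"
      by (rule measurable_compose[OF _ v(1)]) measurable
    then have [measurable]: "(\<lambda>y. v (max 0 (t - fst y)) (snd y)) \<in> borel_measurable (borel \<Otimes>\<^sub>M borel)"
      by simp
    have "(\<lambda>(s, z). c * v (max 0 (t - s)) z powr \<alpha>) \<in> borel_measurable (borel \<Otimes>\<^sub>M borel)"
      unfolding split_beta by measurable
    then show "(\<lambda>s. \<integral>\<omega>. c * v (max 0 (t - s)) (x + W (max 0 s) \<omega>) powr \<alpha> \<partial>B) \<in> borel_measurable borel"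
      by (rule W_integral_measurable)
    show "\<bar>\<integral>\<omega>. c * v (max 0 (t - s)) (x + W (max 0 s) \<omega>) powr \<alpha> \<partial>B\<bar> \<le> c * K powr \<alpha>" if "0 \<le> s" "s \<le> t" for s
    proof -
      have ts: "0 \<le> t - s" using that(2) by linarith
      have "bdd_meas (c * K powr \<alpha>) (step (law 0 s) (\<lambda>z. c * v (t - s) z powr \<alpha>))"
        by (rule step_bdd_meas[OF bd[OF v ts] law_prob[OF order_refl that(1)]])
      moreover have "(\<integral>\<omega>. c * v (max 0 (t - s)) (x + W (max 0 s) \<omega>) powr \<alpha> \<partial>B) = step (law 0 s) (\<lambda>z. c * v (t - s) z powr \<alpha>) x"
        by (rule I_step[OF v that])
      ultimately show ?thesis unfolding bdd_meas_def by simp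
    qed
  qed
  define d where "d t z = exp (- r * t) * \<bar>U t z - u t z\<bar>" for t z
  define S where "S = {d t z | t z. 0 \<le> t \<and> t \<le> 1}"
  have d_le: "d t z \<le> K" if "0 \<le> t" for t z
  proof -
    have "\<bar>U t z - u t z\<bar> \<le> K" using U[OF that, of z] u[OF that, of z] by (simp add: abs_le_iff)
    moreover have "exp (- r * t) \<le> 1" using r that by simp
    ultimately show ?thesis unfolding d_def using mult_mono[of "exp (- r * t)" 1 "\<bar>U t z - u t z\<bar>" K] by simp
  qed
  have bdd: "bdd_above S" unfolding S_def using d_le by (intro bdd_aboveI[of _ K]) auto
  define D where "D = Sup S"
  have dD: "d t z \<le> D" if "0 \<le> t" "t \<le> 1" for t z
    unfolding D_def by (rule cSup_upper[OF _ bdd]) (use that in \<open>auto simp: S_def\<close>)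
  have "0 \<le> d 0 0" by (simp add: d_def)
  then have D0: "0 \<le> D" using dD[OF order_refl zero_le_one, of 0] by linarith
  have diff_D: "\<bar>U t z - u t z\<bar> \<le> D * exp (r * t)" if "0 \<le> t" "t \<le> 1" for t z
  proof -
    have "\<bar>U t z - u t z\<bar> = d t z * exp (r * t)" by (simp add: d_def exp_minus)
    then show ?thesis using dD[OF that, of z] by (simp add: mult_right_mono)
  qed
  have improve: "d t x \<le> \<eta> + D / 2" if t: "0 \<le> t" "t \<le> 1" for t x
  proof -
    let ?I = "\<lambda>v s. \<integral>\<omega>. c * v (max 0 (t - s)) (x + W (max 0 s) \<omega>) powr \<alpha> \<partial>B"
    have iU: "integrable lborel (\<lambda>s. indicator {0..t} s * ?I U s)" by (rule I_int[OF Um U t(1)])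
    have iu: "integrable lborel (\<lambda>s. indicator {0..t} s * ?I u s)" by (rule I_int[OF um u t(1)])
    have hb: "has_bochner_integral lborel (\<lambda>s. q * D * (exp (r * (t - s)) * indicator {0..t} s)) (q * D * ((exp (r * t) - 1) / r))"
      by (intro has_bochner_integral_mult_right exp_kernel_integral t r)
    have "\<bar>(\<integral>s. indicator {0..t} s * ?I U s \<partial>lborel) - (\<integral>s. indicator {0..t} s * ?I u s \<partial>lborel)\<bar> =
        \<bar>\<integral>s. indicator {0..t} s * ?I U s - indicator {0..t} s * ?I u s \<partial>lborel\<bar>"
      using iU iu by simp
    also have "\<dots> \<le> (\<integral>s. q * D * (exp (r * (t - s)) * indicator {0..t} s) \<partial>lborel)"
    proof (rule abs_integral_le_integral[OF Bochner_Integration.integrable_diff[OF iU iu] integrable.intros[OF hb]])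
      fix s
      show "\<bar>indicator {0..t} s * ?I U s - indicator {0..t} s * ?I u s\<bar> \<le> q * D * (exp (r * (t - s)) * indicator {0..t} s)"
      proof (cases "0 \<le> s \<and> s \<le> t")
        case True
        then have ts: "0 \<le> t - s" "t - s \<le> 1" and s: "0 \<le> s" "s \<le> t" using t by auto
        have "\<bar>step (law 0 s) (\<lambda>z. c * U (t - s) z powr \<alpha>) x - step (law 0 s) (\<lambda>z. c * u (t - s) z powr \<alpha>) x\<bar> \<le> q * (D * exp (r * (t - s)))"
        proof (rule step_diff_le[OF bd[OF Um U ts(1)] bd[OF um u ts(1)] law_prob[OF order_refl s(1)]])
          fix z
          have "\<bar>c * U (t - s) z powr \<alpha> - c * u (t - s) z powr \<alpha>\<bar> = c * \<bar>U (t - s) z powr \<alpha> - u (t - s) z powr \<alpha>\<bar>"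
            using c by (simp add: right_diff_distrib[symmetric] abs_mult)
          also have "\<dots> \<le> c * (\<alpha> * K powr (\<alpha> - 1) * \<bar>U (t - s) z - u (t - s) z\<bar>)"
            using U[OF ts(1), of z] u[OF ts(1), of z] c by (intro mult_left_mono powr_diff_le al) auto
          also have "\<dots> = q * \<bar>U (t - s) z - u (t - s) z\<bar>" by (simp add: q_def)
          also have "\<dots> \<le> q * (D * exp (r * (t - s)))" by (intro mult_left_mono diff_D ts q0)
          finally show "\<bar>c * U (t - s) z powr \<alpha> - c * u (t - s) z powr \<alpha>\<bar> \<le> q * (D * exp (r * (t - s)))" .
        qed
        moreover have "?I U s = step (law 0 s) (\<lambda>z. c * U (t - s) z powr \<alpha>) x" by (rule I_step[OF Um U s])
        moreover have "?I u s = step (law 0 s) (\<lambda>z. c * u (t - s) z powr \<alpha>) x" by (rule I_step[OF um u s])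
        ultimately have "\<bar>?I U s - ?I u s\<bar> \<le> q * (D * exp (r * (t - s)))" by (simp only:)
        then show ?thesis using True by (simp add: mult.assoc)
      next
        case False
        then show ?thesis by (auto simp: indicator_def)
      qed
    qed
    also have "\<dots> = q * D * ((exp (r * t) - 1) / r)" using hb by (rule has_bochner_integral_integral_eq)
    also have "\<dots> = (q / r) * (D * (exp (r * t) - 1))" by simp
    also have "\<dots> \<le> (1 / 2) * (D * exp (r * t))"
      using r q0 D0 t by (intro mult_mono mult_left_mono) (auto intro!: mult_nonneg_nonneg)
    finally have I: "\<bar>(\<integral>s. indicator {0..t} s * ?I U s \<partial>lborel) - (\<integral>s. indicator {0..t} s * ?I u s \<partial>lborel)\<bar> \<le> D / 2 * exp (r * t)" by simp
    have "\<bar>U t x - u t x\<bar> \<le> \<eta> + D / 2 * exp (r * t)"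
      using U_eq[OF t, of x] u_eq[OF t, of x] I by linarith
    also have "\<dots> \<le> \<eta> * exp (r * t) + D / 2 * exp (r * t)"
      using \<eta> r t mult_left_mono[of 1 "exp (r * t)" \<eta>] by simp
    finally have "\<bar>U t x - u t x\<bar> \<le> (\<eta> + D / 2) * exp (r * t)" by (simp add: distrib_right)
    then have "exp (- r * t) * \<bar>U t x - u t x\<bar> \<le> exp (- r * t) * ((\<eta> + D / 2) * exp (r * t))" by (intro mult_left_mono) auto
    also have "\<dots> = \<eta> + D / 2" by (simp add: exp_minus)
    finally show ?thesis by (simp add: d_def)
  qed
  \<comment> \<open>The weighted supremum is bounded by half of itself plus \<open>\<eta>\<close>;
    this can be solved for \<open>D\<close> because the a priori bound \<open>K\<close> makes the
    supremum finite.\<close>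
  have "D \<le> \<eta> + D / 2"
    unfolding D_def
  proof (rule cSup_least)
    have "d 0 0 \<in> S" unfolding S_def by force
    then show "S \<noteq> {}" by blast
    show "y \<le> \<eta> + Sup S / 2" if "y \<in> S" for y
      using that improve unfolding S_def D_def by auto
  qed
  then have "D \<le> 2 * \<eta>" by simp
  then have le: "D * exp (r * 1) \<le> 2 * \<eta> * exp (r * 1)" by (intro mult_right_mono) auto
  have "\<bar>U 1 x - u 1 x\<bar> \<le> D * exp (r * 1)" by (rule diff_D) auto
  from order_trans[OF this le] show ?thesis by (simp add: r_def q_def)
qed

theorem scheme_converges:
  fixes u :: "real \<Rightarrow> real ^ 'd \<Rightarrow> real" and G :: "nat \<Rightarrow> real \<Rightarrow> real" and U :: "nat \<Rightarrow> nat \<Rightarrow> real ^ 'd \<Rightarrow> real"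
  assumes c: "0 \<le> c" and \<phi>: "\<And>x. 0 \<le> \<phi> x \<and> \<phi> x \<le> K" "lip L \<phi>"
    and sol: "log_laplace_solution B W c \<alpha> \<phi> u" and uK: "\<And>t x. 0 \<le> t \<Longrightarrow> u t x \<le> K"
    and G0: "\<And>n. G n 0 = 0"
    and G: "\<forall>\<^sub>F n in sequentially. \<forall>v w. 0 \<le> v \<longrightarrow> v \<le> w \<longrightarrow> w \<le> K \<longrightarrow> 0 \<le> G n w - G n v \<and> G n w - G n v \<le> w - v"
    and Gc: "\<And>e. 0 < e \<Longrightarrow> \<forall>\<^sub>F n in sequentially. \<forall>v. 0 \<le> v \<longrightarrow> v \<le> K \<longrightarrow> \<bar>real n * (v - G n v) - c * v powr \<alpha>\<bar> \<le> e"
    and U0: "\<And>n. U n 0 = \<phi>" and USuc: "\<And>n k x. U n (Suc k) x = G n (step (scaled_jump n) (U n k) x)"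
  shows "(\<lambda>n. U n n y) \<longlonglongrightarrow> u 1 y"
proof (rule LIMSEQ_I)
  fix e :: real assume e: "0 < e"
  define q where "q = c * \<alpha> * K powr (\<alpha> - 1)"
  \<comment> \<open>\<open>mild_solution_stability\<close> multiplies the error by
    \<open>2 * exp (2 * (q + 1))\<close>, so the final error is \<open>e / 2\<close>. Half of
    \<open>\<eta>\<close> is reserved for \<open>3 * e1\<close>, the other half for
    \<open>rest\<close>.\<close>
  define \<eta> where "\<eta> = e / (4 * exp (2 * (q + 1)))"
  have \<eta>: "0 < \<eta>" using e by (simp add: \<eta>_def)
  define e1 where "e1 = \<eta> / 6"
  have e1: "0 < e1" using \<eta> by (simp add: e1_def)
  have L0: "0 \<le> L" using \<phi> by (simp add: lip_def)
  have K0: "0 \<le> K" using \<phi>(1)[of 0] by simp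
  have q0: "0 \<le> q" using c alpha12 by (simp add: q_def)
  have qL0: "0 \<le> q * L" using q0 L0 by simp
  have ev1: "\<forall>\<^sub>F n in sequentially. \<forall>j\<le>n. \<forall>f x. bdd_meas K f \<longrightarrow> lip L f \<longrightarrow>
      \<bar>(step (scaled_jump n) ^^ j) f x - step (law 0 (real j / real n)) f x\<bar> \<le> e1"
    by (rule clt_uniform[OF L0 e1])
  \<comment> \<open>A second instance for the nonlinear terms, whose Lipschitz constant
    \<open>q * L\<close> comes from \<open>powr_diff_le\<close>.\<close>
  have ev2: "\<forall>\<^sub>F n in sequentially. \<forall>j\<le>n. \<forall>f x. bdd_meas (c * K powr \<alpha>) f \<longrightarrow> lip (q * L) f \<longrightarrow>
      \<bar>(step (scaled_jump n) ^^ j) f x - step (law 0 (real j / real n)) f x\<bar> \<le> e1"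
    by (rule clt_uniform[OF qL0 e1])
  define rest where "rest n = L * first_const / sqrt (real n) + q * L * first_const / sqrt (real n) +
      q * (L * jump_first / sqrt (real n) + (c * K powr \<alpha> + e1) / real n) + c * K powr \<alpha> / real n" for n
  have "rest \<longlonglongrightarrow> 0" unfolding rest_def by real_asymp
  then have ev3: "\<forall>\<^sub>F n in sequentially. rest n < \<eta> / 2" by (rule order_tendstoD(2)) (use \<eta> in auto)
  have um: "(\<lambda>(r, z). u (max 0 r) z) \<in> borel_measurable (borel \<Otimes>\<^sub>M borel)"
  proof -
    have u: "(\<lambda>(t, x). u t x) \<in> borel_measurable (restrict_space borel {0..} \<Otimes>\<^sub>M borel)"
      using sol by (simp add: log_laplace_solution_def)
    have "(\<lambda>y. (max 0 (fst y), snd y)) \<in> (borel \<Otimes>\<^sub>M borel) \<rightarrow>\<^sub>M (restrict_space borel {0::real..} \<Otimes>\<^sub>M (borel :: (real ^ 'd) measure))"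
      by (intro measurable_Pair measurable_restrict_space2) auto
    from measurable_compose[OF this u] show ?thesis by (simp add: split_beta)
  qed
  have u_range: "0 \<le> u t x \<and> u t x \<le> K" if "0 \<le> t" for t x
    using sol uK[OF that] that unfolding log_laplace_solution_def by blast
  have \<phi>m: "\<phi> \<in> borel_measurable borel" by (rule lip_measurable[OF \<phi>(2)])
  have u_eq: "u t x = step (law 0 t) \<phi> x -
      (\<integral>s. indicator {0..t} s * (\<integral>\<omega>. c * u (max 0 (t - s)) (x + W (max 0 s) \<omega>) powr \<alpha> \<partial>B) \<partial>lborel)" if "0 \<le> t" for t x
  proof -
    have "u t x = (\<integral>\<omega>. \<phi> (x + W t \<omega>) \<partial>B) - c * (LINT s:{0..t}|lborel. (\<integral>\<omega>. u (t - s) (x + W s \<omega>) powr \<alpha> \<partial>B))"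
      using sol that unfolding log_laplace_solution_def by blast
    also have "c * (LINT s:{0..t}|lborel. (\<integral>\<omega>. u (t - s) (x + W s \<omega>) powr \<alpha> \<partial>B)) =
        (\<integral>s. c * (indicator {0..t} s * (\<integral>\<omega>. u (t - s) (x + W s \<omega>) powr \<alpha> \<partial>B)) \<partial>lborel)"
      by (simp add: set_lebesgue_integral_def)
    also have "\<dots> = (\<integral>s. indicator {0..t} s * (\<integral>\<omega>. c * u (max 0 (t - s)) (x + W (max 0 s) \<omega>) powr \<alpha> \<partial>B) \<partial>lborel)"
      by (rule Bochner_Integration.integral_cong) (auto simp: indicator_def max_def)
    finally show ?thesis using that \<phi>m by (simp add: step_law_zero)
  qed
  show "\<exists>no. \<forall>n\<ge>no. norm (U n n y - u 1 y) < e"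
  proof -
    have "\<forall>\<^sub>F n in sequentially. norm (U n n y - u 1 y) < e"
      using ev1 ev2 ev3 G Gc[OF e1] eventually_gt_at_top[of 0]
    proof eventually_elim
      case (elim n)
      have sch: "scheme (G n) K L (scaled_jump n) \<phi> (U n)"
        by unfold_locales (use elim(4) G0 U0 USuc \<phi> scaled_jump_prob in auto)
      interpret scheme "G n" K L "scaled_jump n" \<phi> "U n" by (rule sch)
      have n: "0 < n" by fact
      define V where "V t = U n (nat \<lfloor>real n * t\<rfloor>)" for t
      have "\<bar>V 1 y - u 1 y\<bar> \<le> 2 * \<eta> * exp (2 * (c * \<alpha> * K powr (\<alpha> - 1) + 1))"
      proof (rule mild_solution_stability[OF c less_imp_le[OF \<eta>] _ u_range _ um _ u_eq])
        show "0 \<le> V r z \<and> V r z \<le> K" for r z unfolding V_def using U_range by simp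
        have Um: "U n i \<in> borel_measurable borel" for i using U_bdd by (simp add: bdd_meas_def)
        have "(\<lambda>y. U n (nat \<lfloor>real n * max 0 (fst y)\<rfloor>) (snd y)) \<in> borel_measurable ((borel :: real measure) \<Otimes>\<^sub>M borel)"
          by (rule measurable_compose_countable[where f = "\<lambda>i y. U n i (snd y)"])
            (use measurable_compose[OF measurable_snd Um] in \<open>measurable\<close>)
        then show "(\<lambda>(r, z). V (max 0 r) z) \<in> borel_measurable (borel \<Otimes>\<^sub>M borel)"
          unfolding V_def split_beta .
        fix t x assume t: "0 \<le> t" "t \<le> (1::real)"
        have "(\<integral>s. indicator {0..t} s * (\<integral>\<omega>. c * V (max 0 (t - s)) (x + W (max 0 s) \<omega>) powr \<alpha> \<partial>B) \<partial>lborel) =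
          (\<integral>s. indicator {0..t} s * (\<integral>\<omega>. c * U n (nat \<lfloor>real n * (t - s)\<rfloor>) (x + W (max 0 s) \<omega>) powr \<alpha> \<partial>B) \<partial>lborel)"
          unfolding V_def by (rule Bochner_Integration.integral_cong) (auto simp: indicator_def max_def)
        moreover have "\<bar>U n (nat \<lfloor>real n * t\<rfloor>) x - (step (law 0 t) \<phi> x -
          (\<integral>s. indicator {0..t} s * (\<integral>\<omega>. c * U n (nat \<lfloor>real n * (t - s)\<rfloor>) (x + W (max 0 s) \<omega>) powr \<alpha> \<partial>B) \<partial>lborel))\<bar>
          \<le> 3 * e1 + L * first_const / sqrt (real n) + q * L * first_const / sqrt (real n) +
            q * (L * jump_first / sqrt (real n) + (c * K powr \<alpha> + e1) / real n) + c * K powr \<alpha> / real n"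
          unfolding q_def
          by (rule scheme_mild_error[OF sch n c less_imp_le[OF e1] _ _ _ t]) (use elim(1,2,5) in \<open>auto simp: q_def\<close>)
        then have "\<bar>U n (nat \<lfloor>real n * t\<rfloor>) x - (step (law 0 t) \<phi> x -
          (\<integral>s. indicator {0..t} s * (\<integral>\<omega>. c * U n (nat \<lfloor>real n * (t - s)\<rfloor>) (x + W (max 0 s) \<omega>) powr \<alpha> \<partial>B) \<partial>lborel))\<bar> \<le> \<eta>"
          using elim(3) unfolding rest_def e1_def by linarith
        ultimately show "\<bar>V t x - (step (law 0 t) \<phi> x -
          (\<integral>s. indicator {0..t} s * (\<integral>\<omega>. c * V (max 0 (t - s)) (x + W (max 0 s) \<omega>) powr \<alpha> \<partial>B) \<partial>lborel))\<bar> \<le> \<eta>"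
          by (simp only: V_def)
      qed auto
      also have "\<dots> = e / 2" unfolding \<eta>_def q_def by simp
      also have "\<dots> < e" using e by simp
      finally show ?case by (simp add: V_def)
    qed
    then show ?thesis by (simp add: eventually_sequentially)
  qed
qed

end

section \<open>Visits of the branching random walk\<close>

text \<open>The subtree of the \<open>i\<close>-th child. Its root carries the displacement of that child, which
  \<open>position\<close> ignores; \<open>child_hits\<close> below adds it to the starting point.\<close>

definition subtree :: "nat \<Rightarrow> (nat list \<Rightarrow> 'c) \<Rightarrow> nat list \<Rightarrow> 'c" where
  "subtree i \<omega> v = \<omega> (i # v)"

definition hits :: "(real ^ 'd) set \<Rightarrow> nat \<Rightarrow> real ^ 'd \<Rightarrow> (nat list \<Rightarrow> nat \<times> (real ^ 'd)) \<Rightarrow> bool" where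
  "hits A n a \<omega> \<longleftrightarrow> (\<exists>w\<in>generation \<omega> n. position a \<omega> w \<in> A)"

definition child_hits :: "(real ^ 'd) set \<Rightarrow> nat \<Rightarrow> real ^ 'd \<Rightarrow> (nat list \<Rightarrow> nat \<times> (real ^ 'd)) \<Rightarrow> bool" where
  "child_hits A n a \<omega> \<longleftrightarrow> hits A n (a + snd (\<omega> [])) \<omega>"

lemma generation_0: "generation \<omega> 0 = {[]}"
  by (auto simp: generation_def)

lemma generation_Suc:
  "generation \<omega> (Suc n) = {i # w | i w. i < fst (\<omega> []) \<and> w \<in> generation (subtree i \<omega>) n}"
proof (intro set_eqI iffI)
  fix v assume "v \<in> generation \<omega> (Suc n)"
  then obtain i w where v: "v = i # w" "length w = n" and l: "\<And>k. k < Suc n \<Longrightarrow> (i # w) ! k < fst (\<omega> (take k (i # w)))"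
    by (auto simp: generation_def length_Suc_conv)
  have "i < fst (\<omega> [])" using l[of 0] by simp
  moreover have "w \<in> generation (subtree i \<omega>) n"
    using v l[of "Suc k" for k] by (auto simp: generation_def subtree_def)
  ultimately show "v \<in> {i # w | i w. i < fst (\<omega> []) \<and> w \<in> generation (subtree i \<omega>) n}" using v by blast
next
  fix v assume "v \<in> {i # w | i w. i < fst (\<omega> []) \<and> w \<in> generation (subtree i \<omega>) n}"
  then obtain i w where v: "v = i # w" "i < fst (\<omega> [])" "w \<in> generation (subtree i \<omega>) n" by blast
  have "(i # w) ! k < fst (\<omega> (take k (i # w)))" if "k < Suc n" for k
    using v that by (cases k) (auto simp: generation_def subtree_def)
  then show "v \<in> generation \<omega> (Suc n)" using v by (auto simp: generation_def)
qed

lemma position_Cons: "position a \<omega> (i # w) = position (a + snd (subtree i \<omega> [])) (subtree i \<omega>) w"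
proof -
  have "(\<Sum>k = 1..length (i # w). snd (\<omega> (take k (i # w)))) = (\<Sum>k = 0..length w. snd (\<omega> (i # take k w)))"
    using sum.shift_bounds_cl_Suc_ivl[of "\<lambda>k. snd (\<omega> (take k (i # w)))" 0 "length w"] by simp
  also have "\<dots> = snd (\<omega> [i]) + (\<Sum>k = 1..length w. snd (\<omega> (i # take k w)))"
    by (simp add: sum.atLeast_Suc_atMost)
  finally show ?thesis by (simp add: position_def subtree_def add.assoc)
qed

lemma hits_0: "hits A 0 a \<omega> \<longleftrightarrow> a \<in> A"
  by (simp add: hits_def generation_0 position_def)

lemma hits_Suc: "hits A (Suc n) a \<omega> \<longleftrightarrow> (\<exists>i<fst (\<omega> []). child_hits A n a (subtree i \<omega>))"
  unfolding hits_def child_hits_def generation_Suc by (auto simp: position_Cons) (metis position_Cons)+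

text \<open>Branching at the root reads only the offspring number there and the subtrees of the
  children. \<open>child_hits_prob\<close> uses this to resample the root displacement once it has
  served to shift the starting point.\<close>

lemma hits_root_displacement: "hits A n a (X([] := (k, z))) \<longleftrightarrow> hits A n a (X([] := (k, z')))"
proof (cases n)
  case (Suc m)
  have "subtree i (X([] := x)) = subtree i X" for i x by (auto simp: subtree_def)
  then show ?thesis by (simp add: Suc hits_Suc)
qed (simp add: hits_0)

section \<open>Branching at the root\<close>

context
  fixes p :: "nat pmf" and \<nu> :: "(real ^ 'd) measure" and A :: "(real ^ 'd) set"
  assumes \<nu>: "borel_prob \<nu>" and A: "A \<in> sets borel"
begin

private abbreviation (input) "mark \<equiv> measure_pmf p \<Otimes>\<^sub>M \<nu>"
private abbreviation (input) "M \<equiv> brw_measure p \<nu>"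

lemma mark_prob: "prob_space mark"
proof -
  interpret N: prob_space \<nu> using \<nu> by (simp add: borel_prob_def)
  interpret pair_prob_space "measure_pmf p" \<nu> ..
  show ?thesis by (rule prob_space_axioms)
qed

lemma M_prob: "prob_space M"
  unfolding brw_measure_def by (rule prob_space_PiM) (rule mark_prob)

lemma coord_measurable: "(\<lambda>\<omega>. \<omega> v) \<in> M \<rightarrow>\<^sub>M mark"
  unfolding brw_measure_def by measurable

lemma fst_coord_measurable: "(\<lambda>\<omega>. fst (\<omega> v)) \<in> M \<rightarrow>\<^sub>M count_space UNIV"
  using measurable_compose[OF coord_measurable measurable_fst] by (simp cong: measurable_cong_sets)

lemma snd_coord_measurable: "(\<lambda>\<omega>. snd (\<omega> v)) \<in> borel_measurable M"
  using measurable_compose[OF coord_measurable measurable_snd] \<nu> by (simp add: borel_prob_def cong: measurable_cong_sets)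

lemma subtree_measurable: "subtree i \<in> M \<rightarrow>\<^sub>M M"
proof -
  have "(\<lambda>\<omega>. \<lambda>v\<in>UNIV. \<omega> (i # v)) \<in> M \<rightarrow>\<^sub>M M"
    unfolding brw_measure_def by measurable
  then show ?thesis by (simp add: subtree_def[abs_def] restrict_def)
qed

lemma subtree_law: "distr M M (subtree i) = M"
proof -
  have "distr (Pi\<^sub>M UNIV (\<lambda>_. mark)) (\<Pi>\<^sub>M i\<in>UNIV. mark) (\<lambda>\<omega>. \<lambda>n\<in>UNIV. \<omega> (i # n)) = (\<Pi>\<^sub>M i\<in>UNIV. mark)"
    by (rule distr_PiM_reindex) (auto simp: mark_prob)
  then show ?thesis by (simp add: brw_measure_def subtree_def[abs_def] restrict_def)
qed

lemma hits_measurable: "Measurable.pred (borel \<Otimes>\<^sub>M M) (\<lambda>y. hits A n (fst y) (snd y))"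
proof (induction n)
  case 0
  have "Measurable.pred (borel \<Otimes>\<^sub>M M) (\<lambda>y. fst y \<in> A)" using A by measurable
  then show ?case by (simp add: hits_0)
next
  case (Suc n)
  have [measurable]: "(\<lambda>y. fst (snd y [])) \<in> (borel \<Otimes>\<^sub>M M) \<rightarrow>\<^sub>M count_space UNIV"
    by (rule measurable_compose[OF measurable_snd fst_coord_measurable])
  have "Measurable.pred (borel \<Otimes>\<^sub>M M) (\<lambda>y. child_hits A n (fst y) (subtree i (snd y)))" for i
  proof -
    have [measurable]: "(\<lambda>y. subtree i (snd y)) \<in> (borel \<Otimes>\<^sub>M M) \<rightarrow>\<^sub>M M"
      by (rule measurable_compose[OF measurable_snd subtree_measurable])
    have [measurable]: "(\<lambda>y. snd (subtree i (snd y) [])) \<in> borel_measurable (borel \<Otimes>\<^sub>M M)"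
      by (rule measurable_compose[OF _ snd_coord_measurable]) measurable
    have "(\<lambda>y. (fst y + snd (subtree i (snd y) []), subtree i (snd y))) \<in> (borel \<Otimes>\<^sub>M M) \<rightarrow>\<^sub>M (borel \<Otimes>\<^sub>M M)"
      by measurable
    from measurable_compose[OF this Suc] show ?thesis by (simp add: child_hits_def)
  qed
  note this[measurable]
  show ?case unfolding hits_Suc by measurable
qed

lemma hits_sets: "{\<omega> \<in> space M. hits A n a \<omega>} \<in> sets M"
proof -
  have "Measurable.pred M (\<lambda>\<omega>. hits A n a \<omega>)"
    using measurable_compose[OF measurable_Pair1' hits_measurable, of a] by simp
  then show ?thesis by simp
qed

lemma child_hits_pred: "Measurable.pred M (child_hits A n a)"
proof -
  note snd_coord_measurable[measurable]
  have "(\<lambda>\<omega>. (a + snd (\<omega> []), \<omega>)) \<in> M \<rightarrow>\<^sub>M (borel \<Otimes>\<^sub>M M)" by measurable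
  from measurable_compose[OF this hits_measurable] show ?thesis by (simp add: child_hits_def[abs_def])
qed

text \<open>Splits off the mark of the root, so that its offspring number and its displacement can
  be integrated separately.\<close>

lemma nn_integral_root:
  assumes F: "F \<in> borel_measurable M"
  shows "(\<integral>\<^sup>+\<omega>. F \<omega> \<partial>M) =
    (\<integral>\<^sup>+k. \<integral>\<^sup>+z. \<integral>\<^sup>+X. F (X([] := (k, z))) \<partial>(\<Pi>\<^sub>M v\<in>UNIV - {[]}. mark) \<partial>\<nu> \<partial>measure_pmf p)"
proof -
  let ?M' = "\<Pi>\<^sub>M v\<in>UNIV - {[] :: nat list}. mark"
  interpret N: prob_space \<nu> using \<nu> by (simp add: borel_prob_def)
  interpret M': prob_space ?M' by (rule prob_space_PiM) (rule mark_prob)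
  have eq: "distr (mark \<Otimes>\<^sub>M ?M') M (\<lambda>(x, X). X([] := x)) = M"
    using distr_pair_PiM_eq_PiM[of "UNIV - {[] :: nat list}" "\<lambda>_. mark" "[]"] mark_prob
    by (simp add: brw_measure_def insert_absorb)
  have m: "(\<lambda>(x, X). X([] := x)) \<in> (mark \<Otimes>\<^sub>M ?M') \<rightarrow>\<^sub>M M"
  proof -
    have "(\<lambda>(x, X). X([] := x)) \<in> (mark \<Otimes>\<^sub>M ?M') \<rightarrow>\<^sub>M PiM (insert [] (UNIV - {[]})) (\<lambda>_. mark)"
      unfolding split_beta by (rule measurable_fun_upd[where J = "UNIV - {[]}"]) auto
    then show ?thesis by (simp add: brw_measure_def insert_absorb)
  qed
  have Fm: "(\<lambda>y. F ((snd y)([] := fst y))) \<in> borel_measurable (mark \<Otimes>\<^sub>M ?M')"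
    using measurable_compose[OF m F] by (simp add: split_beta)
  have "(\<integral>\<^sup>+\<omega>. F \<omega> \<partial>M) = (\<integral>\<^sup>+y. F ((snd y)([] := fst y)) \<partial>(mark \<Otimes>\<^sub>M ?M'))"
    by (subst eq[symmetric], subst nn_integral_distr[OF m]) (use F in \<open>simp_all add: split_beta\<close>)
  also have "\<dots> = (\<integral>\<^sup>+x. \<integral>\<^sup>+X. F (X([] := x)) \<partial>?M' \<partial>mark)"
    using M'.nn_integral_fst[OF Fm] by simp
  also have "\<dots> = (\<integral>\<^sup>+k. \<integral>\<^sup>+z. \<integral>\<^sup>+X. F (X([] := (k, z))) \<partial>?M' \<partial>\<nu> \<partial>measure_pmf p)"
  proof -
    have "(\<lambda>x. \<integral>\<^sup>+X. F (X([] := x)) \<partial>?M') \<in> borel_measurable mark"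
      using M'.borel_measurable_nn_integral_fst[OF Fm] by simp
    from N.nn_integral_fst[OF this] show ?thesis by simp
  qed
  finally show ?thesis .
qed

text \<open>The displacement at the root of a child's subtree shifts the starting point and has no
  other effect on the visit, so it is averaged out independently of the rest: hence
  \<open>step \<nu>\<close>.\<close>

lemma child_hits_prob:
  "measure M {\<omega> \<in> space M. child_hits A n a \<omega>} = step \<nu> (\<lambda>b. measure M {\<omega> \<in> space M. hits A n b \<omega>}) a"
proof -
  let ?M' = "\<Pi>\<^sub>M v\<in>UNIV - {[] :: nat list}. mark"
  interpret P: prob_space M by (rule M_prob)
  interpret N: prob_space \<nu> using \<nu> by (simp add: borel_prob_def)
  interpret M': prob_space ?M' by (rule prob_space_PiM) (rule mark_prob)
  interpret S: pair_sigma_finite "measure_pmf p" \<nu> ..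
  have [measurable_cong]: "sets \<nu> = sets borel" using \<nu> by (simp add: borel_prob_def)
  define I where "I b \<omega> = (indicator {\<omega> \<in> space M. hits A n b \<omega>} \<omega> :: ennreal)" for b \<omega>
  have spM: "space M = UNIV"
    using borel_prob_space[OF \<nu>] by (simp add: brw_measure_def space_PiM space_pair_measure PiE_UNIV_domain)
  have I_eq: "I b \<omega> = (if hits A n b \<omega> then 1 else 0)" for b \<omega> by (simp add: I_def spM)
  have I_meas: "(\<lambda>y. I (fst y) (snd y)) \<in> borel_measurable (borel \<Otimes>\<^sub>M M)"
    unfolding I_eq using hits_measurable by measurable
  have Ib: "I b \<in> borel_measurable M" for b
    unfolding I_def using hits_sets by measurable
  define h where "h b = measure M {\<omega> \<in> space M. hits A n b \<omega>}" for b
  have h: "ennreal (h b) = (\<integral>\<^sup>+\<omega>. I b \<omega> \<partial>M)" for b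
    unfolding I_def h_def using hits_sets[of n b] by (simp add: P.emeasure_eq_measure)
  have h_meas: "h \<in> borel_measurable borel"
  proof -
    have "(\<lambda>b. \<integral>\<^sup>+\<omega>. I b \<omega> \<partial>M) \<in> borel_measurable borel"
      using P.borel_measurable_nn_integral_fst[OF I_meas] by simp
    then have "(\<lambda>b. enn2real (ennreal (h b))) \<in> borel_measurable borel" unfolding h by measurable
    then show ?thesis by (simp add: h_def[abs_def])
  qed
  let ?c = "\<lambda>\<omega>. I (a + snd (\<omega> [])) \<omega>"
  have c_meas: "?c \<in> borel_measurable M"
  proof -
    note snd_coord_measurable[measurable]
    have "(\<lambda>\<omega>. (a + snd (\<omega> []), \<omega>)) \<in> M \<rightarrow>\<^sub>M (borel \<Otimes>\<^sub>M M)" by measurable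
    from measurable_compose[OF this I_meas] show ?thesis by simp
  qed
  have "ennreal (measure M {\<omega> \<in> space M. child_hits A n a \<omega>}) = (\<integral>\<^sup>+\<omega>. ?c \<omega> \<partial>M)"
  proof -
    have "{\<omega> \<in> space M. child_hits A n a \<omega>} \<in> sets M" using child_hits_pred[of n a] by simp
    moreover have "?c \<omega> = indicator {\<omega> \<in> space M. child_hits A n a \<omega>} \<omega>" for \<omega>
      by (simp add: I_eq child_hits_def spM)
    ultimately show ?thesis by (simp add: P.emeasure_eq_measure)
  qed
  also have "\<dots> = (\<integral>\<^sup>+k. \<integral>\<^sup>+z. \<integral>\<^sup>+X. I (a + z) (X([] := (k, z))) \<partial>?M' \<partial>\<nu> \<partial>measure_pmf p)"
    by (subst nn_integral_root[OF c_meas]) simp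
  also have "\<dots> = (\<integral>\<^sup>+z. \<integral>\<^sup>+k. \<integral>\<^sup>+X. I (a + z) (X([] := (k, z))) \<partial>?M' \<partial>measure_pmf p \<partial>\<nu>)"
  proof (rule S.Fubini'[symmetric])
    have "(\<lambda>y. I (a + snd (fst y)) ((snd y)([] := fst y))) \<in> borel_measurable (mark \<Otimes>\<^sub>M ?M')"
    proof -
      have m: "(\<lambda>y. (snd y)([] := fst y)) \<in> (mark \<Otimes>\<^sub>M ?M') \<rightarrow>\<^sub>M M"
      proof -
        have "(\<lambda>y. (snd y)([] := fst y)) \<in> (mark \<Otimes>\<^sub>M ?M') \<rightarrow>\<^sub>M PiM (insert [] (UNIV - {[]})) (\<lambda>_. mark)"
          by (rule measurable_fun_upd[where J = "UNIV - {[]}"]) auto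
        then show ?thesis by (simp add: brw_measure_def insert_absorb)
      qed
      have "(\<lambda>y. (a + snd (fst y), (snd y)([] := fst y))) \<in> (mark \<Otimes>\<^sub>M ?M') \<rightarrow>\<^sub>M (borel \<Otimes>\<^sub>M M)"
        using m by measurable
      from measurable_compose[OF this I_meas] show ?thesis by simp
    qed
    from M'.borel_measurable_nn_integral_fst[OF this]
    show "(\<lambda>(k, z). \<integral>\<^sup>+X. I (a + z) (X([] := (k, z))) \<partial>?M') \<in> borel_measurable mark"
      by (simp add: case_prod_unfold)
  qed
  \<comment> \<open>Inserts an independent copy \<open>z'\<close> of the root displacement, so that
    the inner integrals form a complete expectation over \<open>M\<close> with the starting point
    \<open>a + z\<close> held fixed.\<close>
  also have "\<dots> = (\<integral>\<^sup>+z. \<integral>\<^sup>+k. \<integral>\<^sup>+z'. \<integral>\<^sup>+X. I (a + z) (X([] := (k, z'))) \<partial>?M' \<partial>\<nu> \<partial>measure_pmf p \<partial>\<nu>)"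
  proof (intro nn_integral_cong)
    fix z k
    have "I (a + z) (X([] := (k, z'))) = I (a + z) (X([] := (k, z)))" for X z'
      unfolding I_eq by (rule if_cong[OF hits_root_displacement refl refl])
    then have "(\<integral>\<^sup>+z'. \<integral>\<^sup>+X. I (a + z) (X([] := (k, z'))) \<partial>?M' \<partial>\<nu>) = (\<integral>\<^sup>+z'. \<integral>\<^sup>+X. I (a + z) (X([] := (k, z))) \<partial>?M' \<partial>\<nu>)"
      by (intro nn_integral_cong)
    then show "(\<integral>\<^sup>+X. I (a + z) (X([] := (k, z))) \<partial>?M') = (\<integral>\<^sup>+z'. \<integral>\<^sup>+X. I (a + z) (X([] := (k, z'))) \<partial>?M' \<partial>\<nu>)"
      by (simp add: N.emeasure_space_1)
  qed
  also have "\<dots> = (\<integral>\<^sup>+z. ennreal (h (a + z)) \<partial>\<nu>)"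
    unfolding h by (intro nn_integral_cong) (rule nn_integral_root[OF Ib, symmetric])
  also have "\<dots> = ennreal (\<integral>z. h (a + z) \<partial>\<nu>)"
  proof (rule nn_integral_eq_integral)
    have "bdd_meas 1 h" using h_meas by (simp add: bdd_meas_def h_def)
    then show "integrable \<nu> (\<lambda>z. h (a + z))" by (rule bdd_meas_integrable_shift[OF _ \<nu>])
  qed (simp add: h_def)
  finally show ?thesis
    unfolding step_def h_def by (subst (asm) ennreal_inj) (auto intro: integral_nonneg_AE)
qed

lemma space_M: "space M = UNIV"
  using borel_prob_space[OF \<nu>] by (simp add: brw_measure_def space_PiM space_pair_measure PiE_UNIV_domain)

lemma coordinates_independent: "prob_space.indep_vars M (\<lambda>_. mark) (\<lambda>v \<omega>. \<omega> v) UNIV"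
proof -
  interpret P: prob_space M by (rule M_prob)
  have c: "distr M mark (\<lambda>\<omega>. \<omega> v) = mark" for v
    unfolding brw_measure_def by (rule distr_PiM_component) (auto simp: mark_prob)
  have "distr M (\<Pi>\<^sub>M i\<in>UNIV. mark) (\<lambda>x. \<lambda>i\<in>UNIV. x i) = (\<Pi>\<^sub>M i\<in>UNIV. mark)"
    by (simp add: brw_measure_def restrict_def distr_id2)
  then show ?thesis
    using coord_measurable by (subst P.indep_vars_iff_distr_eq_PiM) (simp_all add: c)
qed

text \<open>The offspring number of the root (\<open>None\<close>) and the subtree of the \<open>i\<close>-th child (\<open>Some i\<close>) read
  disjoint sets of words, whence their independence.\<close>

definition words :: "nat option \<Rightarrow> nat list set" where
  "words j = (case j of None \<Rightarrow> {[]} | Some i \<Rightarrow> range ((#) i))"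

definition readout :: "nat \<Rightarrow> real ^ 'd \<Rightarrow> nat option \<Rightarrow> (nat list \<Rightarrow> nat \<times> (real ^ 'd)) \<Rightarrow> nat" where
  "readout n a j f = (case j of None \<Rightarrow> fst (f []) | Some i \<Rightarrow> of_bool (child_hits A n a (subtree i f)))"

lemma readout_measurable: "readout n a j \<in> (\<Pi>\<^sub>M v\<in>words j. mark) \<rightarrow>\<^sub>M count_space UNIV"
proof (cases j)
  case None
  have "(\<lambda>f. f []) \<in> (\<Pi>\<^sub>M v\<in>{[]}. mark) \<rightarrow>\<^sub>M mark" by (rule measurable_component_singleton) simp
  from measurable_compose[OF this measurable_fst] None show ?thesis
    by (simp add: readout_def[abs_def] words_def cong: measurable_cong_sets)
next
  case (Some i)
  have m: "subtree i \<in> (\<Pi>\<^sub>M v\<in>range ((#) i). mark) \<rightarrow>\<^sub>M M"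
  proof -
    have "(\<lambda>f. \<lambda>v\<in>UNIV. f (i # v)) \<in> (\<Pi>\<^sub>M v\<in>range ((#) i). mark) \<rightarrow>\<^sub>M M"
      unfolding brw_measure_def by (intro measurable_restrict measurable_component_singleton) auto
    then show ?thesis by (simp add: subtree_def[abs_def] restrict_def)
  qed
  have [measurable]: "Measurable.pred (\<Pi>\<^sub>M v\<in>range ((#) i). mark) (\<lambda>f. child_hits A n a (subtree i f))"
    by (rule measurable_compose[OF m child_hits_pred])
  have "(\<lambda>f. of_bool (child_hits A n a (subtree i f)) :: nat) \<in> (\<Pi>\<^sub>M v\<in>range ((#) i). mark) \<rightarrow>\<^sub>M count_space UNIV"
    unfolding of_bool_def by measurable
  then show ?thesis using Some by (simp add: readout_def[abs_def] words_def)
qed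

lemma readout_independent:
  "prob_space.indep_vars M (\<lambda>_. count_space UNIV) (\<lambda>j \<omega>. readout n a j \<omega>) UNIV"
proof -
  interpret P: prob_space M by (rule M_prob)
  have "P.indep_vars (\<lambda>j. PiM (words j) (\<lambda>_. mark)) (\<lambda>j \<omega>. restrict (\<lambda>v. \<omega> v) (words j)) UNIV"
    by (rule P.indep_vars_restrict[OF coordinates_independent])
      (auto simp: disjoint_family_on_def words_def split: option.splits)
  from P.indep_vars_compose2[OF this readout_measurable]
  have "P.indep_vars (\<lambda>_. count_space UNIV) (\<lambda>j \<omega>. readout n a j (restrict \<omega> (words j))) UNIV"
    by simp
  moreover have "readout n a j (restrict \<omega> (words j)) = readout n a j \<omega>" for j \<omega>
    by (auto simp: readout_def words_def subtree_def[abs_def] split: option.splits)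
  ultimately show ?thesis by simp
qed

lemma root_offspring_law: "measure M {\<omega> \<in> space M. fst (\<omega> []) = k} = pmf p k"
proof -
  interpret N: prob_space \<nu> using \<nu> by (simp add: borel_prob_def)
  interpret pair_prob_space "measure_pmf p" \<nu> ..
  have c: "distr M mark (\<lambda>\<omega>. \<omega> []) = mark"
    unfolding brw_measure_def by (rule distr_PiM_component) (auto simp: mark_prob)
  have S: "{k} \<times> space \<nu> \<in> sets mark" by simp
  have "measure M {\<omega> \<in> space M. fst (\<omega> []) = k} = measure (distr M mark (\<lambda>\<omega>. \<omega> [])) ({k} \<times> space \<nu>)"
    using S borel_prob_space[OF \<nu>]
    by (subst measure_distr[OF coord_measurable]) (auto simp: space_M mem_Times_iff intro!: arg_cong2[where f = measure])
  also have "\<dots> = pmf p k"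
  proof -
    have "emeasure mark ({k} \<times> space \<nu>) = emeasure (measure_pmf p) {k} * emeasure \<nu> (space \<nu>)"
      by (rule N.emeasure_pair_measure_Times) auto
    then show ?thesis unfolding c measure_def by (simp add: N.emeasure_space_1 emeasure_pmf_single)
  qed
  finally show ?thesis .
qed

text \<open>Decomposition by the offspring number \<open>k\<close> of the root: given
  \<open>k\<close>, all subtrees avoid the set with probability \<open>(1 - c) ^ k\<close> by
  independence, and summing over \<open>k\<close> produces the generating function at
  \<open>1 - c\<close>.\<close>

lemma branching_recursion:
  "measure M {\<omega> \<in> space M. hits A (Suc n) a \<omega>} = hit p (measure M {\<omega> \<in> space M. child_hits A n a \<omega>})"
proof -
  interpret P: prob_space M by (rule M_prob)
  define c where "c = measure M {\<omega> \<in> space M. child_hits A n a \<omega>}"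
  have ch: "{\<omega> \<in> space M. child_hits A n a \<omega>} \<in> sets M" using child_hits_pred[of n a] by simp
  have child: "P.prob {\<omega> \<in> space M. \<not> child_hits A n a (subtree i \<omega>)} = 1 - c" for i
  proof -
    have "c = measure (distr M M (subtree i)) {\<omega> \<in> space M. child_hits A n a \<omega>}"
      unfolding subtree_law c_def ..
    also have "\<dots> = P.prob {\<omega> \<in> space M. child_hits A n a (subtree i \<omega>)}"
      using ch by (subst measure_distr[OF subtree_measurable]) (auto simp: space_M intro!: arg_cong2[where f = measure])
    finally have "c = P.prob {\<omega> \<in> space M. child_hits A n a (subtree i \<omega>)}" .
    moreover have "{\<omega> \<in> space M. child_hits A n a (subtree i \<omega>)} \<in> sets M"
      using measurable_compose[OF subtree_measurable child_hits_pred] by simp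
    ultimately show ?thesis using P.prob_neg[of "\<lambda>\<omega>. child_hits A n a (subtree i \<omega>)"] by simp
  qed
  define E where "E k = {\<omega> \<in> space M. fst (\<omega> []) = k \<and> (\<forall>i<k. \<not> child_hits A n a (subtree i \<omega>))}" for k
  \<comment> \<open>The readout \<open>0\<close> at \<open>Some i\<close> says that the line of the
    \<open>i\<close>-th child makes no visit. Only finitely many readouts enter, as the product rule
    for independent variables requires.\<close>
  have E_eq: "E k = (\<Inter>j\<in>insert None (Some ` {..<k}). (\<lambda>\<omega>. readout n a j \<omega>) -` (case j of None \<Rightarrow> {k} | Some i \<Rightarrow> {0}) \<inter> space M)" for k
    unfolding E_def by (auto simp: readout_def)
  have E_prob: "P.prob (E k) = pmf p k * (1 - c) ^ k" for k
  proof -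
    have "P.prob (E k) = (\<Prod>j\<in>insert None (Some ` {..<k}). P.prob ((\<lambda>\<omega>. readout n a j \<omega>) -` (case j of None \<Rightarrow> {k} | Some i \<Rightarrow> {0}) \<inter> space M))"
      unfolding E_eq by (rule P.indep_varsD[OF readout_independent]) auto
    also have "\<dots> = P.prob ((\<lambda>\<omega>. readout n a None \<omega>) -` {k} \<inter> space M) *
        (\<Prod>j\<in>Some ` {..<k}. P.prob ((\<lambda>\<omega>. readout n a j \<omega>) -` (case j of None \<Rightarrow> {k} | Some i \<Rightarrow> {0}) \<inter> space M))"
      by (subst prod.insert) auto
    also have "(\<Prod>j\<in>Some ` {..<k}. P.prob ((\<lambda>\<omega>. readout n a j \<omega>) -` (case j of None \<Rightarrow> {k} | Some i \<Rightarrow> {0}) \<inter> space M)) =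
        (\<Prod>i<k. P.prob ((\<lambda>\<omega>. readout n a (Some i) \<omega>) -` {0} \<inter> space M))"
      by (subst prod.reindex) auto
    also have "(\<lambda>\<omega>. readout n a None \<omega>) -` {k} \<inter> space M = {\<omega> \<in> space M. fst (\<omega> []) = k}"
      by (auto simp: readout_def)
    also have "(\<Prod>i<k. P.prob ((\<lambda>\<omega>. readout n a (Some i) \<omega>) -` {0} \<inter> space M)) = (\<Prod>i<k. 1 - c)"
    proof (rule prod.cong[OF refl])
      fix i
      have "(\<lambda>\<omega>. readout n a (Some i) \<omega>) -` {0} \<inter> space M = {\<omega> \<in> space M. \<not> child_hits A n a (subtree i \<omega>)}"
        by (auto simp: readout_def)
      then show "P.prob ((\<lambda>\<omega>. readout n a (Some i) \<omega>) -` {0} \<inter> space M) = 1 - c" using child by simp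
    qed
    finally show ?thesis by (simp add: root_offspring_law)
  qed
  have E_sets: "E k \<in> sets M" for k
  proof -
    have r: "(\<lambda>\<omega>. readout n a j \<omega>) \<in> M \<rightarrow>\<^sub>M count_space UNIV" for j
      using readout_independent[of n a] by (simp add: P.indep_vars_def)
    show ?thesis unfolding E_eq by (intro sets.finite_INT measurable_sets[OF r]) auto
  qed
  have "(\<lambda>k. P.prob (E k)) sums P.prob (\<Union>k. E k)"
    by (rule P.finite_measure_UNION) (use E_sets in \<open>auto simp: disjoint_family_on_def E_def\<close>)
  moreover have "(\<Union>k. E k) = {\<omega> \<in> space M. \<not> hits A (Suc n) a \<omega>}" by (auto simp: E_def hits_Suc)
  ultimately have "P.prob {\<omega> \<in> space M. \<not> hits A (Suc n) a \<omega>} = pgf p (1 - c)"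
    unfolding E_prob pgf_def by (simp add: sums_iff)
  moreover have "P.prob {\<omega> \<in> space M. \<not> hits A (Suc n) a \<omega>} = 1 - P.prob {\<omega> \<in> space M. hits A (Suc n) a \<omega>}"
    using P.prob_neg[of "hits A (Suc n) a"] hits_sets by simp
  ultimately show ?thesis by (simp add: hit_def c_def)
qed

theorem hits_prob: "measure M {\<omega> \<in> space M. hits A n a \<omega>} = (hop p \<nu> ^^ n) (indicator A) a"
proof (induction n arbitrary: a)
  case 0
  interpret P: prob_space M by (rule M_prob)
  show ?case using P.prob_space by (simp add: hits_0 indicator_def)
next
  case (Suc n)
  have "(\<lambda>b. measure M {\<omega> \<in> space M. hits A n b \<omega>}) = (hop p \<nu> ^^ n) (indicator A)" using Suc by auto
  then show ?case by (simp add: branching_recursion child_hits_prob hop_def[of p \<nu> "(hop p \<nu> ^^ n) (indicator A)"])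
qed

end

section \<open>Excursion measures\<close>

lemma emeasure_eval_measurable:
  assumes "A \<in> sets (borel :: 'a::topological_space measure)"
  shows "(\<lambda>\<mu>. emeasure \<mu> A) \<in> borel_measurable (finite_measures :: 'a measure measure)"
  unfolding finite_measures_def
proof (rule measurable_Sup1)
  let ?X = "{\<mu> :: 'a measure. finite_measure \<mu> \<and> sets \<mu> = sets borel}"
  show "vimage_algebra ?X (\<lambda>\<mu>. emeasure \<mu> A) borel \<in> (\<lambda>A. vimage_algebra ?X (\<lambda>\<mu>. emeasure \<mu> A) borel) ` sets borel"
    using assms by blast
  show "(\<lambda>\<mu>. emeasure \<mu> A) \<in> borel_measurable (vimage_algebra ?X (\<lambda>\<mu>. emeasure \<mu> A) borel)"
    by (rule measurable_vimage_algebra1) simp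
qed auto

text \<open>Monotone class induction, starting from the evaluations on Borel sets that generate the
  \<open>\<sigma>\<close>-algebra.\<close>

lemma nn_integral_eval_measurable:
  fixes f :: "'a::topological_space \<Rightarrow> ennreal"
  assumes "f \<in> borel_measurable borel"
  shows "(\<lambda>\<mu>. \<integral>\<^sup>+x. f x \<partial>\<mu>) \<in> borel_measurable finite_measures"
  using assms
proof (induct rule: borel_measurable_induct)
  case (cong f g)
  moreover have "(\<integral>\<^sup>+x. f x \<partial>\<mu>) = (\<integral>\<^sup>+x. g x \<partial>\<mu>)" for \<mu> using cong(3) by (intro nn_integral_cong) simp
  ultimately show ?case by simp
next
  case (set A)
  have "(\<lambda>\<mu>. \<integral>\<^sup>+x. indicator A x \<partial>\<mu>) \<in> borel_measurable finite_measures \<longleftrightarrow>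
      (\<lambda>\<mu>. emeasure \<mu> A) \<in> borel_measurable finite_measures"
    by (rule measurable_cong) (use set in \<open>auto simp: space_finite_measures\<close>)
  then show ?case using emeasure_eval_measurable[OF set] by simp
next
  case (mult u c)
  have "(\<lambda>\<mu>. \<integral>\<^sup>+x. c * u x \<partial>\<mu>) \<in> borel_measurable finite_measures \<longleftrightarrow>
      (\<lambda>\<mu>. c * (\<integral>\<^sup>+x. u x \<partial>\<mu>)) \<in> borel_measurable finite_measures"
    by (rule measurable_cong)
      (use mult in \<open>auto simp: space_finite_measures intro!: nn_integral_cmult cong: measurable_cong_sets\<close>)
  then show ?case using mult by simp
next
  case (add u v)
  have "(\<lambda>\<mu>. \<integral>\<^sup>+x. v x + u x \<partial>\<mu>) \<in> borel_measurable finite_measures \<longleftrightarrow>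
      (\<lambda>\<mu>. (\<integral>\<^sup>+x. v x \<partial>\<mu>) + (\<integral>\<^sup>+x. u x \<partial>\<mu>)) \<in> borel_measurable finite_measures"
    by (rule measurable_cong)
      (use add in \<open>auto simp: space_finite_measures intro!: nn_integral_add cong: measurable_cong_sets\<close>)
  then show ?case using add by simp
next
  case (seq U)
  have "(\<lambda>\<mu>. \<integral>\<^sup>+x. (SUP i. U i) x \<partial>\<mu>) \<in> borel_measurable finite_measures \<longleftrightarrow>
      (\<lambda>\<mu>. SUP i. \<integral>\<^sup>+x. U i x \<partial>\<mu>) \<in> borel_measurable finite_measures"
    by (rule measurable_cong)
      (use seq in \<open>auto simp: space_finite_measures intro!: nn_integral_monotone_convergence_SUP simp: image_comp cong: measurable_cong_sets\<close>)
  then show ?case using seq by simp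
qed

lemma excursion_eval_measurable:
  assumes "0 \<le> t"
  shows "(\<lambda>w. w t) \<in> (excursion_space :: (real \<Rightarrow> 'a::topological_space measure) measure) \<rightarrow>\<^sub>M finite_measures"
  unfolding excursion_space_def
  by (rule measurable_restrict_space1) (use assms in \<open>auto intro: measurable_component_singleton\<close>)

locale excursion =
  fixes B :: "'b measure" and W :: "real \<Rightarrow> 'b \<Rightarrow> real ^ 'd" and c \<alpha> :: real
    and P :: "(real ^ 'd) measure \<Rightarrow> (real \<Rightarrow> (real ^ 'd) measure) measure"
    and \<N> :: "real ^ 'd \<Rightarrow> (real \<Rightarrow> (real ^ 'd) measure) measure"
  assumes sbm: "super_brownian_motion B W c \<alpha> P" and exc: "excursion_measures P \<N>"
begin

lemma sets_\<N> [measurable_cong]: "sets (\<N> y) = sets excursion_space"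
  using exc by (simp add: excursion_measures_def)

lemma eval_measurable: "(\<lambda>w. w 1) \<in> \<N> y \<rightarrow>\<^sub>M finite_measures"
  unfolding measurable_cong_sets[OF sets_\<N> refl] by (rule excursion_eval_measurable) simp

lemma space_\<N>: "w \<in> space (\<N> y) \<Longrightarrow> finite_measure (w 1) \<and> sets (w 1) = sets borel"
  using measurable_space[OF eval_measurable, of w y] by (simp add: space_finite_measures)

lemma mass_measurable: "A \<in> sets borel \<Longrightarrow> (\<lambda>w. emeasure (w 1) A) \<in> borel_measurable (\<N> y)"
  using measurable_compose[OF eval_measurable emeasure_eval_measurable] .

text \<open>A Dirac initial measure turns the exponent of the Laplace functional into
  \<open>u 1 y\<close>, so the logarithm in the characterisation of the excursion measures cancels
  the exponential.\<close>

lemma excursion_laplace: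
  assumes \<phi>: "continuous_on UNIV \<phi>" "bounded (range \<phi>)" "\<And>x. 0 \<le> \<phi> x"
  obtains u where "log_laplace_solution B W c \<alpha> \<phi> u"
    "\<And>y. (\<integral>\<^sup>+w. ennreal (1 - exp (- (\<integral>x. \<phi> x \<partial>w 1))) \<partial>\<N> y) = ennreal (u 1 y)"
proof -
  from sbm[unfolded super_brownian_motion_def, THEN conjunct2, rule_format, OF \<phi>]
  obtain u where u: "log_laplace_solution B W c \<alpha> \<phi> u"
    and l: "\<And>\<mu> t. \<mu> \<in> space finite_measures \<Longrightarrow> 0 \<le> t \<Longrightarrow>
      (\<integral>w. exp (- (\<integral>x. \<phi> x \<partial>w t)) \<partial>P \<mu>) = exp (- (\<integral>x. u t x \<partial>\<mu>))"
    by blast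
  have um: "u 1 \<in> borel_measurable borel"
  proof -
    have "(\<lambda>(t, x). u t x) \<in> borel_measurable (restrict_space borel {0..} \<Otimes>\<^sub>M borel)"
      using u by (simp add: log_laplace_solution_def)
    from measurable_compose[OF measurable_Pair1' this, of 1] show ?thesis by (simp add: space_restrict_space)
  qed
  have "(\<integral>\<^sup>+w. ennreal (1 - exp (- (\<integral>x. \<phi> x \<partial>w 1))) \<partial>\<N> y) = ennreal (u 1 y)" for y
  proof -
    have r: "return borel y \<in> space finite_measures"
      using prob_space_return[of y borel] by (auto simp: space_finite_measures prob_space_def)
    have "\<phi> \<in> borel_measurable borel" using \<phi>(1) by (rule borel_measurable_continuous_onI)
    then have "(\<integral>\<^sup>+w. ennreal (1 - exp (- (\<integral>x. \<phi> x \<partial>w 1))) \<partial>\<N> y) =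
        ennreal (- ln (\<integral>w. exp (- (\<integral>x. \<phi> x \<partial>w 1)) \<partial>P (return borel y)))"
      using exc \<phi>(2,3) unfolding excursion_measures_def by simp
    also have "\<dots> = ennreal (u 1 y)"
      using l[OF r, of 1] um by (simp add: integral_return)
    finally show ?thesis .
  qed
  then show thesis using that u by blast
qed

definition charge :: "(real ^ 'd) set \<Rightarrow> real ^ 'd \<Rightarrow> (real \<Rightarrow> (real ^ 'd) measure) set" where
  "charge A y = {w \<in> space (\<N> y). emeasure (w 1) A \<noteq> 0}"

lemma charge_sets: "A \<in> sets borel \<Longrightarrow> charge A y \<in> sets (\<N> y)"
  using measurable_sets[OF mass_measurable, of A "- {0}" y] by (simp add: charge_def vimage_def Int_def conj_commute)

text \<open>As \<open>m\<close> grows, \<open>1 - exp (- m * I)\<close> increases to the indicator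
  of \<open>I > 0\<close>, and the integral \<open>I\<close> of \<open>g\<close> against
  \<open>w 1\<close> is positive exactly if \<open>w 1\<close> charges the set where
  \<open>g\<close> is positive. Monotone convergence does the rest.\<close>

lemma charge_SUP:
  fixes g :: "real ^ 'd \<Rightarrow> real"
  assumes g: "g \<in> borel_measurable borel" "\<And>x. 0 \<le> g x" "\<And>x. g x \<le> 1"
  shows "emeasure (\<N> y) (charge {x. 0 < g x} y) =
    (SUP m::nat. \<integral>\<^sup>+w. ennreal (1 - exp (- (\<integral>x. real m * g x \<partial>w 1))) \<partial>\<N> y)"
proof -
  define I where "I w = (\<integral>x. g x \<partial>w 1)" for w :: "real \<Rightarrow> (real ^ 'd) measure"
  have int: "integrable (w 1) g" if "w \<in> space (\<N> y)" for w
  proof -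
    interpret finite_measure "w 1" using space_\<N>[OF that] by simp
    have "g \<in> borel_measurable (w 1)" using g(1) space_\<N>[OF that] measurable_cong_sets[of "w 1" borel] by auto
    then show ?thesis using g by (intro integrable_const_bound[where B = 1]) auto
  qed
  have I0: "0 \<le> I w" for w unfolding I_def using g by (intro integral_nonneg_AE) auto
  have Ipos: "I w = 0 \<longleftrightarrow> emeasure (w 1) {x. 0 < g x} = 0" if w: "w \<in> space (\<N> y)" for w
  proof -
    have s: "sets (w 1) = sets borel" "space (w 1) = UNIV" using space_\<N>[OF w] sets_eq_imp_space_eq[of "w 1" borel] by auto
    have "I w = 0 \<longleftrightarrow> (AE x in w 1. g x = 0)"
      unfolding I_def using g by (intro integral_nonneg_eq_0_iff_AE int w) auto
    also have "\<dots> \<longleftrightarrow> emeasure (w 1) {x. 0 < g x} = 0"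
    proof (rule AE_iff_measurable)
      show "{x. 0 < g x} \<in> sets (w 1)" unfolding s using g(1) by measurable
      show "{x \<in> space (w 1). g x \<noteq> 0} = {x. 0 < g x}" using g(2) s by (auto simp: less_le)
    qed
    finally show ?thesis .
  qed
  have Im: "I \<in> borel_measurable (\<N> y)"
  proof -
    have "(\<lambda>w. enn2real (\<integral>\<^sup>+x. ennreal (g x) \<partial>w 1)) \<in> borel_measurable (\<N> y)"
      using measurable_compose[OF eval_measurable nn_integral_eval_measurable[of "\<lambda>x. ennreal (g x)"]] g(1) by measurable
    moreover have "enn2real (\<integral>\<^sup>+x. ennreal (g x) \<partial>w 1) = I w" if "w \<in> space (\<N> y)" for w
      unfolding I_def using int[OF that] g by (subst nn_integral_eq_integral) (auto intro!: enn2real_ennreal integral_nonneg_AE)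
    ultimately show ?thesis by (simp cong: measurable_cong)
  qed
  define F where "F m w = ennreal (1 - exp (- (real m * I w)))" for m :: nat and w
  have F_eq: "(\<integral>\<^sup>+w. ennreal (1 - exp (- (\<integral>x. real m * g x \<partial>w 1))) \<partial>\<N> y) = (\<integral>\<^sup>+w. F m w \<partial>\<N> y)" for m :: nat
    by (simp add: F_def I_def)
  have inc: "incseq F"
    unfolding F_def incseq_def le_fun_def using I0 by (auto intro!: ennreal_leI mult_right_mono)
  have lim: "(SUP m. F m w) = indicator (charge {x. 0 < g x} y) w" if w: "w \<in> space (\<N> y)" for w
  proof (cases "I w = 0")
    case True
    then show ?thesis using Ipos[OF w] by (simp add: F_def charge_def)
  next
    case False
    then have p: "0 < I w" using I0[of w] by simp
    have "(\<lambda>m. 1 - exp (- (real m * a))) \<longlonglongrightarrow> 1" if "0 < a" for a :: real using that by real_asymp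
    then have "(\<lambda>m. 1 - exp (- (real m * I w))) \<longlonglongrightarrow> 1" using p by blast
    then have "(\<lambda>m. F m w) \<longlonglongrightarrow> ennreal 1" unfolding F_def by (rule tendsto_ennrealI)
    moreover have "incseq (\<lambda>m. F m w)" using inc by (simp add: incseq_def le_fun_def)
    then have "(\<lambda>m. F m w) \<longlonglongrightarrow> (SUP m. F m w)" by (rule LIMSEQ_SUP)
    ultimately have "(SUP m. F m w) = 1" using LIMSEQ_unique by fastforce
    then show ?thesis using False Ipos[OF w] w by (simp add: charge_def)
  qed
  have "emeasure (\<N> y) (charge {x. 0 < g x} y) = (\<integral>\<^sup>+w. indicator (charge {x. 0 < g x} y) w \<partial>\<N> y)"
  proof -
    have "charge {x. 0 < g x} y \<in> sets (\<N> y)" by (rule charge_sets) (use g(1) in measurable)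
    then show ?thesis by simp
  qed
  also have "\<dots> = (\<integral>\<^sup>+w. (SUP m. F m w) \<partial>\<N> y)" by (intro nn_integral_cong) (simp add: lim)
  also have "\<dots> = (SUP m. \<integral>\<^sup>+w. F m w \<partial>\<N> y)"
  proof (rule nn_integral_monotone_convergence_SUP[OF inc])
    show "F m \<in> borel_measurable (\<N> y)" for m unfolding F_def[abs_def] using Im by measurable
  qed
  finally show ?thesis unfolding F_eq .
qed

end

section \<open>The displacement functional and the support radius\<close>

lemma displacement_lipschitz:
  fixes x y :: "real ^ 'd"
  shows "\<bar>displacement x - displacement y\<bar> \<le> norm (x - y)"
proof (cases "CARD('d) = 1")
  case True
  then obtain i :: 'd where i: "UNIV = {i}" by (auto simp: card_1_singleton_iff)
  have "displacement z = z $ i" for z :: "real ^ 'd" unfolding displacement_def i by simp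
  then show ?thesis using component_le_norm_cart[of "x - y" i] by simp
next
  case False
  then show ?thesis using norm_triangle_ineq3[of x y] by (simp add: displacement_def)
qed

lemma displacement_scaleR: "0 \<le> c \<Longrightarrow> displacement (c *\<^sub>R z) = c * displacement z"
  by (simp add: displacement_def sum_distrib_left)

lemma displacement_le_norm: "\<bar>displacement x\<bar> \<le> norm x"
  using displacement_lipschitz[of x 0] displacement_scaleR[of 0 x] by simp

lemma displacement_measurable [measurable]:
  "(displacement :: real ^ 'd \<Rightarrow> real) \<in> borel_measurable borel"
  by (rule lip_measurable[of 1]) (simp add: lip_def displacement_lipschitz)

text \<open>The inequality is strict so that a maximum of at most \<open>r\<close> means no particle
  in this set, and a support radius of at most \<open>r\<close> means no mass in it.\<close>

definition beyond :: "real \<Rightarrow> (real ^ 'd) set" where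
  "beyond r = {z. r < displacement z}"

lemma beyond_sets [measurable, simp]: "beyond r \<in> sets borel"
  unfolding beyond_def by measurable

lemma compl_displacement_domain: "- displacement_domain r = {z. r \<le> displacement z}"
  by (auto simp: displacement_domain_def)

lemma compl_displacement_domain_sets [measurable, simp]: "- displacement_domain r \<in> sets borel"
  unfolding compl_displacement_domain by measurable

lemma emeasure_zero_mono:
  assumes "emeasure \<mu> A = 0" "B \<subseteq> A" "A \<in> sets \<mu>"
  shows "emeasure \<mu> B = 0"
  using emeasure_mono[OF assms(2,3)] assms(1) by simp

context excursion
begin

definition unbounded :: "real ^ 'd \<Rightarrow> (real \<Rightarrow> (real ^ 'd) measure) set" where
  "unbounded y = (\<Inter>m::nat. charge (- displacement_domain (real m)) y)"

lemma unbounded_sets: "unbounded y \<in> sets (\<N> y)"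
  unfolding unbounded_def by (intro sets.countable_INT) (auto intro: charge_sets)

text \<open>The first two cases are junk values of \<open>Inf\<close>: for \<open>w 1 = 0\<close> the set is a whole half-line or, for
  \<open>d = 1\<close>, the whole line, and for unbounded support it is empty.\<close>

lemma support_radius_le_iff:
  assumes w: "w \<in> space (\<N> y)"
  shows "support_radius 1 w \<le> r \<longleftrightarrow>
    (if w \<notin> charge UNIV y then Inf {r. CARD('d) = 1 \<or> 0 \<le> r} \<le> r
     else if w \<in> unbounded y then Inf {} \<le> r else w \<notin> charge (beyond r) y)"
proof -
  define S where "S = {r. (CARD('d) = 1 \<or> 0 \<le> r) \<and> emeasure (w 1) (- displacement_domain r) = 0}"
  have R: "support_radius 1 w = Inf S" by (simp add: support_radius_def S_def)
  have sets: "sets (w 1) = sets borel" using space_\<N>[OF w] by simp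
  have mono: "emeasure (w 1) (- displacement_domain r') = 0"
    if "emeasure (w 1) (- displacement_domain r) = 0" "r \<le> r'" for r r'
    by (rule emeasure_zero_mono[OF that(1)]) (use that sets in \<open>auto simp: compl_displacement_domain\<close>)
  consider "w \<notin> charge UNIV y" | "w \<in> charge UNIV y" "w \<in> unbounded y" | "w \<in> charge UNIV y" "w \<notin> unbounded y" by blast
  then show ?thesis
  proof cases
    case 1
    then have "emeasure (w 1) UNIV = 0" using w by (simp add: charge_def)
    then have "S = {r. CARD('d) = 1 \<or> 0 \<le> r}" unfolding S_def using emeasure_zero_mono[of "w 1" UNIV] sets by auto
    then show ?thesis using 1 R by simp
  next
    case 2
    have "S = {}"
    proof (rule ccontr)
      assume "S \<noteq> {}"
      then obtain s where "emeasure (w 1) (- displacement_domain s) = 0" by (auto simp: S_def)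
      moreover obtain m :: nat where "s \<le> real m" using real_arch_simple by blast
      ultimately show False using mono 2(2) by (auto simp: unbounded_def charge_def)
    qed
    then show ?thesis using 2 R by simp
  next
    case 3
    obtain m :: nat where m: "emeasure (w 1) (- displacement_domain (real m)) = 0"
      using 3(2) w by (auto simp: unbounded_def charge_def)
    have "real m \<in> S" using m by (simp add: S_def)
    then have ne: "S \<noteq> {}" by blast
    have mass: "emeasure (w 1) UNIV \<noteq> 0" using 3(1) by (simp add: charge_def)
    have bdd: "bdd_below S"
    proof (cases "CARD('d) = 1")
      case False
      then show ?thesis by (intro bdd_belowI[of _ 0]) (auto simp: S_def)
    next
      case True
      show ?thesis
      proof (rule ccontr)
        \<comment> \<open>If \<open>S\<close> were unbounded below, \<open>w 1\<close> would charge
          none of the half-lines that exhaust the line, and would vanish.\<close>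
        assume nb: "\<not> bdd_below S"
        have "emeasure (w 1) (- displacement_domain (- real n)) = 0" for n :: nat
        proof -
          obtain s where "s \<in> S" "s < - real n" using nb by (meson bdd_belowI not_le)
          then show ?thesis using mono by (auto simp: S_def)
        qed
        then have "emeasure (w 1) (\<Union>n::nat. - displacement_domain (- real n)) = 0"
          using sets by (intro emeasure_UN_eq_0) auto
        moreover have "(\<Union>n::nat. - displacement_domain (- real n)) = (UNIV :: (real ^ 'd) set)"
        proof -
          have "\<exists>n::nat. - real n \<le> displacement z" for z :: "real ^ 'd"
            using real_arch_simple[of "- displacement z"] by (auto simp: minus_le_iff)
          then show ?thesis by (auto simp: compl_displacement_domain)
        qed
        ultimately show False using mass by simp
      qed
    qed
    have "Inf S \<le> r \<longleftrightarrow> (\<forall>r'>r. r' \<in> S)"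
    proof
      assume le: "Inf S \<le> r"
      show "\<forall>r'>r. r' \<in> S"
      proof (intro allI impI)
        fix r' assume "r < r'"
        then obtain s where "s \<in> S" "s < r'" using le cInf_lessD[OF ne, of r'] by auto
        then show "r' \<in> S" using mono[of s r'] by (auto simp: S_def)
      qed
    next
      assume "\<forall>r'>r. r' \<in> S"
      then have "Inf S \<le> r'" if "r < r'" for r' using that cInf_lower[OF _ bdd] by blast
      then show "Inf S \<le> r" by (rule dense_ge)
    qed
    also have "\<dots> \<longleftrightarrow> emeasure (w 1) (beyond r) = 0"
    proof
      assume all: "\<forall>r'>r. r' \<in> S"
      have "beyond r = (\<Union>n::nat. - displacement_domain (r + 1 / real (Suc n)) :: (real ^ 'd) set)"
      proof -
        have "\<exists>n::nat. r + 1 / real (Suc n) \<le> d" if "r < d" for d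
          using reals_Archimedean[of "d - r"] that by (auto simp: inverse_eq_divide intro: less_imp_le) (smt (verit, best))
        moreover have "r < d" if "r + 1 / real (Suc n) \<le> d" for d and n :: nat
          using that by (smt (verit) divide_pos_pos of_nat_0_less_iff zero_less_Suc)
        ultimately show ?thesis by (auto simp: beyond_def compl_displacement_domain)
      qed
      moreover have "emeasure (w 1) (\<Union>n::nat. - displacement_domain (r + 1 / real (Suc n))) = 0"
        using all sets by (intro emeasure_UN_eq_0) (auto simp: S_def)
      ultimately show "emeasure (w 1) (beyond r) = 0" by simp
    next
      assume b: "emeasure (w 1) (beyond r) = 0"
      \<comment> \<open>For \<open>d \<ge> 2\<close> a negative \<open>r\<close> is excluded,
        because \<open>beyond r\<close> would be the whole space, which carries mass.\<close>
      have r: "CARD('d) = 1 \<or> 0 \<le> r"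
      proof (rule ccontr)
        assume n: "\<not> ?thesis"
        then have "r < norm z" for z :: "real ^ 'd" using norm_ge_zero[of z] by linarith
        then have "beyond r = (UNIV :: (real ^ 'd) set)"
          using n by (auto simp: beyond_def displacement_def)
        then show False using b mass by simp
      qed
      show "\<forall>r'>r. r' \<in> S"
      proof (intro allI impI)
        fix r' assume "r < r'"
        moreover from this have "emeasure (w 1) (- displacement_domain r') = 0"
          by (intro emeasure_zero_mono[OF b]) (use sets in \<open>auto simp: beyond_def compl_displacement_domain\<close>)
        ultimately show "r' \<in> S" using r by (auto simp: S_def)
      qed
    qed
    finally show ?thesis using 3 w R by (simp add: charge_def)
  qed
qed

lemma support_radius_measurable: "support_radius 1 \<in> borel_measurable (\<N> y)"
proof (rule borel_measurableI_le)
  fix r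
  have [measurable]: "charge UNIV y \<in> sets (\<N> y)" "unbounded y \<in> sets (\<N> y)" "charge (beyond r) y \<in> sets (\<N> y)"
    using unbounded_sets by (auto intro: charge_sets)
  have "{w \<in> space (\<N> y). support_radius 1 w \<le> r} = {w \<in> space (\<N> y).
    (if w \<notin> charge UNIV y then Inf {r. CARD('d) = 1 \<or> 0 \<le> r} \<le> r
     else if w \<in> unbounded y then Inf {} \<le> r else w \<notin> charge (beyond r) y)}"
    using support_radius_le_iff by blast
  also have "\<dots> \<in> sets (\<N> y)" by measurable
  finally show "{w \<in> space (\<N> y). support_radius 1 w \<le> r} \<in> sets (\<N> y)" .
qed

text \<open>By \<open>van\<close> the paths with unbounded support form a null set, since a support
  unbounded in \<open>displacement\<close> meets every \<open>beyond m\<close>. On the survival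
  event the radius is then almost everywhere at most \<open>r\<close> exactly if
  \<open>beyond r\<close> is not charged.\<close>

lemma support_radius_cdf:
  assumes tot: "emeasure (\<N> y) (charge UNIV y) = ennreal cs" "0 < cs"
    and van: "(\<lambda>m. measure (\<N> y) (charge (beyond (real m)) y)) \<longlonglongrightarrow> 0"
  shows "cdf (distr (uniform_measure (\<N> y) (charge UNIV y)) borel (support_radius 1)) r =
    1 - measure (\<N> y) (charge (beyond r) y) / cs"
proof -
  let ?T = "charge UNIV y"
  have T: "?T \<in> sets (\<N> y)" by (rule charge_sets) simp
  have C: "charge (beyond r) y \<in> sets (\<N> y)" for r by (rule charge_sets) simp
  have sub: "charge A y \<subseteq> ?T" if "A \<in> sets borel" for A
    unfolding charge_def using emeasure_zero_mono[of _ UNIV A] space_\<N> by fastforce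
  have fin: "emeasure (\<N> y) X < \<infinity>" if "X \<subseteq> ?T" for X
    by (rule order_le_less_trans[OF emeasure_mono[OF that T]]) (simp add: tot)
  have fm: "X \<in> fmeasurable (\<N> y)" if "X \<subseteq> ?T" "X \<in> sets (\<N> y)" for X
    using that fin by (intro fmeasurableI) auto
  have cs: "measure (\<N> y) ?T = cs" using tot by (simp add: measure_def)
  have ub: "measure (\<N> y) (unbounded y) = 0"
  proof -
    have "measure (\<N> y) (unbounded y) \<le> measure (\<N> y) (charge (beyond (real m)) y)" for m
    proof (rule measure_mono_fmeasurable[OF _ unbounded_sets fm[OF sub C]])
      have "charge (- displacement_domain (real (Suc m))) y \<subseteq> charge (beyond (real m)) y"
        unfolding charge_def using emeasure_zero_mono[of _ "beyond (real m)" "- displacement_domain (real (Suc m))"] space_\<N>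
        by (fastforce simp: beyond_def compl_displacement_domain)
      then show "unbounded y \<subseteq> charge (beyond (real m)) y" unfolding unbounded_def by blast
    qed simp
    then have "measure (\<N> y) (unbounded y) \<le> 0" by (intro LIMSEQ_le_const[OF van]) auto
    then show ?thesis by (simp add: measure_le_0_iff)
  qed
  have "unbounded y \<subseteq> charge (- displacement_domain (real 0)) y"
    unfolding unbounded_def by (rule INT_lower) simp
  also have "\<dots> \<subseteq> ?T" by (rule sub) simp
  finally have ubT: "unbounded y \<subseteq> ?T" .
  let ?R = "{w \<in> space (\<N> y). support_radius 1 w \<le> r}"
  have Rs: "?R \<in> sets (\<N> y)"
    by (rule borel_measurable_iff_le[THEN iffD1, rule_format, OF support_radius_measurable])
  have um: "support_radius 1 \<in> uniform_measure (\<N> y) ?T \<rightarrow>\<^sub>M borel"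
    using support_radius_measurable[of y] measurable_cong_sets[of "uniform_measure (\<N> y) ?T" "\<N> y" borel borel] by simp
  have "cdf (distr (uniform_measure (\<N> y) ?T) borel (support_radius 1)) r = measure (uniform_measure (\<N> y) ?T) ?R"
    unfolding cdf_def by (subst measure_distr[OF um]) (auto intro!: arg_cong2[where f = measure])
  also have "\<dots> = measure (\<N> y) (?T \<inter> ?R) / cs"
    using tot T Rs cs by (subst measure_uniform_measure) auto
  also have "measure (\<N> y) (?T \<inter> ?R) = measure (\<N> y) (?T - charge (beyond r) y)"
  proof (rule measure_eq_AE)
    have "unbounded y \<in> null_sets (\<N> y)"
      using ub unbounded_sets fin[OF ubT] by (auto simp: null_sets_def measure_def enn2real_eq_0_iff)
    then have "AE w in \<N> y. w \<notin> unbounded y" by (rule AE_not_in)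
    then show "AE w in \<N> y. w \<in> ?T \<inter> ?R \<longleftrightarrow> w \<in> ?T - charge (beyond r) y"
    proof eventually_elim
      case (elim w)
      show ?case
      proof (cases "w \<in> ?T")
        case True
        then have "w \<in> space (\<N> y)" by (simp add: charge_def)
        then show ?thesis using support_radius_le_iff[of w y r] True elim by simp
      qed simp
    qed
  qed (use T Rs C in auto)
  also have "\<dots> = cs - measure (\<N> y) (charge (beyond r) y)"
    using measurable_measure_Diff[OF fm[OF order_refl T] C sub] cs by simp
  finally show ?thesis using tot by (simp add: diff_divide_distrib)
qed

end

section \<open>Convergence of the conditioned maximal displacement\<close>

locale brw_limit =
  critical_stable p \<alpha> \<kappa> + brownian_limit \<nu> B W \<alpha> + excursion B W "branching_const p \<alpha> \<kappa>" \<alpha> P \<N>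
  for p :: "nat pmf" and \<alpha> \<kappa> :: real and \<nu> :: "(real ^ 'd) measure" and B :: "'b measure"
    and W :: "real \<Rightarrow> 'b \<Rightarrow> real ^ 'd"
    and P :: "(real ^ 'd) measure \<Rightarrow> (real \<Rightarrow> (real ^ 'd) measure) measure"
    and \<N> :: "real ^ 'd \<Rightarrow> (real \<Rightarrow> (real ^ 'd) measure) measure"
begin

definition scaled_hit :: "nat \<Rightarrow> real \<Rightarrow> real" where
  "scaled_hit n v = real n powr \<beta> * hit p (v / real n powr \<beta>)"

definition iter :: "(real ^ 'd \<Rightarrow> real) \<Rightarrow> nat \<Rightarrow> nat \<Rightarrow> real ^ 'd \<Rightarrow> real" where
  "iter \<phi> n k = ((\<lambda>f x. scaled_hit n (step (scaled_jump n) f x)) ^^ k) \<phi>"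

lemma iter_measurable:
  assumes "\<phi> \<in> borel_measurable borel"
  shows "iter \<phi> n k \<in> borel_measurable borel"
proof (induction k)
  case (Suc k)
  note step_measurable[OF Suc scaled_jump_prob, measurable] hit_measurable[measurable]
  have "iter \<phi> n (Suc k) = (\<lambda>x. real n powr \<beta> * hit p (step (scaled_jump n) (iter \<phi> n k) x / real n powr \<beta>))"
    by (simp add: iter_def scaled_hit_def)
  then show ?case by simp
qed (use assms in \<open>simp add: iter_def\<close>)

lemma iter_eq_hop:
  assumes \<phi>: "\<phi> \<in> borel_measurable borel" and n: "0 < n"
  shows "iter \<phi> n k x = real n powr \<beta> * (hop p \<nu> ^^ k) (\<lambda>z. \<phi> (z /\<^sub>R sqrt (real n)) / real n powr \<beta>) (sqrt (real n) *\<^sub>R x)"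
proof (induction k arbitrary: x)
  case 0 show ?case using n by (simp add: iter_def)
next
  case (Suc k)
  let ?f = "(hop p \<nu> ^^ k) (\<lambda>z. \<phi> (z /\<^sub>R sqrt (real n)) / real n powr \<beta>)"
  have "step (scaled_jump n) (iter \<phi> n k) x = (\<integral>h. iter \<phi> n k (x + h /\<^sub>R sqrt (real n)) \<partial>\<nu>)"
    unfolding scaled_jump_def by (rule scaled_measure(6)[OF \<nu>_prob iter_measurable[OF \<phi>]])
  also have "\<dots> = (\<integral>h. real n powr \<beta> * ?f (sqrt (real n) *\<^sub>R x + h) \<partial>\<nu>)"
    unfolding Suc using n by (simp add: scaleR_add_right)
  also have "\<dots> = real n powr \<beta> * step \<nu> ?f (sqrt (real n) *\<^sub>R x)" by (simp add: step_def)
  finally have s: "step (scaled_jump n) (iter \<phi> n k) x = real n powr \<beta> * step \<nu> ?f (sqrt (real n) *\<^sub>R x)" .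
  have "iter \<phi> n (Suc k) x = scaled_hit n (step (scaled_jump n) (iter \<phi> n k) x)" by (simp add: iter_def)
  also have "\<dots> = real n powr \<beta> * hop p \<nu> ?f (sqrt (real n) *\<^sub>R x)"
    unfolding s scaled_hit_def hop_def using n by simp
  finally show ?case by simp
qed

lemma power_tendsto_infinity: "filterlim (\<lambda>n. real n powr \<beta>) at_top sequentially"
  using beta(1) by real_asymp

lemma scaled_hit_defect:
  assumes K: "0 \<le> K" and e: "0 < e"
  shows "\<forall>\<^sub>F n in sequentially. \<forall>v. 0 \<le> v \<longrightarrow> v \<le> K \<longrightarrow> \<bar>real n * (v - scaled_hit n v) - C * v powr \<alpha>\<bar> \<le> e"
proof -
  define e' where "e' = e / (K powr \<alpha> + 1)"
  have Kp: "0 < K powr \<alpha> + 1" by (simp add: add_nonneg_pos)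
  have e': "0 < e'" using e Kp by (simp add: e'_def)
  obtain b where b: "0 < b" "\<And>s. 0 < s \<Longrightarrow> s < b \<Longrightarrow> \<bar>(s - hit p s) / s powr \<alpha> - C\<bar> < e'"
    using tendstoD[OF defect e'] by (auto simp: eventually_at_right_field dist_real_def)
  have "\<forall>\<^sub>F n in sequentially. K / b < real n powr \<beta>"
    using power_tendsto_infinity by (simp add: filterlim_at_top_dense)
  then show ?thesis using eventually_gt_at_top[of 0]
  proof eventually_elim
    case (elim n)
    show ?case
    proof (intro allI impI)
      fix v assume v: "0 \<le> v" "v \<le> K"
      show "\<bar>real n * (v - scaled_hit n v) - C * v powr \<alpha>\<bar> \<le> e"
      proof (cases "v = 0")
        case True then show ?thesis using e by (simp add: scaled_hit_def)
      next
        case False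
        define N where "N = real n powr \<beta>"
        have N: "0 < N" using elim by (simp add: N_def)
        \<comment> \<open>The identity that determines \<open>\<beta>\<close>: it turns
          \<open>n * N * s powr \<alpha>\<close> into \<open>v powr \<alpha>\<close> for
          \<open>s = v / N\<close>.\<close>
        have NN: "N powr \<alpha> = real n * N"
          using elim by (simp add: N_def powr_powr beta(3) powr_add)
        define s where "s = v / N"
        have "K < N * b" using elim(1) b(1) by (simp add: N_def divide_less_eq)
        then have s: "0 < s" "s < b" using v False N by (auto simp: s_def divide_less_eq mult.commute)
        have "real n * (v - scaled_hit n v) = real n * N * (s - hit p s)"
          using N by (simp add: scaled_hit_def s_def N_def[symmetric] algebra_simps)
        also have "\<dots> = v powr \<alpha> * ((s - hit p s) / s powr \<alpha>)"
          using N v False by (simp add: s_def powr_divide NN)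
        finally have "real n * (v - scaled_hit n v) - C * v powr \<alpha> = v powr \<alpha> * ((s - hit p s) / s powr \<alpha> - C)"
          by (simp add: algebra_simps)
        then have "\<bar>real n * (v - scaled_hit n v) - C * v powr \<alpha>\<bar> = v powr \<alpha> * \<bar>(s - hit p s) / s powr \<alpha> - C\<bar>"
          by (simp add: abs_mult)
        also have "\<dots> \<le> (K powr \<alpha> + 1) * e'"
          using v alpha b(2)[OF s] powr_mono2[of \<alpha> v K] by (intro mult_mono) auto
        also have "\<dots> = e" using Kp by (simp add: e'_def)
        finally show ?thesis .
      qed
    qed
  qed
qed

lemma hop_scaling_limit:
  assumes \<phi>: "\<And>x. 0 \<le> \<phi> x \<and> \<phi> x \<le> K" "lip L \<phi>" and u: "log_laplace_solution B W (branching_const p \<alpha> \<kappa>) \<alpha> \<phi> u"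
  shows "(\<lambda>n. real n powr \<beta> * (hop p \<nu> ^^ n) (\<lambda>z. \<phi> (z /\<^sub>R sqrt (real n)) / real n powr \<beta>) (sqrt (real n) *\<^sub>R y)) \<longlonglongrightarrow> u 1 y"
proof -
  obtain K1 where K1: "\<And>t x. 0 \<le> t \<Longrightarrow> u t x \<le> K1" using u unfolding log_laplace_solution_def by blast
  \<comment> \<open>The bound on \<open>u\<close> is only asserted to exist, so one constant is
    taken to dominate both the initial function and the solution.\<close>
  define K' where "K' = max K K1"
  have K'0: "0 \<le> K'" using \<phi>(1)[of 0] by (auto simp: K'_def intro: max.coboundedI1)
  have "(\<lambda>n. iter \<phi> n n y) \<longlonglongrightarrow> u 1 y"
  proof (rule scheme_converges[where c = C and K = K' and L = L and \<phi> = \<phi> and G = scaled_hit and U = "iter \<phi>"])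
    show "0 \<le> C" using C_pos by simp
    show "0 \<le> \<phi> x \<and> \<phi> x \<le> K'" for x using \<phi>(1)[of x] by (auto simp: K'_def intro: max.coboundedI1)
    show "lip L \<phi>" by fact
    show "log_laplace_solution B W C \<alpha> \<phi> u" unfolding C_def by (rule u)
    show "u t x \<le> K'" if "0 \<le> t" for t x using K1[OF that, of x] by (simp add: K'_def)
    show "scaled_hit n 0 = 0" for n by (simp add: scaled_hit_def)
    show "\<forall>\<^sub>F n in sequentially. \<forall>v. 0 \<le> v \<longrightarrow> v \<le> K' \<longrightarrow> \<bar>real n * (v - scaled_hit n v) - C * v powr \<alpha>\<bar> \<le> e" if "0 < e" for e
      by (rule scaled_hit_defect[OF K'0 that])
    have "\<forall>\<^sub>F n in sequentially. K' \<le> real n powr \<beta>"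
      using power_tendsto_infinity by (simp add: filterlim_at_top)
    then show "\<forall>\<^sub>F n in sequentially. \<forall>v w. 0 \<le> v \<longrightarrow> v \<le> w \<longrightarrow> w \<le> K' \<longrightarrow>
        0 \<le> scaled_hit n w - scaled_hit n v \<and> scaled_hit n w - scaled_hit n v \<le> w - v"
      using eventually_gt_at_top[of 0]
    proof eventually_elim
      case (elim n)
      define N where "N = real n powr \<beta>"
      have N: "0 < N" "K' \<le> N" using elim by (auto simp: N_def)
      show ?case
      proof (intro allI impI)
        fix v w assume vw: "0 \<le> v" "v \<le> w" "w \<le> K'"
        have d: "0 \<le> v / N" "v / N \<le> w / N" "w / N \<le> 1" using vw N by (auto simp: divide_right_mono)
        have "0 \<le> hit p (w / N) - hit p (v / N)" using hit_mono[OF d, of p] by simp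
        moreover have "hit p (w / N) - hit p (v / N) \<le> (w - v) / N"
          using hit_diff_le[OF mean d] by (simp add: diff_divide_distrib)
        ultimately show "0 \<le> scaled_hit n w - scaled_hit n v \<and> scaled_hit n w - scaled_hit n v \<le> w - v"
          unfolding scaled_hit_def N_def[symmetric] right_diff_distrib[symmetric]
          using N by (simp add: pos_le_divide_eq mult.commute)
      qed
    qed
    show "iter \<phi> n 0 = \<phi>" for n by (simp add: iter_def)
    show "iter \<phi> n (Suc k) x = scaled_hit n (step (scaled_jump n) (iter \<phi> n k) x)" for n k x by (simp add: iter_def)
  qed
  then show ?thesis
  proof (rule Lim_transform_eventually)
    show "\<forall>\<^sub>F n in sequentially. iter \<phi> n n y = real n powr \<beta> * (hop p \<nu> ^^ n) (\<lambda>z. \<phi> (z /\<^sub>R sqrt (real n)) / real n powr \<beta>) (sqrt (real n) *\<^sub>R y)"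
      using eventually_gt_at_top[of 0]
      by eventually_elim (rule iter_eq_hop[OF lip_measurable[OF \<phi>(2)]])
  qed
qed

text \<open>The order of limits matters: \<open>n\<close> tends to infinity for each fixed multiple
  \<open>m * g\<close>, which is bounded and Lipschitz, and only afterwards does \<open>m\<close>
  grow, which by \<open>charge_SUP\<close> produces an excursion measure.\<close>

lemma charge_approximation:
  assumes g: "\<And>x. 0 \<le> g x" "\<And>x. g x \<le> 1" "lip L g"
  obtains v :: "nat \<Rightarrow> real" where
    "\<And>m. (\<lambda>n. real n powr \<beta> * (hop p \<nu> ^^ n) (\<lambda>z. real m * g (z /\<^sub>R sqrt (real n)) / real n powr \<beta>) (sqrt (real n) *\<^sub>R y)) \<longlonglongrightarrow> v m"
    "\<And>m. 0 \<le> v m" "emeasure (\<N> y) (charge {x. 0 < g x} y) = (SUP m. ennreal (v m))"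
proof -
  have gm: "g \<in> borel_measurable borel" by (rule lip_measurable[OF g(3)])
  have mg: "lip (real m * L) (\<lambda>x. real m * g x)" for m :: nat
    using g(3) unfolding lip_def
    by (auto simp: right_diff_distrib[symmetric] abs_mult mult.assoc intro: mult_left_mono)
  let ?scaled = "\<lambda>m n. real n powr \<beta> * (hop p \<nu> ^^ n) (\<lambda>z. real m * g (z /\<^sub>R sqrt (real n)) / real n powr \<beta>) (sqrt (real n) *\<^sub>R y)"
  let ?laplace = "\<lambda>m. \<integral>\<^sup>+w. ennreal (1 - exp (- (\<integral>x. real m * g x \<partial>w 1))) \<partial>\<N> y"
  let ?lim = "\<lambda>(m::nat) a. ?scaled m \<longlonglongrightarrow> a \<and> 0 \<le> a \<and> ?laplace m = ennreal a"
  have "\<exists>a. ?lim m a" for m :: nat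
  proof -
    have cont: "continuous_on UNIV (\<lambda>x. real m * g x)"
    proof -
      have "(real m * L)-lipschitz_on UNIV (\<lambda>x. real m * g x)"
        using mg[of m] by (intro lipschitz_onI) (auto simp: lip_def dist_real_def dist_norm)
      then show ?thesis by (rule lipschitz_on_continuous_on)
    qed
    have bdd: "bounded (range (\<lambda>x. real m * g x))"
      using g by (intro boundedI[of _ "real m"]) (auto simp: abs_mult mult_left_le)
    have nn: "0 \<le> real m * g x" for x using g by simp
    obtain u where u: "log_laplace_solution B W (branching_const p \<alpha> \<kappa>) \<alpha> (\<lambda>x. real m * g x) u"
      "\<And>y. (\<integral>\<^sup>+w. ennreal (1 - exp (- (\<integral>x. real m * g x \<partial>w 1))) \<partial>\<N> y) = ennreal (u 1 y)"
      using excursion_laplace[OF cont bdd nn] by blast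
    have "?scaled m \<longlonglongrightarrow> u 1 y"
      by (rule hop_scaling_limit[OF _ mg u(1), where K = "real m"]) (use g in \<open>auto simp: mult_left_le\<close>)
    moreover have "0 \<le> u 1 y" using u(1) unfolding log_laplace_solution_def by auto
    ultimately show ?thesis using u(2)[of y] by blast
  qed
  then have "\<forall>m::nat. \<exists>a. ?lim m a" by blast
  from choice[OF this] obtain v where "\<forall>m::nat. ?lim m (v m)" ..
  then have v: "?scaled m \<longlonglongrightarrow> v m" "0 \<le> v m" "?laplace m = ennreal (v m)" for m :: nat by simp_all
  have "emeasure (\<N> y) (charge {x. 0 < g x} y) = (SUP m. ennreal (v m))"
    by (simp only: charge_SUP[OF gm g(1,2)] v(3))
  from v(1,2) this show thesis by (rule that)
qed

definition "survival_const = ((\<alpha> - 1) * C) powr (- \<beta>)"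

lemma survival_const_pos: "0 < survival_const"
  unfolding survival_const_def using alpha C_pos by simp

text \<open>For \<open>g = 1\<close> space disappears, and \<open>scaled_iterate_limit\<close>
  computes \<open>v m\<close> explicitly for \<open>m > 0\<close>. The supremum equals the limit in
  \<open>survival_asymptotics\<close>: for survival the limits in \<open>n\<close> and in
  \<open>m\<close> may be exchanged.\<close>

lemma total_charge: "emeasure (\<N> y) (charge UNIV y) = ennreal survival_const"
proof -
  define D where "D = (\<alpha> - 1) * C"
  have D: "0 < D" using alpha C_pos by (simp add: D_def)
  have g: "\<And>x::real^'d. (0::real) \<le> 1" "\<And>x::real^'d. (1::real) \<le> 1" "lip 0 (\<lambda>x::real^'d. 1)" by (auto simp: lip_def)
  obtain v :: "nat \<Rightarrow> real" where v: "\<And>m. (\<lambda>n. real n powr \<beta> * (hop p \<nu> ^^ n) (\<lambda>z. real m * 1 / real n powr \<beta>) (sqrt (real n) *\<^sub>R y)) \<longlonglongrightarrow> v m"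
    "\<And>m. 0 \<le> v m" "emeasure (\<N> y) (charge {x. (0::real) < 1} y) = (SUP m. ennreal (v m))"
    by (rule charge_approximation[OF g]) blast
  have v_eq: "v m = (real m powr (1 - \<alpha>) + D) powr (- \<beta>)" if "0 < m" for m
  proof (rule LIMSEQ_unique[OF v(1)])
    have "(\<lambda>n. real n powr \<beta> * (hit p ^^ n) (real m / real n powr \<beta>)) \<longlonglongrightarrow> (real m powr (1 - \<alpha>) + D) powr (- \<beta>)"
      unfolding D_def
    proof (rule scaled_iterate_limit)
      show "(\<lambda>n. real m / real n powr \<beta>) \<longlonglongrightarrow> 0" using beta(1) by real_asymp
      show "\<forall>\<^sub>F n in sequentially. 0 < real m / real n powr \<beta>"
        using eventually_gt_at_top[of 0] by eventually_elim (use that in simp)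
      have "\<forall>\<^sub>F n in sequentially. real m powr (1 - \<alpha>) = (real m / real n powr \<beta>) powr (1 - \<alpha>) / real n"
        using eventually_gt_at_top[of 0]
      proof eventually_elim
        case (elim n)
        have "\<beta> * (1 - \<alpha>) = - 1" using beta(2) by (simp add: algebra_simps)
        then have "(real n powr \<beta>) powr (1 - \<alpha>) = 1 / real n" using elim by (simp add: powr_powr powr_minus divide_inverse)
        then show ?case using elim that by (simp add: powr_divide)
      qed
      then show "(\<lambda>n. (real m / real n powr \<beta>) powr (1 - \<alpha>) / real n) \<longlonglongrightarrow> real m powr (1 - \<alpha>)"
        by (rule Lim_transform_eventually[OF tendsto_const])
      show "(\<lambda>n. real n / real n) \<longlonglongrightarrow> 1" by real_asymp
    qed simp
    then show "(\<lambda>n. real n powr \<beta> * (hop p \<nu> ^^ n) (\<lambda>z. real m * 1 / real n powr \<beta>) (sqrt (real n) *\<^sub>R y)) \<longlonglongrightarrow> (real m powr (1 - \<alpha>) + D) powr (- \<beta>)"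
      by (simp add: hop_pow_const[OF mean \<nu>_prob])
  qed
  have "(\<lambda>m. (real m powr (1 - \<alpha>) + D) powr (- \<beta>)) \<longlonglongrightarrow> (0 + D) powr (- \<beta>)"
  proof (intro tendsto_powr tendsto_add tendsto_const)
    show "(\<lambda>m. real m powr (1 - \<alpha>)) \<longlonglongrightarrow> 0" using alpha by real_asymp
  qed (use D in auto)
  then have "(\<lambda>m. (real m powr (1 - \<alpha>) + D) powr (- \<beta>)) \<longlonglongrightarrow> D powr (- \<beta>)" by simp
  moreover have "\<forall>\<^sub>F m in sequentially. (real m powr (1 - \<alpha>) + D) powr (- \<beta>) = v m"
    using eventually_gt_at_top[of 0] by eventually_elim (simp add: v_eq)
  ultimately have "v \<longlonglongrightarrow> D powr (- \<beta>)" by (rule Lim_transform_eventually)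
  then have lim: "(\<lambda>m. ennreal (v m)) \<longlonglongrightarrow> ennreal (D powr (- \<beta>))" by (rule tendsto_ennrealI)
  have "(SUP m. ennreal (v m)) = ennreal (D powr (- \<beta>))"
  proof (rule antisym)
    show "(SUP m. ennreal (v m)) \<le> ennreal (D powr (- \<beta>))"
    proof (rule SUP_least)
      fix m
      have "v m \<le> D powr (- \<beta>)"
      \<comment> \<open>The formula \<open>v_eq\<close> fails at \<open>m = 0\<close>, where
        \<open>0 powr (1 - \<alpha>)\<close> is \<open>0\<close> by convention rather than infinite;
        the iteration then starts from \<open>0\<close> and stays there.\<close>
      proof (cases "m = 0")
        case True
        have "(\<lambda>n. real n powr \<beta> * (hop p \<nu> ^^ n) (\<lambda>z. real m * 1 / real n powr \<beta>) (sqrt (real n) *\<^sub>R y)) \<longlonglongrightarrow> 0"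
        proof -
          have "(hit p ^^ n) 0 = 0" for n by (induction n) auto
          then show ?thesis using True by (simp add: hop_pow_const[OF mean \<nu>_prob])
        qed
        then have "v m = 0" using LIMSEQ_unique[OF v(1)] by blast
        then show ?thesis by simp
      next
        case False
        then show ?thesis using v_eq[of m] D beta(1) by (simp add: powr_mono2')
      qed
      then show "ennreal (v m) \<le> ennreal (D powr (- \<beta>))" by (rule ennreal_leI)
    qed
    show "ennreal (D powr (- \<beta>)) \<le> (SUP m. ennreal (v m))"
      by (rule LIMSEQ_le_const2[OF lim]) (intro exI[of _ 0] allI impI SUP_upper UNIV_I)
  qed
  then show ?thesis using v(3) by (simp add: survival_const_def D_def)
qed

end

section \<open>The conditioned law of the maximum\<close>

lemma finite_generation: "finite (generation \<omega> n)"
proof (induction n arbitrary: \<omega>)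
  case (Suc n)
  have "generation \<omega> (Suc n) = (\<Union>i<fst (\<omega> []). (#) i ` generation (subtree i \<omega>) n)"
    unfolding generation_Suc by auto
  then show ?case using Suc by simp
qed (simp add: generation_0)

lemma hits_UNIV: "hits UNIV n a \<omega> \<longleftrightarrow> generation \<omega> n \<noteq> {}"
  by (auto simp: hits_def)

lemma population_pos: "0 < emeasure (population a n \<omega>) UNIV \<longleftrightarrow> hits UNIV n a \<omega>"
proof -
  have "emeasure (population a n \<omega>) UNIV = emeasure (count_space (generation \<omega> n)) (generation \<omega> n)"
    unfolding population_def by (subst emeasure_distr) auto
  also have "\<dots> = of_nat (card (generation \<omega> n))"
    by (rule emeasure_count_space_finite[OF order_refl finite_generation])
  finally show ?thesis using finite_generation[of \<omega> n] by (simp add: hits_UNIV card_gt_0_iff)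
qed

lemma max_displacement_le_iff:
  assumes "hits UNIV n a \<omega>" "0 < n"
  shows "max_displacement a n \<omega> / sqrt (real n) \<le> r \<longleftrightarrow> \<not> hits (beyond (r * sqrt (real n))) n a \<omega>"
proof -
  have "max_displacement a n \<omega> / sqrt (real n) \<le> r \<longleftrightarrow> max_displacement a n \<omega> \<le> r * sqrt (real n)"
    using assms(2) by (simp add: pos_divide_le_eq)
  also have "\<dots> \<longleftrightarrow> (\<forall>w\<in>generation \<omega> n. displacement (position a \<omega> w) \<le> r * sqrt (real n))"
    unfolding max_displacement_def using assms(1) finite_generation[of \<omega> n] by (subst Max_le_iff) (auto simp: hits_UNIV)
  finally show ?thesis by (auto simp: hits_def beyond_def not_less)
qed

lemma max_displacement_measurable:
  fixes \<nu> :: "(real ^ 'd) measure"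
  assumes \<nu>: "borel_prob \<nu>" and n: "0 < n"
  shows "(\<lambda>\<omega>. max_displacement a n \<omega> / sqrt (real n)) \<in> borel_measurable (brw_measure p \<nu>)"
proof (rule borel_measurableI_le)
  fix r
  let ?M = "brw_measure p \<nu>"
  let ?none = "Max {} / sqrt (real n)"
  have [measurable]: "{\<omega> \<in> space ?M. hits A n a \<omega>} \<in> sets ?M" if "A \<in> sets borel" for A
    by (rule hits_sets[OF \<nu> that])
  have "max_displacement a n \<omega> / sqrt (real n) \<le> r \<longleftrightarrow>
      (if hits UNIV n a \<omega> then \<not> hits (beyond (r * sqrt (real n))) n a \<omega> else ?none \<le> r)" for \<omega>
  proof (cases "hits UNIV n a \<omega>")
    case False \<comment> \<open>on extinction \<open>max_displacement\<close> is the unspecified constant \<open>Max {}\<close>\<close>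
    then show ?thesis by (simp add: hits_UNIV max_displacement_def)
  qed (simp add: max_displacement_le_iff n)
  moreover have "{\<omega> \<in> space ?M. if hits UNIV n a \<omega> then \<not> hits (beyond (r * sqrt (real n))) n a \<omega> else ?none \<le> r} \<in> sets ?M"
    by measurable auto
  ultimately show "{\<omega> \<in> space ?M. max_displacement a n \<omega> / sqrt (real n) \<le> r} \<in> sets ?M" by simp
qed

lemma walk_cdf:
  fixes \<nu> :: "(real ^ 'd) measure"
  assumes \<nu>: "borel_prob \<nu>" and n: "0 < n" and s: "0 < (hop p \<nu> ^^ n) (indicator UNIV) a"
  shows "cdf (distr (uniform_measure (brw_measure p \<nu>)
      {\<omega> \<in> space (brw_measure p \<nu>). 0 < emeasure (population a n \<omega>) UNIV})
      borel (\<lambda>\<omega>. max_displacement a n \<omega> / sqrt (real n))) r =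
    1 - (hop p \<nu> ^^ n) (indicator (beyond (r * sqrt (real n)))) a / (hop p \<nu> ^^ n) (indicator UNIV) a"
proof -
  let ?M = "brw_measure p \<nu>"
  interpret M: prob_space ?M by (rule M_prob[OF \<nu> sets.top])
  define S where "S = {\<omega> \<in> space ?M. hits UNIV n a \<omega>}"
  define H where "H = {\<omega> \<in> space ?M. hits (beyond (r * sqrt (real n))) n a \<omega>}"
  have sets: "S \<in> sets ?M" "H \<in> sets ?M"
    unfolding S_def H_def by (rule hits_sets[OF \<nu>]; simp)+
  have pr: "M.prob S = (hop p \<nu> ^^ n) (indicator UNIV) a"
    "M.prob H = (hop p \<nu> ^^ n) (indicator (beyond (r * sqrt (real n)))) a"
    unfolding S_def H_def by (rule hits_prob[OF \<nu>]; simp)+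
  have HS: "H \<subseteq> S" by (auto simp: H_def S_def hits_def)
  let ?X = "\<lambda>\<omega>. max_displacement a n \<omega> / sqrt (real n)"
  have X: "?X \<in> borel_measurable ?M" by (rule max_displacement_measurable[OF \<nu> n])
  have U: "?X \<in> borel_measurable (uniform_measure ?M S)"
    using X measurable_cong_sets[of "uniform_measure ?M S" ?M borel borel] by simp
  have R: "{\<omega> \<in> space ?M. ?X \<omega> \<le> r} \<in> sets ?M"
    by (rule borel_measurable_iff_le[THEN iffD1, rule_format, OF X])
  have "cdf (distr (uniform_measure ?M S) borel ?X) r = measure (uniform_measure ?M S) {\<omega> \<in> space ?M. ?X \<omega> \<le> r}"
    unfolding cdf_def by (subst measure_distr[OF U]) (auto intro!: arg_cong2[where f = measure])
  also have "\<dots> = M.prob (S \<inter> {\<omega> \<in> space ?M. ?X \<omega> \<le> r}) / M.prob S"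
    using s sets(1) R pr(1) by (subst measure_uniform_measure) (auto simp: M.emeasure_eq_measure)
  also have "S \<inter> {\<omega> \<in> space ?M. ?X \<omega> \<le> r} = S - H"
    using max_displacement_le_iff[OF _ n] by (auto simp: S_def H_def)
  also have "M.prob (S - H) = M.prob S - M.prob H"
    by (rule M.finite_measure_Diff[OF sets HS])
  finally show ?thesis using s pr unfolding S_def population_pos by (simp add: diff_divide_distrib)
qed

lemma unit_meas_shift:
  assumes "unit_meas f"
  shows "unit_meas (\<lambda>z. f (a + z))"
  using assms bdd_meas_shift[OF unit_meas_bdd[OF assms], of a] by (simp add: unit_meas_def bdd_meas_def)

text \<open>A Lipschitz substitute for the indicator of \<open>beyond r\<close>. For
  \<open>e > 0\<close> it is positive exactly there, whatever the slope, so its multiples recover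
  the excursion measure of that set; it equals \<open>1\<close> from \<open>r + e\<close> on, as the
  upper bound requires.\<close>

definition ramp :: "real \<Rightarrow> real \<Rightarrow> real ^ 'd \<Rightarrow> real" where
  "ramp r e z = min 1 (max 0 ((displacement z - r) / e))"

lemma ramp_bounds: "0 \<le> ramp r e z" "ramp r e z \<le> 1"
  by (auto simp: ramp_def)

lemma ramp_pos: "0 < e \<Longrightarrow> 0 < ramp r e z \<longleftrightarrow> z \<in> beyond r"
  by (simp add: ramp_def beyond_def less_max_iff_disj zero_less_divide_iff)

lemma ramp_eq_1: "0 < e \<Longrightarrow> r + e \<le> displacement z \<Longrightarrow> ramp r e z = 1"
  by (simp add: ramp_def pos_le_divide_eq)

lemma ramp_lip:
  assumes "0 < e"
  shows "lip (1 / e) (ramp r e :: real ^ 'd \<Rightarrow> real)"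
proof -
  have "\<bar>ramp r e x - ramp r e z\<bar> \<le> 1 / e * norm (x - z)" for x z :: "real ^ 'd"
  proof -
    have "\<bar>ramp r e x - ramp r e z\<bar> \<le> \<bar>(displacement x - r) / e - (displacement z - r) / e\<bar>"
      unfolding ramp_def by linarith
    also have "\<dots> = \<bar>displacement x - displacement z\<bar> / e"
      using assms by (simp add: diff_divide_distrib[symmetric])
    also have "\<dots> \<le> norm (x - z) / e"
      using assms displacement_lipschitz[of x z] by (simp add: divide_right_mono)
    finally show ?thesis by simp
  qed
  then show ?thesis using assms by (simp add: lip_def)
qed

lemma unit_meas_scaled_ramp:
  assumes "0 < e" "0 \<le> m" "m \<le> N"
  shows "unit_meas (\<lambda>z :: real ^ 'd. m * ramp r e (z /\<^sub>R c) / N)"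
proof -
  note lip_measurable[OF ramp_lip[OF assms(1)], measurable]
  have "m * ramp r e z \<le> N" for z :: "real ^ 'd"
    using mult_mono[OF assms(3) ramp_bounds(2)[of r e z]] assms ramp_bounds(1)[of r e z] by simp
  then have "m * ramp r e z / N \<le> 1" for z :: "real ^ 'd"
    using assms by (simp add: divide_le_eq_1) (smt (verit))
  moreover have "0 \<le> m * ramp r e z / N" for z :: "real ^ 'd"
    using assms ramp_bounds(1)[of r e z] by simp
  ultimately show ?thesis unfolding unit_meas_def by (intro conjI allI) auto
qed

section \<open>Tail functions of the walk and of the excursion measure\<close>

context brw_limit
begin

definition "tail y r = measure (\<N> y) (charge (beyond r) y)"

definition "walk_tail y n r =
  real n powr \<beta> * (hop p \<nu> ^^ n) (indicator (beyond (r * sqrt (real n)))) (sqrt (real n) *\<^sub>R y)"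

text \<open>After translation the walk starts at \<open>0\<close>, and because
  \<open>displacement\<close> is Lipschitz with constant \<open>1\<close>, reaching
  \<open>beyond s\<close> forces a norm of at least \<open>\<rho>\<close>.\<close>

lemma beyond_bound:
  obtains A where "0 < A" "\<And>n s a \<rho>. 0 < \<rho> \<Longrightarrow> displacement a + \<rho> \<le> s \<Longrightarrow>
    (hop p \<nu> ^^ n) (indicator (beyond s)) a \<le> A * real n powr (real (Suc l) - \<beta>) / \<rho> ^ (2 * Suc l)"
proof -
  obtain A where A: "0 < A" "\<And>m \<rho>. 0 < \<rho> \<Longrightarrow>
    (hop p \<nu> ^^ m) (indicator {x. \<rho> \<le> norm x}) 0 \<le> A * real m powr (real (Suc l) - \<beta>) / \<rho> ^ (2 * Suc l)"
    by (rule displacement_tail_bound[OF jump], rule that)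
  show thesis
  proof (rule that[OF A(1)])
    fix n and s :: real and a :: "real ^ 'd" and \<rho> :: real
    assume \<rho>: "0 < \<rho>" "displacement a + \<rho> \<le> s"
    have "(hop p \<nu> ^^ n) (indicator (beyond s)) a = (hop p \<nu> ^^ n) (\<lambda>z. indicator (beyond s) (a + z)) 0"
      using hop_pow_translate[OF mean \<nu>_prob, of n "indicator (beyond s)" a 0] by simp
    also have "\<dots> \<le> (hop p \<nu> ^^ n) (indicator {x. \<rho> \<le> norm x}) 0"
    proof (rule hop_pow_mono[OF mean \<nu>_prob])
      show "unit_meas (\<lambda>z. indicator (beyond s) (a + z) :: real)"
        by (intro unit_meas_shift unit_meas_indicator) simp
      show "unit_meas (indicator {x :: real ^ 'd. \<rho> \<le> norm x})"
        by (intro unit_meas_indicator) measurable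
      fix z
      have "\<rho> \<le> norm z" if "s < displacement (a + z)"
        using that displacement_lipschitz[of "a + z" a] \<rho>(2) by simp
      then show "indicator (beyond s) (a + z) \<le> (indicator {x. \<rho> \<le> norm x} z :: real)"
        by (auto simp: beyond_def indicator_def)
    qed
    also have "\<dots> \<le> A * real n powr (real (Suc l) - \<beta>) / \<rho> ^ (2 * Suc l)" by (rule A(2)[OF \<rho>(1)])
    finally show "(hop p \<nu> ^^ n) (indicator (beyond s)) a \<le> A * real n powr (real (Suc l) - \<beta>) / \<rho> ^ (2 * Suc l)" .
  qed
qed

lemma charge_finite: "A \<in> sets borel \<Longrightarrow> emeasure (\<N> y) (charge A y) = ennreal (measure (\<N> y) (charge A y))"
proof -
  assume A: "A \<in> sets borel"
  have "charge A y \<subseteq> charge UNIV y"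
    unfolding charge_def using emeasure_zero_mono[of _ UNIV A] space_\<N> by fastforce
  then have "emeasure (\<N> y) (charge A y) \<le> emeasure (\<N> y) (charge UNIV y)"
    by (rule emeasure_mono) (rule charge_sets, simp)
  then have "emeasure (\<N> y) (charge A y) \<le> ennreal survival_const" unfolding total_charge .
  then show ?thesis by (intro emeasure_eq_ennreal_measure) (auto simp: top_unique)
qed

lemma tail_approximation:
  assumes e: "0 < e"
  obtains v :: "nat \<Rightarrow> real" where
    "\<And>m. (\<lambda>n. real n powr \<beta> * (hop p \<nu> ^^ n) (\<lambda>z. real m * ramp r e (z /\<^sub>R sqrt (real n)) / real n powr \<beta>) (sqrt (real n) *\<^sub>R y)) \<longlonglongrightarrow> v m"
    "\<And>m. v m \<le> tail y r" "\<And>b. b < tail y r \<Longrightarrow> \<exists>m. b < v m"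
proof -
  obtain v :: "nat \<Rightarrow> real" where v:
    "\<And>m. (\<lambda>n. real n powr \<beta> * (hop p \<nu> ^^ n) (\<lambda>z. real m * ramp r e (z /\<^sub>R sqrt (real n)) / real n powr \<beta>) (sqrt (real n) *\<^sub>R y)) \<longlonglongrightarrow> v m"
    "\<And>m. 0 \<le> v m" "emeasure (\<N> y) (charge {x. 0 < ramp r e x} y) = (SUP m. ennreal (v m))"
    by (rule charge_approximation[OF ramp_bounds ramp_lip[OF e]], rule that)
  have "{x :: real ^ 'd. 0 < ramp r e x} = beyond r" using ramp_pos[OF e] by auto
  then have S: "ennreal (tail y r) = (SUP m. ennreal (v m))"
    using v(3) charge_finite[OF beyond_sets, of y r] by (simp add: tail_def)
  have t0: "0 \<le> tail y r" by (simp add: tail_def)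
  show thesis
  proof (rule that[OF v(1)])
    fix m
    have "ennreal (v m) \<le> ennreal (tail y r)" unfolding S by (rule SUP_upper) simp
    then show "v m \<le> tail y r" using t0 by (simp add: ennreal_le_iff)
  next
    fix b assume b: "b < tail y r"
    show "\<exists>m. b < v m"
    proof (cases "b < 0")
      case True
      then show ?thesis using v(2)[of 0] by (intro exI[of _ 0]) simp
    next
      case False
      then have "ennreal b < (SUP m. ennreal (v m))" unfolding S[symmetric] using b by (simp add: ennreal_less_iff)
      then obtain m where "ennreal b < ennreal (v m)" by (auto simp: less_SUP_iff)
      then show ?thesis using False by (auto simp: ennreal_less_iff)
    qed
  qed
qed

text \<open>Once \<open>n powr \<beta> \<ge> m\<close>, the ramp multiplied by
  \<open>m / n powr \<beta>\<close> stays below the indicator, so every fixed \<open>m\<close>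
  yields a lower bound in the limit.\<close>

lemma walk_tail_lower:
  assumes b: "b < tail y r"
  shows "\<forall>\<^sub>F n in sequentially. b < walk_tail y n r"
proof -
  obtain v :: "nat \<Rightarrow> real" where v:
    "\<And>m. (\<lambda>n. real n powr \<beta> * (hop p \<nu> ^^ n) (\<lambda>z. real m * ramp r 1 (z /\<^sub>R sqrt (real n)) / real n powr \<beta>) (sqrt (real n) *\<^sub>R y)) \<longlonglongrightarrow> v m"
    "\<And>m. v m \<le> tail y r" "\<And>b. b < tail y r \<Longrightarrow> \<exists>m. b < v m"
    by (rule tail_approximation[OF zero_less_one], rule that)
  obtain m where m: "b < v m" using v(3)[OF b] ..
  have "\<forall>\<^sub>F n in sequentially. real m \<le> real n powr \<beta>"
    using power_tendsto_infinity by (simp add: filterlim_at_top)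
  then show ?thesis using order_tendstoD(1)[OF v(1) m] eventually_gt_at_top[of 0]
  proof eventually_elim
    case (elim n)
    have "(hop p \<nu> ^^ n) (\<lambda>z. real m * ramp r 1 (z /\<^sub>R sqrt (real n)) / real n powr \<beta>) (sqrt (real n) *\<^sub>R y)
      \<le> (hop p \<nu> ^^ n) (indicator (beyond (r * sqrt (real n)))) (sqrt (real n) *\<^sub>R y)"
    proof (rule hop_pow_mono[OF mean \<nu>_prob])
      show u: "unit_meas (\<lambda>z :: real ^ 'd. real m * ramp r 1 (z /\<^sub>R sqrt (real n)) / real n powr \<beta>)"
        by (rule unit_meas_scaled_ramp) (use elim in auto)
      show "unit_meas (indicator (beyond (r * sqrt (real n)) :: (real ^ 'd) set))" by (intro unit_meas_indicator) simp
      fix z :: "real ^ 'd"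
      show "real m * ramp r 1 (z /\<^sub>R sqrt (real n)) / real n powr \<beta> \<le> indicator (beyond (r * sqrt (real n))) z"
      proof (cases "z \<in> beyond (r * sqrt (real n))")
        case True
        then show ?thesis using u by (simp add: unit_meas_def)
      next
        case False
        then have "z /\<^sub>R sqrt (real n) \<notin> beyond r"
          using elim by (simp add: beyond_def displacement_scaleR not_less divide_simps)
        then have "ramp r 1 (z /\<^sub>R sqrt (real n)) = 0"
          using ramp_pos[of 1 r "z /\<^sub>R sqrt (real n)"] ramp_bounds(1)[of r 1 "z /\<^sub>R sqrt (real n)"] by simp
        then show ?thesis by simp
      qed
    qed
    then have "real n powr \<beta> * (hop p \<nu> ^^ n) (\<lambda>z. real m * ramp r 1 (z /\<^sub>R sqrt (real n)) / real n powr \<beta>) (sqrt (real n) *\<^sub>R y)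
      \<le> walk_tail y n r"
      unfolding walk_tail_def by (rule mult_left_mono) simp
    then show ?case using elim by linarith
  qed
qed

lemma sqrt_pow: "0 < n \<Longrightarrow> sqrt (real n) ^ (2 * Suc l) = real n powr real (Suc l)"
  by (simp only: power_mult real_sqrt_pow2 of_nat_0_le_iff powr_realpow of_nat_0_less_iff)

text \<open>The displacement bound for the walk is transferred to the excursion measure through
  \<open>walk_tail_lower\<close>: were \<open>tail y r\<close> larger, the rescaled walk would
  exceed its own bound for large \<open>n\<close>. Under diffusive scaling the powers of
  \<open>n\<close> cancel.\<close>

lemma tail_vanishes: "(\<lambda>m. tail y (real m)) \<longlonglongrightarrow> 0"
proof -
  obtain A where A: "0 < A" "\<And>n s a \<rho>. 0 < \<rho> \<Longrightarrow> displacement a + \<rho> \<le> s \<Longrightarrow>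
    (hop p \<nu> ^^ n) (indicator (beyond s)) a \<le> A * real n powr (real (Suc l) - \<beta>) / \<rho> ^ (2 * Suc l)"
    by (rule beyond_bound, rule that)
  have le: "tail y r \<le> A / (r - norm y) ^ (2 * Suc l)" if r: "norm y < r" for r
  proof (rule ccontr)
    let ?d = "r - norm y"
    assume "\<not> tail y r \<le> A / ?d ^ (2 * Suc l)"
    then have "\<forall>\<^sub>F n in sequentially. A / ?d ^ (2 * Suc l) < walk_tail y n r" by (intro walk_tail_lower) simp
    then have "\<forall>\<^sub>F n::nat in sequentially. False" using eventually_gt_at_top[of 0]
    proof eventually_elim
      case (elim n)
      let ?q = "sqrt (real n)"
      have "displacement (?q *\<^sub>R y) \<le> ?q * norm y"
        using displacement_le_norm[of "?q *\<^sub>R y"] by simp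
      then have "displacement (?q *\<^sub>R y) + ?d * ?q \<le> r * ?q" by (simp add: algebra_simps)
      moreover have "0 < ?d * ?q" using r elim by simp
      ultimately have "walk_tail y n r \<le> real n powr \<beta> * (A * real n powr (real (Suc l) - \<beta>) / (?d * ?q) ^ (2 * Suc l))"
        unfolding walk_tail_def by (intro mult_left_mono A(2)) auto
      also have "\<dots> = A * (real n powr \<beta> * real n powr (real (Suc l) - \<beta>)) / (?d ^ (2 * Suc l) * real n powr real (Suc l))"
        using elim by (simp only: power_mult_distrib sqrt_pow) simp
      also have "\<dots> = A / ?d ^ (2 * Suc l)"
        using elim by (simp only: powr_add[symmetric]) simp
      finally show False using elim by simp
    qed
    then show False by simp
  qed
  have "(\<lambda>m. A / (real m - norm y)) \<longlonglongrightarrow> 0" by real_asymp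
  moreover have "\<forall>\<^sub>F m in sequentially. norm (tail y (real m)) \<le> A / (real m - norm y)"
    using eventually_ge_at_top[of "nat \<lceil>norm y + 1\<rceil>"]
  proof eventually_elim
    case (elim m)
    then have m: "1 \<le> real m - norm y" by linarith
    then have "real m - norm y \<le> (real m - norm y) ^ (2 * Suc l)" by (intro self_le_power) auto
    then have "A / (real m - norm y) ^ (2 * Suc l) \<le> A / (real m - norm y)"
      using m A(1) by (intro divide_left_mono) auto
    then show ?case using le[of "real m"] m by (simp add: tail_def)
  qed
  ultimately show ?thesis by (rule Lim_null_comparison[rotated])
qed

text \<open>Three effects of the cut are made small: the discrepancy between the scales
  \<open>sqrt n\<close> and \<open>sqrt k\<close>, the chance of travelling far in the last
  \<open>\<delta> * n\<close> generations, and the ratio of \<open>n powr \<beta>\<close> to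
  \<open>k powr \<beta>\<close>.\<close>

lemma cut_parameter:
  assumes e: "0 < e" and N: "0 \<le> N" and A: "0 \<le> A" and \<eta>: "0 < \<eta>" and T: "0 \<le> T" and \<gamma>: "0 < \<gamma>"
  obtains \<delta> :: real where "0 < \<delta>" "\<delta> \<le> 1 / 2" "(1 / sqrt (1 - \<delta>) - 1) * N \<le> e" "A * \<delta> powr \<gamma> \<le> \<eta>"
    "(1 - \<delta>) powr (- \<beta>) * (T + \<eta>) \<le> T + 2 * \<eta>"
proof -
  have 1: "((\<lambda>\<delta>::real. (1 / sqrt (1 - \<delta>) - 1) * N) \<longlongrightarrow> (1 / sqrt (1 - 0) - 1) * N) (at_right 0)"
    by (intro tendsto_intros) auto
  have 2: "((\<lambda>\<delta>::real. A * \<delta> powr \<gamma>) \<longlongrightarrow> A * 0) (at_right 0)"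
    by (intro tendsto_mult tendsto_const) (use \<gamma> in real_asymp)
  have 3: "((\<lambda>\<delta>::real. (1 - \<delta>) powr (- \<beta>) * (T + \<eta>)) \<longlongrightarrow> (1 - 0) powr (- \<beta>) * (T + \<eta>)) (at_right 0)"
    by (intro tendsto_intros) auto
  have "\<forall>\<^sub>F \<delta>::real in at_right 0. 0 < \<delta> \<and> \<delta> \<le> 1 / 2 \<and> (1 / sqrt (1 - \<delta>) - 1) * N \<le> e \<and> A * \<delta> powr \<gamma> \<le> \<eta> \<and>
      (1 - \<delta>) powr (- \<beta>) * (T + \<eta>) \<le> T + 2 * \<eta>"
  proof -
    have "\<forall>\<^sub>F \<delta>::real in at_right 0. 0 < \<delta> \<and> \<delta> \<le> 1 / 2"
      unfolding eventually_at_right_field by (intro exI[of _ "1 / 2"]) auto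
    moreover have "\<forall>\<^sub>F \<delta>::real in at_right 0. (1 / sqrt (1 - \<delta>) - 1) * N < e" using 1 e by (intro order_tendstoD(2)) auto
    moreover have "\<forall>\<^sub>F \<delta>::real in at_right 0. A * \<delta> powr \<gamma> < \<eta>" using 2 \<eta> by (intro order_tendstoD(2)) auto
    moreover have "\<forall>\<^sub>F \<delta>::real in at_right 0. (1 - \<delta>) powr (- \<beta>) * (T + \<eta>) < T + 2 * \<eta>"
      using 3 \<eta> by (intro order_tendstoD(2)) auto
    ultimately show ?thesis by eventually_elim auto
  qed
  then obtain \<delta> :: real where \<delta>: "0 < \<delta>" "\<delta> \<le> 1 / 2" "(1 / sqrt (1 - \<delta>) - 1) * N \<le> e" "A * \<delta> powr \<gamma> \<le> \<eta>"
    "(1 - \<delta>) powr (- \<beta>) * (T + \<eta>) \<le> T + 2 * \<eta>"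
    using eventually_happens[of _ "at_right (0::real)"] by auto
  then show thesis by (rule that)
qed

text \<open>The lower bound on \<open>\<delta> * n\<close> makes rounding cost at most half of it,
  so survival over the last \<open>m\<close> generations remains of order
  \<open>(\<delta> * n) powr - \<beta>\<close>.\<close>

lemma split_generation:
  fixes \<delta> :: real and n :: nat
  assumes \<delta>: "0 < \<delta>" "\<delta> \<le> 1 / 2" and n: "2 \<le> \<delta> * real n"
  defines "m \<equiv> nat \<lfloor>\<delta> * real n\<rfloor>"
  shows "\<delta> / 2 * real n \<le> real m" "real m \<le> \<delta> * real n" "m < n" "(1 - \<delta>) * real n \<le> real (n - m)"
    "n \<le> 2 * (n - m)" "0 < m"
proof -
  show 1: "real m \<le> \<delta> * real n" unfolding m_def using n by linarith
  have "\<delta> * real n - 1 \<le> real m" unfolding m_def using n by linarith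
  then show 2: "\<delta> / 2 * real n \<le> real m" using n by simp
  show "0 < m" unfolding m_def using n by linarith
  have n0: "0 < real n" using n \<delta> by (cases "n = 0") auto
  have "\<delta> * real n \<le> 1 / 2 * real n" using \<delta> by (intro mult_right_mono) auto
  then have "2 * real m \<le> real n" using 1 by simp
  then have "2 * m \<le> n" by linarith
  then show "m < n" "n \<le> 2 * (n - m)" using n0 by linarith+
  then show "(1 - \<delta>) * real n \<le> real (n - m)" using 1 by (simp add: of_nat_diff algebra_simps)
qed

text \<open>The probability \<open>g z\<close> that a particle at \<open>z\<close> has a descendant beyond \<open>r * sqrt n\<close> after \<open>n - k\<close>
  generations is at most the survival probability, hence below a multiple of the ramp where the ramp
  is \<open>1\<close>; elsewhere the particle would have to travel at least \<open>e * sqrt n\<close>.\<close>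

lemma walk_tail_split:
  fixes y :: "real ^ 'd"
  assumes c: "\<And>m. 0 < m \<Longrightarrow> (hit p ^^ m) 1 \<le> c * real m powr (- \<beta>)" "0 < c"
    and A: "\<And>n s a \<rho>. 0 < \<rho> \<Longrightarrow> displacement a + \<rho> \<le> s \<Longrightarrow>
      (hop p \<nu> ^^ n) (indicator (beyond s)) a \<le> A * real n powr (real (Suc l) - \<beta>) / \<rho> ^ (2 * Suc l)" "0 < A"
    and e: "0 < e" and \<delta>: "0 < \<delta>" "\<delta> \<le> 1 / 2" "(1 / sqrt (1 - \<delta>) - 1) * (\<bar>r\<bar> + 3 * e + norm y) \<le> e"
    and n: "2 \<le> \<delta> * real n" and M: "c * (\<delta> / 2) powr (- \<beta>) \<le> real M"
    and MN: "real M \<le> real (n - nat \<lfloor>\<delta> * real n\<rfloor>) powr \<beta>"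
  defines "k \<equiv> n - nat \<lfloor>\<delta> * real n\<rfloor>"
  shows "walk_tail y n r \<le> (1 - \<delta>) powr (- \<beta>) * (real k powr \<beta> *
      (hop p \<nu> ^^ k) (\<lambda>z. real M * ramp (r - 3 * e) e (z /\<^sub>R sqrt (real k)) / real k powr \<beta>) (sqrt (real k) *\<^sub>R y))
    + A / e ^ (2 * Suc l) * \<delta> powr (real (Suc l) - \<beta>)"
proof -
  define m where "m = nat \<lfloor>\<delta> * real n\<rfloor>"
  note sp = split_generation[OF \<delta>(1,2) n, folded m_def]
  have km: "k = n - m" by (simp add: k_def m_def)
  have k: "0 < k" "k \<le> n" "(1 - \<delta>) * real n \<le> real k" using sp km by auto
  have n0: "0 < n" using k by simp
  define g :: "real ^ 'd \<Rightarrow> real" where "g = (hop p \<nu> ^^ m) (indicator (beyond (r * sqrt (real n))))"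
  define F :: "real ^ 'd \<Rightarrow> real" where "F z = real M * ramp (r - 3 * e) e (z /\<^sub>R sqrt (real k)) / real k powr \<beta>" for z
  \<comment> \<open>The limit theorem for \<open>k\<close> generations starts at
    \<open>sqrt k\<close> times \<open>y\<close>, the walk at \<open>sqrt n\<close> times
    \<open>y\<close>; translating the test function by \<open>b\<close> reconciles them.\<close>
  define b where "b = sqrt (real k) *\<^sub>R y - sqrt (real n) *\<^sub>R y"
  define \<kappa>\<^sub>0 where "\<kappa>\<^sub>0 = A / e ^ (2 * Suc l) * \<delta> powr (real (Suc l) - \<beta>)"
  have \<kappa>\<^sub>0: "0 \<le> \<kappa>\<^sub>0" using A(2) e by (simp add: \<kappa>\<^sub>0_def)
  have ug: "unit_meas g" unfolding g_def by (intro hop_pow_unit[OF mean \<nu>_prob] unit_meas_indicator) simp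
  have uF: "unit_meas F" unfolding F_def[abs_def]
    by (rule unit_meas_scaled_ramp) (use e MN in \<open>auto simp: k_def\<close>)
  \<comment> \<open>Ratio of the two spatial scales; the choice of \<open>\<delta>\<close> keeps its
    effect on all distances involved below \<open>e\<close>.\<close>
  define q where "q = sqrt (real n) / sqrt (real k)"
  have q: "1 \<le> q" "(q - 1) * (\<bar>r\<bar> + 3 * e + norm y) \<le> e"
  proof -
    show "1 \<le> q" using k by (simp add: q_def)
    have "sqrt (1 - \<delta>) * sqrt (real n) \<le> sqrt (real k)"
      unfolding real_sqrt_mult[symmetric] by (rule real_sqrt_le_mono[OF k(3)])
    then have "q \<le> 1 / sqrt (1 - \<delta>)" using k(1) \<delta>(2) by (simp add: q_def divide_simps mult.commute)
    then have "(q - 1) * (\<bar>r\<bar> + 3 * e + norm y) \<le> (1 / sqrt (1 - \<delta>) - 1) * (\<bar>r\<bar> + 3 * e + norm y)"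
      using e by (intro mult_right_mono) auto
    then show "(q - 1) * (\<bar>r\<bar> + 3 * e + norm y) \<le> e" using \<delta>(3) by linarith
  qed
  have near: "g z \<le> \<kappa>\<^sub>0 * real n powr (- \<beta>)" if "displacement z \<le> (r - e) * sqrt (real n)" for z
  proof -
    have "g z \<le> A * real m powr (real (Suc l) - \<beta>) / (e * sqrt (real n)) ^ (2 * Suc l)"
      unfolding g_def by (rule A(1)) (use that e n0 in \<open>auto simp: algebra_simps\<close>)
    also have "\<dots> \<le> A * (\<delta> * real n) powr (real (Suc l) - \<beta>) / (e * sqrt (real n)) ^ (2 * Suc l)"
      using A(2) sp(2) l_bounds e by (intro divide_right_mono mult_left_mono powr_mono2) auto
    also have "\<dots> = \<kappa>\<^sub>0 * (real n powr (real (Suc l) - \<beta>) / real n powr real (Suc l))"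
      using \<delta>(1) n0 by (simp only: power_mult_distrib sqrt_pow powr_mult) (simp add: \<kappa>\<^sub>0_def)
    also have "real n powr (real (Suc l) - \<beta>) / real n powr real (Suc l) = real n powr (- \<beta>)"
      by (simp only: powr_diff[symmetric]) simp
    finally show ?thesis .
  qed
  have far: "g z \<le> F (b + z)" if z: "(r - e) * sqrt (real n) \<le> displacement z" for z
  proof -
    have "g z \<le> (hop p \<nu> ^^ m) (\<lambda>_. 1) z" unfolding g_def
      by (rule hop_pow_mono[OF mean \<nu>_prob]) (auto intro!: unit_meas_indicator simp: unit_meas_def indicator_def)
    also have "\<dots> = (hit p ^^ m) 1" by (simp add: hop_pow_const[OF mean \<nu>_prob])
    also have "\<dots> \<le> c * real m powr (- \<beta>)" by (rule c(1)[OF sp(6)])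
    also have "\<dots> \<le> c * (\<delta> / 2 * real n) powr (- \<beta>)"
      using sp(1) c(2) beta(1) \<delta>(1) n0 by (intro mult_left_mono powr_mono2') auto
    also have "\<dots> = c * (\<delta> / 2) powr (- \<beta>) * real n powr (- \<beta>)"
      using \<delta>(1) powr_mult[of "\<delta> / 2" "real n" "- \<beta>"] by simp
    also have "\<dots> \<le> real M * real n powr (- \<beta>)" by (rule mult_right_mono[OF M]) simp
    also have "\<dots> \<le> real M * real k powr (- \<beta>)"
      using k beta(1) by (intro mult_left_mono powr_mono2') auto
    also have "\<dots> = F (b + z)"
    proof -
      have nb: "norm b / sqrt (real k) = (q - 1) * norm y"
      proof -
        have "norm b = (sqrt (real n) - sqrt (real k)) * norm y"
          unfolding b_def scaleR_diff_left[symmetric] using k(2) by simp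
        then show ?thesis using k(1) by (simp add: q_def field_simps)
      qed
      have "displacement z - norm b \<le> displacement (b + z)"
        using displacement_lipschitz[of "b + z" z] by simp
      then have "(r - e) * sqrt (real n) - norm b \<le> displacement (b + z)" using z by simp
      then have "((r - e) * sqrt (real n) - norm b) / sqrt (real k) \<le> displacement (b + z) / sqrt (real k)"
        by (rule divide_right_mono) simp
      then have "(r - e) * q - (q - 1) * norm y \<le> displacement (b + z) / sqrt (real k)"
        unfolding nb[symmetric] by (simp add: q_def diff_divide_distrib)
      moreover have "r - 2 * e \<le> (r - e) * q - (q - 1) * norm y"
      proof -
        have "(q - 1) * (- (\<bar>r\<bar> + 3 * e)) \<le> (q - 1) * (r - e)"
          using q(1) e by (intro mult_left_mono) auto
        then show ?thesis using q(2) by (simp add: algebra_simps)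
      qed
      ultimately have "r - 3 * e + e \<le> displacement ((b + z) /\<^sub>R sqrt (real k))"
        by (simp add: displacement_scaleR divide_inverse mult.commute)
      then have "ramp (r - 3 * e) e ((b + z) /\<^sub>R sqrt (real k)) = 1" by (rule ramp_eq_1[OF e])
      then show ?thesis by (simp add: F_def powr_minus divide_inverse)
    qed
    finally show ?thesis .
  qed
  have F0: "0 \<le> F z" for z using uF by (simp add: unit_meas_def)
  have le: "g z \<le> F (b + z) + \<kappa>\<^sub>0 * real n powr (- \<beta>)" for z
  proof (cases "displacement z \<le> (r - e) * sqrt (real n)")
    case True
    then show ?thesis using near[OF True] F0[of "b + z"] by simp
  next
    case False
    have "0 \<le> \<kappa>\<^sub>0 * real n powr (- \<beta>)" using \<kappa>\<^sub>0 by simp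
    then show ?thesis using far[of z] False by simp
  qed
  have "(hop p \<nu> ^^ n) (indicator (beyond (r * sqrt (real n)))) = (hop p \<nu> ^^ k) g"
  proof -
    have "n = k + m" using sp(3) km by simp
    then show ?thesis by (simp add: g_def funpow_add)
  qed
  then have "walk_tail y n r = real n powr \<beta> * (hop p \<nu> ^^ k) g (sqrt (real n) *\<^sub>R y)"
    by (simp add: walk_tail_def)
  also have "\<dots> \<le> real n powr \<beta> * ((hop p \<nu> ^^ k) (\<lambda>z. F (b + z)) (sqrt (real n) *\<^sub>R y) + \<kappa>\<^sub>0 * real n powr (- \<beta>))"
    by (intro mult_left_mono hop_pow_le_add[OF mean \<nu>_prob ug unit_meas_shift[OF uF]] le) (use \<kappa>\<^sub>0 in auto)
  also have "(hop p \<nu> ^^ k) (\<lambda>z. F (b + z)) (sqrt (real n) *\<^sub>R y) = (hop p \<nu> ^^ k) F (sqrt (real k) *\<^sub>R y)"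
    using hop_pow_translate[OF mean \<nu>_prob, of k F b "sqrt (real n) *\<^sub>R y"] by (simp add: b_def)
  also have "real n powr \<beta> * ((hop p \<nu> ^^ k) F (sqrt (real k) *\<^sub>R y) + \<kappa>\<^sub>0 * real n powr (- \<beta>)) =
      real n powr \<beta> * (hop p \<nu> ^^ k) F (sqrt (real k) *\<^sub>R y) + \<kappa>\<^sub>0"
    using n0 by (simp add: algebra_simps powr_minus divide_inverse)
  also have "real n powr \<beta> \<le> (1 - \<delta>) powr (- \<beta>) * real k powr \<beta>"
  proof -
    have "real n \<le> real k / (1 - \<delta>)" using k(3) \<delta>(2) by (simp add: pos_le_divide_eq mult.commute)
    then have "real n powr \<beta> \<le> (real k / (1 - \<delta>)) powr \<beta>" using beta(1) by (intro powr_mono2) auto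
    also have "\<dots> = (1 - \<delta>) powr (- \<beta>) * real k powr \<beta>"
      using powr_divide[of "real k" "1 - \<delta>" \<beta>] \<delta>(2) by (simp add: powr_minus_divide)
    finally show ?thesis .
  qed
  then have "real n powr \<beta> * (hop p \<nu> ^^ k) F (sqrt (real k) *\<^sub>R y) + \<kappa>\<^sub>0 \<le>
      (1 - \<delta>) powr (- \<beta>) * real k powr \<beta> * (hop p \<nu> ^^ k) F (sqrt (real k) *\<^sub>R y) + \<kappa>\<^sub>0"
    using hop_pow_unit[OF mean \<nu>_prob uF, of k] by (intro add_right_mono mult_right_mono) (simp_all add: unit_meas_def)
  finally show ?thesis unfolding \<kappa>\<^sub>0_def F_def[abs_def] by (simp only: mult.assoc)
qed

lemma walk_tail_upper:
  assumes \<epsilon>: "0 < \<epsilon>" and \<eta>: "0 < \<eta>"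
  shows "\<forall>\<^sub>F n in sequentially. walk_tail y n r \<le> tail y (r - \<epsilon>) + \<eta>"
proof -
  \<comment> \<open>Three margins of width \<open>e\<close>: one to be travelled in the last
    generations, one for the change of scale and starting point, and one for the slope of the
    ramp.\<close>
  define e where "e = \<epsilon> / 3"
  have e: "0 < e" "r - \<epsilon> = r - 3 * e" using \<epsilon> by (auto simp: e_def)
  obtain A where A: "0 < A" "\<And>n s a \<rho>. 0 < \<rho> \<Longrightarrow> displacement a + \<rho> \<le> s \<Longrightarrow>
    (hop p \<nu> ^^ n) (indicator (beyond s)) a \<le> A * real n powr (real (Suc l) - \<beta>) / \<rho> ^ (2 * Suc l)"
    by (rule beyond_bound, rule that)
  obtain c where c: "0 < c" "\<And>m. 0 < m \<Longrightarrow> (hit p ^^ m) 1 \<le> c * real m powr (- \<beta>)"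
    by (rule survival_bound, rule that)
  have T0: "0 \<le> tail y (r - \<epsilon>)" by (simp add: tail_def)
  obtain \<delta> :: real where \<delta>: "0 < \<delta>" "\<delta> \<le> 1 / 2" "(1 / sqrt (1 - \<delta>) - 1) * (\<bar>r\<bar> + 3 * e + norm y) \<le> e"
      "A / e ^ (2 * Suc l) * \<delta> powr (real (Suc l) - \<beta>) \<le> \<eta> / 3"
      "(1 - \<delta>) powr (- \<beta>) * (tail y (r - \<epsilon>) + \<eta> / 3) \<le> tail y (r - \<epsilon>) + 2 * (\<eta> / 3)"
  proof (rule cut_parameter[OF e(1) _ _ _ T0])
    show "0 \<le> \<bar>r\<bar> + 3 * e + norm y" "0 \<le> A / e ^ (2 * Suc l)" "0 < \<eta> / 3" using A(1) e(1) \<eta> by auto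
    show "0 < real (Suc l) - \<beta>" using l_bounds by simp
  qed (rule that)
  \<comment> \<open>\<open>M\<close> dominates the rescaled survival probability over the last
    generations; it depends on \<open>\<delta>\<close> but not on \<open>n\<close>, so the limit for
    a fixed multiple of the ramp applies.\<close>
  obtain M :: nat where M: "c * (\<delta> / 2) powr (- \<beta>) \<le> real M" using real_arch_simple by blast
  obtain v :: "nat \<Rightarrow> real" where v:
    "\<And>m. (\<lambda>n. real n powr \<beta> * (hop p \<nu> ^^ n) (\<lambda>z. real m * ramp (r - 3 * e) e (z /\<^sub>R sqrt (real n)) / real n powr \<beta>) (sqrt (real n) *\<^sub>R y)) \<longlonglongrightarrow> v m"
    "\<And>m. v m \<le> tail y (r - 3 * e)" "\<And>b. b < tail y (r - 3 * e) \<Longrightarrow> \<exists>m. b < v m"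
    by (rule tail_approximation[OF e(1)], rule that)
  define k where "k n = n - nat \<lfloor>\<delta> * real n\<rfloor>" for n
  have big: "\<forall>\<^sub>F n in sequentially. 2 \<le> \<delta> * real n" using \<delta>(1) by real_asymp
  have k: "filterlim k sequentially sequentially"
  proof (rule filterlim_at_top[THEN iffD2], rule allI)
    fix Z :: nat
    show "\<forall>\<^sub>F n in sequentially. Z \<le> k n" using big eventually_ge_at_top[of "2 * Z"]
    proof eventually_elim
      case (elim n)
      then show ?case using split_generation(5)[OF \<delta>(1,2) elim(1)] by (simp add: k_def)
    qed
  qed
  have "v M < tail y (r - \<epsilon>) + \<eta> / 3" using v(2)[of M] \<eta> e by simp
  from eventually_compose_filterlim[OF order_tendstoD(2)[OF v(1) this] k]
  have lim: "\<forall>\<^sub>F n in sequentially. real (k n) powr \<beta> * (hop p \<nu> ^^ k n)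
      (\<lambda>z. real M * ramp (r - 3 * e) e (z /\<^sub>R sqrt (real (k n))) / real (k n) powr \<beta>) (sqrt (real (k n)) *\<^sub>R y)
      < tail y (r - \<epsilon>) + \<eta> / 3" .
  have "\<forall>\<^sub>F n in sequentially. real M \<le> real n powr \<beta>"
    using power_tendsto_infinity by (simp add: filterlim_at_top)
  from eventually_compose_filterlim[OF this k]
  have "\<forall>\<^sub>F n in sequentially. real M \<le> real (k n) powr \<beta>" .
  with big lim show ?thesis
  proof eventually_elim
    case (elim n)
    define S where "S = real (k n) powr \<beta> * (hop p \<nu> ^^ k n)
      (\<lambda>z. real M * ramp (r - 3 * e) e (z /\<^sub>R sqrt (real (k n))) / real (k n) powr \<beta>) (sqrt (real (k n)) *\<^sub>R y)"
    have "walk_tail y n r \<le> (1 - \<delta>) powr (- \<beta>) * S + A / e ^ (2 * Suc l) * \<delta> powr (real (Suc l) - \<beta>)"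
      unfolding S_def k_def by (rule walk_tail_split[OF c(2,1) A(2,1) e(1) \<delta>(1-3) elim(1) M elim(3)[unfolded k_def]])
    also have "\<dots> \<le> (1 - \<delta>) powr (- \<beta>) * (tail y (r - \<epsilon>) + \<eta> / 3) + \<eta> / 3"
      using elim(2) \<delta>(4) by (intro add_mono mult_left_mono) (auto simp: S_def)
    also have "\<dots> \<le> tail y (r - \<epsilon>) + \<eta>" using \<delta>(5) by simp
    finally show ?case .
  qed
qed

text \<open>The lower bound holds at every point; the upper bound involves the tail slightly to the
  left of \<open>x\<close>, and continuity at \<open>x\<close> closes the gap.\<close>

lemma walk_tail_tendsto:
  assumes "isCont (tail y) x"
  shows "(\<lambda>n. walk_tail y n x) \<longlonglongrightarrow> tail y x"
proof (rule order_tendstoI)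
  fix b assume "b < tail y x"
  then show "\<forall>\<^sub>F n in sequentially. b < walk_tail y n x" by (rule walk_tail_lower)
next
  fix b assume b: "tail y x < b"
  define \<eta> where "\<eta> = (b - tail y x) / 3"
  have \<eta>: "0 < \<eta>" "3 * \<eta> = b - tail y x" using b by (auto simp: \<eta>_def)
  obtain d where d: "0 < d" "\<And>x'. dist x' x < d \<Longrightarrow> dist (tail y x') (tail y x) < \<eta>"
    using assms \<eta>(1) unfolding continuous_at_eps_delta by (meson dist_commute)
  have "tail y (x - d / 2) < tail y x + \<eta>" using d(2)[of "x - d / 2"] d(1) by (simp add: dist_real_def abs_less_iff)
  then have "tail y (x - d / 2) + \<eta> < b" using \<eta> by linarith
  moreover have "\<forall>\<^sub>F n in sequentially. walk_tail y n x \<le> tail y (x - d / 2) + \<eta>"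
    by (rule walk_tail_upper) (use d(1) \<eta> in auto)
  ultimately show "\<forall>\<^sub>F n in sequentially. walk_tail y n x < b" by (auto elim: eventually_mono)
qed

theorem max_displacement_converges:
  "weak_conv_m
    (\<lambda>n. distr
       (uniform_measure (brw_measure p \<nu>)
         {\<omega> \<in> space (brw_measure p \<nu>). 0 < emeasure (population (sqrt (real n) *\<^sub>R y) n \<omega>) UNIV})
       borel
       (\<lambda>\<omega>. max_displacement (sqrt (real n) *\<^sub>R y) n \<omega> / sqrt (real n)))
    (distr (uniform_measure (\<N> y) (charge UNIV y)) borel (support_radius 1))"
  (is "weak_conv_m ?law ?limit")
  unfolding weak_conv_m_def weak_conv_def
proof (intro allI impI)
  fix x assume cont: "isCont (cdf ?limit) x"
  have F: "cdf ?limit r = 1 - tail y r / survival_const" for r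
    unfolding tail_def
    by (rule support_radius_cdf[OF total_charge survival_const_pos]) (use tail_vanishes in \<open>simp add: tail_def\<close>)
  \<comment> \<open>The limiting distribution function is an affine function of
    \<open>tail y\<close> with nonzero slope, so both have the same continuity points.\<close>
  have "tail y = (\<lambda>r. survival_const * (1 - cdf ?limit r))"
    unfolding F using survival_const_pos by auto
  then have "isCont (tail y) x" using cont by (auto intro!: continuous_intros)
  from walk_tail_tendsto[OF this] survival_asymptotics
  have "(\<lambda>n. 1 - walk_tail y n x / (real n powr \<beta> * (hit p ^^ n) 1)) \<longlonglongrightarrow> 1 - tail y x / survival_const"
    using survival_const_pos by (intro tendsto_intros) (auto simp: survival_const_def)
  \<comment> \<open>The factor \<open>n powr \<beta>\<close> cancels between visit and survival
    probabilities; the positive limit in \<open>survival_asymptotics\<close> makes the denominator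
    eventually positive.\<close>
  moreover have "\<forall>\<^sub>F n in sequentially. 1 - walk_tail y n x / (real n powr \<beta> * (hit p ^^ n) 1) = cdf (?law n) x"
    using order_tendstoD(1)[OF survival_asymptotics survival_const_pos[unfolded survival_const_def]] eventually_gt_at_top[of 0]
  proof eventually_elim
    case (elim n)
    have U: "(hop p \<nu> ^^ n) (\<lambda>_. 1) (sqrt (real n) *\<^sub>R y) = (hit p ^^ n) 1"
      by (simp add: hop_pow_const[OF mean \<nu>_prob])
    have "0 < (hit p ^^ n) 1" using elim by (simp add: zero_less_mult_iff)
    then show ?case
      using walk_cdf[OF \<nu>_prob elim(2), of p "sqrt (real n) *\<^sub>R y" x] elim by (simp add: U walk_tail_def)
  qed
  ultimately show "(\<lambda>n. cdf (?law n) x) \<longlonglongrightarrow> cdf ?limit x"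
    unfolding F by (rule Lim_transform_eventually)
qed

end

theorem corollary1p3:
  fixes p :: "nat pmf"
    and \<alpha> \<kappa> :: real
    and \<nu> :: "(real ^ 'd) measure"
    and B :: "'b measure"
    and W :: "real \<Rightarrow> 'b \<Rightarrow> real ^ 'd"
    and P :: "(real ^ 'd) measure \<Rightarrow> (real \<Rightarrow> (real ^ 'd) measure) measure"
    and \<N> :: "real ^ 'd \<Rightarrow> (real \<Rightarrow> (real ^ 'd) measure) measure"
    and y :: "real ^ 'd"
  assumes "offspring_hyp p \<alpha> \<kappa>"
    and "jump_hyp \<alpha> \<nu>"
    and "brownian_motion B (jump_cov \<nu>) W"
    and "super_brownian_motion B W (branching_const p \<alpha> \<kappa>) \<alpha> P"
    and "excursion_measures P \<N>"
  shows "weak_conv_m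
    (\<lambda>n. distr
       (uniform_measure (brw_measure p \<nu>)
         {\<omega> \<in> space (brw_measure p \<nu>).
            0 < emeasure (population (sqrt (real n) *\<^sub>R y) n \<omega>) UNIV})
       borel
       (\<lambda>\<omega>. max_displacement (sqrt (real n) *\<^sub>R y) n \<omega> / sqrt (real n)))
    (distr
       (uniform_measure (\<N> y) {w \<in> space (\<N> y). emeasure (w 1) UNIV \<noteq> 0})
       borel
       (support_radius 1))"
proof -
  interpret critical_stable p \<alpha> \<kappa> by unfold_locales (rule assms)
  interpret brw_limit p \<alpha> \<kappa> \<nu> B W P \<N>
    by unfold_locales (use assms alpha in auto)
  show ?thesis using max_displacement_converges[of y] unfolding charge_def .
qed

end
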